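(* If $b\in\mathrm{CMO}(\mathbb{R}^{n_1}\times\mathbb{R}^{n_2})$, then the top-level paraproduct $\Pi_b$, its full transpose $\Pi_b^t$, its partial transpose $\Pi_{b,t}$, and $\Pi_{b,t}^t$ are all compact on $L^2(\mathbb{R}^{n_1}\times\mathbb{R}^{n_2})$.
   Context: $\mathrm{CMO}(\mathbb{R}^{n_1}\times\mathbb{R}^{n_2})$ is the closure of $C_0(\mathbb{R}^{n_1}\times\mathbb{R}^{n_2})$ in the Chang–Fefferman product space $\mathrm{BMO}(\mathbb{R}^{n_1}\times\mathbb{R}^{n_2})$. Wavelets: $\mathbb{R}^{n+1}_+=\mathbb{R}^n\times(0,\infty)$ with measure $d\lambda(x,t)=dx\,dt/t^{n+1}$. For $z=(x,t)$ and $f$ on $\mathbb{R}^n$, $f_z:=t^{-n/2}f((\cdot-x)/t)$. Fix real $\psi\in\mathcal{D}(\mathbb{R}^n)$ (for $n=n_1,n_2$) with support in $B(0,1)$, $\int\psi=0$, $\int_0^\infty|\widehat\psi(t\xi)|^2dt/t=1$ for $\xi\ne0$, and fix nonnegative $\varphi\in\mathcal{D}(\mathbb{R}^n)$ with $\int\varphi=1$; set $\varphi^1_{(x,t)}=t^{-n}\varphi((\cdot-x)/t)$. For $z=(z_1,z_2)\in\mathbb{R}^{n_1+1}_+\times\mathbb{R}^{n_2+1}_+$, $\psi_z=\psi_{z_1}\otimes\psi_{z_2}$ and $\phi^1_z=\varphi^1_{z_1}\otimes\varphi^1_{z_2}$, with $dz=d\lambda(z_1)\,d\lambda(z_2)$.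 Top-level paraproduct: for $b\in\mathrm{BMO}(\mathbb{R}^{n_1}\times\mathbb{R}^{n_2})$, $\Pi_bf=\iint_{\mathbb{R}^{n_1+1}_+\times\mathbb{R}^{n_2+1}_+}\langle b,\psi_z\rangle\langle f,\phi^1_z\rangle\psi_z\,dz$. Transposes of an operator $S$ on functions of $(x_1,x_2)$: $\langle S(f_1\otimes f_2),g_1\otimes g_2\rangle=\langle S^t(g_1\otimes g_2),f_1\otimes f_2\rangle=\langle S_t(g_1\otimes f_2),f_1\otimes g_2\rangle=\langle S_t^t(f_1\otimes g_2),g_1\otimes f_2\rangle$; $\Pi_{b,t}:=(\Pi_b)_t$ and $\Pi_{b,t}^t:=(\Pi_b)_t^t$. *)

theory Defs
  imports "HOL-Analysis.Analysis"
begin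

fun iter_partial :: "'a::euclidean_space list \<Rightarrow> ('a \<Rightarrow> real) \<Rightarrow> 'a \<Rightarrow> real" where
  "iter_partial [] f = f"
| "iter_partial (j # js) f = (\<lambda>x. frechet_derivative (iter_partial js f) (at x) j)"

definition smooth_fun :: "('a::euclidean_space \<Rightarrow> real) \<Rightarrow> bool" where
  "smooth_fun f \<longleftrightarrow> (\<forall>js. set js \<subseteq> Basis \<longrightarrow> (\<forall>x. iter_partial js f differentiable (at x)))"

definition test_fun :: "('a::euclidean_space \<Rightarrow> real) \<Rightarrow> bool" where
  "test_fun f \<longleftrightarrow> smooth_fun f \<and> compact (closure {x. f x \<noteq> 0})"

definition fourier :: "('a::euclidean_space \<Rightarrow> real) \<Rightarrow> 'a \<Rightarrow> complex" where
  "fourier f \<xi> = (\<integral>x. complex_of_real (f x) * cis (- 2 * pi * (x \<bullet> \<xi>)) \<partial>lborel)"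

definition adm_wavelet :: "('a::euclidean_space \<Rightarrow> real) \<Rightarrow> bool" where
  "adm_wavelet \<psi> \<longleftrightarrow> test_fun \<psi> \<and> closure {x. \<psi> x \<noteq> 0} \<subseteq> ball 0 1
     \<and> integrable lborel \<psi> \<and> (\<integral>x. \<psi> x \<partial>lborel) = 0
     \<and> (\<forall>\<xi>. \<xi> \<noteq> 0 \<longrightarrow>
          (\<integral>\<^sup>+ t\<in>{0<..}. ennreal ((cmod (fourier \<psi> (t *\<^sub>R \<xi>)))\<^sup>2 / t) \<partial>lborel) = 1)"

definition adm_bump :: "('a::euclidean_space \<Rightarrow> real) \<Rightarrow> bool" where
  "adm_bump \<phi> \<longleftrightarrow> test_fun \<phi> \<and> (\<forall>x. 0 \<le> \<phi> x) \<and> integrable lborel \<phi> \<and> (\<integral>x. \<phi> x \<partial>lborel) = 1"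

definition hspace :: "('a::euclidean_space \<times> real) measure" where
  "hspace = density lborel
     (\<lambda>(x,t). if 0 < t then ennreal (t powr (- (real DIM('a) + 1))) else 0)"

definition wav :: "('a::euclidean_space \<Rightarrow> real) \<Rightarrow> 'a \<times> real \<Rightarrow> 'a \<Rightarrow> complex" where
  "wav f z y = complex_of_real (snd z powr (- real DIM('a) / 2) * f ((1 / snd z) *\<^sub>R (y - fst z)))"

definition avg :: "('a::euclidean_space \<Rightarrow> real) \<Rightarrow> 'a \<times> real \<Rightarrow> 'a \<Rightarrow> complex" where
  "avg f z y = complex_of_real (snd z powr (- real DIM('a)) * f ((1 / snd z) *\<^sub>R (y - fst z)))"

definition tens :: "('a \<Rightarrow> complex) \<Rightarrow> ('b \<Rightarrow> complex) \<Rightarrow> 'a \<times> 'b \<Rightarrow> complex" where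
  "tens f g p = f (fst p) * g (snd p)"

definition L2 :: "('c::euclidean_space \<Rightarrow> complex) set" where
  "L2 = {f. f \<in> borel_measurable lborel \<and> integrable lborel (\<lambda>x. (cmod (f x))\<^sup>2)}"

definition L2norm :: "('c::euclidean_space \<Rightarrow> complex) \<Rightarrow> real" where
  "L2norm f = sqrt (\<integral>x. (cmod (f x))\<^sup>2 \<partial>lborel)"

definition pairing :: "('c::euclidean_space \<Rightarrow> complex) \<Rightarrow> ('c \<Rightarrow> complex) \<Rightarrow> complex" where
  "pairing f g = (\<integral>x. f x * g x \<partial>lborel)"

text \<open>Compact (linear) operator on L2, acting on representatives.\<close>
definition compact_op :: "(('c::euclidean_space \<Rightarrow> complex) \<Rightarrow> ('c \<Rightarrow> complex)) \<Rightarrow> bool" where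
  "compact_op T \<longleftrightarrow>
     (\<forall>f\<in>L2. T f \<in> L2)
   \<and> (\<forall>f\<in>L2. \<forall>g\<in>L2. \<forall>a b. AE x in lborel. T (\<lambda>y. a * f y + b * g y) x = a * T f x + b * T g x)
   \<and> (\<forall>(s :: nat \<Rightarrow> 'c \<Rightarrow> complex) C. (\<forall>k. s k \<in> L2 \<and> L2norm (s k) \<le> C) \<longrightarrow>
        (\<exists>r h. strict_mono r \<and> h \<in> L2 \<and> (\<lambda>k. L2norm (\<lambda>x. T (s (r k)) x - h x)) \<longlonglongrightarrow> 0))"

section \<open>Product BMO and CMO (Chang--Fefferman, via Carleson condition on wavelet coefficients)\<close>

definition zmeasure :: "(('a::euclidean_space \<times> real) \<times> ('b::euclidean_space \<times> real)) measure" where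
  "zmeasure = hspace \<Otimes>\<^sub>M hspace"

definition coef :: "('a::euclidean_space \<Rightarrow> real) \<Rightarrow> ('b::euclidean_space \<Rightarrow> real)
    \<Rightarrow> ('a \<times> 'b \<Rightarrow> complex) \<Rightarrow> ('a \<times> real) \<times> ('b \<times> real) \<Rightarrow> complex" where
  "coef \<psi>1 \<psi>2 b z = pairing b (tens (wav \<psi>1 (fst z)) (wav \<psi>2 (snd z)))"

definition tent :: "('a::euclidean_space \<times> 'b::euclidean_space) set \<Rightarrow> (('a \<times> real) \<times> ('b \<times> real)) set" where
  "tent \<Omega> = {((x1,t1),(x2,t2)). 0 < t1 \<and> 0 < t2 \<and> ball x1 t1 \<times> ball x2 t2 \<subseteq> \<Omega>}"

definition carleson :: "('a::euclidean_space \<Rightarrow> real) \<Rightarrow> ('b::euclidean_space \<Rightarrow> real)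
    \<Rightarrow> ('a \<times> 'b \<Rightarrow> complex) \<Rightarrow> ennreal" where
  "carleson \<psi>1 \<psi>2 b =
     (SUP \<Omega>\<in>{\<Omega>. open \<Omega> \<and> 0 < emeasure lborel \<Omega> \<and> emeasure lborel \<Omega> < \<infinity>}.
        (\<integral>\<^sup>+ z\<in>tent \<Omega>. ennreal ((cmod (coef \<psi>1 \<psi>2 b z))\<^sup>2) \<partial>zmeasure) / emeasure lborel \<Omega>)"

definition loc_int :: "('c::euclidean_space \<Rightarrow> complex) \<Rightarrow> bool" where
  "loc_int b \<longleftrightarrow> b \<in> borel_measurable lborel \<and> (\<forall>K. compact K \<longrightarrow> set_integrable lborel K b)"

definition BMO :: "('a::euclidean_space \<Rightarrow> real) \<Rightarrow> ('b::euclidean_space \<Rightarrow> real)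
    \<Rightarrow> ('a \<times> 'b \<Rightarrow> complex) \<Rightarrow> bool" where
  "BMO \<psi>1 \<psi>2 b \<longleftrightarrow> loc_int b \<and> carleson \<psi>1 \<psi>2 b < \<infinity>"

definition CMO :: "('a::euclidean_space \<Rightarrow> real) \<Rightarrow> ('b::euclidean_space \<Rightarrow> real)
    \<Rightarrow> ('a \<times> 'b \<Rightarrow> complex) \<Rightarrow> bool" where
  "CMO \<psi>1 \<psi>2 b \<longleftrightarrow> BMO \<psi>1 \<psi>2 b \<and>
     (\<forall>e>0. \<exists>g. continuous_on UNIV g \<and> (g \<longlongrightarrow> 0) at_infinity
              \<and> carleson \<psi>1 \<psi>2 (\<lambda>x. b x - g x) < ennreal e)"

definition trunc_region :: "real \<Rightarrow> (('a::euclidean_space \<times> real) \<times> ('b::euclidean_space \<times> real)) set" where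
  "trunc_region e = {((x1,t1),(x2,t2)). e < t1 \<and> t1 < 1/e \<and> e < t2 \<and> t2 < 1/e
                       \<and> norm x1 < 1/e \<and> norm x2 < 1/e}"

definition para_form_trunc :: "('a::euclidean_space \<Rightarrow> real) \<Rightarrow> ('b::euclidean_space \<Rightarrow> real)
    \<Rightarrow> ('a \<Rightarrow> real) \<Rightarrow> ('b \<Rightarrow> real) \<Rightarrow> ('a \<times> 'b \<Rightarrow> complex) \<Rightarrow> real
    \<Rightarrow> ('a \<times> 'b \<Rightarrow> complex) \<Rightarrow> ('a \<times> 'b \<Rightarrow> complex) \<Rightarrow> complex" where
  "para_form_trunc \<psi>1 \<psi>2 \<phi>1 \<phi>2 b e f g =
     (\<integral>z\<in>trunc_region e. coef \<psi>1 \<psi>2 b z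
          * pairing f (tens (avg \<phi>1 (fst z)) (avg \<phi>2 (snd z)))
          * pairing (tens (wav \<psi>1 (fst z)) (wav \<psi>2 (snd z))) g \<partial>zmeasure)"

definition is_paraproduct :: "('a::euclidean_space \<Rightarrow> real) \<Rightarrow> ('b::euclidean_space \<Rightarrow> real)
    \<Rightarrow> ('a \<Rightarrow> real) \<Rightarrow> ('b \<Rightarrow> real) \<Rightarrow> ('a \<times> 'b \<Rightarrow> complex)
    \<Rightarrow> (('a \<times> 'b \<Rightarrow> complex) \<Rightarrow> ('a \<times> 'b \<Rightarrow> complex)) \<Rightarrow> bool" where
  "is_paraproduct \<psi>1 \<psi>2 \<phi>1 \<phi>2 b T \<longleftrightarrow>
     (\<forall>f\<in>L2. \<forall>g\<in>L2. ((\<lambda>e. para_form_trunc \<psi>1 \<psi>2 \<phi>1 \<phi>2 b e f g) \<longlongrightarrow> pairing (T f) g) (at_right 0))"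

definition is_full_transpose :: "(('a::euclidean_space \<times> 'b::euclidean_space \<Rightarrow> complex) \<Rightarrow> ('a \<times> 'b \<Rightarrow> complex))
    \<Rightarrow> (('a \<times> 'b \<Rightarrow> complex) \<Rightarrow> ('a \<times> 'b \<Rightarrow> complex)) \<Rightarrow> bool" where
  "is_full_transpose S R \<longleftrightarrow> (\<forall>f1\<in>L2. \<forall>g1\<in>L2. \<forall>f2\<in>L2. \<forall>g2\<in>L2.
     pairing (R (tens g1 g2)) (tens f1 f2) = pairing (S (tens f1 f2)) (tens g1 g2))"

definition is_partial_transpose :: "(('a::euclidean_space \<times> 'b::euclidean_space \<Rightarrow> complex) \<Rightarrow> ('a \<times> 'b \<Rightarrow> complex))
    \<Rightarrow> (('a \<times> 'b \<Rightarrow> complex) \<Rightarrow> ('a \<times> 'b \<Rightarrow> complex)) \<Rightarrow> bool" where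
  "is_partial_transpose S R \<longleftrightarrow> (\<forall>f1\<in>L2. \<forall>g1\<in>L2. \<forall>f2\<in>L2. \<forall>g2\<in>L2.
     pairing (R (tens g1 f2)) (tens f1 g2) = pairing (S (tens f1 f2)) (tens g1 g2))"

definition is_partial_full_transpose :: "(('a::euclidean_space \<times> 'b::euclidean_space \<Rightarrow> complex) \<Rightarrow> ('a \<times> 'b \<Rightarrow> complex))
    \<Rightarrow> (('a \<times> 'b \<Rightarrow> complex) \<Rightarrow> ('a \<times> 'b \<Rightarrow> complex)) \<Rightarrow> bool" where
  "is_partial_full_transpose S R \<longleftrightarrow> (\<forall>f1\<in>L2. \<forall>g1\<in>L2. \<forall>f2\<in>L2. \<forall>g2\<in>L2.
     pairing (R (tens f1 g2)) (tens g1 f2) = pairing (S (tens f1 f2)) (tens g1 g2))"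

end

theory Submission
  imports Defs "HOL-Complex_Analysis.Great_Picard" "HOL-Library.Diagonal_Subsequence"
begin

text \<open>
  All four operators have a bilinear form \<open>\<integral> c(z) \<langle>F, \<eta>\<^sub>z\<rangle> \<langle>\<theta>\<^sub>z, G\<rangle> dz\<close> with \<open>c(z) = \<langle>b, \<psi>\<^sub>z\<rangle>\<close>, where in each
  of the two variables one of \<open>\<eta>\<close>, \<open>\<theta>\<close> is a wavelet and the other one an average. The main estimate is
  that this integral converges absolutely and is at most a constant times \<open>A\<^sup>1\<^sup>/\<^sup>2 \<parallel>F\<parallel> \<parallel>G\<parallel>\<close> whenever \<open>|c|\<^sup>2\<close> is
  a Carleson measure with constant \<open>A\<close>. It follows from the duality
  \<open>\<integral> |c| \<beta> dz \<lesssim> A\<^sup>1\<^sup>/\<^sup>2 \<integral> w dx\<close> for \<open>w(x)\<^sup>2 = \<integral>\<^sub>x\<^sub>\<in>\<^sub>R\<^sub>(\<^sub>z\<^sub>) \<beta>\<^sup>2 dz / |R(z)|\<close>, where \<open>R(z)\<close> is the rectangle of \<open>z\<close>: let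
  \<open>a(z)\<close> be the average of \<open>w\<^sup>1\<^sup>/\<^sup>2\<close> over \<open>R(z)\<close> and use \<open>|c| \<beta> \<le> s |c|\<^sup>2 a\<^sup>2 + \<beta>\<^sup>2 / (s a\<^sup>2)\<close>. The first term is
  controlled by the Carleson condition and the strong maximal function, the second one by
  \<open>1/a\<^sup>2 \<le> average of 1/w\<close> and Tonelli. The function \<open>w\<close> is then bounded by maximal and square
  functions, and the square function is bounded on \<open>L\<^sup>2\<close> by almost orthogonality and Schur's test.

  For \<open>b\<close> in CMO, the coefficients \<open>c\<close> are approximated, up to a small Carleson constant, by those of a
  Lipschitz function of bounded support restricted to scales between \<open>1/N\<close> and \<open>N\<close>. These give
  operators with Lipschitz kernels of bounded support, which are compact by Arzela--Ascoli, and a norm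
  limit of compact operators is compact.
\<close>

section \<open>Square-integrable functions\<close>

text \<open>Rectangles of two parameters are not nested, so no stopping time selects them; this is
  why the Carleson condition tests arbitrary open sets and why superlevel sets of maximal functions
  are fed into it. The averages are those of w^(1/2) because maximal functions are bounded on L^2
  but not on L^1: the square of the maximal function of w^(1/2) has an integral controlled by that
  of w. For the partial transposes each argument meets a wavelet in one variable and an average in
  the other. Then w is dominated by the root of a product of two mixed functions, each built from a
  square function in one variable of a maximal function in the other; the product arises because |R|
  and the indicator of R factor over the variables. Compactness of a partial transpose does not
  follow from that of the operator, hence the uniform treatment of four forms. In the approximation
  it is enough to cut off scales: for a symbol of bounded support the coefficients at bounded scales
  vanish unless the position is bounded too.\<close>

lemma L2_measurable [measurable_dest]: "f \<in> L2 \<Longrightarrow> f \<in> borel_measurable borel"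
  by (simp add: L2_def)

lemma L2norm_nonneg [simp]: "0 \<le> L2norm f"
  by (simp add: L2norm_def)

lemma nn_integral_L2:
  assumes "f \<in> L2"
  shows "(\<integral>\<^sup>+x. ennreal ((cmod (f x))\<^sup>2) \<partial>lborel) = ennreal ((L2norm f)\<^sup>2)"
  using assms by (subst nn_integral_eq_integral) (auto simp: L2_def L2norm_def)

lemma L2I:
  assumes [measurable]: "f \<in> borel_measurable borel"
    and "(\<integral>\<^sup>+x. ennreal ((cmod (f x))\<^sup>2) \<partial>lborel) < \<infinity>"
  shows "f \<in> L2"
  using assms by (auto simp: L2_def integrable_iff_bounded)

lemma L2norm_leI:
  assumes "f \<in> L2" "(\<integral>\<^sup>+x. ennreal ((cmod (f x))\<^sup>2) \<partial>lborel) \<le> ennreal (C\<^sup>2)" "0 \<le> C"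
  shows "L2norm f \<le> C"
proof -
  have "ennreal ((L2norm f)\<^sup>2) \<le> ennreal (C\<^sup>2)"
    using assms nn_integral_L2 by metis
  then show ?thesis
    using \<open>0 \<le> C\<close> by (simp add: power_mono_iff)
qed

lemma ennreal_power2_le_imp_le:
  fixes a b :: ennreal
  assumes "a\<^sup>2 \<le> b\<^sup>2"
  shows "a \<le> b"
  using assms
  by (cases a rule: ennreal_cases; cases b rule: ennreal_cases)
     (auto simp: ennreal_power abs_le_square_iff[symmetric] top_unique)

lemma L2_nn_Cauchy_Schwarz:
  assumes f: "f \<in> L2" and g: "g \<in> L2"
  shows "(\<integral>\<^sup>+x. ennreal (cmod (f x) * cmod (g x)) \<partial>lborel) \<le> ennreal (L2norm f * L2norm g)"
proof -
  have [measurable]: "f \<in> borel_measurable borel" "g \<in> borel_measurable borel"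
    using f g by measurable
  have "(\<integral>\<^sup>+x. ennreal (cmod (f x)) * ennreal (cmod (g x)) \<partial>lborel)\<^sup>2
      \<le> (\<integral>\<^sup>+x. ennreal (cmod (f x)) ^ 2 \<partial>lborel) * (\<integral>\<^sup>+x. ennreal (cmod (g x)) ^ 2 \<partial>lborel)"
    by (rule Cauchy_Schwarz_nn_integral) auto
  also have "\<dots> = ennreal ((L2norm f * L2norm g)\<^sup>2)"
    using nn_integral_L2[OF f] nn_integral_L2[OF g]
    by (simp add: ennreal_power ennreal_mult[symmetric] power_mult_distrib)
  also have "\<dots> = (ennreal (L2norm f * L2norm g))\<^sup>2"
    by (simp add: ennreal_power)
  finally show ?thesis
    by (simp add: ennreal_mult ennreal_power2_le_imp_le)
qed

lemma integrable_L2_mult: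
  assumes f: "f \<in> L2" and g: "g \<in> L2"
  shows "integrable lborel (\<lambda>x. f x * g x)"
proof -
  have [measurable]: "f \<in> borel_measurable borel" "g \<in> borel_measurable borel"
    using f g by measurable
  have "(\<integral>\<^sup>+x. ennreal (cmod (f x * g x)) \<partial>lborel) < \<infinity>"
    using L2_nn_Cauchy_Schwarz[OF f g] by (simp add: norm_mult order_le_less_trans)
  then show ?thesis by (auto simp: integrable_iff_bounded)
qed

lemma pairing_Cauchy_Schwarz:
  assumes f: "f \<in> L2" and g: "g \<in> L2"
  shows "cmod (pairing f g) \<le> L2norm f * L2norm g"
proof -
  have "cmod (pairing f g) \<le> (\<integral>x. cmod (f x * g x) \<partial>lborel)"
    unfolding pairing_def by (rule integral_norm_bound)
  moreover have "ennreal (\<integral>x. cmod (f x * g x) \<partial>lborel) = (\<integral>\<^sup>+x. ennreal (cmod (f x * g x)) \<partial>lborel)"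
    using integrable_norm[OF integrable_L2_mult[OF f g]] by (subst nn_integral_eq_integral) auto
  ultimately show ?thesis
    using L2_nn_Cauchy_Schwarz[OF f g] ennreal_le_iff[of "L2norm f * L2norm g" "\<integral>x. cmod (f x * g x) \<partial>lborel"]
    by (simp add: norm_mult)
qed

lemma L2_cnj: "f \<in> L2 \<Longrightarrow> (\<lambda>x. cnj (f x)) \<in> L2"
  by (auto simp: L2_def intro: borel_measurable_continuous_on[OF continuous_on_cnj[OF continuous_on_id]])

lemma L2norm_cnj [simp]: "L2norm (\<lambda>x. cnj (f x)) = L2norm f"
  by (simp add: L2norm_def)

text \<open>The pairing is bilinear, without conjugation, so a norm is recovered by testing against
  the conjugate. Bounds on bilinear forms turn into bounds on norms in this way.\<close>

lemma pairing_cnj_self: "f \<in> L2 \<Longrightarrow> pairing f (\<lambda>x. cnj (f x)) = complex_of_real ((L2norm f)\<^sup>2)"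
  by (simp add: pairing_def L2norm_def complex_mult_cnj cmod_power2
      integral_complex_of_real[symmetric] del: integral_complex_of_real of_real_add of_real_power)

lemma L2_scale:
  assumes "f \<in> L2"
  shows "(\<lambda>x. a * f x) \<in> L2"
  using assms by (auto simp: L2_def norm_mult power_mult_distrib)

lemma L2_add:
  assumes f: "f \<in> L2" and g: "g \<in> L2"
  shows "(\<lambda>x. f x + g x) \<in> L2"
proof -
  have [measurable]: "f \<in> borel_measurable borel" "g \<in> borel_measurable borel"
    using f g by measurable
  have "integrable lborel (\<lambda>x. (cmod (f x + g x))\<^sup>2)"
  proof (rule Bochner_Integration.integrable_bound)
    show "integrable lborel (\<lambda>x. 2 * (cmod (f x))\<^sup>2 + 2 * (cmod (g x))\<^sup>2)"
      using f g by (auto simp: L2_def)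
    have "(cmod (f x + g x))\<^sup>2 \<le> 2 * (cmod (f x))\<^sup>2 + 2 * (cmod (g x))\<^sup>2" for x
    proof -
      have "(cmod (f x + g x))\<^sup>2 \<le> (cmod (f x) + cmod (g x))\<^sup>2"
        by (intro power_mono norm_triangle_ineq) auto
      also have "\<dots> \<le> 2 * (cmod (f x))\<^sup>2 + 2 * (cmod (g x))\<^sup>2"
        using zero_le_power2[of "cmod (f x) - cmod (g x)"] by (simp add: power2_eq_square algebra_simps)
      finally show ?thesis .
    qed
    then show "AE x in lborel. norm ((cmod (f x + g x))\<^sup>2) \<le> norm (2 * (cmod (f x))\<^sup>2 + 2 * (cmod (g x))\<^sup>2)"
      by auto
  qed auto
  then show ?thesis by (auto simp: L2_def)
qed

lemma L2_diff: "f \<in> L2 \<Longrightarrow> g \<in> L2 \<Longrightarrow> (\<lambda>x. f x - g x) \<in> L2"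
  using L2_add[of f "\<lambda>x. (-1) * g x"] L2_scale[of g "-1"] by simp

lemma L2norm_diff_commute: "L2norm (\<lambda>x. f x - g x) = L2norm (\<lambda>x. g x - f x)"
  by (simp add: L2norm_def norm_minus_commute)

lemma pairing_add_left:
  assumes "f \<in> L2" "g \<in> L2" "h \<in> L2"
  shows "pairing (\<lambda>x. f x + g x) h = pairing f h + pairing g h"
  using assms by (simp add: pairing_def distrib_right integrable_L2_mult)

lemma pairing_diff_left:
  assumes "f \<in> L2" "g \<in> L2" "h \<in> L2"
  shows "pairing (\<lambda>x. f x - g x) h = pairing f h - pairing g h"
  using assms by (simp add: pairing_def left_diff_distrib integrable_L2_mult)

lemma pairing_scale_left: "pairing (\<lambda>x. a * f x) h = a * pairing f h"
  by (simp add: pairing_def mult.assoc)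

lemma pairing_commute: "pairing f g = pairing g f"
  by (simp add: pairing_def mult.commute)

text \<open>By duality: the sum is tested against its own conjugate, Cauchy-Schwarz is applied to
  both summands, and one factor of the norm cancels.\<close>

lemma L2norm_add_le:
  assumes f: "f \<in> L2" and g: "g \<in> L2"
  shows "L2norm (\<lambda>x. f x + g x) \<le> L2norm f + L2norm g"
proof -
  let ?h = "\<lambda>x. f x + g x" and ?c = "\<lambda>x. cnj (f x + g x)"
  have h: "?h \<in> L2" "?c \<in> L2" using L2_add[OF f g] L2_cnj[of ?h] by auto
  have "(L2norm ?h)\<^sup>2 = cmod (pairing ?h ?c)"
    using pairing_cnj_self[OF h(1)] by (simp add: norm_power)
  also have "\<dots> = cmod (pairing f ?c + pairing g ?c)"
    using pairing_add_left[OF f g h(2)] by simp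
  also have "\<dots> \<le> L2norm f * L2norm ?h + L2norm g * L2norm ?h"
    using pairing_Cauchy_Schwarz[OF f h(2), unfolded L2norm_cnj]
      pairing_Cauchy_Schwarz[OF g h(2), unfolded L2norm_cnj]
      norm_triangle_ineq[of "pairing f ?c" "pairing g ?c"] by linarith
  finally have "L2norm ?h * L2norm ?h \<le> (L2norm f + L2norm g) * L2norm ?h"
    by (simp add: power2_eq_square distrib_right)
  then show ?thesis
    using L2norm_nonneg[of ?h] L2norm_nonneg[of f] L2norm_nonneg[of g]
    by (cases "L2norm ?h = 0") auto
qed

lemma L2norm_diff_triangle:
  assumes "f \<in> L2" "g \<in> L2" "h \<in> L2"
  shows "L2norm (\<lambda>x. f x - h x) \<le> L2norm (\<lambda>x. f x - g x) + L2norm (\<lambda>x. g x - h x)"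
  using L2norm_add_le[OF L2_diff[OF assms(1,2)] L2_diff[OF assms(2,3)]] by simp

lemma L2norm_zero_AE:
  assumes "f \<in> L2" "L2norm f = 0"
  shows "AE x in lborel. f x = 0"
proof -
  have [measurable]: "f \<in> borel_measurable borel"
    using assms(1) by measurable
  have "(\<integral>\<^sup>+x. ennreal ((cmod (f x))\<^sup>2) \<partial>lborel) = 0"
    using nn_integral_L2[OF assms(1)] assms(2) by simp
  then show ?thesis
    by (subst (asm) nn_integral_0_iff_AE) (auto simp: ennreal_eq_0_iff)
qed

text \<open>If the differences \<open>d\<^sub>k\<close> of consecutive terms satisfy \<open>\<parallel>d\<^sub>k\<parallel>\<^sup>2 \<le> 4\<^sup>-\<^sup>k\<close>, then
  \<open>|d\<^sub>k| \<le> 2\<^sup>-\<^sup>k + 2\<^sup>k |d\<^sub>k|\<^sup>2\<close> gives pointwise summability almost everywhere.\<close>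
lemma L2_rapidly_Cauchy_AE_convergent:
  fixes s :: "nat \<Rightarrow> 'c::euclidean_space \<Rightarrow> complex"
  assumes s: "\<And>k. s k \<in> L2"
    and rapid: "\<And>k. L2norm (\<lambda>x. s (Suc k) x - s k x) \<le> (1/2)^k"
  shows "AE x in lborel. convergent (\<lambda>k. s k x)"
proof -
  have [measurable]: "s k \<in> borel_measurable borel" for k
    using s by measurable
  let ?d = "\<lambda>k x. s (Suc k) x - s k x"
  let ?S = "\<lambda>x. \<Sum>k. ennreal (2^k * (cmod (?d k x))\<^sup>2)"
  have "(\<integral>\<^sup>+x. ?S x \<partial>lborel) = (\<Sum>k. \<integral>\<^sup>+x. ennreal (2^k * (cmod (?d k x))\<^sup>2) \<partial>lborel)"
    by (intro nn_integral_suminf) auto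
  also have "\<dots> \<le> (\<Sum>k. ennreal ((1/2)^k))"
  proof (intro suminf_le summableI)
    fix k
    have "(\<integral>\<^sup>+x. ennreal (2^k * (cmod (?d k x))\<^sup>2) \<partial>lborel) = ennreal (2^k) * ennreal ((L2norm (?d k))\<^sup>2)"
      using nn_integral_L2[OF L2_diff[OF s[of "Suc k"] s[of k]]]
      by (simp add: ennreal_mult nn_integral_cmult)
    also have "\<dots> \<le> ennreal (2^k) * ennreal (((1/2)^k)\<^sup>2)"
      by (intro mult_left_mono ennreal_leI power_mono rapid) auto
    also have "\<dots> = ennreal ((1/2)^k)"
      by (simp add: ennreal_mult[symmetric] power2_eq_square power_mult_distrib[symmetric] mult.assoc[symmetric])
    finally show "(\<integral>\<^sup>+x. ennreal (2^k * (cmod (?d k x))\<^sup>2) \<partial>lborel) \<le> ennreal ((1/2)^k)" .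
  qed
  also have "\<dots> = ennreal (\<Sum>k. (1/2)^k)"
    by (intro suminf_ennreal2 summable_geometric) auto
  also have "\<dots> < \<infinity>" by simp
  finally have "AE x in lborel. ?S x \<noteq> \<infinity>"
    by (intro nn_integral_PInf_AE) auto
  then show ?thesis
  proof eventually_elim
    case (elim x)
    then have "summable (\<lambda>k. 2^k * (cmod (?d k x))\<^sup>2)"
      by (intro summable_suminf_not_top) auto
    then have "summable (\<lambda>k. (1/2)^k + 2^k * (cmod (?d k x))\<^sup>2)"
      by (intro summable_add summable_geometric) auto
    then have "summable (\<lambda>k. ?d k x)"
    proof (rule summable_comparison_test[rotated], intro exI allI impI)
      fix k :: nat
      have "0 \<le> 2^k * (cmod (?d k x) - (1/2)^k)\<^sup>2" by simp
      also have "\<dots> = 2^k * (cmod (?d k x))\<^sup>2 - 2 * cmod (?d k x) + (1/2)^k"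
        by (simp add: power2_eq_square algebra_simps power_mult_distrib[symmetric] flip: power_mult_distrib)
      finally show "cmod (?d k x) \<le> (1/2)^k + 2^k * (cmod (?d k x))\<^sup>2"
        by (smt (verit) norm_ge_zero)
    qed
    then have "convergent (\<lambda>n. \<Sum>k<n. ?d k x)"
      by (simp add: summable_iff_convergent)
    then have "convergent (\<lambda>n. (\<Sum>k<n. ?d k x) + s 0 x)"
      by (intro convergent_add convergent_const)
    then show ?case
      using sum_lessThan_telescope[of "\<lambda>k. s k x"] by simp
  qed
qed

theorem L2_complete:
  fixes s :: "nat \<Rightarrow> 'c::euclidean_space \<Rightarrow> complex"
  assumes s: "\<And>k. s k \<in> L2"
    and Cauchy: "\<And>e. 0 < e \<Longrightarrow> \<exists>N. \<forall>m\<ge>N. \<forall>n\<ge>N. L2norm (\<lambda>x. s m x - s n x) < e"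
  shows "\<exists>h\<in>L2. (\<lambda>k. L2norm (\<lambda>x. s k x - h x)) \<longlonglongrightarrow> 0"
proof -
  have [measurable]: "s k \<in> borel_measurable borel" for k
    using s by measurable
  have "\<forall>k::nat. \<exists>N. \<forall>m\<ge>N. \<forall>n\<ge>N. L2norm (\<lambda>x. s m x - s n x) < (1/2)^k"
    using Cauchy by simp
  then obtain M where M: "\<And>k m n. M k \<le> m \<Longrightarrow> M k \<le> n \<Longrightarrow> L2norm (\<lambda>x. s m x - s n x) < (1/2)^k"
    by metis
  \<comment> \<open>\<open>M\<close> fixes the rate of the subsequence; the maximum with
    \<open>Suc (r k)\<close> keeps it strictly increasing.\<close>
  define r where "r = rec_nat (M 0) (\<lambda>k rk. max (M (Suc k)) (Suc rk))"
  have r0: "r 0 = M 0" and rS: "r (Suc k) = max (M (Suc k)) (Suc (r k))" for k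
    by (simp_all add: r_def)
  have rM: "M k \<le> r k" for k
    by (cases k) (auto simp: r0 rS)
  have rmono: "strict_mono r"
    by (rule strict_monoI_Suc) (simp add: rS less_max_iff_disj)
  have "AE x in lborel. convergent (\<lambda>k. s (r k) x)"
  proof (rule L2_rapidly_Cauchy_AE_convergent[of "\<lambda>k. s (r k)"])
    show "L2norm (\<lambda>x. s (r (Suc k)) x - s (r k) x) \<le> (1/2)^k" for k
      using M[of k "r (Suc k)" "r k"] rM[of k] strict_mono_less_eq[OF rmono, of k "Suc k"] by force
  qed (rule s)
  define h where "h x = lim (\<lambda>k. s (r k) x)" for x
  have [measurable]: "h \<in> borel_measurable borel"
    unfolding h_def[abs_def] by (rule borel_measurable_lim_metric) measurable
  have lim: "AE x in lborel. (\<lambda>k. s (r k) x) \<longlonglongrightarrow> h x"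
    using \<open>AE x in lborel. convergent _\<close> by eventually_elim (simp add: h_def convergent_LIMSEQ_iff)
  \<comment> \<open>Fatou along the subsequence, with \<open>n\<close> fixed: the bound holds for
    all late \<open>n\<close> of the full sequence, so that the full sequence converges.\<close>
  have bound: "(\<integral>\<^sup>+x. ennreal ((cmod (s n x - h x))\<^sup>2) \<partial>lborel) \<le> ennreal (e\<^sup>2)"
    if N: "\<forall>m\<ge>N. \<forall>n\<ge>N. L2norm (\<lambda>x. s m x - s n x) < e" and n: "n \<ge> N" for N n e
  proof -
    have e: "0 < e"
      using N n L2norm_nonneg[of "\<lambda>x. s n x - s n x"] by (meson le_less_trans)
    have "(\<integral>\<^sup>+x. ennreal ((cmod (s n x - h x))\<^sup>2) \<partial>lborel)
        = (\<integral>\<^sup>+x. liminf (\<lambda>k. ennreal ((cmod (s n x - s (r k) x))\<^sup>2)) \<partial>lborel)"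
    proof (rule nn_integral_cong_AE, use lim in eventually_elim)
      case (elim x)
      have "(\<lambda>k. ennreal ((cmod (s n x - s (r k) x))\<^sup>2)) \<longlonglongrightarrow> ennreal ((cmod (s n x - h x))\<^sup>2)"
        by (intro tendsto_ennrealI tendsto_power tendsto_norm tendsto_diff tendsto_const elim)
      then show ?case by (rule lim_imp_Liminf[symmetric, rotated]) simp
    qed
    also have "\<dots> \<le> liminf (\<lambda>k. \<integral>\<^sup>+x. ennreal ((cmod (s n x - s (r k) x))\<^sup>2) \<partial>lborel)"
      by (intro nn_integral_liminf) auto
    also have "\<dots> \<le> ennreal (e\<^sup>2)"
    proof (rule Liminf_le)
      show "\<forall>\<^sub>F k in sequentially. (\<integral>\<^sup>+x. ennreal ((cmod (s n x - s (r k) x))\<^sup>2) \<partial>lborel) \<le> ennreal (e\<^sup>2)"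
        using eventually_ge_at_top[of N]
      proof eventually_elim
        case (elim k)
        then have "r k \<ge> N" using seq_suble[OF rmono, of k] by simp
        then have "L2norm (\<lambda>x. s n x - s (r k) x) < e" using N n by blast
        then show ?case
          using e by (subst nn_integral_L2[OF L2_diff[OF s s]]) (auto intro!: ennreal_leI power_mono)
      qed
    qed simp
    finally show ?thesis .
  qed
  have diff: "(\<lambda>x. s n x - h x) \<in> L2"
    if "\<forall>m\<ge>N. \<forall>n\<ge>N. L2norm (\<lambda>x. s m x - s n x) < e" "n \<ge> N" for N n e
    by (rule L2I) (use bound[OF that] in \<open>auto intro: order_le_less_trans\<close>)
  obtain N1 where N1: "\<forall>m\<ge>N1. \<forall>n\<ge>N1. L2norm (\<lambda>x. s m x - s n x) < 1"
    using Cauchy[of 1] by auto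
  \<comment> \<open>\<open>h\<close> is a term of the sequence minus a difference already known to
    be in \<open>L2\<close>.\<close>
  have h: "h \<in> L2"
    using L2_diff[OF s[of N1] diff[OF N1, of N1]] by simp
  have "(\<lambda>k. L2norm (\<lambda>x. s k x - h x)) \<longlonglongrightarrow> 0"
  proof (rule LIMSEQ_I)
    fix e :: real assume "0 < e"
    then obtain N where N: "\<forall>m\<ge>N. \<forall>n\<ge>N. L2norm (\<lambda>x. s m x - s n x) < e/2"
      using Cauchy[of "e/2"] by auto
    have "L2norm (\<lambda>x. s n x - h x) \<le> e/2" if "n \<ge> N" for n
      using L2norm_leI[OF diff[OF N that] bound[OF N that]] \<open>0 < e\<close> by simp
    then show "\<exists>N. \<forall>n\<ge>N. norm (L2norm (\<lambda>x. s n x - h x) - 0) < e"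
      using \<open>0 < e\<close> by (intro exI[of _ N]) force
  qed
  with h show ?thesis by blast
qed

section \<open>Compact operators\<close>

lemma compact_opD:
  fixes s :: "nat \<Rightarrow> 'c::euclidean_space \<Rightarrow> complex"
  assumes "compact_op T"
  shows "f \<in> L2 \<Longrightarrow> T f \<in> L2"
    and "f \<in> L2 \<Longrightarrow> g \<in> L2 \<Longrightarrow> AE x in lborel. T (\<lambda>y. a * f y + b * g y) x = a * T f x + b * T g x"
    and "\<forall>k. s k \<in> L2 \<and> L2norm (s k) \<le> C \<Longrightarrow>
        \<exists>r h. strict_mono r \<and> h \<in> L2 \<and> (\<lambda>k. L2norm (\<lambda>x. T (s (r k)) x - h x)) \<longlonglongrightarrow> 0"
  using assms unfolding compact_op_def by blast+

lemma tendsto_pairing_left: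
  assumes "\<And>n. u n \<in> L2" "v \<in> L2" "g \<in> L2" "(\<lambda>n. L2norm (\<lambda>x. u n x - v x)) \<longlonglongrightarrow> 0"
  shows "(\<lambda>n. pairing (u n) g) \<longlonglongrightarrow> pairing v g"
proof (rule LIM_zero_cancel, rule Lim_null_comparison)
  show "\<forall>\<^sub>F n in sequentially. norm (pairing (u n) g - pairing v g) \<le> L2norm (\<lambda>x. u n x - v x) * L2norm g"
    using pairing_Cauchy_Schwarz[OF L2_diff[OF assms(1,2)] assms(3)] pairing_diff_left[OF assms(1-3)]
    by (simp add: always_eventually)
  show "(\<lambda>n. L2norm (\<lambda>x. u n x - v x) * L2norm g) \<longlonglongrightarrow> 0"
    using tendsto_mult_left_zero[OF assms(4)] .
qed

text \<open>The approximating operators form a Cauchy sequence, so that completeness of \<open>L2\<close> replaces the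
  Riesz representation theorem.\<close>
theorem compact_op_of_form_limit:
  fixes T :: "nat \<Rightarrow> ('c::euclidean_space \<Rightarrow> complex) \<Rightarrow> ('c \<Rightarrow> complex)"
  assumes T: "\<And>n. compact_op (T n)"
    and nonneg: "\<And>n. 0 \<le> \<epsilon> n" and lim: "\<epsilon> \<longlonglongrightarrow> 0"
    and approx: "\<And>n f g. f \<in> L2 \<Longrightarrow> g \<in> L2 \<Longrightarrow>
        cmod (B f g - pairing (T n f) g) \<le> \<epsilon> n * L2norm f * L2norm g"
  shows "\<exists>S. compact_op S \<and> (\<forall>f\<in>L2. \<forall>g\<in>L2. pairing (S f) g = B f g)"
proof -
  note TL2 = compact_opD(1)[OF T]
  \<comment> \<open>Testing against the conjugate of the difference makes \<open>B f\<close> cancel,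
    so the distance of two approximants is bounded without an operator representing
    \<open>B\<close>.\<close>
  have diff: "L2norm (\<lambda>x. T m f x - T n f x) \<le> (\<epsilon> m + \<epsilon> n) * L2norm f" if f: "f \<in> L2" for m n f
  proof -
    let ?D = "\<lambda>x. T m f x - T n f x" and ?c = "\<lambda>x. cnj (T m f x - T n f x)"
    have D: "?D \<in> L2" "?c \<in> L2" using L2_diff[OF TL2 TL2] L2_cnj[of ?D] f by auto
    have "(L2norm ?D)\<^sup>2 = cmod (pairing ?D ?c)"
      using pairing_cnj_self[OF D(1)] by (simp add: norm_power)
    also have "\<dots> = cmod ((B f ?c - pairing (T n f) ?c) - (B f ?c - pairing (T m f) ?c))"
      using pairing_diff_left[OF TL2[OF f] TL2[OF f] D(2)] by simp
    also have "\<dots> \<le> \<epsilon> n * L2norm f * L2norm ?D + \<epsilon> m * L2norm f * L2norm ?D"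
      using norm_triangle_ineq4[of "B f ?c - pairing (T n f) ?c" "B f ?c - pairing (T m f) ?c"]
        approx[OF f D(2), of n, unfolded L2norm_cnj] approx[OF f D(2), of m, unfolded L2norm_cnj] by linarith
    finally have "L2norm ?D * L2norm ?D \<le> ((\<epsilon> m + \<epsilon> n) * L2norm f) * L2norm ?D"
      by (simp add: power2_eq_square algebra_simps)
    then show ?thesis
      using L2norm_nonneg[of ?D] L2norm_nonneg[of f] nonneg[of m] nonneg[of n]
      by (cases "L2norm ?D = 0") auto
  qed
  have "\<exists>h\<in>L2. (\<lambda>k. L2norm (\<lambda>x. T k f x - h x)) \<longlonglongrightarrow> 0" if f: "f \<in> L2" for f
  proof (rule L2_complete)
    show "T k f \<in> L2" for k using TL2 f by auto
    fix e :: real assume e: "0 < e"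
    then have "0 < e / (2 * (L2norm f + 1))" by (simp add: add_nonneg_pos)
    then obtain N where N: "\<And>n. n \<ge> N \<Longrightarrow> \<epsilon> n < e / (2 * (L2norm f + 1))"
      using order_tendstoD(2)[OF lim] by (auto simp: eventually_sequentially)
    have "L2norm (\<lambda>x. T m f x - T n f x) < e" if "m \<ge> N" "n \<ge> N" for m n
    proof -
      have pos: "0 < L2norm f + 1" by (simp add: add_nonneg_pos)
      have "L2norm (\<lambda>x. T m f x - T n f x) \<le> (\<epsilon> m + \<epsilon> n) * (L2norm f + 1)"
        using diff[OF f, of m n] nonneg[of m] nonneg[of n] by (simp add: distrib_left)
      also have "\<dots> < e"
        using N[OF that(1)] N[OF that(2)] pos by (simp add: pos_less_divide_eq algebra_simps)
      finally show ?thesis .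
    qed
    then show "\<exists>N. \<forall>m\<ge>N. \<forall>n\<ge>N. L2norm (\<lambda>x. T m f x - T n f x) < e" by blast
  qed
  then obtain S where SL2: "\<And>f. f \<in> L2 \<Longrightarrow> S f \<in> L2"
    and S: "\<And>f. f \<in> L2 \<Longrightarrow> (\<lambda>k. L2norm (\<lambda>x. T k f x - S f x)) \<longlonglongrightarrow> 0"
    by metis
  \<comment> \<open>Let \<open>m\<close> tend to infinity in the estimate for \<open>T m\<close> and
    \<open>T n\<close>. The error is uniform on bounded sets, as the compactness argument
    requires.\<close>
  have err: "L2norm (\<lambda>x. T n f x - S f x) \<le> \<epsilon> n * L2norm f" if f: "f \<in> L2" for n f
  proof (rule LIMSEQ_le_const)
    have "(\<lambda>m. (\<epsilon> n + \<epsilon> m) * L2norm f + L2norm (\<lambda>x. T m f x - S f x)) \<longlonglongrightarrow> (\<epsilon> n + 0) * L2norm f + 0"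
      by (intro tendsto_intros lim S f)
    then show "(\<lambda>m. (\<epsilon> n + \<epsilon> m) * L2norm f + L2norm (\<lambda>x. T m f x - S f x)) \<longlonglongrightarrow> \<epsilon> n * L2norm f"
      by simp
    show "\<exists>N. \<forall>m\<ge>N. L2norm (\<lambda>x. T n f x - S f x) \<le> (\<epsilon> n + \<epsilon> m) * L2norm f + L2norm (\<lambda>x. T m f x - S f x)"
      using L2norm_diff_triangle[OF TL2[OF f] TL2[OF f] SL2[OF f]] diff[OF f]
      by (meson add_right_mono order_trans)
  qed
  have limB: "(\<lambda>n. pairing (T n f) g) \<longlonglongrightarrow> B f g" if f: "f \<in> L2" and g: "g \<in> L2" for f g
  proof (rule LIM_zero_cancel, rule Lim_null_comparison)
    show "\<forall>\<^sub>F n in sequentially. norm (pairing (T n f) g - B f g) \<le> \<epsilon> n * L2norm f * L2norm g"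
      using approx[OF f g] by (simp add: always_eventually norm_minus_commute)
    show "(\<lambda>n. \<epsilon> n * L2norm f * L2norm g) \<longlonglongrightarrow> 0"
      by (intro tendsto_mult_left_zero lim)
  qed
  have pair: "pairing (S f) g = B f g" if f: "f \<in> L2" and g: "g \<in> L2" for f g
    using LIMSEQ_unique[OF tendsto_pairing_left[OF TL2[OF f] SL2[OF f] g S[OF f]] limB[OF f g]] .
  \<comment> \<open>\<open>S f\<close> is chosen separately for each \<open>f\<close>, so linearity
    has to come from \<open>B\<close>: the form is a limit of linear ones, and the defect of
    \<open>S\<close> pairs to zero with its own conjugate, hence vanishes almost everywhere.\<close>
  have lin: "AE x in lborel. S (\<lambda>y. a * f y + b * g y) x = a * S f x + b * S g x"
    if f: "f \<in> L2" and g: "g \<in> L2" for f g a b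
  proof -
    let ?k = "\<lambda>y. a * f y + b * g y" and ?l = "\<lambda>x. a * S f x + b * S g x"
    have k: "?k \<in> L2" and l: "?l \<in> L2"
      using f g SL2 by (auto intro!: L2_add L2_scale)
    have Blin: "B ?k c = a * B f c + b * B g c" if c: "c \<in> L2" for c
    proof (rule LIMSEQ_unique[OF limB[OF k c]])
      have "pairing (T n ?k) c = a * pairing (T n f) c + b * pairing (T n g) c" for n
      proof -
        have [measurable]: "T n f \<in> borel_measurable borel" "T n g \<in> borel_measurable borel"
            "T n ?k \<in> borel_measurable borel" "c \<in> borel_measurable borel"
          using TL2[OF f] TL2[OF g] TL2[OF k] c by (auto simp: L2_def)
        have "pairing (T n ?k) c = pairing (\<lambda>x. a * T n f x + b * T n g x) c"
          unfolding pairing_def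
          by (rule integral_cong_AE, measurable)
             (use compact_opD(2)[OF T f g, of n a b] in \<open>auto simp: L2_def\<close>)
        then show ?thesis
          using TL2[OF f] TL2[OF g] c
          by (simp add: pairing_add_left L2_scale pairing_scale_left)
      qed
      then show "(\<lambda>n. pairing (T n ?k) c) \<longlonglongrightarrow> a * B f c + b * B g c"
        using tendsto_add[OF tendsto_mult_left[OF limB[OF f c]] tendsto_mult_left[OF limB[OF g c]]] by simp
    qed
    let ?D = "\<lambda>x. S ?k x - ?l x" and ?c = "\<lambda>x. cnj (S ?k x - ?l x)"
    have D: "?D \<in> L2" "?c \<in> L2" using L2_diff[OF SL2[OF k] l] L2_cnj[of ?D] by auto
    have "pairing ?D ?c = B ?k ?c - (a * B f ?c + b * B g ?c)"
      using pairing_diff_left[OF SL2[OF k] l D(2)] pair[OF k D(2)] pair[OF f D(2)] pair[OF g D(2)]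
        pairing_add_left[OF L2_scale[OF SL2[OF f], of a] L2_scale[OF SL2[OF g], of b] D(2)]
      by (simp add: pairing_scale_left)
    then have "pairing ?D ?c = 0" by (simp only: Blin[OF D(2)] diff_self)
    then have "L2norm ?D = 0"
      using pairing_cnj_self[OF D(1)] by simp
    from L2norm_zero_AE[OF D(1) this] show ?thesis by auto
  qed
  have cpt: "\<exists>r h. strict_mono r \<and> h \<in> L2 \<and> (\<lambda>k. L2norm (\<lambda>x. S (s (r k)) x - h x)) \<longlonglongrightarrow> 0"
    if s: "\<And>k. s k \<in> L2 \<and> L2norm (s k) \<le> C" for s :: "nat \<Rightarrow> 'c \<Rightarrow> complex" and C
  proof -
    define P where "P n r = (\<exists>h. h \<in> L2 \<and> (\<lambda>k. L2norm (\<lambda>x. T n (s (r k)) x - h x)) \<longlonglongrightarrow> 0)"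
      for n and r :: "nat \<Rightarrow> nat"
    interpret subseqs P
    proof
      fix n and r :: "nat \<Rightarrow> nat"
      show "\<exists>r'. strict_mono r' \<and> P n (r \<circ> r')"
        using compact_opD(3)[OF T, of "s \<circ> r" C n] s unfolding P_def by auto
    qed
    \<comment> \<open>From index \<open>Suc n\<close> on, the diagonal sequence is a subsequence of
      one that makes \<open>T n\<close> converge; convergence passes to subsequences, so one
      sequence serves every \<open>n\<close>.\<close>
    have Pdiag: "P n (diagseq \<circ> ((+) (Suc n)))" for n
    proof (rule diagseq_holds)
      fix r q :: "nat \<Rightarrow> nat" and n assume "strict_mono r" "P n q"
      then obtain h where "h \<in> L2" "(\<lambda>k. L2norm (\<lambda>x. T n (s (q k)) x - h x)) \<longlonglongrightarrow> 0"
        by (auto simp: P_def)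
      then show "P n (q \<circ> r)"
        using LIMSEQ_subseq_LIMSEQ[OF _ \<open>strict_mono r\<close>] unfolding P_def by (fastforce simp: o_def)
    qed
    have C: "0 \<le> C" using s[of 0] L2norm_nonneg[of "s 0"] by linarith
    have "\<exists>h\<in>L2. (\<lambda>k. L2norm (\<lambda>x. S (s (diagseq k)) x - h x)) \<longlonglongrightarrow> 0"
    proof (rule L2_complete)
      show "S (s (diagseq k)) \<in> L2" for k using SL2 s by auto
      fix e :: real assume e: "0 < e"
      then have "0 < e / (4 * (C + 1))" using C by simp
      then obtain n where n: "\<epsilon> n < e / (4 * (C + 1))"
        using order_tendstoD(2)[OF lim] by (auto simp: eventually_sequentially)
      have nC: "\<epsilon> n * C < e / 4"
      proof -
        have "\<epsilon> n * C \<le> \<epsilon> n * (C + 1)" using nonneg C by (simp add: mult_left_mono)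
        also have "\<dots> < e / (4 * (C + 1)) * (C + 1)" using n C by (intro mult_strict_right_mono) auto
        also have "\<dots> = e / 4" using C by (simp add: field_simps)
        finally show ?thesis .
      qed
      obtain h where h: "h \<in> L2"
        and "(\<lambda>k. L2norm (\<lambda>x. T n (s (diagseq (Suc n + k))) x - h x)) \<longlonglongrightarrow> 0"
        using Pdiag[of n] unfolding P_def o_def by auto
      then obtain N where "\<And>k. k \<ge> N \<Longrightarrow> L2norm (\<lambda>x. T n (s (diagseq (Suc n + k))) x - h x) < e / 4"
        using order_tendstoD(2)[of _ 0 sequentially "e/4"] e by (auto simp: eventually_sequentially)
      then have N: "L2norm (\<lambda>x. T n (s (diagseq k)) x - h x) < e / 4" if "k \<ge> Suc n + N" for k
        using that by (metis le_Suc_ex add.assoc le_add1)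
      have near: "L2norm (\<lambda>x. S (s (diagseq k)) x - h x) < e / 2" if "k \<ge> Suc n + N" for k
      proof -
        let ?u = "s (diagseq k)"
        have u: "?u \<in> L2" "L2norm ?u \<le> C" using s by auto
        have "L2norm (\<lambda>x. S ?u x - h x) \<le> L2norm (\<lambda>x. S ?u x - T n ?u x) + L2norm (\<lambda>x. T n ?u x - h x)"
          by (intro L2norm_diff_triangle SL2 TL2 u h)
        moreover have "L2norm (\<lambda>x. S ?u x - T n ?u x) \<le> \<epsilon> n * C"
          using err[OF u(1), of n] mult_left_mono[OF u(2) nonneg[of n]]
            L2norm_diff_commute[of "S ?u" "T n ?u"] by linarith
        ultimately show ?thesis using nC N[OF that] by linarith
      qed
      show "\<exists>N. \<forall>m\<ge>N. \<forall>k\<ge>N. L2norm (\<lambda>x. S (s (diagseq m)) x - S (s (diagseq k)) x) < e"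
      proof (intro exI[of _ "Suc n + N"] allI impI)
        fix m k assume mk: "m \<ge> Suc n + N" "k \<ge> Suc n + N"
        have "S (s (diagseq m)) \<in> L2" "S (s (diagseq k)) \<in> L2" using SL2 s by auto
        then show "L2norm (\<lambda>x. S (s (diagseq m)) x - S (s (diagseq k)) x) < e"
          using L2norm_diff_triangle[OF _ h, of "S (s (diagseq m))" "S (s (diagseq k))"]
            near[OF mk(1)] near[OF mk(2)] L2norm_diff_commute[of h "S (s (diagseq k))"] by linarith
      qed
    qed
    then show ?thesis using subseq_diagseq by blast
  qed
  have "compact_op S"
    unfolding compact_op_def using SL2 lin cpt by blast
  then show ?thesis using pair by blast
qed

section \<open>Superpositions of rank one operators with Lipschitz kernels\<close>

lemma L2_bounded_support:
  fixes f :: "'c::euclidean_space \<Rightarrow> complex"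
  assumes [measurable]: "f \<in> borel_measurable borel"
    and K: "\<And>x. cmod (f x) \<le> K" and supp: "\<And>x. x \<notin> cball 0 R \<Longrightarrow> f x = 0"
  shows "f \<in> L2" and "L2norm f \<le> K * sqrt (measure lborel (cball (0::'c) R))"
proof -
  have K0: "0 \<le> K" using K[of 0] norm_ge_zero[of "f 0"] by linarith
  have "(\<integral>\<^sup>+x. ennreal ((cmod (f x))\<^sup>2) \<partial>lborel) \<le> (\<integral>\<^sup>+x. ennreal (K\<^sup>2) * indicator (cball (0::'c) R) x \<partial>lborel)"
  proof (rule nn_integral_mono)
    show "ennreal ((cmod (f x))\<^sup>2) \<le> ennreal (K\<^sup>2) * indicator (cball 0 R) x" for x
      using K[of x] supp[of x] by (auto simp: indicator_def intro!: ennreal_leI power_mono)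
  qed
  also have "\<dots> = ennreal (K\<^sup>2) * emeasure lborel (cball (0::'c) R)"
    by (rule nn_integral_cmult_indicator) simp
  also have "\<dots> = ennreal ((K * sqrt (measure lborel (cball (0::'c) R)))\<^sup>2)"
    using emeasure_lborel_cball_finite[of "0::'c" R]
    by (simp add: emeasure_eq_ennreal_measure ennreal_mult power_mult_distrib)
  finally have *: "(\<integral>\<^sup>+x. ennreal ((cmod (f x))\<^sup>2) \<partial>lborel)
      \<le> ennreal ((K * sqrt (measure lborel (cball (0::'c) R)))\<^sup>2)" .
  then show "f \<in> L2" by (intro L2I) (auto intro: order_le_less_trans)
  then show "L2norm f \<le> K * sqrt (measure lborel (cball (0::'c) R))"
    using * K0 by (intro L2norm_leI) auto
qed

text \<open>The operator is the integral of the rank one operators that send \<open>f\<close> to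
  \<open>c z * pairing f (\<eta> z)\<close> times \<open>\<theta> z\<close>. The bounds are demanded
  where \<open>c z\<close> does not vanish, because wavelets and averages are uniformly bounded only
  for scales away from 0 and infinity. The Lipschitz condition is on \<open>\<theta>\<close>, which
  determines the regularity of the output.\<close>

locale superposition = sigma_finite_measure M for M :: "'z measure" +
  fixes c :: "'z \<Rightarrow> complex" and \<eta> \<theta> :: "'z \<Rightarrow> 'c::euclidean_space \<Rightarrow> complex" and K L R :: real
  assumes space: "space M = UNIV"
    and c: "integrable M c"
    and \<eta>: "(\<lambda>(z, x). \<eta> z x) \<in> borel_measurable (M \<Otimes>\<^sub>M borel)"
    and \<theta>: "(\<lambda>(z, x). \<theta> z x) \<in> borel_measurable (M \<Otimes>\<^sub>M borel)"
    and \<eta>_bound: "\<And>z x. c z \<noteq> 0 \<Longrightarrow> cmod (\<eta> z x) \<le> K"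
    and \<theta>_bound: "\<And>z x. c z \<noteq> 0 \<Longrightarrow> cmod (\<theta> z x) \<le> K"
    and \<eta>_supp: "\<And>z x. c z \<noteq> 0 \<Longrightarrow> x \<notin> cball 0 R \<Longrightarrow> \<eta> z x = 0"
    and \<theta>_supp: "\<And>z x. c z \<noteq> 0 \<Longrightarrow> x \<notin> cball 0 R \<Longrightarrow> \<theta> z x = 0"
    and \<theta>_lipschitz: "\<And>z x y. c z \<noteq> 0 \<Longrightarrow> cmod (\<theta> z x - \<theta> z y) \<le> L * norm (x - y)"
begin

definition T :: "('c \<Rightarrow> complex) \<Rightarrow> 'c \<Rightarrow> complex" where
  "T f x = (\<integral>z. c z * pairing f (\<eta> z) * \<theta> z x \<partial>M)"

definition V :: real where "V = K * sqrt (measure lborel (cball (0::'c) R))"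

lemmas [measurable] = \<eta> \<theta> c[THEN borel_measurable_integrable]

lemma \<eta>_z [measurable]: "\<eta> z \<in> borel_measurable borel" and \<theta>_z [measurable]: "\<theta> z \<in> borel_measurable borel"
  using measurable_Pair2[OF \<eta>, of z] measurable_Pair2[OF \<theta>, of z] space by auto

lemma \<theta>_x [measurable]: "(\<lambda>z. \<theta> z x) \<in> borel_measurable M"
  using measurable_Pair1[OF \<theta>, of x] by auto

lemma \<eta>_L2: "c z \<noteq> 0 \<Longrightarrow> \<eta> z \<in> L2" "c z \<noteq> 0 \<Longrightarrow> L2norm (\<eta> z) \<le> V"
  and \<theta>_L2: "c z \<noteq> 0 \<Longrightarrow> \<theta> z \<in> L2" "c z \<noteq> 0 \<Longrightarrow> L2norm (\<theta> z) \<le> V"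
  using L2_bounded_support[of "\<eta> z" K R] L2_bounded_support[of "\<theta> z" K R]
    \<eta>_bound[of z] \<theta>_bound[of z] \<eta>_supp[of z] \<theta>_supp[of z] by (auto simp: V_def)

lemma coefficient_measurable [measurable]:
  assumes "f \<in> L2"
  shows "(\<lambda>z. pairing f (\<eta> z)) \<in> borel_measurable M"
proof -
  have [measurable]: "f \<in> borel_measurable borel" using assms by measurable
  show ?thesis unfolding pairing_def by measurable
qed

lemma coefficient_bound:
  assumes "f \<in> L2"
  shows "cmod (c z * pairing f (\<eta> z)) \<le> L2norm f * V * cmod (c z)"
proof (cases "c z = 0")
  case False
  have "cmod (pairing f (\<eta> z)) \<le> L2norm f * L2norm (\<eta> z)"
    by (rule pairing_Cauchy_Schwarz[OF assms \<eta>_L2(1)[OF False]])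
  also have "\<dots> \<le> L2norm f * V"
    by (intro mult_left_mono \<eta>_L2(2)[OF False]) simp
  finally show ?thesis by (simp add: norm_mult mult.commute mult_left_mono)
qed simp

lemma coefficient_integrable:
  assumes "f \<in> L2"
  shows "integrable M (\<lambda>z. c z * pairing f (\<eta> z))"
proof (rule Bochner_Integration.integrable_bound)
  show "integrable M (\<lambda>z. L2norm f * V * cmod (c z))" using c by auto
  show "AE z in M. norm (c z * pairing f (\<eta> z)) \<le> norm (L2norm f * V * cmod (c z))"
    using coefficient_bound[OF assms] by (fastforce intro: always_eventually order_trans[OF _ abs_ge_self])
qed (use assms in measurable)

lemma coefficient_L1:
  assumes "f \<in> L2"
  shows "(\<integral>z. cmod (c z * pairing f (\<eta> z)) \<partial>M) \<le> L2norm f * (V * (\<integral>z. cmod (c z) \<partial>M))"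
proof -
  have "(\<integral>z. cmod (c z * pairing f (\<eta> z)) \<partial>M) \<le> (\<integral>z. L2norm f * V * cmod (c z) \<partial>M)"
    using coefficient_bound[OF assms] coefficient_integrable[OF assms] c by (intro integral_mono) auto
  then show ?thesis by (simp add: mult.assoc)
qed

lemma T_integrable:
  assumes "f \<in> L2"
  shows "integrable M (\<lambda>z. c z * pairing f (\<eta> z) * \<theta> z x)"
proof (rule Bochner_Integration.integrable_bound)
  show "integrable M (\<lambda>z. K * cmod (c z * pairing f (\<eta> z)))"
    using coefficient_integrable[OF assms] by auto
  have "norm (c z * pairing f (\<eta> z) * \<theta> z x) \<le> K * cmod (c z * pairing f (\<eta> z))" for z
    using \<theta>_bound[of z x] by (cases "c z = 0") (auto simp: norm_mult mult.commute intro!: mult_right_mono)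
  then show "AE z in M. norm (c z * pairing f (\<eta> z) * \<theta> z x) \<le> norm (K * cmod (c z * pairing f (\<eta> z)))"
    by (auto intro!: always_eventually order_trans[OF _ abs_ge_self] simp del: abs_mult)
qed (use assms in measurable)

text \<open>Equicontinuity on bounded sets: the modulus of continuity depends on \<open>f\<close>
  only through its norm.\<close>

lemma T_diff_le:
  assumes f: "f \<in> L2"
  shows "cmod (T f x - T f y) \<le> L2norm f * (V * (\<integral>z. cmod (c z) \<partial>M)) * (L * norm (x - y))"
proof -
  have "T f x - T f y = (\<integral>z. c z * pairing f (\<eta> z) * (\<theta> z x - \<theta> z y) \<partial>M)"
    unfolding T_def by (simp add: T_integrable[OF f] right_diff_distrib flip: Bochner_Integration.integral_diff)
  also have "cmod \<dots> \<le> (\<integral>z. cmod (c z * pairing f (\<eta> z) * (\<theta> z x - \<theta> z y)) \<partial>M)"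
    by (rule integral_norm_bound)
  also have "\<dots> \<le> (\<integral>z. cmod (c z * pairing f (\<eta> z)) * (L * norm (x - y)) \<partial>M)"
  proof (rule integral_mono)
    show "integrable M (\<lambda>z. cmod (c z * pairing f (\<eta> z) * (\<theta> z x - \<theta> z y)))"
      using Bochner_Integration.integrable_diff[OF T_integrable[OF f, of x] T_integrable[OF f, of y]]
      by (intro integrable_norm) (simp add: right_diff_distrib)
    show "integrable M (\<lambda>z. cmod (c z * pairing f (\<eta> z)) * (L * norm (x - y)))"
      using coefficient_integrable[OF f] by auto
    show "cmod (c z * pairing f (\<eta> z) * (\<theta> z x - \<theta> z y)) \<le> cmod (c z * pairing f (\<eta> z)) * (L * norm (x - y))" for z
      using \<theta>_lipschitz[of z x y] by (cases "c z = 0") (auto simp: norm_mult intro!: mult_left_mono)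
  qed
  also have "\<dots> = (\<integral>z. cmod (c z * pairing f (\<eta> z)) \<partial>M) * (L * norm (x - y))"
    by simp
  \<comment> \<open>That \<open>L * norm (x - y)\<close> is nonnegative is known only through the
    Lipschitz bound at some \<open>z\<close> with \<open>c z\<close> nonzero; if there is none,
    everything is 0.\<close>
  also have "\<dots> \<le> L2norm f * (V * (\<integral>z. cmod (c z) \<partial>M)) * (L * norm (x - y))"
  proof (cases "\<forall>z. c z = 0")
    case False
    then obtain z where "c z \<noteq> 0" by auto
    from order_trans[OF norm_ge_zero \<theta>_lipschitz[OF this, of x y]]
    show ?thesis by (intro mult_right_mono coefficient_L1[OF f])
  qed simp
  finally show ?thesis .
qed

lemma T_bound:
  assumes f: "f \<in> L2"
  shows "cmod (T f x) \<le> L2norm f * (V * (\<integral>z. cmod (c z) \<partial>M)) * K"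
proof -
  have "cmod (T f x) \<le> (\<integral>z. cmod (c z * pairing f (\<eta> z) * \<theta> z x) \<partial>M)"
    unfolding T_def by (rule integral_norm_bound)
  also have "\<dots> \<le> (\<integral>z. cmod (c z * pairing f (\<eta> z)) * K \<partial>M)"
  proof (rule integral_mono)
    show "integrable M (\<lambda>z. cmod (c z * pairing f (\<eta> z)) * K)"
      using coefficient_integrable[OF f] by auto
    show "cmod (c z * pairing f (\<eta> z) * \<theta> z x) \<le> cmod (c z * pairing f (\<eta> z)) * K" for z
      using \<theta>_bound[of z x] by (cases "c z = 0") (auto simp: norm_mult intro!: mult_left_mono)
  qed (use T_integrable[OF f] in auto)
  also have "\<dots> = (\<integral>z. cmod (c z * pairing f (\<eta> z)) \<partial>M) * K"
    by simp
  also have "\<dots> \<le> L2norm f * (V * (\<integral>z. cmod (c z) \<partial>M)) * K"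
  proof (cases "\<forall>z. c z = 0")
    case False
    then obtain z where "c z \<noteq> 0" by auto
    from order_trans[OF norm_ge_zero \<theta>_bound[OF this, of x]]
    show ?thesis by (intro mult_right_mono coefficient_L1[OF f])
  qed simp
  finally show ?thesis .
qed

lemma T_supp: "x \<notin> cball 0 R \<Longrightarrow> T f x = 0"
  unfolding T_def using \<theta>_supp by (intro integral_eq_zero_AE) fastforce

lemma T_L2:
  assumes f: "f \<in> L2"
  shows "T f \<in> L2"
proof (rule L2_bounded_support(1))
  have [measurable]: "f \<in> borel_measurable borel" using f by measurable
  show "T f \<in> borel_measurable borel"
    unfolding T_def[abs_def] pairing_def by measurable
qed (use T_bound[OF f] T_supp in auto)

text \<open>Arzela-Ascoli on \<open>cball 0 R\<close>: the images of a bounded sequence are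
  uniformly bounded and equicontinuous there and vanish outside, so that uniform convergence on the
  ball is convergence in \<open>L2\<close>.\<close>

theorem compact_op_T: "compact_op T"
  unfolding compact_op_def
proof (intro conjI ballI allI impI)
  fix f g :: "'c \<Rightarrow> complex" and a b assume f: "f \<in> L2" and g: "g \<in> L2"
  have "T (\<lambda>y. a * f y + b * g y) x = a * T f x + b * T g x" for x
  proof -
    have "c z * pairing (\<lambda>y. a * f y + b * g y) (\<eta> z) * \<theta> z x
        = a * (c z * pairing f (\<eta> z) * \<theta> z x) + b * (c z * pairing g (\<eta> z) * \<theta> z x)" for z
      using pairing_add_left[OF L2_scale[OF f] L2_scale[OF g] \<eta>_L2(1), of z a b]
      by (cases "c z = 0") (auto simp: pairing_scale_left algebra_simps)
    then show ?thesis unfolding T_def using T_integrable[OF f] T_integrable[OF g] by simp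
  qed
  then show "AE x in lborel. T (\<lambda>y. a * f y + b * g y) x = a * T f x + b * T g x" by simp
next
  fix s :: "nat \<Rightarrow> 'c \<Rightarrow> complex" and C
  assume s: "\<forall>k. s k \<in> L2 \<and> L2norm (s k) \<le> C"
  have C: "0 \<le> C" using s L2norm_nonneg[of "s 0"] by (meson order_trans)
  \<comment> \<open>The absolute value is taken because \<open>K\<close>, hence \<open>V\<close>,
    may be negative when \<open>c\<close> vanishes identically.\<close>
  define W where "W = (\<bar>V\<bar> * (\<integral>z. cmod (c z) \<partial>M))"
  have W: "0 \<le> W" by (simp add: W_def)
  have sW: "L2norm (s n) * (V * (\<integral>z. cmod (c z) \<partial>M)) \<le> C * W" for n
  proof -
    have "V * (\<integral>z. cmod (c z) \<partial>M) \<le> W"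
      unfolding W_def by (intro mult_right_mono) auto
    then have "L2norm (s n) * (V * (\<integral>z. cmod (c z) \<partial>M)) \<le> L2norm (s n) * W"
      by (intro mult_left_mono) auto
    also have "\<dots> \<le> C * W" using s W by (intro mult_right_mono) auto
    finally show ?thesis .
  qed
  have T_le: "cmod (T (s n) x) \<le> C * W * \<bar>K\<bar>" for n x
  proof -
    have "cmod (T (s n) x) \<le> L2norm (s n) * (V * (\<integral>z. cmod (c z) \<partial>M)) * K"
      using T_bound s by blast
    also have "\<dots> \<le> \<bar>L2norm (s n) * (V * (\<integral>z. cmod (c z) \<partial>M))\<bar> * \<bar>K\<bar>"
      by (metis abs_ge_self abs_mult)
    also have "\<dots> \<le> C * W * \<bar>K\<bar>"
    proof (rule mult_right_mono)
      have "\<bar>L2norm (s n) * (V * (\<integral>z. cmod (c z) \<partial>M))\<bar> = L2norm (s n) * W"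
        by (simp add: abs_mult W_def)
      also have "\<dots> \<le> C * W" using s W by (intro mult_right_mono) auto
      finally show "\<bar>L2norm (s n) * (V * (\<integral>z. cmod (c z) \<partial>M))\<bar> \<le> C * W" .
    qed simp
    finally show ?thesis .
  qed
  have T_lip: "cmod (T (s n) x - T (s n) y) \<le> C * W * (\<bar>L\<bar> * norm (x - y))" for n x y
  proof -
    have "cmod (T (s n) x - T (s n) y) \<le> L2norm (s n) * (V * (\<integral>z. cmod (c z) \<partial>M)) * (L * norm (x - y))"
      using T_diff_le s by blast
    also have "\<dots> \<le> \<bar>L2norm (s n) * (V * (\<integral>z. cmod (c z) \<partial>M))\<bar> * \<bar>L * norm (x - y)\<bar>"
      by (metis abs_ge_self abs_mult)
    also have "\<dots> \<le> C * W * \<bar>L * norm (x - y)\<bar>"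
    proof (rule mult_right_mono)
      have "\<bar>L2norm (s n) * (V * (\<integral>z. cmod (c z) \<partial>M))\<bar> = L2norm (s n) * W"
        by (simp add: abs_mult W_def)
      also have "\<dots> \<le> C * W" using s W by (intro mult_right_mono) auto
      finally show "\<bar>L2norm (s n) * (V * (\<integral>z. cmod (c z) \<partial>M))\<bar> \<le> C * W" .
    qed simp
    finally show ?thesis by (simp add: abs_mult)
  qed
  obtain g k where g: "continuous_on (cball 0 R) g" and k: "strict_mono (k :: nat \<Rightarrow> nat)"
    and unif: "\<And>e. 0 < e \<Longrightarrow> \<exists>N. \<forall>n x. n \<ge> N \<and> x \<in> cball 0 R \<longrightarrow> norm (T (s (k n)) x - g x) < e"
  proof (rule Arzela_Ascoli[of "cball 0 R" "\<lambda>n. T (s n)" "C * W * \<bar>K\<bar>"])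
    fix x :: 'c and e :: real assume e: "0 < e"
    show "\<exists>d>0. \<forall>n y. y \<in> cball 0 R \<and> norm (x - y) < d \<longrightarrow> cmod (T (s n) x - T (s n) y) < e"
    proof (intro exI[of _ "e / (C * W * \<bar>L\<bar> + 1)"] conjI allI impI)
      have pos: "0 < C * W * \<bar>L\<bar> + 1" using C W by (simp add: add_nonneg_pos)
      then show "0 < e / (C * W * \<bar>L\<bar> + 1)" using e by simp
      fix n y assume "y \<in> cball 0 R \<and> norm (x - y) < e / (C * W * \<bar>L\<bar> + 1)"
      then have "(C * W * \<bar>L\<bar> + 1) * norm (x - y) < e"
        using pos by (simp add: pos_less_divide_eq mult.commute)
      moreover have "C * W * (\<bar>L\<bar> * norm (x - y)) \<le> (C * W * \<bar>L\<bar> + 1) * norm (x - y)"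
        by (simp add: algebra_simps)
      ultimately show "cmod (T (s n) x - T (s n) y) < e"
        using T_lip[of n x y] by linarith
    qed
  qed (use T_le in auto)
  define h where "h x = (if x \<in> cball 0 R then g x else 0)" for x
  have h_meas [measurable]: "h \<in> borel_measurable borel"
    unfolding h_def[abs_def] using g by (intro borel_measurable_continuous_on_if) auto
  have T_meas: "T (s n) \<in> borel_measurable borel" for n
    using T_L2 s by (auto simp: L2_def)
  have close: "L2norm (\<lambda>x. T (s (k n)) x - h x) \<le> e * sqrt (measure lborel (cball (0::'c) R))"
      "(\<lambda>x. T (s (k n)) x - h x) \<in> L2"
    if "\<forall>n x. n \<ge> N \<and> x \<in> cball 0 R \<longrightarrow> norm (T (s (k n)) x - g x) < e" "n \<ge> N" "0 < e" for N n e
  proof -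
    have "cmod (T (s (k n)) x - h x) \<le> e" for x
      using that T_supp[of x "s (k n)"] by (cases "x \<in> cball 0 R") (force simp: h_def)+
    moreover have "T (s (k n)) x - h x = 0" if "x \<notin> cball 0 R" for x
      using that T_supp[of x "s (k n)"] by (simp add: h_def)
    ultimately show "L2norm (\<lambda>x. T (s (k n)) x - h x) \<le> e * sqrt (measure lborel (cball (0::'c) R))"
      "(\<lambda>x. T (s (k n)) x - h x) \<in> L2"
      using T_meas by (intro L2_bounded_support; measurable)+
  qed
  obtain N1 where "\<forall>n x. n \<ge> N1 \<and> x \<in> cball 0 R \<longrightarrow> norm (T (s (k n)) x - g x) < 1"
    using unif[of 1] by auto
  from close(2)[OF this order_refl] have hL2: "h \<in> L2"
    using L2_diff[OF T_L2[of "s (k N1)"], of "\<lambda>x. T (s (k N1)) x - h x"] s by auto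
  have "(\<lambda>n. L2norm (\<lambda>x. T (s (k n)) x - h x)) \<longlonglongrightarrow> 0"
  proof (rule LIMSEQ_I)
    fix e :: real assume e: "0 < e"
    define v where "v = sqrt (measure lborel (cball (0::'c) R))"
    have v: "0 \<le> v" by (simp add: v_def)
    then have e': "0 < e / (v + 1)" using e by simp
    then obtain N where N: "\<forall>n x. n \<ge> N \<and> x \<in> cball 0 R \<longrightarrow> norm (T (s (k n)) x - g x) < e / (v + 1)"
      using unif by blast
    have "e / (v + 1) * v < e" using e v by (simp add: field_simps)
    then have "L2norm (\<lambda>x. T (s (k n)) x - h x) < e" if "n \<ge> N" for n
      using close(1)[OF N that e'] unfolding v_def by linarith
    then show "\<exists>N. \<forall>n\<ge>N. norm (L2norm (\<lambda>x. T (s (k n)) x - h x) - 0) < e" by auto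
  qed
  then show "\<exists>r h. strict_mono r \<and> h \<in> L2 \<and> (\<lambda>k. L2norm (\<lambda>x. T (s (r k)) x - h x)) \<longlonglongrightarrow> 0"
    using k hL2 by blast
qed (rule T_L2)

text \<open>Fubini, justified by the majorant that Cauchy-Schwarz in \<open>x\<close> provides. This
  ties the operator, defined pointwise, to its bilinear form.\<close>

theorem pairing_T:
  assumes f: "f \<in> L2" and g: "g \<in> L2"
  shows "pairing (T f) g = (\<integral>z. c z * pairing f (\<eta> z) * pairing (\<theta> z) g \<partial>M)"
proof -
  interpret P: pair_sigma_finite M "lborel :: 'c measure" ..
  have [measurable]: "f \<in> borel_measurable borel" "g \<in> borel_measurable borel" using f g by auto
  let ?u = "\<lambda>z. c z * pairing f (\<eta> z)"
  have [measurable]: "?u \<in> borel_measurable M" using f by measurable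
  have int: "integrable (M \<Otimes>\<^sub>M lborel) (\<lambda>(z, x). ?u z * \<theta> z x * g x)"
  proof (rule integrableI_bounded)
    show "(\<lambda>(z, x). ?u z * \<theta> z x * g x) \<in> borel_measurable (M \<Otimes>\<^sub>M lborel)"
      by measurable
    have "(\<integral>\<^sup>+p. ennreal (norm (case p of (z, x) \<Rightarrow> ?u z * \<theta> z x * g x)) \<partial>(M \<Otimes>\<^sub>M lborel))
        = (\<integral>\<^sup>+z. \<integral>\<^sup>+x. ennreal (cmod (?u z * \<theta> z x * g x)) \<partial>lborel \<partial>M)"
      by (subst lborel.nn_integral_fst[symmetric]) (auto intro!: nn_integral_cong)
    also have "\<dots> \<le> (\<integral>\<^sup>+z. ennreal (cmod (?u z) * (V * L2norm g)) \<partial>M)"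
    proof (rule nn_integral_mono)
      fix z
      show "(\<integral>\<^sup>+x. ennreal (cmod (?u z * \<theta> z x * g x)) \<partial>lborel) \<le> ennreal (cmod (?u z) * (V * L2norm g))"
      proof (cases "c z = 0")
        case False
        have "(\<integral>\<^sup>+x. ennreal (cmod (?u z * \<theta> z x * g x)) \<partial>lborel)
            = ennreal (cmod (?u z)) * (\<integral>\<^sup>+x. ennreal (cmod (\<theta> z x) * cmod (g x)) \<partial>lborel)"
          by (subst nn_integral_cmult[symmetric]) (auto simp: norm_mult ennreal_mult mult.assoc)
        also have "\<dots> \<le> ennreal (cmod (?u z)) * ennreal (L2norm (\<theta> z) * L2norm g)"
          by (intro mult_left_mono L2_nn_Cauchy_Schwarz \<theta>_L2 False g) auto
        also have "\<dots> \<le> ennreal (cmod (?u z)) * ennreal (V * L2norm g)"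
          by (intro mult_left_mono ennreal_leI mult_right_mono \<theta>_L2 False) auto
        finally show ?thesis by (simp add: ennreal_mult')
      qed simp
    qed
    also have "\<dots> < \<infinity>"
    proof -
      have "integrable M (\<lambda>z. cmod (?u z) * (V * L2norm g))"
        using coefficient_integrable[OF f] by auto
      then show ?thesis
        by (metis infinity_ennreal_def nn_integral_cong real_integrable_def less_top)
    qed
    finally show "(\<integral>\<^sup>+p. ennreal (norm (case p of (z, x) \<Rightarrow> ?u z * \<theta> z x * g x)) \<partial>(M \<Otimes>\<^sub>M lborel)) < \<infinity>" .
  qed
  have "pairing (T f) g = (\<integral>x. (\<integral>z. ?u z * \<theta> z x * g x \<partial>M) \<partial>lborel)"
    by (simp add: pairing_def T_def)
  also have "\<dots> = (\<integral>z. (\<integral>x. ?u z * \<theta> z x * g x \<partial>lborel) \<partial>M)"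
    using P.Fubini_integral[of "\<lambda>z x. ?u z * \<theta> z x * g x"] int by simp
  also have "\<dots> = (\<integral>z. ?u z * pairing (\<theta> z) g \<partial>M)"
    by (simp add: pairing_def mult.assoc)
  finally show ?thesis .
qed

end

section \<open>The Hardy--Littlewood maximal function\<close>

lemma unit_vol_pos: "0 < measure lborel (ball (0::'a::euclidean_space) 1)"
  using content_ball_pos[of 1 "0::'a"] by simp

lemma emeasure_lborel_ball:
  fixes x :: "'a::euclidean_space"
  assumes "0 \<le> r"
  shows "emeasure lborel (ball x r) = ennreal (r ^ DIM('a) * measure lborel (ball (0::'a) 1))"
  using content_ball_conv_unit_ball[OF assms, of x] emeasure_lborel_ball_finite[of x r]
  by (simp add: emeasure_eq_ennreal_measure)

lemma emeasure_lborel_cball: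
  fixes x :: "'a::euclidean_space"
  assumes "0 \<le> r"
  shows "emeasure lborel (cball x r) = ennreal (r ^ DIM('a) * measure lborel (ball (0::'a) 1))"
  using content_ball_conv_unit_ball[OF assms, of x] content_cball_conv_ball[of x r] emeasure_lborel_cball_finite[of x r]
  by (simp add: emeasure_eq_ennreal_measure)

lemma ennreal_eq_top_if_ge_nat:
  assumes "\<And>n::nat. ennreal (real n) \<le> x"
  shows "x = top"
proof (cases x rule: ennreal_cases)
  case (real r)
  obtain n :: nat where "r < real n" using reals_Archimedean2 by blast
  then show ?thesis using assms[of n] real by simp
qed

lemma emeasure_positive_reals_less: "emeasure lborel {l::real. 0 < l \<and> ennreal l < a} = a"
proof (cases a rule: ennreal_cases)
  case (real r)
  then have "{l. 0 < l \<and> ennreal l < a} = {0<..<r}" by (auto simp: ennreal_less_iff)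
  then show ?thesis using real by simp
next
  case top
  have "ennreal (real n) \<le> emeasure lborel {0::real<..}" for n
    using emeasure_mono[of "{0<..<real n}" "{0<..}" lborel] by (simp add: subset_eq)
  then have "emeasure lborel {0::real<..} = top"
    by (rule ennreal_eq_top_if_ge_nat)
  then show ?thesis using top by (simp add: greaterThan_def)
qed

text \<open>The layer cake formula. Together with Tonelli it replaces an integral by one over the
  measures of superlevel sets, infinite values included.\<close>

lemma nn_integral_positive_reals_less:
  "(\<integral>\<^sup>+l. indicator {l::real. 0 < l \<and> ennreal l < a} l \<partial>lborel) = a"
  by (subst nn_integral_indicator) (simp_all add: emeasure_positive_reals_less)

lemma power2_le_layer_cake:
  "a\<^sup>2 \<le> (\<integral>\<^sup>+l. ennreal (2 * l) * indicator {l::real. 0 < l \<and> ennreal l < a} l \<partial>lborel)"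
proof -
  have fin: "(\<integral>\<^sup>+l. ennreal (2 * l) * indicator {l::real. 0 < l \<and> ennreal l < ennreal r} l \<partial>lborel) = ennreal (r\<^sup>2)"
    if "0 \<le> r" for r :: real
  proof -
    have "(\<integral>\<^sup>+l. ennreal (2 * l) * indicator {l::real. 0 < l \<and> ennreal l < ennreal r} l \<partial>lborel)
        = (\<integral>\<^sup>+l. ennreal (2 * l) * indicator {0..r} l \<partial>lborel)"
      using AE_lborel_singleton[of 0] AE_lborel_singleton[of r]
      by (intro nn_integral_cong_AE) (auto simp: ennreal_less_iff indicator_def)
    also have "\<dots> = ennreal (r\<^sup>2 - 0\<^sup>2)"
      using that by (intro nn_integral_FTC_Icc) (auto intro!: derivative_eq_intros)
    finally show ?thesis by simp
  qed
  show ?thesis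
  proof (cases a rule: ennreal_cases)
    case (real r)
    then show ?thesis using fin[of r] by (simp add: ennreal_power)
  next
    case top
    have "ennreal (real n) \<le> (\<integral>\<^sup>+l. ennreal (2 * l) * indicator {l::real. 0 < l \<and> ennreal l < a} l \<partial>lborel)" for n :: nat
    proof -
      have "real n \<le> (real n)\<^sup>2" by (cases n) (auto simp: power2_eq_square)
      then have "ennreal (real n) \<le> ennreal ((real n)\<^sup>2)" by (rule ennreal_leI)
      also have "\<dots> = (\<integral>\<^sup>+l. ennreal (2 * l) * indicator {l::real. 0 < l \<and> ennreal l < ennreal (real n)} l \<partial>lborel)"
        by (rule fin[symmetric]) simp
      also have "\<dots> \<le> (\<integral>\<^sup>+l. ennreal (2 * l) * indicator {l::real. 0 < l \<and> ennreal l < a} l \<partial>lborel)"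
        using top by (intro nn_integral_mono mult_left_mono) (auto simp: indicator_def)
      finally show ?thesis .
    qed
    then have "(\<integral>\<^sup>+l. ennreal (2 * l) * indicator {l::real. 0 < l \<and> ennreal l < a} l \<partial>lborel) = top"
      by (rule ennreal_eq_top_if_ge_nat)
    then show ?thesis by simp
  qed
qed

text \<open>The centred Hardy-Littlewood maximal function. Dyadic radii make the supremum countable,
  hence measurable, and lose at most a factor 2 in the radius. Averages are normalised by the power
  of the radius alone; the volume of the unit ball appears in the constants instead.\<close>

definition HL :: "('a::euclidean_space \<Rightarrow> ennreal) \<Rightarrow> 'a \<Rightarrow> ennreal" where
  "HL f x = (SUP k::int. ennreal (1 / (2 powr k) ^ DIM('a)) * (\<integral>\<^sup>+y. f y * indicator (ball x (2 powr k)) y \<partial>lborel))"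

lemma indicator_ball_measurable [measurable (raw)]:
  fixes f g :: "'z \<Rightarrow> 'a::euclidean_space"
  assumes [measurable]: "f \<in> borel_measurable M" "r \<in> borel_measurable M" "g \<in> borel_measurable M"
  shows "(\<lambda>z. indicator (ball (f z) (r z)) (g z) :: ennreal) \<in> borel_measurable M"
proof -
  have "(\<lambda>z. indicator (ball (f z) (r z)) (g z) :: ennreal) = (\<lambda>z. if dist (f z) (g z) < r z then 1 else 0)"
    by (auto simp: indicator_def fun_eq_iff)
  then show ?thesis by simp
qed

text \<open>The function may depend on a parameter, as is required for iterating \<open>HL\<close>
  in two variables and for applying it to wavelet coefficients.\<close>

lemma HL_measurable [measurable (raw)]:
  assumes [measurable]: "(\<lambda>p. f (fst p) (snd p)) \<in> borel_measurable (M \<Otimes>\<^sub>M borel)" "g \<in> borel_measurable M"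
  shows "(\<lambda>u. HL (f u) (g u)) \<in> borel_measurable M"
proof -
  have [measurable]: "(\<lambda>(u, y). f u y) \<in> borel_measurable (M \<Otimes>\<^sub>M lborel)"
    using assms(1) by (simp add: case_prod_beta)
  show ?thesis unfolding HL_def by measurable
qed

lemma HL_measurable' [measurable]:
  assumes [measurable]: "f \<in> borel_measurable borel"
  shows "HL f \<in> borel_measurable borel"
  by (rule HL_measurable) measurable

text \<open>Subadditivity written with \<open>count_space\<close>, so that a covering family can be
  indexed by its own centres without an enumeration.\<close>

lemma emeasure_UN_countable_le:
  assumes [measurable]: "\<And>i. i \<in> I \<Longrightarrow> X i \<in> sets M" and "countable I"
  shows "emeasure M (\<Union>i\<in>I. X i) \<le> (\<integral>\<^sup>+i. emeasure M (X i) \<partial>count_space I)"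
proof -
  have [measurable]: "(\<Union>i\<in>I. X i) \<in> sets M"
    using assms by (intro sets.countable_UN'') auto
  have "emeasure M (\<Union>i\<in>I. X i) = (\<integral>\<^sup>+x. indicator (\<Union>i\<in>I. X i) x \<partial>M)" by simp
  also have "\<dots> \<le> (\<integral>\<^sup>+x. \<integral>\<^sup>+i. indicator (X i) x \<partial>count_space I \<partial>M)"
  proof (rule nn_integral_mono)
    fix x show "indicator (\<Union>i\<in>I. X i) x \<le> (\<integral>\<^sup>+i. (indicator (X i) x :: ennreal) \<partial>count_space I)"
    proof (cases "x \<in> (\<Union>i\<in>I. X i)")
      case True
      then obtain i where i: "i \<in> I" "x \<in> X i" by auto
      then show ?thesis
        using nn_integral_ge_point[OF i(1), of "\<lambda>i. indicator (X i) x"] by (simp add: indicator_def)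
    qed simp
  qed
  also have "\<dots> = (\<integral>\<^sup>+i. \<integral>\<^sup>+x. indicator (X i) x \<partial>M \<partial>count_space I)"
    using assms by (intro nn_integral_count_space_nn_integral) auto
  also have "\<dots> = (\<integral>\<^sup>+i. emeasure M (X i) \<partial>count_space I)"
    by (intro nn_integral_cong) auto
  finally show ?thesis .
qed

text \<open>Vitali covering: of the balls on which the average exceeds \<open>l\<close>, disjoint
  ones are selected whose fivefold enlargements still cover the set, and the integrals of
  \<open>f\<close> over disjoint balls add up to at most the total integral.\<close>

lemma HL_weak_type:
  fixes f :: "'a::euclidean_space \<Rightarrow> ennreal"
  assumes [measurable]: "f \<in> borel_measurable borel" and fin: "(\<integral>\<^sup>+x. f x \<partial>lborel) < \<infinity>" and l: "0 < l"
  shows "emeasure lborel {x. ennreal l < HL f x}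
      \<le> ennreal (5 ^ DIM('a) * measure lborel (ball (0::'a) 1) / l) * (\<integral>\<^sup>+x. f x \<partial>lborel)"
proof -
  let ?E = "{x. ennreal l < HL f x}" and ?n = "DIM('a)" and ?w = "measure lborel (ball (0::'a) 1)"
  obtain I where I: "(\<integral>\<^sup>+x. f x \<partial>lborel) = ennreal I" "0 \<le> I"
    using fin by (cases "\<integral>\<^sup>+x. f x \<partial>lborel" rule: ennreal_cases) auto
  have "\<exists>r>0. ennreal (l * r ^ ?n) \<le> (\<integral>\<^sup>+y. f y * indicator (ball x r) y \<partial>lborel)" if "x \<in> ?E" for x
  proof -
    from that obtain k :: int where k: "ennreal l < ennreal (1 / (2 powr k) ^ ?n) * (\<integral>\<^sup>+y. f y * indicator (ball x (2 powr k)) y \<partial>lborel)"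
      by (auto simp: HL_def less_SUP_iff)
    have "ennreal (l * (2 powr k) ^ ?n) = ennreal ((2 powr k) ^ ?n) * ennreal l"
      using l by (simp add: ennreal_mult mult.commute)
    also have "\<dots> \<le> ennreal ((2 powr k) ^ ?n) * (ennreal (1 / (2 powr k) ^ ?n) * (\<integral>\<^sup>+y. f y * indicator (ball x (2 powr k)) y \<partial>lborel))"
      using k by (intro mult_left_mono) auto
    also have "\<dots> = (\<integral>\<^sup>+y. f y * indicator (ball x (2 powr k)) y \<partial>lborel)"
      by (simp add: mult.assoc[symmetric] ennreal_mult[symmetric])
    finally show ?thesis by (intro exI[of _ "2 powr k"]) auto
  qed
  then obtain r where r: "\<And>x. x \<in> ?E \<Longrightarrow> 0 < r x"
    and rI: "\<And>x. x \<in> ?E \<Longrightarrow> ennreal (l * r x ^ ?n) \<le> (\<integral>\<^sup>+y. f y * indicator (ball x (r x)) y \<partial>lborel)"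
    by metis
  \<comment> \<open>The covering lemma asks for bounded radii. A radius \<open>r\<close> above 1 is
    at most \<open>r ^ ?n\<close>, and the latter is at most \<open>I / l\<close>.\<close>
  have rB: "r x \<le> max 1 (I / l)" if x: "x \<in> ?E" for x
  proof (cases "r x \<le> 1")
    case False
    have "ennreal (l * r x ^ ?n) \<le> (\<integral>\<^sup>+y. f y \<partial>lborel)"
      by (rule order_trans[OF rI[OF x]]) (auto intro!: nn_integral_mono simp: indicator_def)
    then have "l * r x ^ ?n \<le> I" using I by simp
    then have "r x ^ ?n \<le> I / l" using l by (simp add: pos_le_divide_eq mult.commute)
    moreover have "r x \<le> r x ^ ?n" using False by (intro self_le_power) auto
    ultimately show ?thesis by simp
  qed simp
  obtain C where C: "countable C" "C \<subseteq> ?E"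
    and disj: "pairwise (\<lambda>i j. disjnt (cball i (r i)) (cball j (r j))) C"
    and cover: "?E \<subseteq> (\<Union>i\<in>C. cball i (5 * r i))"
  proof (rule Vitali_covering_lemma_cballs[of ?E "\<lambda>x. x" r ?E "max 1 (I / l)"])
    show "?E \<subseteq> (\<Union>i\<in>?E. cball i (r i))" using r by (force intro: less_imp_le)
  qed (use r rB in auto)
  have df: "disjoint_family_on (\<lambda>i. ball i (r i)) C"
    using disj unfolding disjoint_family_on_def pairwise_def disjnt_def by (meson ball_subset_cball disjoint_iff subsetD)
  have "emeasure lborel ?E \<le> emeasure lborel (\<Union>i\<in>C. cball i (5 * r i))"
    using C by (intro emeasure_mono cover) (auto intro!: sets.countable_UN'')
  also have "\<dots> \<le> (\<integral>\<^sup>+i. emeasure lborel (cball i (5 * r i)) \<partial>count_space C)"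
    using C by (intro emeasure_UN_countable_le) auto
  also have "\<dots> \<le> (\<integral>\<^sup>+i. ennreal (5 ^ ?n * ?w / l) * emeasure (density lborel f) (ball i (r i)) \<partial>count_space C)"
  proof (rule nn_integral_mono)
    fix i assume "i \<in> space (count_space C)"
    then have i: "i \<in> ?E" using C by auto
    have "emeasure lborel (cball i (5 * r i)) = ennreal ((5 * r i) ^ ?n * ?w)"
      using r[OF i] by (intro emeasure_lborel_cball) simp
    also have "\<dots> = ennreal (5 ^ ?n * ?w / l) * ennreal (l * r i ^ ?n)"
      using l r[OF i] by (subst ennreal_mult[symmetric]) (auto simp: power_mult_distrib)
    also have "\<dots> \<le> ennreal (5 ^ ?n * ?w / l) * (\<integral>\<^sup>+y. f y * indicator (ball i (r i)) y \<partial>lborel)"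
      by (intro mult_left_mono rI[OF i]) simp
    finally show "emeasure lborel (cball i (5 * r i)) \<le> ennreal (5 ^ ?n * ?w / l) * emeasure (density lborel f) (ball i (r i))"
      by (simp add: emeasure_density)
  qed
  also have "\<dots> = ennreal (5 ^ ?n * ?w / l) * (\<integral>\<^sup>+i. emeasure (density lborel f) (ball i (r i)) \<partial>count_space C)"
    by (simp add: nn_integral_cmult)
  also have "(\<integral>\<^sup>+i. emeasure (density lborel f) (ball i (r i)) \<partial>count_space C) = emeasure (density lborel f) (\<Union>i\<in>C. ball i (r i))"
    using C df by (intro emeasure_UN_countable[symmetric]) auto
  also have "\<dots> \<le> emeasure (density lborel f) (space (density lborel f))"
    by (rule emeasure_space)
  also have "\<dots> = (\<integral>\<^sup>+x. f x \<partial>lborel)"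
    by (simp add: emeasure_density)
  finally show ?thesis by (simp add: mult_left_mono)
qed

text \<open>By the normalisation of the averages, \<open>HL\<close> of the constant 1 is the volume
  of the unit ball; hence the factor of \<open>c\<close>.\<close>

lemma HL_mono_add_const:
  fixes f g :: "'a::euclidean_space \<Rightarrow> ennreal"
  assumes [measurable]: "f \<in> borel_measurable borel" "g \<in> borel_measurable borel"
    and le: "\<And>x. f x \<le> g x + c"
  shows "HL f x \<le> HL g x + c * ennreal (measure lborel (ball (0::'a) 1))"
  unfolding HL_def
proof (rule SUP_least)
  fix k :: int
  let ?n = "DIM('a)" and ?w = "measure lborel (ball (0::'a) 1)" and ?r = "2 powr real_of_int k"
  have "(\<integral>\<^sup>+y. f y * indicator (ball x ?r) y \<partial>lborel) \<le> (\<integral>\<^sup>+y. g y * indicator (ball x ?r) y + c * indicator (ball x ?r) y \<partial>lborel)"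
    using le by (intro nn_integral_mono) (auto simp: indicator_def)
  also have "\<dots> = (\<integral>\<^sup>+y. g y * indicator (ball x ?r) y \<partial>lborel) + c * ennreal (?r ^ ?n * ?w)"
    by (simp add: nn_integral_add nn_integral_cmult_indicator emeasure_lborel_ball)
  finally have "ennreal (1 / ?r ^ ?n) * (\<integral>\<^sup>+y. f y * indicator (ball x ?r) y \<partial>lborel)
      \<le> ennreal (1 / ?r ^ ?n) * ((\<integral>\<^sup>+y. g y * indicator (ball x ?r) y \<partial>lborel) + c * ennreal (?r ^ ?n * ?w))"
    by (intro mult_left_mono) auto
  also have "\<dots> = ennreal (1 / ?r ^ ?n) * (\<integral>\<^sup>+y. g y * indicator (ball x ?r) y \<partial>lborel) + c * (ennreal (1 / ?r ^ ?n) * ennreal (?r ^ ?n * ?w))"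
    by (simp add: distrib_left ac_simps)
  also have "ennreal (1 / ?r ^ ?n) * ennreal (?r ^ ?n * ?w) = ennreal ?w"
    by (subst ennreal_mult[symmetric]) auto
  finally show "ennreal (1 / ?r ^ ?n) * (\<integral>\<^sup>+y. f y * indicator (ball x ?r) y \<partial>lborel)
      \<le> (SUP k::int. ennreal (1 / (2 powr k) ^ ?n) * (\<integral>\<^sup>+y. g y * indicator (ball x (2 powr k)) y \<partial>lborel)) + c * ennreal ?w"
    by (rule order_trans) (intro add_right_mono SUP_upper, simp)
qed

text \<open>This is \<open>2 * ?A * d\<close> with \<open>?A = 5 ^ ?n * d\<close> and
  \<open>d = 2 * ?w\<close> in the proof of \<open>HL_L2_bound\<close>: 2 from the derivative of
  l^2, \<open>?A\<close> from the weak type bound at level l/2, and \<open>d\<close> from the range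
  of levels.\<close>

definition HL_const :: "'a::euclidean_space itself \<Rightarrow> real" where
  "HL_const _ = 8 * 5 ^ DIM('a) * (measure lborel (ball (0::'a) 1))\<^sup>2"

lemma HL_const_nonneg [simp]: "0 \<le> HL_const a"
  by (simp add: HL_const_def)

text \<open>Marcinkiewicz interpolation between the weak type bound and the trivial bound for
  bounded functions. At level \<open>l\<close> only the part of \<open>f\<close> above
  \<open>l / d\<close> matters, so that integrating over \<open>l\<close> leaves \<open>f\<close>
  times the length \<open>d * f\<close> of the range of levels.\<close>

theorem HL_L2_bound:
  fixes f :: "'a::euclidean_space \<Rightarrow> ennreal"
  assumes [measurable]: "f \<in> borel_measurable borel"
  shows "(\<integral>\<^sup>+x. (HL f x)\<^sup>2 \<partial>lborel) \<le> ennreal (HL_const TYPE('a)) * (\<integral>\<^sup>+x. (f x)\<^sup>2 \<partial>lborel)"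
proof (cases "(\<integral>\<^sup>+x. (f x)\<^sup>2 \<partial>lborel) = \<infinity>")
  case True
  then show ?thesis using unit_vol_pos[where 'a='a]
    by (simp add: HL_const_def ennreal_mult_top)
next
  case False
  then have fin: "(\<integral>\<^sup>+x. (f x)\<^sup>2 \<partial>lborel) < \<infinity>" by (simp add: less_top)
  let ?n = "DIM('a)" and ?w = "measure lborel (ball (0::'a) 1)"
  have w: "0 < ?w" by (rule unit_vol_pos)
  \<comment> \<open>With this \<open>d\<close> the part of \<open>f\<close> below
    \<open>l / d\<close> has maximal function at most \<open>l / 2\<close>, so the maximal function
    of the other part has to exceed \<open>l / 2\<close>.\<close>
  define d where "d = 2 * ?w"
  have d: "0 < d" using w by (simp add: d_def)
  let ?A = "5 ^ ?n * d"
  have level: "emeasure lborel {x. ennreal l < HL f x}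
      \<le> ennreal (?A / l) * (\<integral>\<^sup>+x. f x * indicator {x. ennreal l < ennreal d * f x} x \<partial>lborel)" if l: "0 < l" for l
  proof -
    let ?g = "\<lambda>x. f x * indicator {x. ennreal l < ennreal d * f x} x"
    \<comment> \<open>The weak type bound asks for an integrable function: where
      \<open>d * f\<close> exceeds \<open>l\<close>, \<open>f\<close> is dominated by a multiple of
      its square.\<close>
    have g_fin: "(\<integral>\<^sup>+x. ?g x \<partial>lborel) < \<infinity>"
    proof -
      have "(\<integral>\<^sup>+x. ?g x \<partial>lborel) \<le> (\<integral>\<^sup>+x. ennreal (d / l) * (f x)\<^sup>2 \<partial>lborel)"
      proof (rule nn_integral_mono)
        fix x
        have "f x \<le> ennreal (d / l) * (f x)\<^sup>2" if "ennreal l < ennreal d * f x"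
        proof -
          have "f x = ennreal (1 / l) * ennreal l * f x" using l by (simp add: ennreal_mult[symmetric])
          also have "\<dots> \<le> ennreal (1 / l) * (ennreal d * f x) * f x"
            using that by (intro mult_right_mono mult_left_mono) auto
          also have "\<dots> = ennreal (d / l) * (f x)\<^sup>2"
            using l d by (simp add: power2_eq_square mult.assoc[symmetric] ennreal_mult[symmetric])
          finally show ?thesis .
        qed
        then show "?g x \<le> ennreal (d / l) * (f x)\<^sup>2" by (auto simp: indicator_def)
      qed
      also have "\<dots> = ennreal (d / l) * (\<integral>\<^sup>+x. (f x)\<^sup>2 \<partial>lborel)" by (simp add: nn_integral_cmult)
      also have "\<dots> < \<infinity>" using fin by (simp add: ennreal_mult_less_top)
      finally show ?thesis .
    qed
    have "f x \<le> ?g x + ennreal (l / d)" for x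
    proof (cases "ennreal l < ennreal d * f x")
      case False
      then have "ennreal (1 / d) * (ennreal d * f x) \<le> ennreal (1 / d) * ennreal l"
        by (intro mult_left_mono) auto
      then have "f x \<le> ennreal (l / d)"
        using d l by (simp add: mult.assoc[symmetric] ennreal_mult[symmetric])
      then show ?thesis by (simp add: add_increasing)
    qed (simp add: indicator_def)
    then have "HL f x \<le> HL ?g x + ennreal (l / d) * ennreal ?w" for x
      by (intro HL_mono_add_const) auto
    moreover have "ennreal (l / d) * ennreal ?w = ennreal (l / 2)"
      using l d w by (subst ennreal_mult[symmetric]) (auto simp: d_def)
    ultimately have HLle: "HL f x \<le> HL ?g x + ennreal (l / 2)" for x by simp
    have "{x. ennreal l < HL f x} \<subseteq> {x. ennreal (l/2) < HL ?g x}"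
    proof safe
      fix x assume "ennreal l < HL f x"
      show "ennreal (l/2) < HL ?g x"
      proof (rule ccontr)
        assume "\<not> ennreal (l/2) < HL ?g x"
        then have "HL f x \<le> ennreal (l/2) + ennreal (l/2)"
          by (intro order_trans[OF HLle] add_right_mono) simp
        also have "\<dots> = ennreal l" using l by (simp flip: ennreal_plus)
        finally show False using \<open>ennreal l < HL f x\<close> by simp
      qed
    qed
    then have "emeasure lborel {x. ennreal l < HL f x} \<le> emeasure lborel {x. ennreal (l/2) < HL ?g x}"
      by (intro emeasure_mono) auto
    also have "\<dots> \<le> ennreal (5 ^ ?n * ?w / (l/2)) * (\<integral>\<^sup>+x. ?g x \<partial>lborel)"
      using l by (intro HL_weak_type g_fin) auto
    finally show ?thesis by (simp add: d_def ac_simps)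
  qed
  have "(\<integral>\<^sup>+x. (HL f x)\<^sup>2 \<partial>lborel)
      \<le> (\<integral>\<^sup>+x. \<integral>\<^sup>+l. ennreal (2 * l) * indicator {l::real. 0 < l \<and> ennreal l < HL f x} l \<partial>lborel \<partial>lborel)"
    by (intro nn_integral_mono power2_le_layer_cake)
  also have "\<dots> = (\<integral>\<^sup>+l. \<integral>\<^sup>+x. ennreal (2 * l) * indicator {l::real. 0 < l \<and> ennreal l < HL f x} l \<partial>lborel \<partial>lborel)"
    by (rule lborel_pair.Fubini') (simp add: indicator_def)
  also have "\<dots> \<le> (\<integral>\<^sup>+l. \<integral>\<^sup>+x. ennreal (2 * ?A) * (f x * indicator {l. 0 < l \<and> ennreal l < ennreal d * f x} l) \<partial>lborel \<partial>lborel)"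
  proof (rule nn_integral_mono)
    fix l :: real
    show "(\<integral>\<^sup>+x. ennreal (2 * l) * indicator {l::real. 0 < l \<and> ennreal l < HL f x} l \<partial>lborel)
        \<le> (\<integral>\<^sup>+x. ennreal (2 * ?A) * (f x * indicator {l. 0 < l \<and> ennreal l < ennreal d * f x} l) \<partial>lborel)"
    proof (cases "0 < l")
      case True
      have "(\<integral>\<^sup>+x. ennreal (2 * l) * indicator {l::real. 0 < l \<and> ennreal l < HL f x} l \<partial>lborel)
          = (\<integral>\<^sup>+x. ennreal (2 * l) * indicator {x. ennreal l < HL f x} x \<partial>lborel)"
        using True by (intro nn_integral_cong) (auto simp: indicator_def)
      also have "\<dots> = ennreal (2 * l) * emeasure lborel {x. ennreal l < HL f x}"
        by (rule nn_integral_cmult_indicator) simp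
      also have "\<dots> \<le> ennreal (2 * l) * (ennreal (?A / l) * (\<integral>\<^sup>+x. f x * indicator {x. ennreal l < ennreal d * f x} x \<partial>lborel))"
        by (intro mult_left_mono level True) auto
      also have "\<dots> = ennreal (2 * ?A) * (\<integral>\<^sup>+x. f x * indicator {x. ennreal l < ennreal d * f x} x \<partial>lborel)"
        using True d by (simp add: mult.assoc[symmetric] ennreal_mult[symmetric])
      also have "\<dots> = (\<integral>\<^sup>+x. ennreal (2 * ?A) * (f x * indicator {l. 0 < l \<and> ennreal l < ennreal d * f x} l) \<partial>lborel)"
        using True by (subst nn_integral_cmult[symmetric]) (auto simp: indicator_def intro!: nn_integral_cong)
      finally show ?thesis .
    qed simp
  qed
  also have "\<dots> = (\<integral>\<^sup>+x. \<integral>\<^sup>+l. ennreal (2 * ?A) * (f x * indicator {l. 0 < l \<and> ennreal l < ennreal d * f x} l) \<partial>lborel \<partial>lborel)"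
    by (rule lborel_pair.Fubini') (simp add: indicator_def)
  also have "\<dots> = (\<integral>\<^sup>+x. ennreal (2 * ?A * d) * (f x)\<^sup>2 \<partial>lborel)"
  proof (rule nn_integral_cong)
    fix x
    have "(\<integral>\<^sup>+l. ennreal (2 * ?A) * (f x * indicator {l. 0 < l \<and> ennreal l < ennreal d * f x} l) \<partial>lborel)
        = ennreal (2 * ?A) * (f x * (\<integral>\<^sup>+l. indicator {l. 0 < l \<and> ennreal l < ennreal d * f x} l \<partial>lborel))"
      by (subst nn_integral_cmult, simp)+ simp
    then show "(\<integral>\<^sup>+l. ennreal (2 * ?A) * (f x * indicator {l. 0 < l \<and> ennreal l < ennreal d * f x} l) \<partial>lborel)
        = ennreal (2 * ?A * d) * (f x)\<^sup>2"
      using d by (simp only: nn_integral_positive_reals_less) (simp add: power2_eq_square ennreal_mult ac_simps)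
  qed
  also have "\<dots> = ennreal (2 * ?A * d) * (\<integral>\<^sup>+x. (f x)\<^sup>2 \<partial>lborel)"
    by (simp add: nn_integral_cmult)
  also have "2 * ?A * d = HL_const TYPE('a)"
    by (simp add: HL_const_def d_def power2_eq_square)
  finally show ?thesis .
qed

text \<open>The centre is moved from \<open>x\<close> to \<open>y\<close> by doubling the radius,
  and a dyadic radius lies between \<open>2 * s\<close> and \<open>4 * s\<close>. Validity for every
  \<open>y\<close> of the ball is what controls an average on a whole rectangle.\<close>

lemma nn_integral_ball_le_HL:
  fixes f :: "'a::euclidean_space \<Rightarrow> ennreal"
  assumes s: "0 < s" and y: "dist x y < s"
  shows "(\<integral>\<^sup>+u. f u * indicator (ball x s) u \<partial>lborel) \<le> ennreal ((4 * s) ^ DIM('a)) * HL f y"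
proof -
  let ?n = "DIM('a)"
  define k where "k = \<lceil>log 2 (2 * s)\<rceil>"
  have "log 2 (2 * s) \<le> real_of_int k" "real_of_int k \<le> log 2 (2 * s) + 1"
    unfolding k_def by linarith+
  then have "2 powr log 2 (2 * s) \<le> 2 powr k" "2 powr k \<le> 2 powr (log 2 (2 * s) + 1)"
    by simp_all
  then have k: "2 * s \<le> 2 powr k" "2 powr k \<le> 4 * s"
    using s by (simp_all add: powr_add)
  have "ball x s \<subseteq> ball y (2 powr k)"
  proof
    fix u assume "u \<in> ball x s"
    then have "dist y u < 2 * s" using y dist_triangle[of y u x] by (simp add: dist_commute)
    then show "u \<in> ball y (2 powr k)" using k by simp
  qed
  then have "(\<integral>\<^sup>+u. f u * indicator (ball x s) u \<partial>lborel) \<le> (\<integral>\<^sup>+u. f u * indicator (ball y (2 powr k)) u \<partial>lborel)"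
    by (intro nn_integral_mono mult_left_mono) (auto simp: indicator_def)
  also have "\<dots> = ennreal ((2 powr k) ^ ?n) * (ennreal (1 / (2 powr k) ^ ?n) * (\<integral>\<^sup>+u. f u * indicator (ball y (2 powr k)) u \<partial>lborel))"
    by (simp add: mult.assoc[symmetric] ennreal_mult[symmetric])
  also have "\<dots> \<le> ennreal ((4 * s) ^ ?n) * HL f y"
    unfolding HL_def using k by (intro mult_mono ennreal_leI power_mono SUP_upper) auto
  finally show ?thesis .
qed

section \<open>Wavelets and the square function\<close>

lemma borel_measurable_fst [measurable]:
  "fst \<in> (borel :: ('a::{second_countable_topology} \<times> 'b::{second_countable_topology}) measure) \<rightarrow>\<^sub>M borel"
  by (rule borel_measurable_continuous_onI) (intro continuous_intros)

lemma borel_measurable_snd [measurable]: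
  "snd \<in> (borel :: ('a::{second_countable_topology} \<times> 'b::{second_countable_topology}) measure) \<rightarrow>\<^sub>M borel"
  by (rule borel_measurable_continuous_onI) (intro continuous_intros)

section \<open>The measure on the upper half space\<close>

lemma sets_hspace [measurable_cong, simp]: "sets (hspace :: ('a::euclidean_space \<times> real) measure) = sets borel"
  by (simp add: hspace_def)

lemma space_hspace [simp]: "space (hspace :: ('a::euclidean_space \<times> real) measure) = UNIV"
  by (simp add: hspace_def)

lemma hspace_density_measurable [measurable]:
  "(\<lambda>(x::'a::euclidean_space, t::real). if 0 < t then ennreal (t powr (- (real DIM('a) + 1))) else 0) \<in> borel_measurable borel"
  by (simp add: case_prod_beta)

text \<open>The half space is encoded as a density on the whole product that vanishes for
  nonpositive scales, so positivity of the scale is available almost everywhere.\<close>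

lemma AE_hspace: "AE z in (hspace :: ('a::euclidean_space \<times> real) measure). 0 < snd z"
  unfolding hspace_def by (subst AE_density) (auto split: if_splits)

lemma sigma_finite_hspace: "sigma_finite_measure (hspace :: ('a::euclidean_space \<times> real) measure)"
  unfolding hspace_def
  by (subst sigma_finite_measure.sigma_finite_iff_density_finite[OF sigma_finite_lborel])
     (auto simp: case_prod_beta intro!: always_eventually)

lemma nn_integral_hspace:
  fixes F :: "'a::euclidean_space \<times> real \<Rightarrow> ennreal"
  assumes [measurable]: "F \<in> borel_measurable borel"
  shows "(\<integral>\<^sup>+z. F z \<partial>hspace)
      = (\<integral>\<^sup>+t. \<integral>\<^sup>+x. indicator {0<..} t * ennreal (t powr (- (real DIM('a) + 1))) * F (x, t) \<partial>lborel \<partial>lborel)"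
proof -
  let ?G = "\<lambda>z::'a\<times>real. indicator {0<..} (snd z) * ennreal (snd z powr (- (real DIM('a) + 1))) * F z"
  have "(\<integral>\<^sup>+z. F z \<partial>hspace) = (\<integral>\<^sup>+z. ?G z \<partial>lborel)"
    unfolding hspace_def by (subst nn_integral_density) (auto intro!: nn_integral_cong simp: indicator_def)
  also have "\<dots> = integral\<^sup>N (lborel \<Otimes>\<^sub>M lborel) ?G"
    by (simp add: lborel_prod)
  also have "\<dots> = (\<integral>\<^sup>+t. \<integral>\<^sup>+x. ?G (x, t) \<partial>lborel \<partial>lborel)"
    by (rule lborel_pair.nn_integral_snd[symmetric]) (simp add: lborel_prod)
  finally show ?thesis by simp
qed

section \<open>Pointwise estimates for scaled bumps\<close>

lemma wav_measurable [measurable (raw)]: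
  fixes f :: "'a::euclidean_space \<Rightarrow> real"
  assumes [measurable]: "f \<in> borel_measurable borel" "g \<in> M \<rightarrow>\<^sub>M borel" "h \<in> borel_measurable M"
  shows "(\<lambda>u. wav f (g u) (h u)) \<in> borel_measurable M"
  unfolding wav_def by measurable

lemma avg_measurable [measurable (raw)]:
  fixes f :: "'a::euclidean_space \<Rightarrow> real"
  assumes [measurable]: "f \<in> borel_measurable borel" "g \<in> M \<rightarrow>\<^sub>M borel" "h \<in> borel_measurable M"
  shows "(\<lambda>u. avg f (g u) (h u)) \<in> borel_measurable M"
  unfolding avg_def by measurable

lemma pairing_wav_measurable [measurable (raw)]:
  fixes f :: "'a::euclidean_space \<Rightarrow> real" and F :: "'z \<Rightarrow> 'a \<Rightarrow> complex"
  assumes [measurable]: "f \<in> borel_measurable borel" "(\<lambda>p. F (fst p) (snd p)) \<in> borel_measurable (M \<Otimes>\<^sub>M borel)" "g \<in> M \<rightarrow>\<^sub>M borel"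
  shows "(\<lambda>u. pairing (F u) (wav f (g u))) \<in> borel_measurable M"
proof -
  have [measurable]: "(\<lambda>(u, y). F u y) \<in> borel_measurable (M \<Otimes>\<^sub>M lborel)"
    using assms(2) by (simp add: case_prod_beta)
  show ?thesis unfolding pairing_def by measurable
qed

text \<open>Holds without integrability, as the Bochner integral of a function that is not
  integrable is 0 by convention.\<close>

lemma ennreal_norm_integral_le:
  fixes f :: "'z \<Rightarrow> complex"
  shows "ennreal (cmod (\<integral>x. f x \<partial>M)) \<le> (\<integral>\<^sup>+x. ennreal (cmod (f x)) \<partial>M)"
proof (cases "integrable M f")
  case True
  then show ?thesis by (rule integral_norm_bound_ennreal)
qed (simp add: not_integrable_integral_eq)

text \<open>Collects the size, support and Lipschitz bounds through which \<open>\<psi>\<close> and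
  \<open>\<phi>\<close> enter the estimates. The normalisation \<open>1 \<le> r\<close> ensures that
  the ball of radius \<open>r * t\<close> contains the one of radius \<open>t\<close>.\<close>

definition bump :: "('a::euclidean_space \<Rightarrow> real) \<Rightarrow> real \<Rightarrow> real \<Rightarrow> bool" where
  "bump f r B \<longleftrightarrow> 1 \<le> r \<and> 1 \<le> B \<and> (\<forall>x. \<bar>f x\<bar> \<le> B) \<and> (\<forall>x. r \<le> norm x \<longrightarrow> f x = 0)
     \<and> (\<forall>x y. \<bar>f x - f y\<bar> \<le> B * norm (x - y))"

lemma bumpD:
  assumes "bump f r B"
  shows "1 \<le> r" "1 \<le> B" "\<bar>f x\<bar> \<le> B" "r \<le> norm x \<Longrightarrow> f x = 0" "\<bar>f x - f y\<bar> \<le> B * norm (x - y)"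
  using assms by (auto simp: bump_def)

lemma bump_measurable:
  assumes "bump f r B"
  shows "f \<in> borel_measurable borel"
proof (rule borel_measurable_continuous_onI, rule lipschitz_on_continuous_on)
  show "B-lipschitz_on UNIV f"
    using assms by (intro lipschitz_onI) (auto simp: bump_def dist_norm dest: order_trans)
qed

lemma scaled_bump:
  fixes f :: "'a::euclidean_space \<Rightarrow> real"
  assumes f: "bump f r B" and t: "0 < t"
  shows "\<bar>f ((1 / t) *\<^sub>R (y - x))\<bar> \<le> B * indicator (ball x (r * t)) y"
    and "\<bar>f ((1 / t) *\<^sub>R (y - x)) - f ((1 / t) *\<^sub>R (y' - x))\<bar> \<le> B * (norm (y - y') / t)"
proof -
  have "f ((1 / t) *\<^sub>R (y - x)) = 0" if "r * t \<le> dist x y"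
  proof (rule bumpD(4)[OF f])
    have "r \<le> norm (y - x) / t" using that t by (simp add: dist_norm norm_minus_commute pos_le_divide_eq)
    then show "r \<le> norm ((1 / t) *\<^sub>R (y - x))" using t by simp
  qed
  then show "\<bar>f ((1 / t) *\<^sub>R (y - x))\<bar> \<le> B * indicator (ball x (r * t)) y"
    using bumpD(3)[OF f] by (auto simp: indicator_def)
  have "\<bar>f ((1 / t) *\<^sub>R (y - x)) - f ((1 / t) *\<^sub>R (y' - x))\<bar> \<le> B * norm ((1 / t) *\<^sub>R (y - y'))"
    using bumpD(5)[OF f, of "(1 / t) *\<^sub>R (y - x)" "(1 / t) *\<^sub>R (y' - x)"] by (simp flip: scaleR_diff_right)
  then show "\<bar>f ((1 / t) *\<^sub>R (y - x)) - f ((1 / t) *\<^sub>R (y' - x))\<bar> \<le> B * (norm (y - y') / t)"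
    using t by simp
qed

lemma wav_bound:
  fixes f :: "'a::euclidean_space \<Rightarrow> real"
  assumes "bump f r B" "0 < t"
  shows "cmod (wav f (x, t) y) \<le> t powr (- real DIM('a) / 2) * (B * indicator (ball x (r * t)) y)"
  using scaled_bump(1)[OF assms, of y x] by (simp add: wav_def norm_mult mult_left_mono)

lemma avg_bound:
  fixes f :: "'a::euclidean_space \<Rightarrow> real"
  assumes "bump f r B" "0 < t"
  shows "cmod (avg f (x, t) y) \<le> t powr (- real DIM('a)) * (B * indicator (ball x (r * t)) y)"
  using scaled_bump(1)[OF assms, of y x] by (simp add: avg_def norm_mult mult_left_mono)

lemma wav_lipschitz:
  fixes f :: "'a::euclidean_space \<Rightarrow> real"
  assumes "bump f r B" "0 < t"
  shows "cmod (wav f (x, t) y - wav f (x, t) y') \<le> t powr (- real DIM('a) / 2) * (B * (norm (y - y') / t))"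
  using scaled_bump(2)[OF assms, of y x y']
  by (simp only: wav_def fst_conv snd_conv norm_of_real abs_mult abs_of_nonneg[OF powr_ge_zero]
      flip: of_real_diff right_diff_distrib) (rule mult_left_mono, simp_all)

lemma avg_lipschitz:
  fixes f :: "'a::euclidean_space \<Rightarrow> real"
  assumes "bump f r B" "0 < t"
  shows "cmod (avg f (x, t) y - avg f (x, t) y') \<le> t powr (- real DIM('a)) * (B * (norm (y - y') / t))"
  using scaled_bump(2)[OF assms, of y x y']
  by (simp only: avg_def fst_conv snd_conv norm_of_real abs_mult abs_of_nonneg[OF powr_ge_zero]
      flip: of_real_diff right_diff_distrib) (rule mult_left_mono, simp_all)

lemma powr_minus_le_on_scales:
  fixes t N a :: real
  assumes "0 < N" "1 / N \<le> t" "0 \<le> a"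
  shows "t powr (- a) \<le> N powr a"
proof -
  have "0 < t" using assms by (metis less_le_trans zero_less_divide_1_iff)
  have "t powr (- a) = (1 / t) powr a" using \<open>0 < t\<close> by (simp add: powr_minus_divide powr_divide)
  also have "\<dots> \<le> N powr a"
    using assms \<open>0 < t\<close> by (intro powr_mono2) (auto simp: field_simps)
  finally show ?thesis .
qed

text \<open>A compact part of the half space: it has finite measure, and on it wavelets and averages
  obey uniform bounds.\<close>

definition scale_region :: "real \<Rightarrow> ('a::euclidean_space \<times> real) set" where
  "scale_region N = {z. norm (fst z) \<le> N \<and> 1 / N \<le> snd z \<and> snd z \<le> N}"

lemma scale_region_measurable [measurable]: "scale_region N \<in> sets borel"
  unfolding scale_region_def by measurable

lemma emeasure_scale_region_finite:
  assumes "1 \<le> N"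
  shows "emeasure (hspace :: ('a::euclidean_space \<times> real) measure) (scale_region N) < \<infinity>"
proof -
  let ?n = "real DIM('a) + 1"
  have "emeasure (hspace :: ('a \<times> real) measure) (scale_region N)
      = (\<integral>\<^sup>+z. (if 0 < snd z then ennreal (snd z powr (- ?n)) else 0) * indicator (scale_region N) (z::'a\<times>real) \<partial>lborel)"
    unfolding hspace_def by (subst emeasure_density) (auto simp: case_prod_beta)
  also have "\<dots> \<le> (\<integral>\<^sup>+z. ennreal (N powr ?n) * indicator (scale_region N) (z::'a\<times>real) \<partial>lborel)"
    using assms powr_minus_le_on_scales[of N _ ?n]
    by (intro nn_integral_mono) (auto simp: indicator_def scale_region_def intro!: ennreal_leI)
  also have "\<dots> = ennreal (N powr ?n) * emeasure lborel (scale_region N :: ('a \<times> real) set)"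
    by (rule nn_integral_cmult_indicator) simp
  also have "\<dots> < \<infinity>"
  proof -
    have "scale_region N \<subseteq> (cball 0 (N + N) :: ('a \<times> real) set)"
    proof
      fix z :: "'a \<times> real" assume z: "z \<in> scale_region N"
      have "0 < 1 / N" using assms by simp
      then have "0 < snd z" using z unfolding scale_region_def by (metis (mono_tags) less_le_trans mem_Collect_eq)
      then have "\<bar>snd z\<bar> \<le> N" using z by (simp add: scale_region_def)
      moreover have "norm z \<le> norm (fst z) + norm (snd z)"
        using norm_Pair_le[of "fst z" "snd z"] by simp
      ultimately show "z \<in> cball 0 (N + N)" using z by (simp add: scale_region_def)
    qed
    then have "emeasure lborel (scale_region N :: ('a \<times> real) set) \<le> emeasure lborel (cball 0 (N + N) :: ('a \<times> real) set)"
      by (intro emeasure_mono) auto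
    then have "emeasure lborel (scale_region N :: ('a \<times> real) set) < \<infinity>"
      using emeasure_lborel_cball_finite order_le_less_trans by blast
    then show ?thesis by (simp add: ennreal_mult_less_top)
  qed
  finally show ?thesis .
qed

text \<open>One exponent serves all cases: on these scales \<open>t powr (- a)\<close> is at most
  \<open>N powr a\<close>, where \<open>a\<close> is at most the dimension for the normalisation and
  one more for the factor 1/t of the Lipschitz bound.\<close>

lemma wav_avg_on_scales:
  fixes f :: "'a::euclidean_space \<Rightarrow> real"
  assumes f: "bump f r B" and N: "1 \<le> N" and z: "z \<in> scale_region N" and h: "h = wav f z \<or> h = avg f z"
  shows "cmod (h y) \<le> N powr (real DIM('a) + 1) * B"
    and "y \<notin> cball 0 (N + r * N) \<Longrightarrow> h y = 0"
    and "cmod (h y - h y') \<le> N powr (real DIM('a) + 1) * B * norm (y - y')"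
proof -
  obtain x t where zxt: "z = (x, t)" by (cases z)
  let ?n = "real DIM('a)"
  have x: "norm x \<le> N" and t: "1 / N \<le> t" "t \<le> N" using z by (auto simp: scale_region_def zxt)
  have t0: "0 < t" using N t by (metis less_le_trans zero_less_divide_1_iff zero_less_one)
  have B: "1 \<le> B" and r: "1 \<le> r" using bumpD[OF f] by auto
  have p: "t powr (- a) \<le> N powr (?n + 1)" "t powr (- a) / t \<le> N powr (?n + 1)" if "0 \<le> a" "a \<le> ?n" for a
  proof -
    show "t powr (- a) \<le> N powr (?n + 1)"
      using powr_minus_le_on_scales[of N t a] N t that powr_mono[of a "?n + 1" N] by auto
    have "t powr (- a) / t = t powr (- (a + 1))"
      using t0 powr_diff[of t "- a" 1] by (simp add: minus_diff_commute)
    then show "t powr (- a) / t \<le> N powr (?n + 1)"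
      using powr_minus_le_on_scales[of N t "a + 1"] N t that powr_mono[of "a + 1" "?n + 1" N] by auto
  qed
  define a where "a = (if h = wav f z then ?n / 2 else ?n)"
  have a: "0 \<le> a" "a \<le> ?n" by (auto simp: a_def)
  have hb: "cmod (h y) \<le> t powr (- a) * (B * indicator (ball x (r * t)) y)" for y
    using wav_bound[OF f t0, of x y] avg_bound[OF f t0, of x y] h by (auto simp: a_def zxt)
  have hl: "cmod (h y - h y') \<le> t powr (- a) * (B * (norm (y - y') / t))"
    using wav_lipschitz[OF f t0, of x y y'] avg_lipschitz[OF f t0, of x y y'] h by (auto simp: a_def zxt)
  have "cmod (h y) \<le> t powr (- a) * B"
    using hb[of y] B by (auto simp: indicator_def split: if_splits intro: order_trans)
  also have "\<dots> \<le> N powr (?n + 1) * B" using B by (intro mult_right_mono p a) auto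
  finally show "cmod (h y) \<le> N powr (?n + 1) * B" .
  have "cmod (h y - h y') \<le> t powr (- a) / t * (B * norm (y - y'))"
    using hl by simp
  also have "\<dots> \<le> N powr (?n + 1) * (B * norm (y - y'))" using B by (intro mult_right_mono p a) auto
  finally show "cmod (h y - h y') \<le> N powr (?n + 1) * B * norm (y - y')" by (simp add: mult.assoc)
  assume y: "y \<notin> cball 0 (N + r * N)"
  have "r * t \<le> r * N" using r t by (intro mult_left_mono) auto
  then have "y \<notin> ball x (r * t)"
    using y x norm_triangle_ineq2[of y x] by (auto simp: dist_norm norm_minus_commute)
  then show "h y = 0" using hb[of y] by simp
qed

lemma integral_scaled:
  fixes f :: "'a::euclidean_space \<Rightarrow> real"
  assumes [measurable]: "f \<in> borel_measurable borel" and s: "0 < s"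
  shows "(\<integral>y. f ((1 / s) *\<^sub>R (y - x)) \<partial>lborel) = s ^ DIM('a) * (\<integral>y. f y \<partial>lborel)"
proof -
  have "(\<integral>y. f ((1 / s) *\<^sub>R (y - x)) \<partial>lborel)
      = (\<integral>y. f ((1 / s) *\<^sub>R (y - x)) \<partial>(density (distr lborel borel (\<lambda>u. x + s *\<^sub>R u)) (\<lambda>_. ennreal (s ^ DIM('a)))))"
    using lborel_affine[of s x] s by (simp add: ennreal_power)
  also have "\<dots> = (\<integral>u. s ^ DIM('a) * f u \<partial>lborel)"
    using s by (subst integral_density) (auto simp: integral_distr)
  finally show ?thesis by simp
qed

lemma ennreal_le_indicator: "a \<le> c * indicator A x \<Longrightarrow> ennreal a \<le> ennreal c * indicator A x"
  by (cases "x \<in> A") (auto simp: ennreal_leI ennreal_eq_0_iff)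

lemma (in sigma_finite_measure) nn_integral_cmult_add_twice:
  assumes [measurable]: "(\<lambda>(z, w). P z w) \<in> borel_measurable (N \<Otimes>\<^sub>M M)" "(\<lambda>(z, w). Q z w) \<in> borel_measurable (N \<Otimes>\<^sub>M M)"
  shows "(\<integral>\<^sup>+z. \<integral>\<^sup>+w. c * (P z w + Q z w) \<partial>M \<partial>N)
    = c * ((\<integral>\<^sup>+z. \<integral>\<^sup>+w. P z w \<partial>M \<partial>N) + (\<integral>\<^sup>+z. \<integral>\<^sup>+w. Q z w \<partial>M \<partial>N))"
proof -
  have "(\<integral>\<^sup>+z. \<integral>\<^sup>+w. c * (P z w + Q z w) \<partial>M \<partial>N) = (\<integral>\<^sup>+z. c * ((\<integral>\<^sup>+w. P z w \<partial>M) + (\<integral>\<^sup>+w. Q z w \<partial>M)) \<partial>N)"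
  proof (rule nn_integral_cong)
    fix z assume z: "z \<in> space N"
    have [measurable]: "P z \<in> borel_measurable M" "Q z \<in> borel_measurable M"
      using measurable_Pair2[OF assms(1) z] measurable_Pair2[OF assms(2) z] by auto
    show "(\<integral>\<^sup>+w. c * (P z w + Q z w) \<partial>M) = c * ((\<integral>\<^sup>+w. P z w \<partial>M) + (\<integral>\<^sup>+w. Q z w \<partial>M))"
      by (simp add: nn_integral_cmult nn_integral_add)
  qed
  also have "\<dots> = c * ((\<integral>\<^sup>+z. \<integral>\<^sup>+w. P z w \<partial>M \<partial>N) + (\<integral>\<^sup>+z. \<integral>\<^sup>+w. Q z w \<partial>M \<partial>N))"
    by (simp add: nn_integral_cmult nn_integral_add)
  finally show ?thesis .
qed

section \<open>Almost orthogonality of wavelets and Schur's test\<close>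

locale mean_zero_bump =
  fixes \<psi> :: "'a::euclidean_space \<Rightarrow> real" and B :: real
  assumes bump: "bump \<psi> 1 B" and mean_zero: "(\<integral>x. \<psi> x \<partial>lborel) = 0"
begin

lemmas \<psi>_measurable [measurable] = bump_measurable[OF bump]

lemma wav_\<psi>_L2:
  assumes "0 < t"
  shows "wav \<psi> (x, t) \<in> L2"
proof (rule L2_bounded_support(1))
  show "cmod (wav \<psi> (x, t) y) \<le> t powr (- real DIM('a) / 2) * B" for y
    using wav_bound[OF bump assms, of x y] bumpD(2)[OF bump]
    by (auto simp: indicator_def split: if_splits intro: order_trans)
  show "wav \<psi> (x, t) y = 0" if "y \<notin> cball 0 (norm x + t)" for y
  proof -
    have "y \<notin> ball x t" using that norm_triangle_ineq2[of y x] by (auto simp: dist_norm norm_minus_commute)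
    then show ?thesis using wav_bound[OF bump assms, of x y] by simp
  qed
qed measurable

lemma integral_wav_\<psi>:
  assumes "0 < s"
  shows "(\<integral>y. wav \<psi> (x, s) y \<partial>lborel) = 0"
proof -
  have "(\<integral>y. wav \<psi> (x, s) y \<partial>lborel)
      = complex_of_real (\<integral>y. s powr (- real DIM('a) / 2) * \<psi> ((1 / s) *\<^sub>R (y - x)) \<partial>lborel)"
    unfolding wav_def by (simp only: integral_complex_of_real fst_conv snd_conv)
  then show ?thesis using integral_scaled[OF \<psi>_measurable assms, of x] mean_zero by simp
qed

text \<open>By the mean zero condition, one may subtract from the wavelet of larger scale its value at the centre of the other one.\<close>
lemma almost_orthogonal:
  fixes x x' :: 'a
  assumes s: "0 < s" and st: "s \<le> t"
  shows "cmod (pairing (wav \<psi> (x, t)) (wav \<psi> (x', s)))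
    \<le> (B\<^sup>2 * measure lborel (ball (0::'a) 1)) * (s / t) powr (1 + real DIM('a) / 2) * indicator (ball x (2 * t)) x'"
proof (cases "x' \<in> ball x (2 * t)")
  case False
  have t: "0 < t" using s st by simp
  have "wav \<psi> (x, t) y * wav \<psi> (x', s) y = 0" for y
  proof (rule ccontr)
    assume ne: "wav \<psi> (x, t) y * wav \<psi> (x', s) y \<noteq> 0"
    have "y \<in> ball x t"
      using wav_bound[OF bump t, of x y] ne by (cases "y \<in> ball x t") auto
    moreover have "y \<in> ball x' s"
      using wav_bound[OF bump s, of x' y] ne by (cases "y \<in> ball x' s") auto
    ultimately have "dist x x' < 2 * t"
      using st dist_triangle[of x x' y] by (simp add: dist_commute)
    then show False using False by simp
  qed
  then have "pairing (wav \<psi> (x, t)) (wav \<psi> (x', s)) = 0"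
    by (simp only: pairing_def integral_zero)
  then show ?thesis by simp
next
  case True
  have t: "0 < t" using s st by simp
  let ?n = "real DIM('a)" and ?w = "measure lborel (ball (0::'a) 1)"
  \<comment> \<open>The Lipschitz bound of the wider wavelet over a distance of at most
    \<open>s\<close>, times the height of the narrower one. Multiplied by the volume of the smaller
    ball this yields the power \<open>1 + ?n / 2\<close> of \<open>s / t\<close>.\<close>
  let ?c = "t powr (- ?n / 2) * (B * (s / t)) * (s powr (- ?n / 2) * B)"
  have B: "1 \<le> B" using bumpD(2)[OF bump] .
  have int: "integrable lborel (wav \<psi> (x', s))"
  proof (rule integrableI_bounded)
    have "(\<integral>\<^sup>+y. ennreal (norm (wav \<psi> (x', s) y)) \<partial>lborel) \<le> (\<integral>\<^sup>+y. ennreal (s powr (- ?n / 2) * B) * indicator (ball x' s) y \<partial>lborel)"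
      using wav_bound[OF bump s, of x'] by (intro nn_integral_mono ennreal_le_indicator) (simp add: mult.assoc)
    also have "\<dots> < \<infinity>"
      using emeasure_lborel_ball_finite[of x' s] by (simp add: nn_integral_cmult_indicator ennreal_mult_less_top)
    finally show "(\<integral>\<^sup>+y. ennreal (norm (wav \<psi> (x', s) y)) \<partial>lborel) < \<infinity>" .
  qed measurable
  have "pairing (wav \<psi> (x, t)) (wav \<psi> (x', s)) = (\<integral>y. (wav \<psi> (x, t) y - wav \<psi> (x, t) x') * wav \<psi> (x', s) y \<partial>lborel)"
    unfolding pairing_def left_diff_distrib
    using integrable_L2_mult[OF wav_\<psi>_L2[OF t] wav_\<psi>_L2[OF s]] int integral_wav_\<psi>[OF s]
    by (subst Bochner_Integration.integral_diff) auto
  also have "ennreal (cmod \<dots>) \<le> (\<integral>\<^sup>+y. ennreal (cmod ((wav \<psi> (x, t) y - wav \<psi> (x, t) x') * wav \<psi> (x', s) y)) \<partial>lborel)"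
    by (rule ennreal_norm_integral_le)
  also have "\<dots> \<le> (\<integral>\<^sup>+y. ennreal ?c * indicator (ball x' s) y \<partial>lborel)"
  proof (rule nn_integral_mono)
    fix y
    have "cmod ((wav \<psi> (x, t) y - wav \<psi> (x, t) x') * wav \<psi> (x', s) y) \<le> ?c * indicator (ball x' s) y"
    proof (cases "y \<in> ball x' s")
      case y: True
      have "norm (y - x') \<le> s" using y by (simp add: dist_norm norm_minus_commute)
      then have "t powr (- ?n / 2) * (B * (norm (y - x') / t)) \<le> t powr (- ?n / 2) * (B * (s / t))"
        using B t by (intro mult_left_mono divide_right_mono) auto
      from order_trans[OF wav_lipschitz[OF bump t, of x y x'] this]
      have "cmod (wav \<psi> (x, t) y - wav \<psi> (x, t) x') * cmod (wav \<psi> (x', s) y) \<le> ?c"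
        using wav_bound[OF bump s, of x' y] y B t s by (intro mult_mono) auto
      then show ?thesis using y by (simp add: norm_mult)
    next
      case y: False
      then show ?thesis using wav_bound[OF bump s, of x' y] by simp
    qed
    then show "ennreal (cmod ((wav \<psi> (x, t) y - wav \<psi> (x, t) x') * wav \<psi> (x', s) y)) \<le> ennreal ?c * indicator (ball x' s) y"
      by (rule ennreal_le_indicator)
  qed
  also have "\<dots> = ennreal ?c * ennreal (s ^ DIM('a) * ?w)"
    using s by (simp add: nn_integral_cmult_indicator emeasure_lborel_ball)
  also have "\<dots> = ennreal (?c * (s ^ DIM('a) * ?w))"
    using s t B by (intro ennreal_mult[symmetric]) auto
  also have "?c * (s ^ DIM('a) * ?w) = B\<^sup>2 * ?w * (s / t) powr (1 + ?n / 2)"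
  proof -
    have "s powr (- ?n / 2) * s ^ DIM('a) = s powr (?n / 2)"
      using s by (simp add: powr_realpow[symmetric] powr_add[symmetric])
    moreover have "t powr (- ?n / 2) = 1 / t powr (?n / 2)" by (simp add: powr_minus_divide)
    moreover have "(s / t) powr (1 + ?n / 2) = (s / t) * (s powr (?n / 2) / t powr (?n / 2))"
      using s t by (simp add: powr_add powr_divide)
    moreover have "?c * (s ^ DIM('a) * ?w) = t powr (- ?n / 2) * (s / t) * (s powr (- ?n / 2) * s ^ DIM('a)) * (B\<^sup>2 * ?w)"
      by (simp only: power2_eq_square ac_simps)
    ultimately show ?thesis by (simp only:) (simp add: ac_simps)
  qed
  finally show ?thesis using True B by simp
qed

text \<open>The volume of \<open>ball x (2 * max s t)\<close> contributes \<open>2 ^ DIM('a)\<close>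
  and one unit volume, almost orthogonality the rest. The leading 2 counts the ranges of smaller and
  of larger scales, each of which integrates to 1.\<close>

definition schur_const :: real where
  "schur_const = 2 * (B\<^sup>2 * measure lborel (ball (0::'a) 1) * (2 ^ DIM('a) * measure lborel (ball (0::'a) 1)))"

lemma schur_const_pos: "0 < schur_const"
  using bumpD(2)[OF bump] unit_vol_pos[where 'a='a] by (simp add: schur_const_def)

text \<open>The weight t^(n/2) is reproduced by the kernel of pairings. After integrating out the
  position and inserting the density s^(-n-1), the scales \<open>s \<le> t\<close> contribute 1/t
  and the scales \<open>s \<ge> t\<close> contribute t/s^2, relative to the weight and up to a
  constant; both have integral 1.\<close>

lemma schur_bound:
  fixes x :: 'a
  assumes t: "0 < t"
  shows "(\<integral>\<^sup>+w. ennreal (cmod (pairing (wav \<psi> (x, t)) (wav \<psi> w)) * snd w powr (real DIM('a) / 2)) \<partial>hspace)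
    \<le> ennreal (schur_const * t powr (real DIM('a) / 2))"
proof -
  let ?n = "real DIM('a)" and ?w = "measure lborel (ball (0::'a) 1)"
  let ?k = "\<lambda>x' s. cmod (pairing (wav \<psi> (x, t)) (wav \<psi> (x', s)))"
  let ?C = "B\<^sup>2 * ?w" and ?D = "schur_const / 2"
  have D: "?D = ?C * (2 ^ DIM('a) * ?w)" by (simp add: schur_const_def)
  have C0: "0 \<le> ?C" by simp
  have slice: "(\<integral>\<^sup>+x'. ennreal (?k x' s) \<partial>lborel)
      \<le> ennreal (?D * (min s t / max s t) powr (1 + ?n / 2) * max s t powr ?n)" if s: "0 < s" for s
  proof -
    have "?k x' s \<le> ?C * (min s t / max s t) powr (1 + ?n / 2) * indicator (ball x (2 * max s t)) x'" for x'
    proof (cases "s \<le> t")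
      case True
      then show ?thesis using almost_orthogonal[OF s True, of x x'] by (simp add: min_def max_def)
    next
      case False
      then show ?thesis using almost_orthogonal[OF t, of s x' x]
        by (simp add: min_def max_def pairing_commute[of "wav \<psi> (x, t)"] indicator_def dist_commute split: if_splits)
    qed
    then have "(\<integral>\<^sup>+x'. ennreal (?k x' s) \<partial>lborel)
        \<le> (\<integral>\<^sup>+x'. ennreal (?C * (min s t / max s t) powr (1 + ?n / 2)) * indicator (ball x (2 * max s t)) x' \<partial>lborel)"
      by (intro nn_integral_mono ennreal_le_indicator)
    also have "\<dots> = ennreal (?C * (min s t / max s t) powr (1 + ?n / 2)) * ennreal ((2 * max s t) ^ DIM('a) * ?w)"
      using s t by (simp add: nn_integral_cmult_indicator emeasure_lborel_ball)
    also have "\<dots> = ennreal (?C * (min s t / max s t) powr (1 + ?n / 2) * ((2 * max s t) ^ DIM('a) * ?w))"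
      using s t C0 by (intro ennreal_mult[symmetric]) auto
    also have "?C * (min s t / max s t) powr (1 + ?n / 2) * ((2 * max s t) ^ DIM('a) * ?w)
        = ?D * (min s t / max s t) powr (1 + ?n / 2) * max s t powr ?n"
      using s t by (simp add: D power_mult_distrib powr_realpow)
    finally show ?thesis .
  qed
  have meas [measurable]: "(\<lambda>w. ennreal (cmod (pairing (wav \<psi> (x, t)) (wav \<psi> w)) * snd w powr (?n / 2))) \<in> borel_measurable borel"
    by measurable
  have "(\<integral>\<^sup>+w. ennreal (cmod (pairing (wav \<psi> (x, t)) (wav \<psi> w)) * snd w powr (?n / 2)) \<partial>hspace)
      = (\<integral>\<^sup>+s. \<integral>\<^sup>+x'. indicator {0<..} s * ennreal (s powr (- (?n + 1))) * ennreal (?k x' s * s powr (?n / 2)) \<partial>lborel \<partial>lborel)"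
    by (subst nn_integral_hspace) auto
  also have "\<dots> \<le> (\<integral>\<^sup>+s. ennreal (?D * t powr (?n / 2)) * (ennreal (1 / t) * indicator {0..t} s + ennreal (t / s\<^sup>2) * indicator {t..} s) \<partial>lborel)"
  proof (rule nn_integral_mono)
    fix s :: real
    show "(\<integral>\<^sup>+x'. indicator {0<..} s * ennreal (s powr (- (?n + 1))) * ennreal (?k x' s * s powr (?n / 2)) \<partial>lborel)
      \<le> ennreal (?D * t powr (?n / 2)) * (ennreal (1 / t) * indicator {0..t} s + ennreal (t / s\<^sup>2) * indicator {t..} s)"
    proof (cases "0 < s")
      case s: True
      have [measurable]: "(\<lambda>x'. ennreal (?k x' s)) \<in> borel_measurable borel" by measurable
      have "(\<integral>\<^sup>+x'. indicator {0<..} s * ennreal (s powr (- (?n + 1))) * ennreal (?k x' s * s powr (?n / 2)) \<partial>lborel)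
          = (\<integral>\<^sup>+x'. ennreal (s powr (- (?n + 1)) * s powr (?n / 2)) * ennreal (?k x' s) \<partial>lborel)"
        using s by (intro nn_integral_cong) (simp add: ennreal_mult ac_simps)
      also have "\<dots> = ennreal (s powr (- (?n + 1)) * s powr (?n / 2)) * (\<integral>\<^sup>+x'. ennreal (?k x' s) \<partial>lborel)"
        by (rule nn_integral_cmult) simp
      also have "\<dots> \<le> ennreal (s powr (- (?n + 1)) * s powr (?n / 2)) * ennreal (?D * (min s t / max s t) powr (1 + ?n / 2) * max s t powr ?n)"
        by (intro mult_left_mono slice s) simp
      also have "\<dots> = ennreal (s powr (- (?n + 1)) * s powr (?n / 2) * (?D * (min s t / max s t) powr (1 + ?n / 2) * max s t powr ?n))"
        using schur_const_pos by (intro ennreal_mult[symmetric]) auto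
      also have "\<dots> \<le> ennreal (?D * t powr (?n / 2)) * (ennreal (1 / t) * indicator {0..t} s + ennreal (t / s\<^sup>2) * indicator {t..} s)"
      proof (cases "s \<le> t")
        case True
        have "s powr (- (?n + 1)) * s powr (?n / 2) * (s / t) powr (1 + ?n / 2) * t powr ?n = t powr (?n / 2) * (1 / t)"
        proof -
          have "s powr (- (?n + 1)) * s powr (?n / 2) * s powr (1 + ?n / 2) = 1"
            using s by (simp add: powr_add[symmetric])
          moreover have "t powr ?n / t powr (1 + ?n / 2) = t powr (?n / 2) * (1 / t)"
            using t powr_add[of t "?n / 2" "?n / 2"] by (simp add: powr_add)
          ultimately show ?thesis using s t by (simp add: powr_divide)
        qed
        then have "s powr (- (?n + 1)) * s powr (?n / 2) * (?D * (s / t) powr (1 + ?n / 2) * t powr ?n) = ?D * t powr (?n / 2) * (1 / t)"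
          by (simp add: ac_simps)
        then have "ennreal (s powr (- (?n + 1)) * s powr (?n / 2) * (?D * (min s t / max s t) powr (1 + ?n / 2) * max s t powr ?n)) = ennreal (?D * t powr (?n / 2)) * ennreal (1 / t)"
          using True t schur_const_pos by (simp add: ennreal_mult[symmetric] max_absorb2 min_absorb1 del: times_divide_eq_right)
        also have "\<dots> \<le> ennreal (?D * t powr (?n / 2)) * (ennreal (1 / t) * indicator {0..t} s + ennreal (t / s\<^sup>2) * indicator {t..} s)"
          using True s by (intro mult_left_mono) (auto simp: indicator_def)
        finally show ?thesis .
      next
        case False
        have "s powr (- (?n + 1)) * s powr (?n / 2) * (t / s) powr (1 + ?n / 2) * s powr ?n = t powr (?n / 2) * (t / s\<^sup>2)"
        proof -
          have "s powr (- (?n + 1)) * s powr (?n / 2) * s powr ?n / s powr (1 + ?n / 2) = s powr (-2)"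
            using s by (simp add: powr_add[symmetric] powr_diff[symmetric])
          also have "\<dots> = 1 / s\<^sup>2" using s by (simp add: powr_minus_divide)
          finally have *: "s powr (- (?n + 1)) * s powr (?n / 2) * s powr ?n / s powr (1 + ?n / 2) = 1 / s\<^sup>2" .
          have "s powr (- (?n + 1)) * s powr (?n / 2) * (t / s) powr (1 + ?n / 2) * s powr ?n
              = (s powr (- (?n + 1)) * s powr (?n / 2) * s powr ?n / s powr (1 + ?n / 2)) * t powr (1 + ?n / 2)"
            using s t by (simp add: powr_divide)
          then show ?thesis unfolding * using t by (simp add: powr_add)
        qed
        then have "s powr (- (?n + 1)) * s powr (?n / 2) * (?D * (t / s) powr (1 + ?n / 2) * s powr ?n) = ?D * t powr (?n / 2) * (t / s\<^sup>2)"
          by (simp add: ac_simps)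
        then have "ennreal (s powr (- (?n + 1)) * s powr (?n / 2) * (?D * (min s t / max s t) powr (1 + ?n / 2) * max s t powr ?n)) = ennreal (?D * t powr (?n / 2)) * ennreal (t / s\<^sup>2)"
          using False t schur_const_pos by (simp add: ennreal_mult[symmetric] max_absorb1 min_absorb2 del: times_divide_eq_right)
        also have "\<dots> \<le> ennreal (?D * t powr (?n / 2)) * (ennreal (1 / t) * indicator {0..t} s + ennreal (t / s\<^sup>2) * indicator {t..} s)"
          using False s by (intro mult_left_mono) (auto simp: indicator_def)
        finally show ?thesis .
      qed
      finally show ?thesis .
    qed simp
  qed
  also have "\<dots> = ennreal (?D * t powr (?n / 2)) * ((\<integral>\<^sup>+s. ennreal (1 / t) * indicator {0..t} s \<partial>lborel) + (\<integral>\<^sup>+s. ennreal (t / s\<^sup>2) * indicator {t..} s \<partial>lborel))"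
    by (subst nn_integral_cmult, simp) (subst nn_integral_add, auto)
  also have "(\<integral>\<^sup>+s. ennreal (1 / t) * indicator {0..t} s \<partial>lborel) = 1"
    using t by (simp add: nn_integral_cmult_indicator ennreal_mult[symmetric])
  also have "(\<integral>\<^sup>+s. ennreal (t / s\<^sup>2) * indicator {t..} s \<partial>lborel) = ennreal (0 - (- t / t))"
  proof (rule nn_integral_FTC_atLeast[where F = "\<lambda>s. - t / s"])
    show "DERIV (\<lambda>s. - t / s) s :> t / s\<^sup>2" if "t \<le> s" for s
      using that t by (auto intro!: derivative_eq_intros simp: power2_eq_square)
    show "((\<lambda>s. - t / s) \<longlongrightarrow> 0) at_top"
      by (rule real_tendsto_divide_at_top[OF tendsto_const filterlim_ident])
  qed (use t in auto)
  also have "ennreal (?D * t powr (?n / 2)) * (1 + ennreal (0 - (- t / t))) = ennreal (schur_const * t powr (?n / 2))"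
    using t schur_const_pos by (simp add: ennreal_mult[symmetric] mult.commute flip: ennreal_1 ennreal_plus) (simp add: ennreal_mult[symmetric] ac_simps flip: ennreal_numeral)
  finally show ?thesis .
qed

lemma superposition_wav:
  assumes N: "1 \<le> N"
  shows "superposition hspace (\<lambda>z. indicator (scale_region N) z) (wav \<psi>) (wav \<psi>)
    (N powr (real DIM('a) + 1) * B) (N powr (real DIM('a) + 1) * B) (N + N)"
proof -
  note * = wav_avg_on_scales[OF bump N, OF _ disjI1[OF refl]]
  show ?thesis
  proof (intro superposition.intro superposition_axioms.intro sigma_finite_hspace)
    have "integrable hspace (\<lambda>z. complex_of_real (indicator (scale_region N :: ('a \<times> real) set) z))"
      using emeasure_scale_region_finite[OF N, where 'a='a] by (intro integrable_of_real integrable_real_indicator) auto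
    moreover have "(\<lambda>z. complex_of_real (indicator (scale_region N :: ('a \<times> real) set) z)) = indicator (scale_region N)"
      by (auto simp: indicator_def)
    ultimately show "integrable hspace (\<lambda>z. indicator (scale_region N :: ('a \<times> real) set) z :: complex)" by simp
    show "(\<lambda>(z, x). wav \<psi> z x) \<in> borel_measurable (hspace \<Otimes>\<^sub>M borel)"
      by (simp add: case_prod_beta)
    then show "(\<lambda>(z, x). wav \<psi> z x) \<in> borel_measurable (hspace \<Otimes>\<^sub>M borel)" .
  qed (use * in \<open>auto simp: indicator_eq_0_iff simp del: mem_cball\<close>)
qed

text \<open>\<open>G\<close> is the superposition of wavelets over a bounded region with the
  conjugate coefficients of \<open>f\<close>. Its pairing with \<open>f\<close> is the truncated
  integral \<open>I\<close> of the squared coefficients, while Schur's test gives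
  \<open>(L2norm G)\<^sup>2 \<le> schur_const * I\<close>. By Cauchy-Schwarz
  \<open>I\<^sup>2\<close> is at most \<open>schur_const * I * (L2norm f)\<^sup>2\<close>, and one
  factor \<open>I\<close> cancels.\<close>

theorem square_function_bound:
  fixes f :: "'a \<Rightarrow> complex"
  assumes [measurable]: "f \<in> borel_measurable borel"
  shows "(\<integral>\<^sup>+z. ennreal ((cmod (pairing f (wav \<psi> z)))\<^sup>2) \<partial>hspace)
    \<le> ennreal schur_const * (\<integral>\<^sup>+x. ennreal ((cmod (f x))\<^sup>2) \<partial>lborel)"
proof (cases "f \<in> L2")
  case False
  then have "(\<integral>\<^sup>+x. ennreal ((cmod (f x))\<^sup>2) \<partial>lborel) = \<infinity>"
    using L2I[OF assms] by (metis infinity_ennreal_def less_top)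
  then show ?thesis using schur_const_pos by (simp add: ennreal_mult_top)
next
  case f: True
  interpret h: sigma_finite_measure "hspace :: ('a \<times> real) measure" by (rule sigma_finite_hspace)
  interpret hh: pair_sigma_finite "hspace :: ('a \<times> real) measure" "hspace :: ('a \<times> real) measure" ..
  let ?u = "\<lambda>z. pairing f (wav \<psi> z)"
  let ?n = "real DIM('a)"
  have [measurable]: "?u \<in> borel_measurable borel" by measurable
  have [measurable]: "(\<lambda>z. pairing (wav \<psi> (fst z)) (wav \<psi> (snd z))) \<in> borel_measurable (borel \<Otimes>\<^sub>M borel)"
    by measurable
  \<comment> \<open>Truncation makes \<open>I\<close> finite, which is necessary for cancelling it;
    the regions exhaust the half space by monotone convergence at the end.\<close>
  have region: "(\<integral>\<^sup>+z. ennreal ((cmod (?u z))\<^sup>2) * indicator (scale_region N) z \<partial>hspace) \<le> ennreal (schur_const * (L2norm f)\<^sup>2)"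
    if N: "1 \<le> N" for N
  proof -
    interpret superposition hspace "\<lambda>z. indicator (scale_region N) z" "wav \<psi>" "wav \<psi>"
      "N powr (?n + 1) * B" "N powr (?n + 1) * B" "N + N"
      by (rule superposition_wav[OF N])
    let ?K = "scale_region N :: ('a \<times> real) set"
    define G where "G = T (\<lambda>x. cnj (f x))"
    have cf: "(\<lambda>x. cnj (f x)) \<in> L2" by (rule L2_cnj[OF f])
    have G: "G \<in> L2" unfolding G_def by (rule T_L2[OF cf])
    \<comment> \<open>Wavelets are real valued, so conjugation passes through the pairing.\<close>
    have cu: "pairing (\<lambda>x. cnj (f x)) (wav \<psi> z) = cnj (?u z)" for z
      unfolding pairing_def by (subst Bochner_Integration.integral_cnj[symmetric]) (simp add: wav_def)
    define I where "I = (\<integral>z. (cmod (?u z))\<^sup>2 * indicator ?K z \<partial>hspace)"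
    have uI: "indicator ?K z * pairing (\<lambda>x. cnj (f x)) (wav \<psi> z) * pairing (wav \<psi> z) f
        = complex_of_real ((cmod (?u z))\<^sup>2 * indicator ?K z)" for z
      using complex_norm_square[of "?u z"]
      by (cases "z \<in> ?K") (simp_all add: cu pairing_commute[of "wav \<psi> z" f] mult.commute)
    have u_bound: "cmod (?u z) * indicator ?K z \<le> L2norm f * V * indicator ?K z" for z
      using coefficient_bound[OF f, of z] by (auto simp: indicator_def split: if_splits)
    have sq_int: "integrable hspace (\<lambda>z. (cmod (?u z))\<^sup>2 * indicator ?K z)"
    proof (rule Bochner_Integration.integrable_bound)
      show "integrable hspace (\<lambda>z. (L2norm f * V)\<^sup>2 * indicator ?K z)"
        using emeasure_scale_region_finite[OF N, where 'a='a] by simp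
      show "AE z in hspace. norm ((cmod (?u z))\<^sup>2 * indicator ?K z) \<le> norm ((L2norm f * V)\<^sup>2 * indicator ?K z)"
      proof (rule AE_I2)
        fix z show "norm ((cmod (?u z))\<^sup>2 * indicator ?K z) \<le> norm ((L2norm f * V)\<^sup>2 * indicator ?K z)"
          using u_bound[of z] by (cases "z \<in> ?K") (auto intro!: power_mono)
      qed
    qed measurable
    have I0: "0 \<le> I" unfolding I_def by (intro Bochner_Integration.integral_nonneg) auto
    have nnI: "(\<integral>\<^sup>+z. ennreal ((cmod (?u z))\<^sup>2 * indicator ?K z) \<partial>hspace) = ennreal I"
      unfolding I_def by (rule nn_integral_eq_integral[OF sq_int]) auto
    have pGf: "pairing G f = complex_of_real I"
      unfolding G_def pairing_T[OF cf f] uI I_def by (rule integral_complex_of_real)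
    have norm_G: "ennreal ((L2norm G)\<^sup>2) \<le> ennreal (schur_const * I)"
    proof -
      have GG: "ennreal ((L2norm G)\<^sup>2) = ennreal (cmod (pairing G (\<lambda>x. cnj (G x))))"
        using pairing_cnj_self[OF G] by (simp add: norm_power)
      have "ennreal (cmod (pairing G (\<lambda>x. cnj (G x))))
          \<le> (\<integral>\<^sup>+z. ennreal (cmod (?u z) * indicator ?K z) * ennreal (cmod (pairing G (wav \<psi> z))) \<partial>hspace)"
      proof -
        have 1: "pairing G (\<lambda>x. cnj (G x)) = (\<integral>z. indicator ?K z * cnj (?u z) * pairing (wav \<psi> z) (\<lambda>x. cnj (G x)) \<partial>hspace)"
          using pairing_T[OF cf L2_cnj[OF G]] by (simp add: G_def[symmetric] cu)
        have 2: "pairing (wav \<psi> z) (\<lambda>x. cnj (G x)) = cnj (pairing G (wav \<psi> z))" for z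
          unfolding pairing_def by (subst Bochner_Integration.integral_cnj[symmetric]) (simp add: wav_def mult.commute)
        show ?thesis unfolding 1 2
          by (rule order_trans[OF ennreal_norm_integral_le])
             (auto intro!: nn_integral_mono simp: norm_mult indicator_def ennreal_mult)
      qed
      also have "\<dots> \<le> (\<integral>\<^sup>+z. ennreal (cmod (?u z) * indicator ?K z)
          * (\<integral>\<^sup>+w. ennreal (cmod (?u w) * indicator ?K w) * ennreal (cmod (pairing (wav \<psi> z) (wav \<psi> w))) \<partial>hspace) \<partial>hspace)"
      proof (rule nn_integral_mono)
        fix z :: "'a \<times> real"
        show "ennreal (cmod (?u z) * indicator ?K z) * ennreal (cmod (pairing G (wav \<psi> z)))
          \<le> ennreal (cmod (?u z) * indicator ?K z)
            * (\<integral>\<^sup>+w. ennreal (cmod (?u w) * indicator ?K w) * ennreal (cmod (pairing (wav \<psi> z) (wav \<psi> w))) \<partial>hspace)"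
        proof (cases "z \<in> ?K")
          case True
          then have "pairing G (wav \<psi> z) = (\<integral>w. indicator ?K w * cnj (?u w) * pairing (wav \<psi> w) (wav \<psi> z) \<partial>hspace)"
            unfolding G_def using pairing_T[OF cf \<theta>_L2(1), of z] by (simp add: cu)
          then have "ennreal (cmod (pairing G (wav \<psi> z)))
              \<le> (\<integral>\<^sup>+w. ennreal (cmod (indicator ?K w * cnj (?u w) * pairing (wav \<psi> w) (wav \<psi> z))) \<partial>hspace)"
            using ennreal_norm_integral_le by metis
          also have "\<dots> = (\<integral>\<^sup>+w. ennreal (cmod (?u w) * indicator ?K w) * ennreal (cmod (pairing (wav \<psi> z) (wav \<psi> w))) \<partial>hspace)"
            by (intro nn_integral_cong) (auto simp: norm_mult indicator_def ennreal_mult pairing_commute[of "wav \<psi> z"])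
          finally show ?thesis by (intro mult_left_mono) auto
        qed simp
      qed
      also have "\<dots> = (\<integral>\<^sup>+z. \<integral>\<^sup>+w. ennreal (cmod (?u z) * indicator ?K z)
          * (ennreal (cmod (?u w) * indicator ?K w) * ennreal (cmod (pairing (wav \<psi> z) (wav \<psi> w)))) \<partial>hspace \<partial>hspace)"
        by (intro nn_integral_cong nn_integral_cmult[symmetric]) measurable
      also have "\<dots> \<le> (\<integral>\<^sup>+z. \<integral>\<^sup>+w. ennreal (1/2) *
            (ennreal ((cmod (?u z))\<^sup>2 * indicator ?K z * snd z powr (- ?n/2)) * ennreal (cmod (pairing (wav \<psi> z) (wav \<psi> w)) * snd w powr (?n/2))
           + ennreal ((cmod (?u w))\<^sup>2 * indicator ?K w * snd w powr (- ?n/2)) * ennreal (cmod (pairing (wav \<psi> w) (wav \<psi> z)) * snd z powr (?n/2))) \<partial>hspace \<partial>hspace)"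
      proof (intro nn_integral_mono, goal_cases)
        case (1 z w)
        show ?case
        proof (cases "z \<in> ?K \<and> w \<in> ?K")
          case True
          have "0 < 1 / N" using N by simp
          then have pos: "0 < snd z" "0 < snd w"
            using True unfolding scale_region_def by (metis (mono_tags) less_le_trans mem_Collect_eq)+
          define p where "p = snd z powr (?n/2)"
          define q where "q = snd w powr (?n/2)"
          define k where "k = cmod (pairing (wav \<psi> z) (wav \<psi> w))"
          define a where "a = cmod (?u z)"
          define b where "b = cmod (?u w)"
          have pq: "0 < p" "0 < q" using pos by (auto simp: p_def q_def)
          have k: "0 \<le> k" "0 \<le> a" "0 \<le> b" by (auto simp: k_def a_def b_def)
          \<comment> \<open>Young's inequality with the Schur weights: each square is multiplied by
            the ratio that lets \<open>schur_bound\<close> integrate out the other variable.\<close>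
          have "a * b \<le> 1/2 * (a\<^sup>2 * (q / p) + b\<^sup>2 * (p / q))"
          proof -
            have "0 \<le> (a * q - b * p)\<^sup>2 / (2 * (p * q))" using pq by simp
            also have "\<dots> = 1/2 * (a\<^sup>2 * (q / p) + b\<^sup>2 * (p / q)) - a * b"
              using pq by (simp add: power2_eq_square field_simps)
            finally show ?thesis by simp
          qed
          then have "k * (a * b) \<le> k * (1/2 * (a\<^sup>2 * (q / p) + b\<^sup>2 * (p / q)))"
            using k by (intro mult_left_mono)
          then have "a * (b * k) \<le> 1/2 * (a\<^sup>2 * (1 / p) * (k * q) + b\<^sup>2 * (1 / q) * (k * p))"
            by (simp add: algebra_simps)
          then have "ennreal (a * (b * k)) \<le> ennreal (1/2 * (a\<^sup>2 * (1 / p) * (k * q) + b\<^sup>2 * (1 / q) * (k * p)))"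
            by (rule ennreal_leI)
          also have "\<dots> = ennreal (1/2) * (ennreal (a\<^sup>2 * (1 / p)) * ennreal (k * q) + ennreal (b\<^sup>2 * (1 / q)) * ennreal (k * p))"
            using pq k by (simp add: ennreal_mult ennreal_plus del: times_divide_eq_right times_divide_eq_left)
          finally show ?thesis
            using True pos k by (simp add: a_def b_def k_def p_def q_def powr_minus_divide pairing_commute[of "wav \<psi> w"] ennreal_mult[symmetric])
        qed (auto simp: indicator_def)
      qed
      also have "\<dots> = ennreal (1/2) * ((\<integral>\<^sup>+z. \<integral>\<^sup>+w. ennreal ((cmod (?u z))\<^sup>2 * indicator ?K z * snd z powr (- ?n/2)) * ennreal (cmod (pairing (wav \<psi> z) (wav \<psi> w)) * snd w powr (?n/2)) \<partial>hspace \<partial>hspace)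
           + (\<integral>\<^sup>+z. \<integral>\<^sup>+w. ennreal ((cmod (?u w))\<^sup>2 * indicator ?K w * snd w powr (- ?n/2)) * ennreal (cmod (pairing (wav \<psi> w) (wav \<psi> z)) * snd z powr (?n/2)) \<partial>hspace \<partial>hspace))"
        by (rule h.nn_integral_cmult_add_twice) measurable
      \<comment> \<open>With the names of \<open>z\<close> and \<open>w\<close> exchanged, Tonelli
        turns the second half into the first.\<close>
      also have "(\<integral>\<^sup>+z. \<integral>\<^sup>+w. ennreal ((cmod (?u w))\<^sup>2 * indicator ?K w * snd w powr (- ?n/2)) * ennreal (cmod (pairing (wav \<psi> w) (wav \<psi> z)) * snd z powr (?n/2)) \<partial>hspace \<partial>hspace)
         = (\<integral>\<^sup>+z. \<integral>\<^sup>+w. ennreal ((cmod (?u z))\<^sup>2 * indicator ?K z * snd z powr (- ?n/2)) * ennreal (cmod (pairing (wav \<psi> z) (wav \<psi> w)) * snd w powr (?n/2)) \<partial>hspace \<partial>hspace)"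
        by (rule hh.Fubini') measurable
      also have "(\<integral>\<^sup>+z. \<integral>\<^sup>+w. ennreal ((cmod (?u z))\<^sup>2 * indicator ?K z * snd z powr (- ?n/2)) * ennreal (cmod (pairing (wav \<psi> z) (wav \<psi> w)) * snd w powr (?n/2)) \<partial>hspace \<partial>hspace)
         \<le> (\<integral>\<^sup>+z. ennreal schur_const * ennreal ((cmod (?u z))\<^sup>2 * indicator ?K z) \<partial>hspace)"
      proof (rule nn_integral_mono_AE, use AE_hspace in eventually_elim)
        case (elim z)
        have "(\<integral>\<^sup>+w. ennreal ((cmod (?u z))\<^sup>2 * indicator ?K z * snd z powr (- ?n/2)) * ennreal (cmod (pairing (wav \<psi> z) (wav \<psi> w)) * snd w powr (?n/2)) \<partial>hspace)
           = ennreal ((cmod (?u z))\<^sup>2 * indicator ?K z * snd z powr (- ?n/2)) * (\<integral>\<^sup>+w. ennreal (cmod (pairing (wav \<psi> z) (wav \<psi> w)) * snd w powr (?n/2)) \<partial>hspace)"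
          by (rule nn_integral_cmult) measurable
        also have "\<dots> \<le> ennreal ((cmod (?u z))\<^sup>2 * indicator ?K z * snd z powr (- ?n/2)) * ennreal (schur_const * snd z powr (?n / 2))"
          using schur_bound[OF elim, of "fst z"] by (intro mult_left_mono) auto
        also have "\<dots> = ennreal schur_const * ennreal ((cmod (?u z))\<^sup>2 * indicator ?K z)"
          using elim schur_const_pos by (simp add: ennreal_mult[symmetric] powr_minus_divide)
        finally show ?case .
      qed
      also have "\<dots> = ennreal (schur_const * I)"
        using schur_const_pos I0 by (subst nn_integral_cmult, measurable) (simp only: nnI ennreal_mult[symmetric] less_imp_le)
      finally have "ennreal (cmod (pairing G (\<lambda>x. cnj (G x)))) \<le> ennreal (1/2) * (ennreal (schur_const * I) + ennreal (schur_const * I))"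
        by (simp add: add_mono mult_left_mono)
      also have "\<dots> = ennreal (schur_const * I)"
      proof -
        have "0 \<le> schur_const * I" using schur_const_pos I0 by simp
        then have "ennreal (1/2) * (ennreal (schur_const * I) + ennreal (schur_const * I)) = ennreal (1/2 * (schur_const * I + schur_const * I))"
          by (simp only: ennreal_plus[symmetric]) (rule ennreal_mult[symmetric], simp_all add: mult.commute)
        then show ?thesis by (simp add: mult.commute)
      qed
      finally show ?thesis unfolding GG .
    qed
    have "I \<le> L2norm G * L2norm f"
      using pairing_Cauchy_Schwarz[OF G f] I0 by (simp add: pGf)
    then have "I\<^sup>2 \<le> (L2norm G)\<^sup>2 * (L2norm f)\<^sup>2"
      using I0 by (metis power_mono power_mult_distrib)
    also have "\<dots> \<le> schur_const * I * (L2norm f)\<^sup>2"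
      using norm_G schur_const_pos I0 by (intro mult_right_mono) auto
    finally have "I * I \<le> (schur_const * (L2norm f)\<^sup>2) * I" by (simp add: power2_eq_square ac_simps)
    then have "I \<le> schur_const * (L2norm f)\<^sup>2"
      using I0 schur_const_pos by (cases "I = 0") auto
    moreover have "(\<integral>\<^sup>+z. ennreal ((cmod (?u z))\<^sup>2) * indicator ?K z \<partial>hspace) = ennreal I"
      unfolding nnI[symmetric] by (intro nn_integral_cong) (auto simp: indicator_def)
    ultimately show ?thesis by (simp add: ennreal_leI)
  qed
  let ?S = "\<lambda>k z. ennreal ((cmod (?u z))\<^sup>2) * indicator (scale_region (real (Suc k))) z"
  have "(\<integral>\<^sup>+z. ennreal ((cmod (?u z))\<^sup>2) \<partial>hspace) = (\<integral>\<^sup>+z. (SUP k. ?S k z) \<partial>hspace)"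
  proof (rule nn_integral_cong_AE, use AE_hspace in eventually_elim)
    case (elim z)
    obtain k :: nat where k: "max (norm (fst z)) (max (snd z) (1 / snd z)) < real k"
      using reals_Archimedean2 by blast
    then have "1 / real (Suc k) \<le> snd z" using elim by (simp add: field_simps)
    with k have "z \<in> scale_region (real (Suc k))" by (auto simp: scale_region_def)
    then have "ennreal ((cmod (?u z))\<^sup>2) \<le> (SUP k. ?S k z)"
      by (intro SUP_upper2[of k]) auto
    moreover have "(SUP k. ?S k z) \<le> ennreal ((cmod (?u z))\<^sup>2)"
      by (intro SUP_least) (auto simp: indicator_def)
    ultimately show ?case by (rule antisym)
  qed
  also have "\<dots> = (SUP k. \<integral>\<^sup>+z. ?S k z \<partial>hspace)"
  proof (rule nn_integral_monotone_convergence_SUP)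
    show "incseq ?S"
    proof (intro incseq_SucI le_funI)
      fix k z
      have "scale_region (real (Suc k)) \<subseteq> (scale_region (real (Suc (Suc k))) :: ('a \<times> real) set)"
        using frac_le[of 1 1 "real (Suc k)" "real (Suc (Suc k))"]
        unfolding scale_region_def by (auto intro: order_trans simp del: of_nat_Suc) 
      then show "?S k z \<le> ?S (Suc k) z" by (intro mult_left_mono) (auto simp: indicator_def)
    qed
  qed measurable
  also have "\<dots> \<le> ennreal (schur_const * (L2norm f)\<^sup>2)"
    by (intro SUP_least region) auto
  also have "\<dots> = ennreal schur_const * (\<integral>\<^sup>+x. ennreal ((cmod (f x))\<^sup>2) \<partial>lborel)"
    using schur_const_pos by (simp add: nn_integral_L2[OF f] ennreal_mult)
  finally show ?thesis .
qed

end

section \<open>Carleson measures and duality\<close>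

lemma nn_integral_lborel_pair:
  fixes F :: "'a::euclidean_space \<times> 'b::euclidean_space \<Rightarrow> ennreal"
  assumes "F \<in> borel_measurable borel"
  shows "(\<integral>\<^sup>+p. F p \<partial>lborel) = (\<integral>\<^sup>+x. \<integral>\<^sup>+y. F (x, y) \<partial>lborel \<partial>lborel)"
    and "(\<integral>\<^sup>+p. F p \<partial>lborel) = (\<integral>\<^sup>+y. \<integral>\<^sup>+x. F (x, y) \<partial>lborel \<partial>lborel)"
proof -
  have F: "F \<in> borel_measurable (lborel \<Otimes>\<^sub>M lborel)" using assms by (simp add: lborel_prod)
  show "(\<integral>\<^sup>+p. F p \<partial>lborel) = (\<integral>\<^sup>+x. \<integral>\<^sup>+y. F (x, y) \<partial>lborel \<partial>lborel)"
    using lborel.nn_integral_fst[OF F] by (simp add: lborel_prod)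
  show "(\<integral>\<^sup>+p. F p \<partial>lborel) = (\<integral>\<^sup>+y. \<integral>\<^sup>+x. F (x, y) \<partial>lborel \<partial>lborel)"
    using lborel_pair.nn_integral_snd[OF F] by (simp add: lborel_prod)
qed

lemma borel_measurable_Pair_borel [measurable (raw)]:
  fixes f :: "'z \<Rightarrow> 'a::second_countable_topology" and g :: "'z \<Rightarrow> 'b::second_countable_topology"
  assumes [measurable]: "f \<in> borel_measurable M" "g \<in> borel_measurable M"
  shows "(\<lambda>z. (f z, g z)) \<in> M \<rightarrow>\<^sub>M borel"
  by (simp add: borel_prod[symmetric])

text \<open>Iterating the maximal function dominates the averages over all rectangles, by
  \<open>nn_integral_rectangle_le_strong\<close>, and inherits an \<open>L2\<close> bound from the
  one-parameter case by Tonelli. This avoids a covering argument for rectangles of arbitrary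
  eccentricity.\<close>

definition strong :: "('a::euclidean_space \<times> 'b::euclidean_space \<Rightarrow> ennreal) \<Rightarrow> 'a \<times> 'b \<Rightarrow> ennreal" where
  "strong F p = HL (\<lambda>y1. HL (\<lambda>y2. F (y1, y2)) (snd p)) (fst p)"

lemma strong_measurable [measurable]:
  assumes [measurable]: "F \<in> borel_measurable borel"
  shows "strong F \<in> borel_measurable borel"
  unfolding strong_def[abs_def] by measurable

lemma strong_L2_bound:
  fixes F :: "'a::euclidean_space \<times> 'b::euclidean_space \<Rightarrow> ennreal"
  assumes [measurable]: "F \<in> borel_measurable borel"
  shows "(\<integral>\<^sup>+p. (strong F p)\<^sup>2 \<partial>lborel)
    \<le> ennreal (HL_const TYPE('a) * HL_const TYPE('b)) * (\<integral>\<^sup>+p. (F p)\<^sup>2 \<partial>lborel)"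
proof -
  let ?H = "\<lambda>y1 x2. HL (\<lambda>y2. F (y1, y2)) x2"
  have "(\<integral>\<^sup>+p. (strong F p)\<^sup>2 \<partial>lborel) = (\<integral>\<^sup>+x2. \<integral>\<^sup>+x1. (HL (\<lambda>y1. ?H y1 x2) x1)\<^sup>2 \<partial>lborel \<partial>lborel)"
    by (subst nn_integral_lborel_pair(2)) (auto simp: strong_def)
  also have "\<dots> \<le> (\<integral>\<^sup>+x2. ennreal (HL_const TYPE('a)) * (\<integral>\<^sup>+y1. (?H y1 x2)\<^sup>2 \<partial>lborel) \<partial>lborel)"
    by (intro nn_integral_mono HL_L2_bound) measurable
  also have "\<dots> = ennreal (HL_const TYPE('a)) * (\<integral>\<^sup>+x2. \<integral>\<^sup>+y1. (?H y1 x2)\<^sup>2 \<partial>lborel \<partial>lborel)"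
    by (rule nn_integral_cmult) measurable
  also have "(\<integral>\<^sup>+x2. \<integral>\<^sup>+y1. (?H y1 x2)\<^sup>2 \<partial>lborel \<partial>lborel) = (\<integral>\<^sup>+y1. \<integral>\<^sup>+x2. (?H y1 x2)\<^sup>2 \<partial>lborel \<partial>lborel)"
    by (rule lborel_pair.Fubini') measurable
  also have "\<dots> \<le> (\<integral>\<^sup>+y1. ennreal (HL_const TYPE('b)) * (\<integral>\<^sup>+y2. (F (y1, y2))\<^sup>2 \<partial>lborel) \<partial>lborel)"
    by (intro nn_integral_mono HL_L2_bound) measurable
  also have "\<dots> = ennreal (HL_const TYPE('b)) * (\<integral>\<^sup>+y1. \<integral>\<^sup>+y2. (F (y1, y2))\<^sup>2 \<partial>lborel \<partial>lborel)"
    by (rule nn_integral_cmult) measurable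
  also have "(\<integral>\<^sup>+y1. \<integral>\<^sup>+y2. (F (y1, y2))\<^sup>2 \<partial>lborel \<partial>lborel) = (\<integral>\<^sup>+p. (F p)\<^sup>2 \<partial>lborel)"
    by (rule nn_integral_lborel_pair(1)[symmetric]) measurable
  finally show ?thesis by (simp add: mult_left_mono ennreal_mult mult.assoc)
qed

lemma indicator_rectangle:
  "(indicator (A \<times> B) p :: ennreal) = indicator A (fst p) * indicator B (snd p)"
  by (cases p) (simp add: indicator_times)

lemma nn_integral_rectangle_le_strong:
  fixes F :: "'a::euclidean_space \<times> 'b::euclidean_space \<Rightarrow> ennreal"
  assumes [measurable]: "F \<in> borel_measurable borel"
    and s: "0 < s1" "0 < s2" and y: "dist x1 y1 < s1" "dist x2 y2 < s2"
  shows "(\<integral>\<^sup>+p. F p * indicator (ball x1 s1 \<times> ball x2 s2) p \<partial>lborel)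
    \<le> ennreal ((4 * s1) ^ DIM('a) * (4 * s2) ^ DIM('b)) * strong F (y1, y2)"
proof -
  have "(\<integral>\<^sup>+p. F p * indicator (ball x1 s1 \<times> ball x2 s2) p \<partial>lborel)
      = (\<integral>\<^sup>+u1. \<integral>\<^sup>+u2. F (u1, u2) * indicator (ball x2 s2) u2 * indicator (ball x1 s1) u1 \<partial>lborel \<partial>lborel)"
    unfolding indicator_rectangle by (subst nn_integral_lborel_pair(1)) (auto simp: ac_simps)
  also have "\<dots> = (\<integral>\<^sup>+u1. (\<integral>\<^sup>+u2. F (u1, u2) * indicator (ball x2 s2) u2 \<partial>lborel) * indicator (ball x1 s1) u1 \<partial>lborel)"
    by (intro nn_integral_cong nn_integral_multc) measurable
  also have "\<dots> \<le> (\<integral>\<^sup>+u1. ennreal ((4 * s2) ^ DIM('b)) * (HL (\<lambda>u2. F (u1, u2)) y2 * indicator (ball x1 s1) u1) \<partial>lborel)"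
    unfolding mult.assoc[symmetric]
    by (intro nn_integral_mono mult_right_mono nn_integral_ball_le_HL s y) auto
  also have "\<dots> = ennreal ((4 * s2) ^ DIM('b)) * (\<integral>\<^sup>+u1. HL (\<lambda>u2. F (u1, u2)) y2 * indicator (ball x1 s1) u1 \<partial>lborel)"
    by (rule nn_integral_cmult) measurable
  also have "\<dots> \<le> ennreal ((4 * s2) ^ DIM('b)) * (ennreal ((4 * s1) ^ DIM('a)) * HL (\<lambda>u1. HL (\<lambda>u2. F (u1, u2)) y2) y1)"
    by (intro mult_left_mono nn_integral_ball_le_HL s y) auto
  also have "\<dots> = ennreal ((4 * s1) ^ DIM('a) * (4 * s2) ^ DIM('b)) * strong F (y1, y2)"
    using s by (simp add: strong_def ennreal_mult ac_simps)
  finally show ?thesis .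
qed

section \<open>Rectangles and tents over the product of two half spaces\<close>

lemma sets_zmeasure [measurable_cong, simp]:
  "sets (zmeasure :: (('a::euclidean_space \<times> real) \<times> ('b::euclidean_space \<times> real)) measure) = sets (borel \<Otimes>\<^sub>M borel)"
  unfolding zmeasure_def by (rule sets_pair_measure_cong) simp_all

lemma space_zmeasure [simp]:
  "space (zmeasure :: (('a::euclidean_space \<times> real) \<times> ('b::euclidean_space \<times> real)) measure) = UNIV"
  by (simp add: zmeasure_def space_pair_measure)

lemma pair_sigma_finite_hspace:
  "pair_sigma_finite (hspace :: ('a::euclidean_space \<times> real) measure) (hspace :: ('b::euclidean_space \<times> real) measure)"
  by (simp add: pair_sigma_finite_def sigma_finite_hspace)

lemma sigma_finite_zmeasure:
  "sigma_finite_measure (zmeasure :: (('a::euclidean_space \<times> real) \<times> ('b::euclidean_space \<times> real)) measure)"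
proof -
  interpret pair_sigma_finite "hspace :: ('a \<times> real) measure" "hspace :: ('b \<times> real) measure"
    by (rule pair_sigma_finite_hspace)
  show ?thesis unfolding zmeasure_def by (rule P.sigma_finite_measure_axioms)
qed

lemma nn_integral_zmeasure:
  fixes F :: "('a::euclidean_space \<times> real) \<times> ('b::euclidean_space \<times> real) \<Rightarrow> ennreal"
  assumes "F \<in> borel_measurable (borel \<Otimes>\<^sub>M borel)"
  shows "(\<integral>\<^sup>+z. F z \<partial>zmeasure) = (\<integral>\<^sup>+z1. \<integral>\<^sup>+z2. F (z1, z2) \<partial>hspace \<partial>hspace)"
    and "(\<integral>\<^sup>+z. F z \<partial>zmeasure) = (\<integral>\<^sup>+z2. \<integral>\<^sup>+z1. F (z1, z2) \<partial>hspace \<partial>hspace)"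
proof -
  interpret pair_sigma_finite "hspace :: ('a \<times> real) measure" "hspace :: ('b \<times> real) measure"
    by (rule pair_sigma_finite_hspace)
  have F: "F \<in> borel_measurable (hspace \<Otimes>\<^sub>M hspace)" using assms by measurable
  show "(\<integral>\<^sup>+z. F z \<partial>zmeasure) = (\<integral>\<^sup>+z1. \<integral>\<^sup>+z2. F (z1, z2) \<partial>hspace \<partial>hspace)"
    unfolding zmeasure_def by (rule M2.nn_integral_fst[OF F, symmetric])
  show "(\<integral>\<^sup>+z. F z \<partial>zmeasure) = (\<integral>\<^sup>+z2. \<integral>\<^sup>+z1. F (z1, z2) \<partial>hspace \<partial>hspace)"
    unfolding zmeasure_def by (rule nn_integral_snd[OF F, symmetric])
qed

lemma AE_zmeasure:
  "AE z in (zmeasure :: (('a::euclidean_space \<times> real) \<times> ('b::euclidean_space \<times> real)) measure).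
     0 < snd (fst z) \<and> 0 < snd (snd z)"
proof -
  interpret pair_sigma_finite "hspace :: ('a \<times> real) measure" "hspace :: ('b \<times> real) measure"
    by (rule pair_sigma_finite_hspace)
  have "AE z1 in (hspace :: ('a \<times> real) measure). AE z2 in (hspace :: ('b \<times> real) measure). 0 < snd z1 \<and> 0 < snd z2"
    using AE_hspace
  proof eventually_elim
    case (elim z1)
    show ?case using AE_hspace elim by auto
  qed
  then show ?thesis
    unfolding zmeasure_def
  proof (intro AE_pair_measure)
    have s: "snd \<in> borel_measurable (hspace :: ('a \<times> real) measure)" "snd \<in> borel_measurable (hspace :: ('b \<times> real) measure)"
      using borel_measurable_snd by (simp_all cong: measurable_cong_sets)
    have [measurable]: "(\<lambda>z. snd (fst z)) \<in> borel_measurable ((hspace :: ('a \<times> real) measure) \<Otimes>\<^sub>M (hspace :: ('b \<times> real) measure))"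
        "(\<lambda>z. snd (snd z)) \<in> borel_measurable ((hspace :: ('a \<times> real) measure) \<Otimes>\<^sub>M (hspace :: ('b \<times> real) measure))"
      by (rule measurable_compose[OF measurable_fst s(1)], rule measurable_compose[OF measurable_snd s(2)])
    show "{z \<in> space ((hspace :: ('a \<times> real) measure) \<Otimes>\<^sub>M (hspace :: ('b \<times> real) measure)). 0 < snd (fst z) \<and> 0 < snd (snd z)}
        \<in> sets (hspace \<Otimes>\<^sub>M hspace)"
      by (intro sets.sets_Collect borel_measurable_less) auto
  qed simp
qed

definition rect :: "('a::euclidean_space \<times> real) \<times> ('b::euclidean_space \<times> real) \<Rightarrow> ('a \<times> 'b) set" where
  "rect z = ball (fst (fst z)) (snd (fst z)) \<times> ball (fst (snd z)) (snd (snd z))"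

text \<open>The volume of \<open>rect z\<close> up to the volumes of the unit balls, which
  \<open>emeasure_rect\<close> restores; it matches the normalisation of \<open>HL\<close>.\<close>

definition vol :: "('a::euclidean_space \<times> real) \<times> ('b::euclidean_space \<times> real) \<Rightarrow> real" where
  "vol z = snd (fst z) ^ DIM('a) * snd (snd z) ^ DIM('b)"

lemma vol_pos: "0 < snd (fst z) \<Longrightarrow> 0 < snd (snd z) \<Longrightarrow> 0 < vol z"
  by (simp add: vol_def)

lemma tent_eq: "tent \<Omega> = {z. 0 < snd (fst z) \<and> 0 < snd (snd z) \<and> rect z \<subseteq> \<Omega>}"
  by (auto simp: tent_def rect_def)

lemma open_rect: "open (rect z)"
  by (simp add: rect_def open_Times)

lemma sets_rect [measurable]: "rect z \<in> sets borel"
  by (rule borel_open[OF open_rect])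

lemma indicator_rect_measurable [measurable (raw)]:
  fixes g :: "'z \<Rightarrow> ('a::euclidean_space \<times> real) \<times> ('b::euclidean_space \<times> real)"
  assumes [measurable]: "g \<in> M \<rightarrow>\<^sub>M borel \<Otimes>\<^sub>M borel" "h \<in> borel_measurable M"
  shows "(\<lambda>u. indicator (rect (g u)) (h u) :: ennreal) \<in> borel_measurable M"
  unfolding rect_def indicator_rectangle by measurable

lemma vol_measurable [measurable]: "vol \<in> borel_measurable (borel \<Otimes>\<^sub>M borel)"
  unfolding vol_def[abs_def] by measurable

lemma emeasure_rect:
  fixes z :: "('a::euclidean_space \<times> real) \<times> ('b::euclidean_space \<times> real)"
  assumes "0 < snd (fst z)" "0 < snd (snd z)"
  shows "emeasure lborel (rect z)
    = ennreal (vol z * (measure lborel (ball (0::'a) 1) * measure lborel (ball (0::'b) 1)))"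
proof -
  have "emeasure lborel (rect z) = emeasure (lborel \<Otimes>\<^sub>M lborel) (ball (fst (fst z)) (snd (fst z)) \<times> ball (fst (snd z)) (snd (snd z)))"
    by (simp add: rect_def lborel_prod)
  also have "\<dots> = emeasure lborel (ball (fst (fst z)) (snd (fst z))) * emeasure lborel (ball (fst (snd z)) (snd (snd z)))"
    by (rule lborel.emeasure_pair_measure_Times) auto
  also have "\<dots> = ennreal (vol z * (measure lborel (ball (0::'a) 1) * measure lborel (ball (0::'b) 1)))"
    using assms by (simp add: emeasure_lborel_ball ennreal_mult[symmetric] vol_def ac_simps)
  finally show ?thesis .
qed

text \<open>Extended nonnegative values admit no cancellation, so instead of expanding a square
  \<open>v\<close> is compared with \<open>ennreal r * u\<close>; in either case one of the two
  summands alone dominates.\<close>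

lemma ennreal_young:
  fixes u v :: ennreal
  assumes "0 < r"
  shows "u * v \<le> ennreal r * u\<^sup>2 + ennreal (1 / r) * v\<^sup>2"
proof (cases "v \<le> ennreal r * u")
  case True
  then have "u * v \<le> u * (ennreal r * u)" by (intro mult_left_mono) auto
  then show ?thesis by (simp add: power2_eq_square ac_simps add_increasing2)
next
  case False
  then have "ennreal (1 / r) * (ennreal r * u) \<le> ennreal (1 / r) * v" by (intro mult_left_mono) auto
  then have "u \<le> ennreal (1 / r) * v"
    using assms by (simp add: mult.assoc[symmetric] ennreal_mult[symmetric])
  then have "u * v \<le> ennreal (1 / r) * v * v" by (intro mult_right_mono) auto
  then show ?thesis by (simp add: power2_eq_square ac_simps add_increasing)
qed

text \<open>The Carleson condition for the square of an arbitrary nonnegative function, so that it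
  covers differences and cut-offs of coefficients too. Written with a product instead of a quotient
  it includes open sets of measure 0.\<close>

definition carleson_bound :: "(('a::euclidean_space \<times> real) \<times> ('b::euclidean_space \<times> real) \<Rightarrow> ennreal) \<Rightarrow> real \<Rightarrow> bool" where
  "carleson_bound c A \<longleftrightarrow> (\<forall>\<Omega>::('a \<times> 'b) set. open \<Omega> \<longrightarrow> emeasure lborel \<Omega> < \<infinity> \<longrightarrow>
     (\<integral>\<^sup>+z. (c z)\<^sup>2 * indicator (tent \<Omega>) z \<partial>zmeasure) \<le> ennreal A * emeasure lborel \<Omega>)"

text \<open>The square of the factor lost in passing from an average to \<open>strong\<close>, times
  the bound of \<open>strong\<close> on \<open>L2\<close>.\<close>

definition embedding_const :: "'a::euclidean_space itself \<Rightarrow> 'b::euclidean_space itself \<Rightarrow> real" where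
  "embedding_const _ _ = (4 ^ DIM('a) * 4 ^ DIM('b))\<^sup>2 * (HL_const TYPE('a) * HL_const TYPE('b))"

lemma embedding_const_nonneg [simp]: "0 \<le> embedding_const a b"
  by (simp add: embedding_const_def)

text \<open>The averages of \<open>q\<close> over the rectangle of \<open>z\<close> are dominated on that rectangle by the strong
  maximal function, so that the superlevel sets of the average lie in tents over small open sets.\<close>
lemma carleson_embedding:
  fixes c :: "('a::euclidean_space \<times> real) \<times> ('b::euclidean_space \<times> real) \<Rightarrow> ennreal"
  assumes [measurable]: "c \<in> borel_measurable (borel \<Otimes>\<^sub>M borel)" "q \<in> borel_measurable borel"
    and A: "0 \<le> A" and c: "carleson_bound c A" and q: "(\<integral>\<^sup>+p. (q p)\<^sup>2 \<partial>lborel) < \<infinity>"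
  shows "(\<integral>\<^sup>+z. (c z)\<^sup>2 * (ennreal (1 / vol z) * (\<integral>\<^sup>+p. q p * indicator (rect z) p \<partial>lborel))\<^sup>2 \<partial>zmeasure)
    \<le> ennreal (A * embedding_const TYPE('a) TYPE('b)) * (\<integral>\<^sup>+p. (q p)\<^sup>2 \<partial>lborel)"
proof -
  interpret zm: sigma_finite_measure "zmeasure :: (('a \<times> real) \<times> ('b \<times> real)) measure"
    by (rule sigma_finite_zmeasure)
  interpret zl: pair_sigma_finite "zmeasure :: (('a \<times> real) \<times> ('b \<times> real)) measure" "lborel :: real measure" ..
  define a where "a z = ennreal (1 / vol z) * (\<integral>\<^sup>+p. q p * indicator (rect z) p \<partial>lborel)"
    for z :: "('a \<times> real) \<times> ('b \<times> real)"
  have [measurable]: "a \<in> borel_measurable (borel \<Otimes>\<^sub>M borel)"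
    unfolding a_def[abs_def] by measurable
  define k where "k = (4::real) ^ DIM('a) * 4 ^ DIM('b)"
  have k: "0 \<le> k" by (simp add: k_def)
  let ?M = "\<lambda>p. (ennreal k * strong q p)\<^sup>2"
  have a_le: "a z \<le> ennreal k * strong q p" if "0 < snd (fst z)" "0 < snd (snd z)" "p \<in> rect z" for z p
  proof -
    have "a z \<le> ennreal (1 / vol z) * (ennreal ((4 * snd (fst z)) ^ DIM('a) * (4 * snd (snd z)) ^ DIM('b)) * strong q p)"
      unfolding a_def rect_def using that
        nn_integral_rectangle_le_strong[of q "snd (fst z)" "snd (snd z)" "fst (fst z)" "fst p" "fst (snd z)" "snd p"]
      by (intro mult_left_mono) (auto simp: rect_def)
    also have "\<dots> = ennreal k * strong q p"
      using that vol_pos[of z] by (simp add: mult.assoc[symmetric] ennreal_mult[symmetric] k_def vol_def power_mult_distrib)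
    finally show ?thesis .
  qed
  have M_le: "(\<integral>\<^sup>+p. ?M p \<partial>lborel) \<le> ennreal (embedding_const TYPE('a) TYPE('b)) * (\<integral>\<^sup>+p. (q p)\<^sup>2 \<partial>lborel)"
  proof -
    have "(\<integral>\<^sup>+p. ?M p \<partial>lborel) = ennreal (k\<^sup>2) * (\<integral>\<^sup>+p. (strong q p)\<^sup>2 \<partial>lborel)"
      using k by (simp add: power_mult_distrib ennreal_power nn_integral_cmult)
    also have "\<dots> \<le> ennreal (k\<^sup>2) * (ennreal (HL_const TYPE('a) * HL_const TYPE('b)) * (\<integral>\<^sup>+p. (q p)\<^sup>2 \<partial>lborel))"
      by (intro mult_left_mono strong_L2_bound) auto
    also have "\<dots> = ennreal (embedding_const TYPE('a) TYPE('b)) * (\<integral>\<^sup>+p. (q p)\<^sup>2 \<partial>lborel)"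
      by (simp add: mult.assoc[symmetric] ennreal_mult[symmetric] embedding_const_def k_def)
    finally show ?thesis .
  qed
  have level: "(\<integral>\<^sup>+z. (c z)\<^sup>2 * indicator {z. ennreal l < (a z)\<^sup>2} z \<partial>zmeasure)
      \<le> ennreal A * emeasure lborel {p. ennreal l < ?M p}" if l: "0 < l" for l
  proof -
    \<comment> \<open>As a union of open rectangles \<open>W\<close> is admissible in the Carleson
      condition, and by \<open>a_le\<close> it stays inside the superlevel set of the maximal
      function.\<close>
    define W where "W = (\<Union>z\<in>{z. 0 < snd (fst z) \<and> 0 < snd (snd z) \<and> ennreal l < (a z)\<^sup>2}. rect z)"
    have "open W" unfolding W_def by (intro open_UN ballI open_rect)
    have W_sub: "W \<subseteq> {p. ennreal l < ?M p}"
    proof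
      fix p assume "p \<in> W"
      then obtain z where z: "0 < snd (fst z)" "0 < snd (snd z)" "ennreal l < (a z)\<^sup>2" "p \<in> rect z"
        by (auto simp: W_def)
      have "(a z)\<^sup>2 \<le> ?M p" using a_le[OF z(1,2,4)] by (intro power_mono) auto
      then show "p \<in> {p. ennreal l < ?M p}" using z(3) by auto
    qed
    \<comment> \<open>Chebyshev: the Carleson condition is available for open sets of finite
      measure, and square integrability of \<open>q\<close> provides this.\<close>
    have "emeasure lborel {p. ennreal l < ?M p} \<le> ennreal (1 / l) * (\<integral>\<^sup>+p. ?M p \<partial>lborel)"
    proof -
      have "emeasure lborel {p. ennreal l < ?M p} = (\<integral>\<^sup>+p. indicator {p. ennreal l < ?M p} p \<partial>lborel)"
        by (rule nn_integral_indicator[symmetric]) measurable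
      also have "\<dots> \<le> (\<integral>\<^sup>+p. ennreal (1 / l) * ?M p \<partial>lborel)"
      proof (rule nn_integral_mono)
        fix p show "indicator {p. ennreal l < ?M p} p \<le> ennreal (1 / l) * ?M p"
        proof (cases "ennreal l < ?M p")
          case True
          have "1 = ennreal (1 / l) * ennreal l" using l by (simp add: ennreal_mult[symmetric])
          also have "\<dots> \<le> ennreal (1 / l) * ?M p" using True by (intro mult_left_mono) auto
          finally show ?thesis using True by simp
        qed simp
      qed
      also have "\<dots> = ennreal (1 / l) * (\<integral>\<^sup>+p. ?M p \<partial>lborel)" by (rule nn_integral_cmult) measurable
      finally show ?thesis .
    qed
    also have "\<dots> < \<infinity>"
      using M_le q by (simp add: ennreal_mult_less_top) (metis (no_types, lifting) ennreal_less_top ennreal_mult_less_top order_le_less_trans)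
    finally have fin: "emeasure lborel {p. ennreal l < ?M p} < \<infinity>" .
    have W_le: "emeasure lborel W \<le> emeasure lborel {p. ennreal l < ?M p}"
      using W_sub by (intro emeasure_mono) measurable
    have "(\<integral>\<^sup>+z. (c z)\<^sup>2 * indicator {z. ennreal l < (a z)\<^sup>2} z \<partial>zmeasure) \<le> (\<integral>\<^sup>+z. (c z)\<^sup>2 * indicator (tent W) z \<partial>zmeasure)"
    proof (rule nn_integral_mono_AE, use AE_zmeasure in eventually_elim)
      case (elim z)
      have "z \<in> tent W" if "ennreal l < (a z)\<^sup>2"
        using elim that by (auto simp: tent_eq W_def)
      then show ?case by (intro mult_left_mono) (auto simp: indicator_def)
    qed
    also have "\<dots> \<le> ennreal A * emeasure lborel W"
      using c \<open>open W\<close> W_le fin unfolding carleson_bound_def by (meson order_le_less_trans)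
    also have "\<dots> \<le> ennreal A * emeasure lborel {p. ennreal l < ?M p}"
      by (intro mult_left_mono W_le) auto
    finally show ?thesis .
  qed
  \<comment> \<open>Layer cake in the levels of the squared average, then the same formula backwards
    for the maximal function.\<close>
  have "(\<integral>\<^sup>+z. (c z)\<^sup>2 * (a z)\<^sup>2 \<partial>zmeasure)
      = (\<integral>\<^sup>+z. \<integral>\<^sup>+l. (c z)\<^sup>2 * indicator {l. 0 < l \<and> ennreal l < (a z)\<^sup>2} l \<partial>lborel \<partial>zmeasure)"
    by (intro nn_integral_cong, subst nn_integral_cmult) (auto simp: nn_integral_positive_reals_less)
  also have "\<dots> = (\<integral>\<^sup>+l. \<integral>\<^sup>+z. (c z)\<^sup>2 * indicator {l. 0 < l \<and> ennreal l < (a z)\<^sup>2} l \<partial>zmeasure \<partial>lborel)"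
    by (rule zl.Fubini'[symmetric]) (simp add: indicator_def)
  also have "\<dots> \<le> (\<integral>\<^sup>+l. \<integral>\<^sup>+p. ennreal A * indicator {l. 0 < l \<and> ennreal l < ?M p} l \<partial>lborel \<partial>lborel)"
  proof (rule nn_integral_mono)
    fix l :: real
    show "(\<integral>\<^sup>+z. (c z)\<^sup>2 * indicator {l. 0 < l \<and> ennreal l < (a z)\<^sup>2} l \<partial>zmeasure)
        \<le> (\<integral>\<^sup>+p. ennreal A * indicator {l. 0 < l \<and> ennreal l < ?M p} l \<partial>lborel)"
    proof (cases "0 < l")
      case True
      have "(\<integral>\<^sup>+z. (c z)\<^sup>2 * indicator {l. 0 < l \<and> ennreal l < (a z)\<^sup>2} l \<partial>zmeasure)
          = (\<integral>\<^sup>+z. (c z)\<^sup>2 * indicator {z. ennreal l < (a z)\<^sup>2} z \<partial>zmeasure)"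
        using True by (intro nn_integral_cong) (auto simp: indicator_def)
      also have "\<dots> \<le> ennreal A * emeasure lborel {p. ennreal l < ?M p}" by (rule level[OF True])
      also have "\<dots> = (\<integral>\<^sup>+p. ennreal A * indicator {p. ennreal l < ?M p} p \<partial>lborel)"
        by (rule nn_integral_cmult_indicator[symmetric]) measurable
      also have "\<dots> = (\<integral>\<^sup>+p. ennreal A * indicator {l. 0 < l \<and> ennreal l < ?M p} l \<partial>lborel)"
        using True by (intro nn_integral_cong) (auto simp: indicator_def)
      finally show ?thesis .
    qed simp
  qed
  also have "\<dots> = (\<integral>\<^sup>+p. \<integral>\<^sup>+l. ennreal A * indicator {l. 0 < l \<and> ennreal l < ?M p} l \<partial>lborel \<partial>lborel)"
    by (rule lborel_pair.Fubini') (simp add: indicator_def)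
  also have "\<dots> = (\<integral>\<^sup>+p. ennreal A * ?M p \<partial>lborel)"
    by (intro nn_integral_cong, subst nn_integral_cmult) (auto simp: nn_integral_positive_reals_less)
  also have "\<dots> = ennreal A * (\<integral>\<^sup>+p. ?M p \<partial>lborel)"
    by (rule nn_integral_cmult) measurable
  also have "\<dots> \<le> ennreal A * (ennreal (embedding_const TYPE('a) TYPE('b)) * (\<integral>\<^sup>+p. (q p)\<^sup>2 \<partial>lborel))"
    by (intro mult_left_mono M_le) auto
  finally show ?thesis using A by (simp add: a_def ennreal_mult mult.assoc)
qed

text \<open>Jensen's inequality for \<open>x\<^sup>-\<^sup>2\<close>, by integrating the tangent line at the average.\<close>
lemma inverse_average_squared_le:
  fixes z :: "('a::euclidean_space \<times> real) \<times> ('b::euclidean_space \<times> real)" and q :: "'a \<times> 'b \<Rightarrow> real"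
  defines "w \<equiv> measure lborel (ball (0::'a) 1) * measure lborel (ball (0::'b) 1)"
  assumes [measurable]: "q \<in> borel_measurable borel"
    and q: "\<And>p. 0 < q p" and z: "0 < snd (fst z)" "0 < snd (snd z)"
    and a: "0 < a" and avg: "ennreal (1 / vol z) * (\<integral>\<^sup>+p. ennreal (q p) * indicator (rect z) p \<partial>lborel) = ennreal a"
  shows "ennreal (1 / a\<^sup>2) \<le> ennreal (1 / w ^ 3) * (ennreal (1 / vol z) * (\<integral>\<^sup>+p. ennreal (1 / (q p)\<^sup>2) * indicator (rect z) p \<partial>lborel))"
proof -
  have w: "0 < w" using unit_vol_pos[where 'a='a] unit_vol_pos[where 'a='b] by (simp add: w_def)
  note v = vol_pos[OF z]
  \<comment> \<open>\<open>a\<close> is normalised without the volumes \<open>w\<close> of the unit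
    balls; \<open>\<alpha>\<close> is the true average, at which the tangent is taken.\<close>
  define \<alpha> where "\<alpha> = a / w"
  have \<alpha>: "0 < \<alpha>" using a w by (simp add: \<alpha>_def)
  have tangent: "3 / \<alpha>\<^sup>2 \<le> 1 / x\<^sup>2 + 2 / \<alpha> ^ 3 * x" if "0 < x" for x :: real
  proof -
    have "1 / x\<^sup>2 + 2 / \<alpha> ^ 3 * x - 3 / \<alpha>\<^sup>2 = (\<alpha> - x)\<^sup>2 * (\<alpha> + 2 * x) / (x\<^sup>2 * \<alpha> ^ 3)"
      using that \<alpha> by (simp add: field_simps power2_eq_square power3_eq_cube)
    also have "\<dots> \<ge> 0" using that \<alpha> by simp
    finally show ?thesis by simp
  qed
  have int_q: "(\<integral>\<^sup>+p. ennreal (q p) * indicator (rect z) p \<partial>lborel) = ennreal (a * vol z)"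
  proof -
    have "ennreal (vol z) * (ennreal (1 / vol z) * (\<integral>\<^sup>+p. ennreal (q p) * indicator (rect z) p \<partial>lborel)) = ennreal (vol z) * ennreal a"
      using avg by simp
    then show ?thesis using v a by (simp add: mult.assoc[symmetric] ennreal_mult[symmetric] mult.commute)
  qed
  let ?J = "\<integral>\<^sup>+p. ennreal (1 / (q p)\<^sup>2) * indicator (rect z) p \<partial>lborel"
  have "ennreal (3 / \<alpha>\<^sup>2 * (vol z * w)) = (\<integral>\<^sup>+p. ennreal (3 / \<alpha>\<^sup>2) * indicator (rect z) p \<partial>lborel)"
    using v w by (subst nn_integral_cmult_indicator) (auto simp: emeasure_rect[OF z] w_def ennreal_mult[symmetric])
  also have "\<dots> \<le> (\<integral>\<^sup>+p. ennreal (1 / (q p)\<^sup>2) * indicator (rect z) p + ennreal (2 / \<alpha> ^ 3) * (ennreal (q p) * indicator (rect z) p) \<partial>lborel)"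
  proof (rule nn_integral_mono)
    fix p
    have "ennreal (3 / \<alpha>\<^sup>2) \<le> ennreal (1 / (q p)\<^sup>2 + 2 / \<alpha> ^ 3 * q p)"
      by (intro ennreal_leI tangent q)
    also have "\<dots> = ennreal (1 / (q p)\<^sup>2) + ennreal (2 / \<alpha> ^ 3) * ennreal (q p)"
      using q[of p] \<alpha> by (simp add: ennreal_mult[symmetric] less_imp_le flip: ennreal_plus)
    finally show "ennreal (3 / \<alpha>\<^sup>2) * indicator (rect z) p
        \<le> ennreal (1 / (q p)\<^sup>2) * indicator (rect z) p + ennreal (2 / \<alpha> ^ 3) * (ennreal (q p) * indicator (rect z) p)"
      by (auto simp: indicator_def)
  qed
  also have "\<dots> = ?J + (\<integral>\<^sup>+p. ennreal (2 / \<alpha> ^ 3) * (ennreal (q p) * indicator (rect z) p) \<partial>lborel)"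
    by (rule nn_integral_add) measurable
  also have "(\<integral>\<^sup>+p. ennreal (2 / \<alpha> ^ 3) * (ennreal (q p) * indicator (rect z) p) \<partial>lborel)
      = ennreal (2 / \<alpha> ^ 3) * (\<integral>\<^sup>+p. ennreal (q p) * indicator (rect z) p \<partial>lborel)"
    by (rule nn_integral_cmult) measurable
  also have "\<dots> = ennreal (2 / \<alpha>\<^sup>2 * (vol z * w))"
  proof -
    have "2 / \<alpha> ^ 3 * (a * vol z) = 2 / \<alpha>\<^sup>2 * (vol z * w)"
      using \<alpha> w a by (simp add: \<alpha>_def field_simps power2_eq_square power3_eq_cube)
    then show ?thesis unfolding int_q using \<alpha> a v by (subst ennreal_mult[symmetric]) auto
  qed
  finally have *: "ennreal (3 / \<alpha>\<^sup>2 * (vol z * w)) \<le> ?J + ennreal (2 / \<alpha>\<^sup>2 * (vol z * w))" .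
  \<comment> \<open>The linear term integrates to two of the three parts on the left; being finite,
    it can be cancelled.\<close>
  have J: "ennreal (1 / \<alpha>\<^sup>2 * (vol z * w)) \<le> ?J"
  proof -
    let ?y = "1 / \<alpha>\<^sup>2 * (vol z * w)"
    have y: "0 \<le> ?y" using v w by simp
    have "ennreal ?y + ennreal (2 * ?y) = ennreal (?y + 2 * ?y)"
      using y by (intro ennreal_plus[symmetric]) simp_all
    also have "\<dots> = ennreal (3 / \<alpha>\<^sup>2 * (vol z * w))" by (simp add: mult.commute)
    also note *
    finally have "ennreal ?y + ennreal (2 * ?y) \<le> ?J + ennreal (2 * ?y)" by simp
    then show ?thesis by (simp add: add.commute[of _ "ennreal (2 * ?y)"] ennreal_add_left_cancel_le)
  qed
  \<comment> \<open>Two powers of \<open>w\<close> come from \<open>\<alpha> = a / w\<close>, the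
    third from dividing by \<open>vol z\<close> and not by the full volume.\<close>
  have "1 / a\<^sup>2 = 1 / w ^ 3 * (1 / vol z * (1 / \<alpha>\<^sup>2 * (vol z * w)))"
    using w v a by (simp add: \<alpha>_def field_simps power2_eq_square power3_eq_cube)
  then have "ennreal (1 / a\<^sup>2) = ennreal (1 / w ^ 3) * (ennreal (1 / vol z) * ennreal (1 / \<alpha>\<^sup>2 * (vol z * w)))"
    using w v by (simp only:) (subst ennreal_mult[symmetric], simp, simp, subst ennreal_mult[symmetric], auto)
  also have "\<dots> \<le> ennreal (1 / w ^ 3) * (ennreal (1 / vol z) * ?J)"
    by (intro mult_left_mono J) auto
  finally show ?thesis .
qed

text \<open>The first summand is the cost of the Carleson embedding, the second that of Jensen's
  inequality.\<close>

definition duality_const :: "'a::euclidean_space itself \<Rightarrow> 'b::euclidean_space itself \<Rightarrow> real" where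
  "duality_const _ _ = embedding_const TYPE('a) TYPE('b)
     + 1 / (measure lborel (ball (0::'a) 1) * measure lborel (ball (0::'b) 1)) ^ 3"

lemma duality_const_nonneg: "0 \<le> duality_const a b"
  by (simp add: duality_const_def)

text \<open>Strict positivity and integrability of \<open>w\<close> make every average of its square
  root positive and finite, so that dividing by it is legitimate; \<open>carleson_duality\<close>
  removes the positivity.\<close>

lemma carleson_duality_positive:
  fixes c \<beta> :: "('a::euclidean_space \<times> real) \<times> ('b::euclidean_space \<times> real) \<Rightarrow> ennreal" and w :: "'a \<times> 'b \<Rightarrow> real"
  assumes [measurable]: "c \<in> borel_measurable (borel \<Otimes>\<^sub>M borel)" "\<beta> \<in> borel_measurable (borel \<Otimes>\<^sub>M borel)" "w \<in> borel_measurable borel"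
    and A: "0 < A" and c: "carleson_bound c A"
    and w: "\<And>p. 0 < w p" and fin: "(\<integral>\<^sup>+p. ennreal (w p) \<partial>lborel) < \<infinity>"
    and \<beta>: "AE p in lborel. (\<integral>\<^sup>+z. (\<beta> z)\<^sup>2 * ennreal (1 / vol z) * indicator (rect z) p \<partial>zmeasure) \<le> (ennreal (w p))\<^sup>2"
  shows "(\<integral>\<^sup>+z. c z * \<beta> z \<partial>zmeasure) \<le> ennreal (duality_const TYPE('a) TYPE('b) * sqrt A) * (\<integral>\<^sup>+p. ennreal (w p) \<partial>lborel)"
proof -
  interpret zm: sigma_finite_measure "zmeasure :: (('a \<times> real) \<times> ('b \<times> real)) measure"
    by (rule sigma_finite_zmeasure)
  interpret zl: pair_sigma_finite "zmeasure :: (('a \<times> real) \<times> ('b \<times> real)) measure" "lborel :: ('a \<times> 'b) measure" ..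
  define v where "v = measure lborel (ball (0::'a) 1) * measure lborel (ball (0::'b) 1)"
  have v: "0 < v" using unit_vol_pos[where 'a='a] unit_vol_pos[where 'a='b] by (simp add: v_def)
  define q where "q p = sqrt (w p)" for p
  have [measurable]: "q \<in> borel_measurable borel" unfolding q_def[abs_def] by measurable
  have q: "0 < q p" "(q p)\<^sup>2 = w p" for p using w[of p] by (auto simp: q_def)
  have q2: "(ennreal (q p))\<^sup>2 = ennreal (w p)" for p
    using q[of p] by (simp add: ennreal_power)
  define a where "a z = ennreal (1 / vol z) * (\<integral>\<^sup>+p. ennreal (q p) * indicator (rect z) p \<partial>lborel)"
    for z :: "('a \<times> real) \<times> ('b \<times> real)"
  have [measurable]: "a \<in> borel_measurable (borel \<Otimes>\<^sub>M borel)"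
    unfolding a_def[abs_def] by measurable
  have a_fin: "\<exists>r>0. a z = ennreal r" if z: "0 < snd (fst z)" "0 < snd (snd z)" for z
  proof -
    \<comment> \<open>The square root is at most \<open>1 + w\<close>, and both summands are
      integrable over a rectangle.\<close>
    have "(\<integral>\<^sup>+p. ennreal (q p) * indicator (rect z) p \<partial>lborel) \<le> (\<integral>\<^sup>+p. indicator (rect z) p + ennreal (w p) \<partial>lborel)"
    proof (rule nn_integral_mono)
      fix p
      have "q p \<le> 1 + w p"
        using q[of p] zero_le_power2[of "q p - 1"] by (simp add: power2_eq_square algebra_simps)
      then have "ennreal (q p) \<le> 1 + ennreal (w p)"
        using w[of p] by (metis ennreal_1 ennreal_leI ennreal_plus less_imp_le zero_le_one)
      then show "ennreal (q p) * indicator (rect z) p \<le> indicator (rect z) p + ennreal (w p)"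
        by (auto simp: indicator_def)
    qed
    also have "\<dots> = emeasure lborel (rect z) + (\<integral>\<^sup>+p. ennreal (w p) \<partial>lborel)"
      by (subst nn_integral_add) auto
    also have "\<dots> < \<infinity>" using fin by (simp add: emeasure_rect[OF z])
    finally have "a z < \<infinity>" by (simp add: a_def ennreal_mult_less_top)
    moreover have "a z \<noteq> 0"
    proof
      assume "a z = 0"
      then have "(\<integral>\<^sup>+p. ennreal (q p) * indicator (rect z) p \<partial>lborel) = 0"
        using vol_pos[OF z] by (simp add: a_def)
      then have "AE p in lborel. p \<notin> rect z"
        using q(1) by (subst (asm) nn_integral_0_iff_AE) (auto simp: indicator_def less_le)
      then have "emeasure lborel (rect z) = 0"
        by (subst (asm) AE_iff_measurable[of "rect z"]) auto
      then show False using vol_pos[OF z] v by (simp add: emeasure_rect[OF z] v_def[symmetric])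
    qed
    ultimately show ?thesis
      by (cases "a z" rule: ennreal_cases) (auto simp: less_le)
  qed
  \<comment> \<open>Balances the two terms: \<open>s * A\<close> and \<open>1 / s\<close> both equal
    \<open>sqrt A\<close>.\<close>
  define s where "s = 1 / sqrt A"
  have s: "0 < s" using A by (simp add: s_def)
  let ?I = "\<lambda>z. \<integral>\<^sup>+p. ennreal (1 / w p) * indicator (rect z) p \<partial>lborel"
  have [measurable]: "?I \<in> borel_measurable (borel \<Otimes>\<^sub>M borel)" by measurable
  have "(\<integral>\<^sup>+z. c z * \<beta> z \<partial>zmeasure)
      \<le> (\<integral>\<^sup>+z. ennreal s * ((c z)\<^sup>2 * (a z)\<^sup>2) + ennreal (1 / s * (1 / v ^ 3)) * ((\<beta> z)\<^sup>2 * (ennreal (1 / vol z) * ?I z)) \<partial>zmeasure)"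
  proof (rule nn_integral_mono_AE, use AE_zmeasure in eventually_elim)
    case (elim z)
    then obtain r where r: "0 < r" "a z = ennreal r" using a_fin by blast
    have "c z * \<beta> z \<le> ennreal (s * r\<^sup>2) * (c z)\<^sup>2 + ennreal (1 / (s * r\<^sup>2)) * (\<beta> z)\<^sup>2"
      using s r by (intro ennreal_young) auto
    also have "ennreal (s * r\<^sup>2) * (c z)\<^sup>2 = ennreal s * ((c z)\<^sup>2 * (a z)\<^sup>2)"
      using s r by (simp add: ennreal_mult ennreal_power ac_simps)
    also have "ennreal (1 / (s * r\<^sup>2)) * (\<beta> z)\<^sup>2 = ennreal (1 / s) * ennreal (1 / r\<^sup>2) * (\<beta> z)\<^sup>2"
      using s r by (simp add: ennreal_mult[symmetric])
    also have "\<dots> \<le> ennreal (1 / s) * (ennreal (1 / v ^ 3) * (ennreal (1 / vol z) * ?I z)) * (\<beta> z)\<^sup>2"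
      using inverse_average_squared_le[of q z r] q elim r
      by (intro mult_right_mono mult_left_mono) (auto simp: v_def a_def)
    also have "\<dots> = ennreal (1 / s * (1 / v ^ 3)) * ((\<beta> z)\<^sup>2 * (ennreal (1 / vol z) * ?I z))"
      using s v by (simp add: ennreal_mult[of "1/s"] ac_simps del: times_divide_eq_left times_divide_eq_right)
    finally show ?case by (simp add: add_left_mono)
  qed
  also have "\<dots> = ennreal s * (\<integral>\<^sup>+z. (c z)\<^sup>2 * (a z)\<^sup>2 \<partial>zmeasure)
      + ennreal (1 / s * (1 / v ^ 3)) * (\<integral>\<^sup>+z. (\<beta> z)\<^sup>2 * (ennreal (1 / vol z) * ?I z) \<partial>zmeasure)"
    by (subst nn_integral_add, measurable) (subst nn_integral_cmult, measurable, subst nn_integral_cmult, measurable)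
  also have "\<dots> \<le> ennreal s * (ennreal (A * embedding_const TYPE('a) TYPE('b)) * (\<integral>\<^sup>+p. ennreal (w p) \<partial>lborel))
      + ennreal (1 / s * (1 / v ^ 3)) * (\<integral>\<^sup>+p. ennreal (w p) \<partial>lborel)"
  proof (intro add_mono mult_left_mono)
    show "(\<integral>\<^sup>+z. (c z)\<^sup>2 * (a z)\<^sup>2 \<partial>zmeasure) \<le> ennreal (A * embedding_const TYPE('a) TYPE('b)) * (\<integral>\<^sup>+p. ennreal (w p) \<partial>lborel)"
      using carleson_embedding[of c "\<lambda>p. ennreal (q p)" A] A c fin by (simp add: a_def[symmetric] q2)
    \<comment> \<open>Tonelli moves the average of \<open>1 / w\<close> outside the integral over
      \<open>z\<close>, which the hypothesis bounds by the square of \<open>w\<close>; what remains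
      is the integral of \<open>w\<close>.\<close>
    have "(\<integral>\<^sup>+z. (\<beta> z)\<^sup>2 * (ennreal (1 / vol z) * ?I z) \<partial>zmeasure)
        = (\<integral>\<^sup>+z. \<integral>\<^sup>+p. (\<beta> z)\<^sup>2 * ennreal (1 / vol z) * (ennreal (1 / w p) * indicator (rect z) p) \<partial>lborel \<partial>zmeasure)"
      by (subst mult.assoc[symmetric], intro nn_integral_cong nn_integral_cmult[symmetric]) measurable
    also have "\<dots> = (\<integral>\<^sup>+p. \<integral>\<^sup>+z. (\<beta> z)\<^sup>2 * ennreal (1 / vol z) * (ennreal (1 / w p) * indicator (rect z) p) \<partial>zmeasure \<partial>lborel)"
      by (rule zl.Fubini'[symmetric]) measurable
    also have "\<dots> = (\<integral>\<^sup>+p. ennreal (1 / w p) * (\<integral>\<^sup>+z. (\<beta> z)\<^sup>2 * ennreal (1 / vol z) * indicator (rect z) p \<partial>zmeasure) \<partial>lborel)"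
      by (intro nn_integral_cong, subst nn_integral_cmult[symmetric]) (auto simp: ac_simps)
    also have "\<dots> \<le> (\<integral>\<^sup>+p. ennreal (w p) \<partial>lborel)"
    proof (rule nn_integral_mono_AE, use \<beta> in eventually_elim)
      case (elim p)
      have "ennreal (1 / w p) * (\<integral>\<^sup>+z. (\<beta> z)\<^sup>2 * ennreal (1 / vol z) * indicator (rect z) p \<partial>zmeasure) \<le> ennreal (1 / w p) * (ennreal (w p))\<^sup>2"
        by (intro mult_left_mono elim) auto
      also have "\<dots> = ennreal (w p)"
        using w[of p] by (simp add: power2_eq_square mult.assoc[symmetric] ennreal_mult[symmetric])
      finally show ?case .
    qed
    finally show "(\<integral>\<^sup>+z. (\<beta> z)\<^sup>2 * (ennreal (1 / vol z) * ?I z) \<partial>zmeasure) \<le> (\<integral>\<^sup>+p. ennreal (w p) \<partial>lborel)" .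
  qed auto
  also have "\<dots> = (ennreal (s * (A * embedding_const TYPE('a) TYPE('b))) + ennreal (1 / s * (1 / v ^ 3))) * (\<integral>\<^sup>+p. ennreal (w p) \<partial>lborel)"
    using s A by (simp add: ennreal_mult distrib_right mult.assoc)
  also have "ennreal (s * (A * embedding_const TYPE('a) TYPE('b))) + ennreal (1 / s * (1 / v ^ 3))
      = ennreal (s * (A * embedding_const TYPE('a) TYPE('b)) + 1 / s * (1 / v ^ 3))"
    using s A v by (intro ennreal_plus[symmetric]) auto
  also have "s * (A * embedding_const TYPE('a) TYPE('b)) + 1 / s * (1 / v ^ 3) = duality_const TYPE('a) TYPE('b) * sqrt A"
  proof -
    have "s * A = sqrt A" "1 / s = sqrt A" using A by (auto simp: s_def real_div_sqrt)
    then show ?thesis unfolding duality_const_def v_def[symmetric] mult.assoc[symmetric] by (simp add: algebra_simps)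
  qed
  finally show ?thesis .
qed

text \<open>\<open>U\<close> may vanish or be infinite. Its infinite values form a null set; zeros
  are removed by adding a small multiple of a positive integrable function \<open>h\<close>, and the
  multiple tends to 0 at the end.\<close>

theorem carleson_duality:
  fixes c \<beta> :: "('a::euclidean_space \<times> real) \<times> ('b::euclidean_space \<times> real) \<Rightarrow> ennreal" and U :: "'a \<times> 'b \<Rightarrow> ennreal"
  assumes [measurable]: "c \<in> borel_measurable (borel \<Otimes>\<^sub>M borel)" "\<beta> \<in> borel_measurable (borel \<Otimes>\<^sub>M borel)" "U \<in> borel_measurable borel"
    and A: "0 < A" and c: "carleson_bound c A"
    and fin: "(\<integral>\<^sup>+p. U p \<partial>lborel) < \<infinity>"
    and \<beta>: "\<And>p. (\<integral>\<^sup>+z. (\<beta> z)\<^sup>2 * ennreal (1 / vol z) * indicator (rect z) p \<partial>zmeasure) \<le> (U p)\<^sup>2"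
  shows "(\<integral>\<^sup>+z. c z * \<beta> z \<partial>zmeasure) \<le> ennreal (duality_const TYPE('a) TYPE('b) * sqrt A) * (\<integral>\<^sup>+p. U p \<partial>lborel)"
proof -
  obtain h where h [measurable]: "h \<in> borel_measurable (lborel :: ('a \<times> 'b) measure)"
    and h_fin: "integral\<^sup>N lborel h \<noteq> \<infinity>" and h_pos: "\<And>p. 0 < h p \<and> h p < \<infinity>"
    using sigma_finite_measure.Ex_finite_integrable_function[OF sigma_finite_lborel] by auto
  let ?K = "duality_const TYPE('a) TYPE('b) * sqrt A"
  have K: "0 \<le> ?K" using A by (intro mult_nonneg_nonneg duality_const_nonneg) auto
  have U_fin: "AE p in lborel. U p \<noteq> \<infinity>"
    using fin by (intro nn_integral_PInf_AE) auto
  have bound: "(\<integral>\<^sup>+z. c z * \<beta> z \<partial>zmeasure) \<le> ennreal ?K * ((\<integral>\<^sup>+p. U p \<partial>lborel) + ennreal e * (\<integral>\<^sup>+p. h p \<partial>lborel))"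
    if e: "0 < e" for e
  proof -
    define w where "w p = enn2real (U p) + e * enn2real (h p)" for p
    have [measurable]: "w \<in> borel_measurable borel" unfolding w_def[abs_def] using h by measurable
    have hp: "0 < enn2real (h p)" "ennreal (enn2real (h p)) = h p" for p
      using h_pos[of p] by (auto simp: enn2real_positive_iff)
    have w: "0 < w p" for p unfolding w_def using hp[of p] e by (intro add_nonneg_pos) auto
    have w_eq: "ennreal (w p) = ennreal (enn2real (U p)) + ennreal e * h p" for p
      unfolding w_def using hp[of p] e by (simp add: ennreal_mult)
    have w_le: "(\<integral>\<^sup>+p. ennreal (w p) \<partial>lborel) \<le> (\<integral>\<^sup>+p. U p \<partial>lborel) + ennreal e * (\<integral>\<^sup>+p. h p \<partial>lborel)"
    proof -
      have "(\<integral>\<^sup>+p. ennreal (w p) \<partial>lborel) \<le> (\<integral>\<^sup>+p. U p + ennreal e * h p \<partial>lborel)"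
        unfolding w_eq by (intro nn_integral_mono add_right_mono) (metis ennreal_enn2real_if order_refl top_greatest zero_le)
      also have "\<dots> = (\<integral>\<^sup>+p. U p \<partial>lborel) + ennreal e * (\<integral>\<^sup>+p. h p \<partial>lborel)"
        by (subst nn_integral_add) (auto simp: nn_integral_cmult)
      finally show ?thesis .
    qed
    have "(\<integral>\<^sup>+z. c z * \<beta> z \<partial>zmeasure) \<le> ennreal ?K * (\<integral>\<^sup>+p. ennreal (w p) \<partial>lborel)"
    proof (rule carleson_duality_positive[OF _ _ _ A c w])
      show "(\<integral>\<^sup>+p. ennreal (w p) \<partial>lborel) < \<infinity>"
        using w_le fin h_fin by (simp add: ennreal_mult_less_top less_top order_le_less_trans)
      show "AE p in lborel. (\<integral>\<^sup>+z. (\<beta> z)\<^sup>2 * ennreal (1 / vol z) * indicator (rect z) p \<partial>zmeasure) \<le> (ennreal (w p))\<^sup>2"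
        using U_fin
      proof eventually_elim
        case (elim p)
        have "U p \<le> ennreal (w p)"
          unfolding w_eq using elim by (simp add: less_top)
        then have "(U p)\<^sup>2 \<le> (ennreal (w p))\<^sup>2" by (intro power_mono) auto
        then show ?case using \<beta>[of p] by (rule order_trans[rotated])
      qed
    qed measurable
    also have "\<dots> \<le> ennreal ?K * ((\<integral>\<^sup>+p. U p \<partial>lborel) + ennreal e * (\<integral>\<^sup>+p. h p \<partial>lborel))"
      by (intro mult_left_mono w_le) auto
    finally show ?thesis .
  qed
  obtain u where u: "(\<integral>\<^sup>+p. U p \<partial>lborel) = ennreal u" "0 \<le> u"
    using fin by (cases "\<integral>\<^sup>+p. U p \<partial>lborel" rule: ennreal_cases) auto
  obtain H where H: "(\<integral>\<^sup>+p. h p \<partial>lborel) = ennreal H" "0 \<le> H"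
    using h_fin by (cases "\<integral>\<^sup>+p. h p \<partial>lborel" rule: ennreal_cases) auto
  have bound': "(\<integral>\<^sup>+z. c z * \<beta> z \<partial>zmeasure) \<le> ennreal (?K * (u + e * H))" if "0 < e" for e
    using bound[OF that] u H K that by (simp add: ennreal_mult[symmetric] flip: ennreal_plus)
  obtain X where X: "(\<integral>\<^sup>+z. c z * \<beta> z \<partial>zmeasure) = ennreal X" "0 \<le> X"
    using bound'[of 1] by (cases "\<integral>\<^sup>+z. c z * \<beta> z \<partial>zmeasure" rule: ennreal_cases) (auto simp: top_unique)
  have "X \<le> ?K * u"
  proof (rule tendsto_lowerbound)
    have "((\<lambda>e. ?K * (u + e * H)) \<longlongrightarrow> ?K * (u + 0 * H)) (at_right 0)"
      by (intro tendsto_intros)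
    then show "((\<lambda>e. ?K * (u + e * H)) \<longlongrightarrow> ?K * u) (at_right 0)" by simp
    show "\<forall>\<^sub>F e in at_right 0. X \<le> ?K * (u + e * H)"
      using eventually_at_right_less[of 0]
    proof eventually_elim
      case (elim e)
      have "0 \<le> ?K * (u + e * H)" using K u H elim by simp
      then show ?case using bound'[OF elim] X by simp
    qed
  qed simp
  then show ?thesis using X u K by (simp add: ennreal_mult[symmetric] ennreal_leI)
qed

section \<open>Boundedness of the paraproduct forms\<close>

lemma HL_mono:
  assumes "\<And>x. f x \<le> g x"
  shows "HL f y \<le> HL g y"
  unfolding HL_def using assms
  by (intro SUP_mono' mult_left_mono nn_integral_mono mult_right_mono) auto

lemma HL_cmult:
  assumes [measurable]: "f \<in> borel_measurable borel"
  shows "HL (\<lambda>x. c * f x) y = c * HL f y"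
proof -
  have "(\<integral>\<^sup>+u. c * f u * indicator (ball y s) u \<partial>lborel) = c * (\<integral>\<^sup>+u. f u * indicator (ball y s) u \<partial>lborel)" for s
    unfolding mult.assoc by (rule nn_integral_cmult) measurable
  then show ?thesis
    unfolding HL_def by (simp add: SUP_mult_left_ennreal mult.left_commute[of c])
qed

text \<open>A root on extended values, so that a product of two integrable functions can be passed
  to Cauchy-Schwarz without regard to finiteness.\<close>

definition esqrt :: "ennreal \<Rightarrow> ennreal" where
  "esqrt x = (if x = \<infinity> then \<infinity> else ennreal (sqrt (enn2real x)))"

lemma esqrt_power2 [simp]: "(esqrt x)\<^sup>2 = x"
  by (cases x rule: ennreal_cases) (auto simp: esqrt_def ennreal_power)

lemma esqrt_measurable [measurable]: "esqrt \<in> borel_measurable borel"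
  unfolding esqrt_def[abs_def] by measurable

lemma tens_measurable [measurable]:
  assumes [measurable]: "a \<in> borel_measurable borel" "b \<in> borel_measurable borel"
  shows "tens a b \<in> borel_measurable (borel :: ('a::euclidean_space \<times> 'b::euclidean_space) measure)"
  unfolding tens_def[abs_def] by measurable

lemma tens_L2:
  fixes a :: "'a::euclidean_space \<Rightarrow> complex" and b :: "'b::euclidean_space \<Rightarrow> complex"
  assumes a: "a \<in> L2" and b: "b \<in> L2"
  shows "tens a b \<in> L2"
proof (rule L2I)
  have [measurable]: "a \<in> borel_measurable borel" "b \<in> borel_measurable borel" using a b by auto
  show "tens a b \<in> borel_measurable borel" by measurable
  have "(\<integral>\<^sup>+p. ennreal ((cmod (tens a b p))\<^sup>2) \<partial>lborel)
      = (\<integral>\<^sup>+x. \<integral>\<^sup>+y. ennreal ((cmod (a x))\<^sup>2) * ennreal ((cmod (b y))\<^sup>2) \<partial>lborel \<partial>lborel)"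
    by (subst nn_integral_lborel_pair(1)) (auto simp: tens_def norm_mult power_mult_distrib ennreal_mult)
  also have "\<dots> = ennreal ((L2norm a)\<^sup>2) * ennreal ((L2norm b)\<^sup>2)"
    by (simp add: nn_integral_cmult nn_integral_multc nn_integral_L2[OF a] nn_integral_L2[OF b])
  finally show "(\<integral>\<^sup>+p. ennreal ((cmod (tens a b p))\<^sup>2) \<partial>lborel) < \<infinity>"
    by (simp add: ennreal_mult_less_top)
qed

lemma pairing_tens:
  fixes F :: "'a::euclidean_space \<times> 'b::euclidean_space \<Rightarrow> complex"
  assumes "integrable lborel (\<lambda>p. F p * tens a b p)"
  shows "pairing F (tens a b) = pairing (\<lambda>y2. pairing (\<lambda>y1. F (y1, y2)) a) b"
    and "pairing F (tens a b) = pairing (\<lambda>y1. pairing (\<lambda>y2. F (y1, y2)) b) a"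
proof -
  have int: "integrable (lborel \<Otimes>\<^sub>M lborel) (\<lambda>p. F p * tens a b p)"
    using assms by (simp add: lborel_prod)
  have "pairing F (tens a b) = (\<integral>y2. \<integral>y1. F (y1, y2) * tens a b (y1, y2) \<partial>lborel \<partial>lborel)"
    using lborel_pair.integral_snd[of "\<lambda>y1 y2. F (y1, y2) * tens a b (y1, y2)"] int
    by (simp add: pairing_def lborel_prod case_prod_beta')
  then show "pairing F (tens a b) = pairing (\<lambda>y2. pairing (\<lambda>y1. F (y1, y2)) a) b"
    by (simp add: pairing_def tens_def mult.assoc[symmetric])
  have "pairing F (tens a b) = (\<integral>y1. \<integral>y2. F (y1, y2) * tens a b (y1, y2) \<partial>lborel \<partial>lborel)"
    using lborel_pair.integral_fst'[OF int] by (simp add: pairing_def lborel_prod)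
  then show "pairing F (tens a b) = pairing (\<lambda>y1. pairing (\<lambda>y2. F (y1, y2)) b) a"
    by (simp add: pairing_def tens_def mult.assoc[symmetric] mult.commute[of "a _"])
qed

lemma wav_avg_L2:
  fixes f :: "'a::euclidean_space \<Rightarrow> real"
  assumes f: "bump f r B" and t: "0 < snd z"
  shows "wav f z \<in> L2" "avg f z \<in> L2"
proof -
  obtain x t' where z: "z = (x, t')" by (cases z)
  have [measurable]: "f \<in> borel_measurable borel" by (rule bump_measurable[OF f])
  define N where "N = max 1 (max (norm x) (max t' (1 / t')))"
  have "1 / N \<le> t'"
  proof -
    have "1 / t' \<le> N" "0 < N" by (auto simp: N_def)
    then show ?thesis using t z by (simp add: field_simps)
  qed
  then have "z \<in> scale_region N" "1 \<le> N" by (auto simp: scale_region_def N_def z)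
  note * = wav_avg_on_scales[OF f this(2,1)]
  show "wav f z \<in> L2"
    using *(1,2)[OF disjI1[OF refl]] by (intro L2_bounded_support(1)) (measurable, auto)
  show "avg f z \<in> L2"
    using *(1,2)[OF disjI2[OF refl]] by (intro L2_bounded_support(1)) (measurable, auto)
qed

text \<open>The support of the average lies in the ball of radius \<open>r * t\<close>, which
  contains \<open>y\<close>. The normalisation t^(-n) cancels the power of the radius, so the factor
  does not depend on the scale.\<close>

lemma pairing_avg_le_HL:
  fixes f :: "'a::euclidean_space \<Rightarrow> real" and h :: "'a \<Rightarrow> complex"
  assumes f: "bump f r B" and t: "0 < snd z" and y: "y \<in> ball (fst z) (snd z)"
    and [measurable]: "h \<in> borel_measurable borel"
  shows "ennreal (cmod (pairing h (avg f z))) \<le> ennreal (B * (4 * r) ^ DIM('a)) * HL (\<lambda>u. ennreal (cmod (h u))) y"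
proof -
  obtain x t' where z: "z = (x, t')" by (cases z)
  have t': "0 < t'" using t z by simp
  have r: "1 \<le> r" and B: "1 \<le> B" using bumpD[OF f] by auto
  let ?k = "t' powr (- real DIM('a)) * B"
  have "ennreal (cmod (pairing h (avg f z))) \<le> (\<integral>\<^sup>+u. ennreal (cmod (h u * avg f z u)) \<partial>lborel)"
    unfolding pairing_def by (rule ennreal_norm_integral_le)
  also have "\<dots> \<le> (\<integral>\<^sup>+u. ennreal ?k * (ennreal (cmod (h u)) * indicator (ball x (r * t')) u) \<partial>lborel)"
  proof (rule nn_integral_mono)
    fix u
    have "cmod (h u * avg f z u) \<le> cmod (h u) * (?k * indicator (ball x (r * t')) u)"
      using avg_bound[OF f t', of x u] unfolding z norm_mult by (intro mult_left_mono) (auto simp: mult.assoc)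
    then have "cmod (h u * avg f z u) \<le> ?k * cmod (h u) * indicator (ball x (r * t')) u"
      by (simp add: ac_simps)
    then have "ennreal (cmod (h u * avg f z u)) \<le> ennreal (?k * cmod (h u)) * indicator (ball x (r * t')) u"
      by (rule ennreal_le_indicator)
    then show "ennreal (cmod (h u * avg f z u)) \<le> ennreal ?k * (ennreal (cmod (h u)) * indicator (ball x (r * t')) u)"
      using B by (simp add: ennreal_mult mult.assoc)
  qed
  also have "\<dots> = ennreal ?k * (\<integral>\<^sup>+u. ennreal (cmod (h u)) * indicator (ball x (r * t')) u \<partial>lborel)"
    by (rule nn_integral_cmult) measurable
  also have "\<dots> \<le> ennreal ?k * (ennreal ((4 * (r * t')) ^ DIM('a)) * HL (\<lambda>u. ennreal (cmod (h u))) y)"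
  proof (intro mult_left_mono nn_integral_ball_le_HL)
    show "dist x y < r * t'" using y r t' z by (simp add: less_le_trans[of _ "1 * t'"])
    show "0 < r * t'" using r t' by simp
  qed auto
  also have "\<dots> = ennreal (B * (4 * r) ^ DIM('a)) * HL (\<lambda>u. ennreal (cmod (h u))) y"
  proof -
    have eq: "?k * (4 * (r * t')) ^ DIM('a) = B * (4 * r) ^ DIM('a)"
      using t' by (simp add: power_mult_distrib powr_minus powr_realpow field_simps)
    have "ennreal ?k * ennreal ((4 * (r * t')) ^ DIM('a)) = ennreal (B * (4 * r) ^ DIM('a))"
      unfolding eq[symmetric] using B r t' by (intro ennreal_mult[symmetric]) auto
    then show ?thesis by (simp only: mult.assoc[symmetric])
  qed
  finally show ?thesis .
qed

text \<open>Duality with the function (P W)^(1/2): Cauchy-Schwarz separates the contributions of the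
  two arguments of a form.\<close>

lemma carleson_duality_product:
  fixes c \<beta> :: "('a::euclidean_space \<times> real) \<times> ('b::euclidean_space \<times> real) \<Rightarrow> ennreal" and P W :: "'a \<times> 'b \<Rightarrow> ennreal"
  assumes [measurable]: "c \<in> borel_measurable (borel \<Otimes>\<^sub>M borel)" "\<beta> \<in> borel_measurable (borel \<Otimes>\<^sub>M borel)"
      "P \<in> borel_measurable borel" "W \<in> borel_measurable borel"
    and A: "0 < A" and c: "carleson_bound c A"
    and \<beta>: "\<And>p. (\<integral>\<^sup>+z. (\<beta> z)\<^sup>2 * ennreal (1 / vol z) * indicator (rect z) p \<partial>zmeasure) \<le> P p * W p"
    and P: "(\<integral>\<^sup>+p. P p \<partial>lborel) \<le> ennreal (a\<^sup>2)" and W: "(\<integral>\<^sup>+p. W p \<partial>lborel) \<le> ennreal (b\<^sup>2)" and "0 \<le> a" "0 \<le> b"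
  shows "(\<integral>\<^sup>+z. c z * \<beta> z \<partial>zmeasure) \<le> ennreal (duality_const TYPE('a) TYPE('b) * sqrt A * (a * b))"
proof -
  let ?U = "\<lambda>p. esqrt (P p) * esqrt (W p)"
  have "(\<integral>\<^sup>+p. ?U p \<partial>lborel)\<^sup>2 \<le> (\<integral>\<^sup>+p. P p \<partial>lborel) * (\<integral>\<^sup>+p. W p \<partial>lborel)"
    using Cauchy_Schwarz_nn_integral[of "\<lambda>p. esqrt (P p)" lborel "\<lambda>p. esqrt (W p)"] by simp
  also have "\<dots> \<le> ennreal (a\<^sup>2) * ennreal (b\<^sup>2)" by (intro mult_mono P W) auto
  also have "\<dots> = (ennreal (a * b))\<^sup>2"
    using \<open>0 \<le> a\<close> \<open>0 \<le> b\<close> by (simp add: ennreal_power ennreal_mult[symmetric] power_mult_distrib)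
  finally have U: "(\<integral>\<^sup>+p. ?U p \<partial>lborel) \<le> ennreal (a * b)" by (rule ennreal_power2_le_imp_le)
  have "(\<integral>\<^sup>+z. c z * \<beta> z \<partial>zmeasure) \<le> ennreal (duality_const TYPE('a) TYPE('b) * sqrt A) * (\<integral>\<^sup>+p. ?U p \<partial>lborel)"
  proof (rule carleson_duality[OF _ _ _ A c])
    show "(\<integral>\<^sup>+p. ?U p \<partial>lborel) < \<infinity>" using U by (simp add: order_le_less_trans)
    show "(\<integral>\<^sup>+z. (\<beta> z)\<^sup>2 * ennreal (1 / vol z) * indicator (rect z) p \<partial>zmeasure) \<le> (?U p)\<^sup>2" for p
      using \<beta>[of p] by (simp add: power_mult_distrib)
  qed measurable
  also have "\<dots> \<le> ennreal (duality_const TYPE('a) TYPE('b) * sqrt A) * ennreal (a * b)"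
    by (intro mult_left_mono U) auto
  also have "\<dots> = ennreal (duality_const TYPE('a) TYPE('b) * sqrt A * (a * b))"
    using A \<open>0 \<le> a\<close> \<open>0 \<le> b\<close> by (intro ennreal_mult[symmetric] mult_nonneg_nonneg duality_const_nonneg) auto
  finally show ?thesis .
qed

section \<open>Form bounds for wavelets and averages in two parameters\<close>

locale wavelet_system = m1: mean_zero_bump \<psi>1 B1 + m2: mean_zero_bump \<psi>2 B2
  for \<psi>1 :: "'a::euclidean_space \<Rightarrow> real" and B1 and \<psi>2 :: "'b::euclidean_space \<Rightarrow> real" and B2 +
  fixes \<phi>1 :: "'a \<Rightarrow> real" and r1 C1 :: real and \<phi>2 :: "'b \<Rightarrow> real" and r2 C2 :: real
  assumes \<phi>1: "bump \<phi>1 r1 C1" and \<phi>2: "bump \<phi>2 r2 C2"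
begin

lemmas \<phi>_measurable [measurable] = bump_measurable[OF \<phi>1] bump_measurable[OF \<phi>2]

lemma tens_measurable_joint [measurable]:
  "(\<lambda>(z, p). tens (wav \<psi>1 (fst z)) (wav \<psi>2 (snd z)) p) \<in> borel_measurable ((borel \<Otimes>\<^sub>M borel) \<Otimes>\<^sub>M borel)"
  "(\<lambda>(z, p). tens (avg \<phi>1 (fst z)) (avg \<phi>2 (snd z)) p) \<in> borel_measurable ((borel \<Otimes>\<^sub>M borel) \<Otimes>\<^sub>M borel)"
  "(\<lambda>(z, p). tens (wav \<psi>1 (fst z)) (avg \<phi>2 (snd z)) p) \<in> borel_measurable ((borel \<Otimes>\<^sub>M borel) \<Otimes>\<^sub>M borel)"
  "(\<lambda>(z, p). tens (avg \<phi>1 (fst z)) (wav \<psi>2 (snd z)) p) \<in> borel_measurable ((borel \<Otimes>\<^sub>M borel) \<Otimes>\<^sub>M borel)"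
  unfolding tens_def by measurable

lemma pairing_tens_measurable [measurable]:
  assumes [measurable]: "F \<in> borel_measurable borel"
  shows "(\<lambda>z. pairing F (tens (wav \<psi>1 (fst z)) (wav \<psi>2 (snd z)))) \<in> borel_measurable (borel \<Otimes>\<^sub>M borel)"
    "(\<lambda>z. pairing F (tens (avg \<phi>1 (fst z)) (avg \<phi>2 (snd z)))) \<in> borel_measurable (borel \<Otimes>\<^sub>M borel)"
    "(\<lambda>z. pairing F (tens (wav \<psi>1 (fst z)) (avg \<phi>2 (snd z)))) \<in> borel_measurable (borel \<Otimes>\<^sub>M borel)"
    "(\<lambda>z. pairing F (tens (avg \<phi>1 (fst z)) (wav \<psi>2 (snd z)))) \<in> borel_measurable (borel \<Otimes>\<^sub>M borel)"
  unfolding pairing_def by measurable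

definition S1 :: real where "S1 = m1.schur_const"
definition S2 :: real where "S2 = m2.schur_const"
definition k1 :: real where "k1 = C1 * (4 * r1) ^ DIM('a)"
definition k2 :: real where "k2 = C2 * (4 * r2) ^ DIM('b)"
definition v1 :: real where "v1 = measure lborel (ball (0::'a) 1)"
definition v2 :: real where "v2 = measure lborel (ball (0::'b) 1)"

lemma S_pos: "0 < S1" "0 < S2"
  using m1.schur_const_pos m2.schur_const_pos by (auto simp: S1_def S2_def)

lemma k_nonneg: "0 \<le> k1" "0 \<le> k2"
  using bumpD[OF \<phi>1] bumpD[OF \<phi>2] by (auto simp: k1_def k2_def)

lemma kernel_L2:
  assumes "0 < snd (fst z)" "0 < snd (snd z)"
  shows "tens (wav \<psi>1 (fst z)) (wav \<psi>2 (snd z)) \<in> L2" "tens (avg \<phi>1 (fst z)) (avg \<phi>2 (snd z)) \<in> L2"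
    "tens (wav \<psi>1 (fst z)) (avg \<phi>2 (snd z)) \<in> L2" "tens (avg \<phi>1 (fst z)) (wav \<psi>2 (snd z)) \<in> L2"
  using wav_avg_L2[OF m1.bump assms(1)] wav_avg_L2[OF m2.bump assms(2)]
    wav_avg_L2[OF \<phi>1 assms(1)] wav_avg_L2[OF \<phi>2 assms(2)] by (auto intro: tens_L2)

lemma avg_avg_le:
  fixes F :: "'a \<times> 'b \<Rightarrow> complex"
  assumes F: "F \<in> L2" and z: "0 < snd (fst z)" "0 < snd (snd z)" and p: "p \<in> rect z"
  shows "ennreal (cmod (pairing F (tens (avg \<phi>1 (fst z)) (avg \<phi>2 (snd z)))))
    \<le> ennreal (k1 * k2) * strong (\<lambda>p. ennreal (cmod (F p))) p"
proof -
  have [measurable]: "F \<in> borel_measurable borel" using F by auto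
  have p12: "fst p \<in> ball (fst (fst z)) (snd (fst z))" "snd p \<in> ball (fst (snd z)) (snd (snd z))"
    using p by (auto simp: rect_def)
  let ?h = "\<lambda>y1. pairing (\<lambda>y2. F (y1, y2)) (avg \<phi>2 (snd z))"
  have [measurable]: "?h \<in> borel_measurable borel" unfolding pairing_def by measurable
  have "pairing F (tens (avg \<phi>1 (fst z)) (avg \<phi>2 (snd z))) = pairing ?h (avg \<phi>1 (fst z))"
    by (rule pairing_tens(2)[OF integrable_L2_mult[OF F kernel_L2(2)[OF z]]])
  then have "ennreal (cmod (pairing F (tens (avg \<phi>1 (fst z)) (avg \<phi>2 (snd z)))))
      \<le> ennreal k1 * HL (\<lambda>y1. ennreal (cmod (?h y1))) (fst p)"
    using pairing_avg_le_HL[OF \<phi>1 z(1) p12(1), of ?h] by (simp add: k1_def)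
  also have "\<dots> \<le> ennreal k1 * HL (\<lambda>y1. ennreal k2 * HL (\<lambda>y2. ennreal (cmod (F (y1, y2)))) (snd p)) (fst p)"
    using pairing_avg_le_HL[OF \<phi>2 z(2) p12(2)] by (intro mult_left_mono HL_mono) (auto simp: k2_def)
  also have "\<dots> = ennreal (k1 * k2) * strong (\<lambda>p. ennreal (cmod (F p))) p"
    using k_nonneg by (subst HL_cmult) (auto simp: strong_def ennreal_mult mult.assoc)
  finally show ?thesis .
qed

text \<open>The one-parameter square function bound is applied in the second variable for fixed
  \<open>z1\<close>, then in the first for fixed \<open>y2\<close>. The coefficients are iterated by
  Fubini at positive scales, where the kernels are in \<open>L2\<close>.\<close>

lemma wav_wav_L2:
  fixes G :: "'a \<times> 'b \<Rightarrow> complex"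
  assumes G: "G \<in> L2"
  shows "(\<integral>\<^sup>+z. ennreal ((cmod (pairing G (tens (wav \<psi>1 (fst z)) (wav \<psi>2 (snd z)))))\<^sup>2) \<partial>zmeasure) \<le> ennreal (S1 * S2 * (L2norm G)\<^sup>2)"
proof -
  interpret hl: pair_sigma_finite "hspace :: ('a \<times> real) measure" "lborel :: 'b measure"
    by (simp add: pair_sigma_finite_def sigma_finite_hspace sigma_finite_lborel)
  have [measurable]: "G \<in> borel_measurable borel" using G by auto
  let ?g = "\<lambda>z1 y2. pairing (\<lambda>y1. G (y1, y2)) (wav \<psi>1 z1)"
  have "(\<integral>\<^sup>+z. ennreal ((cmod (pairing G (tens (wav \<psi>1 (fst z)) (wav \<psi>2 (snd z)))))\<^sup>2) \<partial>zmeasure)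
      = (\<integral>\<^sup>+z. ennreal ((cmod (pairing (?g (fst z)) (wav \<psi>2 (snd z))))\<^sup>2) \<partial>zmeasure)"
  proof (rule nn_integral_cong_AE, use AE_zmeasure in eventually_elim)
    case (elim z)
    then show ?case
      using pairing_tens(1)[OF integrable_L2_mult[OF G kernel_L2(1)], of z] by simp
  qed
  also have "\<dots> = (\<integral>\<^sup>+z1. \<integral>\<^sup>+z2. ennreal ((cmod (pairing (?g z1) (wav \<psi>2 z2)))\<^sup>2) \<partial>hspace \<partial>hspace)"
    by (subst nn_integral_zmeasure(1)) auto
  also have "\<dots> \<le> (\<integral>\<^sup>+z1. ennreal S2 * (\<integral>\<^sup>+y2. ennreal ((cmod (?g z1 y2))\<^sup>2) \<partial>lborel) \<partial>hspace)"
    unfolding S2_def by (intro nn_integral_mono m2.square_function_bound) measurable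
  also have "\<dots> = ennreal S2 * (\<integral>\<^sup>+z1. \<integral>\<^sup>+y2. ennreal ((cmod (?g z1 y2))\<^sup>2) \<partial>lborel \<partial>hspace)"
    by (rule nn_integral_cmult) measurable
  also have "(\<integral>\<^sup>+z1. \<integral>\<^sup>+y2. ennreal ((cmod (?g z1 y2))\<^sup>2) \<partial>lborel \<partial>hspace) = (\<integral>\<^sup>+y2. \<integral>\<^sup>+z1. ennreal ((cmod (?g z1 y2))\<^sup>2) \<partial>hspace \<partial>lborel)"
    by (rule hl.Fubini'[symmetric]) measurable
  also have "\<dots> \<le> (\<integral>\<^sup>+y2. ennreal S1 * (\<integral>\<^sup>+y1. ennreal ((cmod (G (y1, y2)))\<^sup>2) \<partial>lborel) \<partial>lborel)"
    unfolding S1_def by (intro nn_integral_mono m1.square_function_bound) measurable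
  also have "\<dots> = ennreal S1 * (\<integral>\<^sup>+y2. \<integral>\<^sup>+y1. ennreal ((cmod (G (y1, y2)))\<^sup>2) \<partial>lborel \<partial>lborel)"
    by (rule nn_integral_cmult) measurable
  also have "(\<integral>\<^sup>+y2. \<integral>\<^sup>+y1. ennreal ((cmod (G (y1, y2)))\<^sup>2) \<partial>lborel \<partial>lborel) = ennreal ((L2norm G)\<^sup>2)"
    by (subst nn_integral_L2[OF G, symmetric]) (rule nn_integral_lborel_pair(2)[symmetric], measurable)
  finally show ?thesis using S_pos by (simp add: mult_left_mono mult_right_mono ennreal_mult ac_simps)
qed

text \<open>Each \<open>z\<close> is seen from the points \<open>x\<close> of one ball, whose volume
  the factor normalises away. The conical square function therefore has the same integral as the
  vertical one, up to the volume of the unit ball.\<close>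

lemma cone_average:
  fixes Q :: "'c::euclidean_space \<times> real \<Rightarrow> ennreal"
  assumes [measurable]: "Q \<in> borel_measurable borel"
  shows "(\<integral>\<^sup>+x. \<integral>\<^sup>+z. Q z * (ennreal (1 / snd z ^ DIM('c)) * indicator (ball (fst z) (snd z)) x) \<partial>hspace \<partial>lborel)
    = ennreal (measure lborel (ball (0::'c) 1)) * (\<integral>\<^sup>+z. Q z \<partial>hspace)"
proof -
  interpret hl: pair_sigma_finite "hspace :: ('c \<times> real) measure" "lborel :: 'c measure"
    by (simp add: pair_sigma_finite_def sigma_finite_hspace sigma_finite_lborel)
  have "(\<integral>\<^sup>+x. \<integral>\<^sup>+z. Q z * (ennreal (1 / snd z ^ DIM('c)) * indicator (ball (fst z) (snd z)) x) \<partial>hspace \<partial>lborel)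
     = (\<integral>\<^sup>+z. \<integral>\<^sup>+x. Q z * (ennreal (1 / snd z ^ DIM('c)) * indicator (ball (fst z) (snd z)) x) \<partial>lborel \<partial>hspace)"
    by (rule hl.Fubini') measurable
  also have "\<dots> = (\<integral>\<^sup>+z. ennreal (measure lborel (ball (0::'c) 1)) * Q z \<partial>hspace)"
  proof (rule nn_integral_cong_AE, use AE_hspace in eventually_elim)
    case (elim z)
    have "(\<integral>\<^sup>+x. Q z * (ennreal (1 / snd z ^ DIM('c)) * indicator (ball (fst z) (snd z)) x) \<partial>lborel)
        = Q z * ennreal (1 / snd z ^ DIM('c)) * emeasure lborel (ball (fst z) (snd z))"
      unfolding mult.assoc[symmetric] by (rule nn_integral_cmult_indicator) simp
    also have "\<dots> = Q z * (ennreal (1 / snd z ^ DIM('c)) * ennreal (snd z ^ DIM('c) * measure lborel (ball (0::'c) 1)))"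
      using elim by (simp add: emeasure_lborel_ball mult.assoc)
    also have "ennreal (1 / snd z ^ DIM('c)) * ennreal (snd z ^ DIM('c) * measure lborel (ball (0::'c) 1)) = ennreal (measure lborel (ball (0::'c) 1))"
      using elim by (subst ennreal_mult[symmetric]) auto
    finally show ?case by (simp add: mult.commute)
  qed
  also have "\<dots> = ennreal (measure lborel (ball (0::'c) 1)) * (\<integral>\<^sup>+z. Q z \<partial>hspace)"
    by (rule nn_integral_cmult) measurable
  finally show ?thesis .
qed

definition para_const :: real where
  "para_const = duality_const TYPE('a) TYPE('b)
     * (k1 * k2 * sqrt (HL_const TYPE('a) * HL_const TYPE('b)) * sqrt (v1 * v2 * (S1 * S2)))"

lemma para_const_nonneg: "0 \<le> para_const"
  using k_nonneg S_pos unfolding para_const_def v1_def v2_def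
  by (intro mult_nonneg_nonneg duality_const_nonneg) auto

text \<open>Both averages fall on \<open>F\<close>, so its coefficient is at most a multiple of the
  strong maximal function at each \<open>p\<close> of the rectangle and leaves the integral over
  \<open>z\<close> as \<open>P\<close>. What remains, \<open>W\<close>, is the conical square
  function of \<open>G\<close>.\<close>

theorem paraproduct_form_bound:
  fixes F G :: "'a \<times> 'b \<Rightarrow> complex" and c :: "('a \<times> real) \<times> ('b \<times> real) \<Rightarrow> ennreal"
  assumes [measurable]: "c \<in> borel_measurable (borel \<Otimes>\<^sub>M borel)" and A: "0 < A" and c: "carleson_bound c A"
    and F: "F \<in> L2" and G: "G \<in> L2"
  shows "(\<integral>\<^sup>+z. c z * ennreal (cmod (pairing F (tens (avg \<phi>1 (fst z)) (avg \<phi>2 (snd z))))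
      * cmod (pairing G (tens (wav \<psi>1 (fst z)) (wav \<psi>2 (snd z))))) \<partial>zmeasure)
    \<le> ennreal (para_const * sqrt A * (L2norm F * L2norm G))"
proof -
  interpret zm: sigma_finite_measure "zmeasure :: (('a \<times> real) \<times> ('b \<times> real)) measure"
    by (rule sigma_finite_zmeasure)
  interpret zl: pair_sigma_finite "zmeasure :: (('a \<times> real) \<times> ('b \<times> real)) measure" "lborel :: ('a \<times> 'b) measure" ..
  have [measurable]: "F \<in> borel_measurable borel" "G \<in> borel_measurable borel" using F G by auto
  define u where "u z = ennreal (cmod (pairing F (tens (avg \<phi>1 (fst z)) (avg \<phi>2 (snd z)))))" for z
  define v where "v z = ennreal (cmod (pairing G (tens (wav \<psi>1 (fst z)) (wav \<psi>2 (snd z)))))" for z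
  have [measurable]: "u \<in> borel_measurable (borel \<Otimes>\<^sub>M borel)" "v \<in> borel_measurable (borel \<Otimes>\<^sub>M borel)"
    unfolding u_def[abs_def] v_def[abs_def] by measurable
  define P where "P p = (ennreal (k1 * k2) * strong (\<lambda>p. ennreal (cmod (F p))) p)\<^sup>2" for p
  define W where "W p = (\<integral>\<^sup>+z. (v z)\<^sup>2 * ennreal (1 / vol z) * indicator (rect z) p \<partial>zmeasure)" for p
  let ?a = "k1 * k2 * sqrt (HL_const TYPE('a) * HL_const TYPE('b)) * L2norm F"
  let ?b = "sqrt (v1 * v2 * (S1 * S2)) * L2norm G"
  have v0: "0 \<le> v1" "0 \<le> v2" by (auto simp: v1_def v2_def)
  have "(\<integral>\<^sup>+z. c z * (u z * v z) \<partial>zmeasure) \<le> ennreal (duality_const TYPE('a) TYPE('b) * sqrt A * (?a * ?b))"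
  proof (rule carleson_duality_product[OF _ _ _ _ A c])
    show "P \<in> borel_measurable borel" unfolding P_def[abs_def] by measurable
    show "W \<in> borel_measurable borel" unfolding W_def[abs_def] by measurable
    show "(\<integral>\<^sup>+z. (u z * v z)\<^sup>2 * ennreal (1 / vol z) * indicator (rect z) p \<partial>zmeasure) \<le> P p * W p" for p
    proof -
      have "(\<integral>\<^sup>+z. (u z * v z)\<^sup>2 * ennreal (1 / vol z) * indicator (rect z) p \<partial>zmeasure)
          \<le> (\<integral>\<^sup>+z. P p * ((v z)\<^sup>2 * ennreal (1 / vol z) * indicator (rect z) p) \<partial>zmeasure)"
      proof (rule nn_integral_mono_AE, use AE_zmeasure in eventually_elim)
        case (elim z)
        show ?case
        proof (cases "p \<in> rect z")
          case True
          have "(u z)\<^sup>2 \<le> P p" unfolding P_def u_def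
            using avg_avg_le[OF F _ _ True] elim by (intro power_mono) auto
          then have "(u z)\<^sup>2 * ((v z)\<^sup>2 * ennreal (1 / vol z) * indicator (rect z) p) \<le> P p * ((v z)\<^sup>2 * ennreal (1 / vol z) * indicator (rect z) p)"
            by (intro mult_right_mono) auto
          then show ?thesis by (simp add: power_mult_distrib mult.assoc)
        qed simp
      qed
      also have "\<dots> = P p * W p" unfolding W_def by (rule nn_integral_cmult) measurable
      finally show ?thesis .
    qed
    show "(\<integral>\<^sup>+p. P p \<partial>lborel) \<le> ennreal (?a\<^sup>2)"
    proof -
      have "(\<integral>\<^sup>+p. P p \<partial>lborel) = ennreal ((k1 * k2)\<^sup>2) * (\<integral>\<^sup>+p. (strong (\<lambda>p. ennreal (cmod (F p))) p)\<^sup>2 \<partial>lborel)"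
        unfolding P_def power_mult_distrib[of "ennreal _"] using k_nonneg by (simp add: nn_integral_cmult ennreal_power)
      also have "\<dots> \<le> ennreal ((k1 * k2)\<^sup>2) * (ennreal (HL_const TYPE('a) * HL_const TYPE('b)) * (\<integral>\<^sup>+p. (ennreal (cmod (F p)))\<^sup>2 \<partial>lborel))"
        by (intro mult_left_mono strong_L2_bound) auto
      also have "(\<integral>\<^sup>+p. (ennreal (cmod (F p)))\<^sup>2 \<partial>lborel) = ennreal ((L2norm F)\<^sup>2)"
        using nn_integral_L2[OF F] by (simp add: ennreal_power)
      also have "ennreal ((k1 * k2)\<^sup>2) * (ennreal (HL_const TYPE('a) * HL_const TYPE('b)) * ennreal ((L2norm F)\<^sup>2)) = ennreal (?a\<^sup>2)"
        by (simp add: ennreal_mult[symmetric] power_mult_distrib ac_simps)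
      finally show ?thesis .
    qed
    show "(\<integral>\<^sup>+p. W p \<partial>lborel) \<le> ennreal (?b\<^sup>2)"
    proof -
      have "(\<integral>\<^sup>+p. W p \<partial>lborel) = (\<integral>\<^sup>+z. \<integral>\<^sup>+p. (v z)\<^sup>2 * ennreal (1 / vol z) * indicator (rect z) p \<partial>lborel \<partial>zmeasure)"
        unfolding W_def by (rule zl.Fubini') measurable
      also have "\<dots> = (\<integral>\<^sup>+z. ennreal (v1 * v2) * (v z)\<^sup>2 \<partial>zmeasure)"
      proof (rule nn_integral_cong_AE, use AE_zmeasure in eventually_elim)
        case (elim z)
        have "(\<integral>\<^sup>+p. (v z)\<^sup>2 * ennreal (1 / vol z) * indicator (rect z) p \<partial>lborel) = (v z)\<^sup>2 * ennreal (1 / vol z) * emeasure lborel (rect z)"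
          by (rule nn_integral_cmult_indicator) simp
        also have "\<dots> = (v z)\<^sup>2 * (ennreal (1 / vol z) * ennreal (vol z * (v1 * v2)))"
          using elim by (simp add: emeasure_rect v1_def v2_def mult.assoc)
        also have "ennreal (1 / vol z) * ennreal (vol z * (v1 * v2)) = ennreal (v1 * v2)"
          using elim vol_pos[of z] v0 by (subst ennreal_mult[symmetric]) auto
        finally show ?case by (simp add: mult.commute)
      qed
      also have "\<dots> = ennreal (v1 * v2) * (\<integral>\<^sup>+z. (v z)\<^sup>2 \<partial>zmeasure)"
        by (rule nn_integral_cmult) measurable
      also have "\<dots> \<le> ennreal (v1 * v2) * ennreal (S1 * S2 * (L2norm G)\<^sup>2)"
        using wav_wav_L2[OF G] by (intro mult_left_mono) (auto simp: v_def ennreal_power)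
      also have "\<dots> = ennreal (?b\<^sup>2)"
        using S_pos v0 by (simp add: ennreal_mult[symmetric] power_mult_distrib ac_simps)
      finally show ?thesis .
    qed
    show "0 \<le> ?a" "0 \<le> ?b" using k_nonneg S_pos v0 by auto
  qed measurable
  then show ?thesis
    by (simp add: u_def v_def ennreal_mult para_const_def ac_simps)
qed

text \<open>A square function in the first variable of a maximal function in the second: the maximal
  bound is used for each \<open>z1\<close>, then Tonelli and the square function bound for each
  \<open>y2\<close>. This is the contribution of an argument that meets a wavelet in the first
  variable and an average in the second.\<close>

lemma wav_HL_L2_first:
  fixes F :: "'a \<times> 'b \<Rightarrow> complex"
  assumes F: "F \<in> L2"
  shows "(\<integral>\<^sup>+z1. \<integral>\<^sup>+p2. (HL (\<lambda>y2. ennreal (cmod (pairing (\<lambda>y1. F (y1, y2)) (wav \<psi>1 z1)))) p2)\<^sup>2 \<partial>lborel \<partial>hspace)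
    \<le> ennreal (HL_const TYPE('b) * S1 * (L2norm F)\<^sup>2)"
proof -
  interpret hl: pair_sigma_finite "hspace :: ('a \<times> real) measure" "lborel :: 'b measure"
    by (simp add: pair_sigma_finite_def sigma_finite_hspace sigma_finite_lborel)
  have [measurable]: "F \<in> borel_measurable borel" using F by auto
  let ?g = "\<lambda>z1 y2. pairing (\<lambda>y1. F (y1, y2)) (wav \<psi>1 z1)"
  have "(\<integral>\<^sup>+z1. \<integral>\<^sup>+p2. (HL (\<lambda>y2. ennreal (cmod (?g z1 y2))) p2)\<^sup>2 \<partial>lborel \<partial>hspace)
      \<le> (\<integral>\<^sup>+z1. ennreal (HL_const TYPE('b)) * (\<integral>\<^sup>+y2. ennreal ((cmod (?g z1 y2))\<^sup>2) \<partial>lborel) \<partial>hspace)"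
    by (rule nn_integral_mono, rule order_trans[OF HL_L2_bound], measurable) (simp add: ennreal_power)
  also have "\<dots> = ennreal (HL_const TYPE('b)) * (\<integral>\<^sup>+z1. \<integral>\<^sup>+y2. ennreal ((cmod (?g z1 y2))\<^sup>2) \<partial>lborel \<partial>hspace)"
    by (rule nn_integral_cmult) measurable
  also have "(\<integral>\<^sup>+z1. \<integral>\<^sup>+y2. ennreal ((cmod (?g z1 y2))\<^sup>2) \<partial>lborel \<partial>hspace) = (\<integral>\<^sup>+y2. \<integral>\<^sup>+z1. ennreal ((cmod (?g z1 y2))\<^sup>2) \<partial>hspace \<partial>lborel)"
    by (rule hl.Fubini'[symmetric]) measurable
  also have "\<dots> \<le> (\<integral>\<^sup>+y2. ennreal S1 * (\<integral>\<^sup>+y1. ennreal ((cmod (F (y1, y2)))\<^sup>2) \<partial>lborel) \<partial>lborel)"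
    unfolding S1_def by (intro nn_integral_mono m1.square_function_bound) measurable
  also have "\<dots> = ennreal S1 * (\<integral>\<^sup>+y2. \<integral>\<^sup>+y1. ennreal ((cmod (F (y1, y2)))\<^sup>2) \<partial>lborel \<partial>lborel)"
    by (rule nn_integral_cmult) measurable
  also have "(\<integral>\<^sup>+y2. \<integral>\<^sup>+y1. ennreal ((cmod (F (y1, y2)))\<^sup>2) \<partial>lborel \<partial>lborel) = ennreal ((L2norm F)\<^sup>2)"
    by (subst nn_integral_L2[OF F, symmetric]) (rule nn_integral_lborel_pair(2)[symmetric], measurable)
  finally show ?thesis using S_pos by (simp add: mult_left_mono mult_right_mono ennreal_mult ac_simps)
qed

lemma wav_HL_L2_second:
  fixes G :: "'a \<times> 'b \<Rightarrow> complex"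
  assumes G: "G \<in> L2"
  shows "(\<integral>\<^sup>+z2. \<integral>\<^sup>+p1. (HL (\<lambda>y1. ennreal (cmod (pairing (\<lambda>y2. G (y1, y2)) (wav \<psi>2 z2)))) p1)\<^sup>2 \<partial>lborel \<partial>hspace)
    \<le> ennreal (HL_const TYPE('a) * S2 * (L2norm G)\<^sup>2)"
proof -
  interpret hl: pair_sigma_finite "hspace :: ('b \<times> real) measure" "lborel :: 'a measure"
    by (simp add: pair_sigma_finite_def sigma_finite_hspace sigma_finite_lborel)
  have [measurable]: "G \<in> borel_measurable borel" using G by auto
  let ?g = "\<lambda>z2 y1. pairing (\<lambda>y2. G (y1, y2)) (wav \<psi>2 z2)"
  have "(\<integral>\<^sup>+z2. \<integral>\<^sup>+p1. (HL (\<lambda>y1. ennreal (cmod (?g z2 y1))) p1)\<^sup>2 \<partial>lborel \<partial>hspace)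
      \<le> (\<integral>\<^sup>+z2. ennreal (HL_const TYPE('a)) * (\<integral>\<^sup>+y1. ennreal ((cmod (?g z2 y1))\<^sup>2) \<partial>lborel) \<partial>hspace)"
    by (rule nn_integral_mono, rule order_trans[OF HL_L2_bound], measurable) (simp add: ennreal_power)
  also have "\<dots> = ennreal (HL_const TYPE('a)) * (\<integral>\<^sup>+z2. \<integral>\<^sup>+y1. ennreal ((cmod (?g z2 y1))\<^sup>2) \<partial>lborel \<partial>hspace)"
    by (rule nn_integral_cmult) measurable
  also have "(\<integral>\<^sup>+z2. \<integral>\<^sup>+y1. ennreal ((cmod (?g z2 y1))\<^sup>2) \<partial>lborel \<partial>hspace) = (\<integral>\<^sup>+y1. \<integral>\<^sup>+z2. ennreal ((cmod (?g z2 y1))\<^sup>2) \<partial>hspace \<partial>lborel)"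
    by (rule hl.Fubini'[symmetric]) measurable
  also have "\<dots> \<le> (\<integral>\<^sup>+y1. ennreal S2 * (\<integral>\<^sup>+y2. ennreal ((cmod (G (y1, y2)))\<^sup>2) \<partial>lborel) \<partial>lborel)"
    unfolding S2_def by (intro nn_integral_mono m2.square_function_bound) measurable
  also have "\<dots> = ennreal S2 * (\<integral>\<^sup>+y1. \<integral>\<^sup>+y2. ennreal ((cmod (G (y1, y2)))\<^sup>2) \<partial>lborel \<partial>lborel)"
    by (rule nn_integral_cmult) measurable
  also have "(\<integral>\<^sup>+y1. \<integral>\<^sup>+y2. ennreal ((cmod (G (y1, y2)))\<^sup>2) \<partial>lborel \<partial>lborel) = ennreal ((L2norm G)\<^sup>2)"
    by (subst nn_integral_L2[OF G, symmetric]) (rule nn_integral_lborel_pair(1)[symmetric], measurable)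
  finally show ?thesis using S_pos by (simp add: mult_left_mono mult_right_mono ennreal_mult ac_simps)
qed

definition mixed_const :: real where
  "mixed_const = duality_const TYPE('a) TYPE('b)
     * (k2 * sqrt (v1 * (HL_const TYPE('b) * S1)) * (k1 * sqrt (v2 * (HL_const TYPE('a) * S2))))"

lemma mixed_const_nonneg: "0 \<le> mixed_const"
  using k_nonneg S_pos unfolding mixed_const_def v1_def v2_def
  by (intro mult_nonneg_nonneg duality_const_nonneg) auto

text \<open>\<open>F\<close> leads to a maximal function in the second variable that depends on
  \<open>z1\<close> alone, \<open>G\<close> to one in the first variable that depends on
  \<open>z2\<close> alone. As the factor from the rectangle is a product over the variables too, the
  integral over \<open>z\<close> splits into \<open>P\<close>, from \<open>F\<close>, and
  \<open>W\<close>, from \<open>G\<close>.\<close>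

theorem mixed_form_bound:
  fixes F G :: "'a \<times> 'b \<Rightarrow> complex" and c :: "('a \<times> real) \<times> ('b \<times> real) \<Rightarrow> ennreal"
  assumes [measurable]: "c \<in> borel_measurable (borel \<Otimes>\<^sub>M borel)" and A: "0 < A" and c: "carleson_bound c A"
    and F: "F \<in> L2" and G: "G \<in> L2"
  shows "(\<integral>\<^sup>+z. c z * ennreal (cmod (pairing F (tens (wav \<psi>1 (fst z)) (avg \<phi>2 (snd z))))
      * cmod (pairing G (tens (avg \<phi>1 (fst z)) (wav \<psi>2 (snd z))))) \<partial>zmeasure)
    \<le> ennreal (mixed_const * sqrt A * (L2norm F * L2norm G))"
proof -
  interpret h1: sigma_finite_measure "hspace :: ('a \<times> real) measure" by (rule sigma_finite_hspace)
  interpret h2: sigma_finite_measure "hspace :: ('b \<times> real) measure" by (rule sigma_finite_hspace)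
  interpret hl1: pair_sigma_finite "hspace :: ('a \<times> real) measure" "lborel :: 'b measure" ..
  interpret hl2: pair_sigma_finite "hspace :: ('b \<times> real) measure" "lborel :: 'a measure" ..
  have [measurable]: "F \<in> borel_measurable borel" "G \<in> borel_measurable borel" using F G by auto
  define u where "u z = ennreal (cmod (pairing F (tens (wav \<psi>1 (fst z)) (avg \<phi>2 (snd z)))))" for z
  define v where "v z = ennreal (cmod (pairing G (tens (avg \<phi>1 (fst z)) (wav \<psi>2 (snd z)))))" for z
  have [measurable]: "u \<in> borel_measurable (borel \<Otimes>\<^sub>M borel)" "v \<in> borel_measurable (borel \<Otimes>\<^sub>M borel)"
    unfolding u_def[abs_def] v_def[abs_def] by measurable
  define HF where "HF z1 p2 = HL (\<lambda>y2. ennreal (cmod (pairing (\<lambda>y1. F (y1, y2)) (wav \<psi>1 z1)))) p2" for z1 p2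
  define HG where "HG z2 p1 = HL (\<lambda>y1. ennreal (cmod (pairing (\<lambda>y2. G (y1, y2)) (wav \<psi>2 z2)))) p1" for z2 p1
  have HF [measurable]: "(\<lambda>(z1, p2). HF z1 p2) \<in> borel_measurable (borel \<Otimes>\<^sub>M borel)"
    unfolding HF_def[abs_def] by measurable
  have HG [measurable]: "(\<lambda>(z2, p1). HG z2 p1) \<in> borel_measurable (borel \<Otimes>\<^sub>M borel)"
    unfolding HG_def[abs_def] by measurable
  define e1 where "e1 z1 p1 = ennreal (1 / snd z1 ^ DIM('a)) * indicator (ball (fst z1) (snd z1)) p1" for z1 :: "'a \<times> real" and p1
  define e2 where "e2 z2 p2 = ennreal (1 / snd z2 ^ DIM('b)) * indicator (ball (fst z2) (snd z2)) p2" for z2 :: "'b \<times> real" and p2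
  have e1 [measurable]: "(\<lambda>(z1, p1). e1 z1 p1) \<in> borel_measurable (borel \<Otimes>\<^sub>M borel)"
    unfolding e1_def[abs_def] by measurable
  have e2 [measurable]: "(\<lambda>(z2, p2). e2 z2 p2) \<in> borel_measurable (borel \<Otimes>\<^sub>M borel)"
    unfolding e2_def[abs_def] by measurable
  have v0: "0 \<le> v1" "0 \<le> v2" by (auto simp: v1_def v2_def)
  define P where "P p = (\<integral>\<^sup>+z1. (ennreal k2 * HF z1 (snd p))\<^sup>2 * e1 z1 (fst p) \<partial>hspace)" for p
  define W where "W p = (\<integral>\<^sup>+z2. (ennreal k1 * HG z2 (fst p))\<^sup>2 * e2 z2 (snd p) \<partial>hspace)" for p
  have P_meas [measurable]: "P \<in> borel_measurable borel" unfolding P_def[abs_def] by measurable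
  have W_meas [measurable]: "W \<in> borel_measurable borel" unfolding W_def[abs_def] by measurable
  let ?a = "k2 * sqrt (v1 * (HL_const TYPE('b) * S1)) * L2norm F"
  let ?b = "k1 * sqrt (v2 * (HL_const TYPE('a) * S2)) * L2norm G"
  have "(\<integral>\<^sup>+z. c z * (u z * v z) \<partial>zmeasure) \<le> ennreal (duality_const TYPE('a) TYPE('b) * sqrt A * (?a * ?b))"
  proof (rule carleson_duality_product[OF _ _ P_meas W_meas A c])
    show "(\<integral>\<^sup>+z. (u z * v z)\<^sup>2 * ennreal (1 / vol z) * indicator (rect z) p \<partial>zmeasure) \<le> P p * W p" for p
    proof -
      have "(\<integral>\<^sup>+z. (u z * v z)\<^sup>2 * ennreal (1 / vol z) * indicator (rect z) p \<partial>zmeasure)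
          \<le> (\<integral>\<^sup>+z. ((ennreal k2 * HF (fst z) (snd p))\<^sup>2 * e1 (fst z) (fst p)) * ((ennreal k1 * HG (snd z) (fst p))\<^sup>2 * e2 (snd z) (snd p)) \<partial>zmeasure)"
      proof (rule nn_integral_mono_AE, use AE_zmeasure in eventually_elim)
        case (elim z)
        then have z: "0 < snd (fst z)" "0 < snd (snd z)" by auto
        show ?case
        proof (cases "p \<in> rect z")
          case True
          then have p: "fst p \<in> ball (fst (fst z)) (snd (fst z))" "snd p \<in> ball (fst (snd z)) (snd (snd z))"
            by (auto simp: rect_def)
          let ?f = "\<lambda>y2. pairing (\<lambda>y1. F (y1, y2)) (wav \<psi>1 (fst z))" and ?g = "\<lambda>y1. pairing (\<lambda>y2. G (y1, y2)) (wav \<psi>2 (snd z))"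
          have "u z \<le> ennreal k2 * HF (fst z) (snd p)"
            unfolding u_def HF_def k2_def pairing_tens(1)[OF integrable_L2_mult[OF F kernel_L2(3)[OF z]]]
            by (rule pairing_avg_le_HL[OF \<phi>2 z(2) p(2)]) measurable
          moreover have "v z \<le> ennreal k1 * HG (snd z) (fst p)"
            unfolding v_def HG_def k1_def pairing_tens(2)[OF integrable_L2_mult[OF G kernel_L2(4)[OF z]]]
            by (rule pairing_avg_le_HL[OF \<phi>1 z(1) p(1)]) measurable
          ultimately have "(u z * v z)\<^sup>2 \<le> ((ennreal k2 * HF (fst z) (snd p)) * (ennreal k1 * HG (snd z) (fst p)))\<^sup>2"
            by (intro power_mono mult_mono) auto
          then have "(u z * v z)\<^sup>2 * (ennreal (1 / vol z) * indicator (rect z) p)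
              \<le> ((ennreal k2 * HF (fst z) (snd p)) * (ennreal k1 * HG (snd z) (fst p)))\<^sup>2 * (ennreal (1 / vol z) * indicator (rect z) p)"
            by (intro mult_right_mono) auto
          moreover have "ennreal (1 / vol z) * indicator (rect z) p = e1 (fst z) (fst p) * e2 (snd z) (snd p)"
            using z p True by (simp add: e1_def e2_def vol_def ennreal_mult[symmetric] rect_def)
          ultimately have "(u z * v z)\<^sup>2 * ennreal (1 / vol z) * indicator (rect z) p
              \<le> ((ennreal k2 * HF (fst z) (snd p)) * (ennreal k1 * HG (snd z) (fst p)))\<^sup>2 * (e1 (fst z) (fst p) * e2 (snd z) (snd p))"
            by (simp only: mult.assoc)
          then show ?thesis by (simp only: power_mult_distrib ac_simps)
        qed simp
      qed
      also have "\<dots> = (\<integral>\<^sup>+z1. \<integral>\<^sup>+z2. ((ennreal k2 * HF z1 (snd p))\<^sup>2 * e1 z1 (fst p)) * ((ennreal k1 * HG z2 (fst p))\<^sup>2 * e2 z2 (snd p)) \<partial>hspace \<partial>hspace)"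
        by (subst nn_integral_zmeasure(1)) auto
      also have "\<dots> = (\<integral>\<^sup>+z1. ((ennreal k2 * HF z1 (snd p))\<^sup>2 * e1 z1 (fst p)) * W p \<partial>hspace)"
        unfolding W_def by (intro nn_integral_cong nn_integral_cmult) measurable
      also have "\<dots> = P p * W p"
        unfolding P_def by (rule nn_integral_multc) measurable
      finally show ?thesis .
    qed
    show "(\<integral>\<^sup>+p. P p \<partial>lborel) \<le> ennreal (?a\<^sup>2)"
    proof -
      have "(\<integral>\<^sup>+p. P p \<partial>lborel) = (\<integral>\<^sup>+p2. \<integral>\<^sup>+p1. P (p1, p2) \<partial>lborel \<partial>lborel)"
        by (rule nn_integral_lborel_pair(2)) measurable
      also have "\<dots> = (\<integral>\<^sup>+p2. ennreal v1 * (\<integral>\<^sup>+z1. (ennreal k2 * HF z1 p2)\<^sup>2 \<partial>hspace) \<partial>lborel)"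
        unfolding P_def e1_def v1_def fst_conv snd_conv by (intro nn_integral_cong cone_average) measurable
      also have "\<dots> = ennreal v1 * (\<integral>\<^sup>+p2. \<integral>\<^sup>+z1. (ennreal k2 * HF z1 p2)\<^sup>2 \<partial>hspace \<partial>lborel)"
        by (rule nn_integral_cmult) measurable
      also have "(\<integral>\<^sup>+p2. \<integral>\<^sup>+z1. (ennreal k2 * HF z1 p2)\<^sup>2 \<partial>hspace \<partial>lborel) = (\<integral>\<^sup>+z1. \<integral>\<^sup>+p2. (ennreal k2 * HF z1 p2)\<^sup>2 \<partial>lborel \<partial>hspace)"
        by (rule hl1.Fubini') measurable
      also have "\<dots> = (\<integral>\<^sup>+z1. ennreal (k2\<^sup>2) * (\<integral>\<^sup>+p2. (HF z1 p2)\<^sup>2 \<partial>lborel) \<partial>hspace)"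
        unfolding power_mult_distrib ennreal_power[OF k_nonneg(2)] by (intro nn_integral_cong nn_integral_cmult) measurable
      also have "\<dots> = ennreal (k2\<^sup>2) * (\<integral>\<^sup>+z1. \<integral>\<^sup>+p2. (HF z1 p2)\<^sup>2 \<partial>lborel \<partial>hspace)"
        by (rule nn_integral_cmult) measurable
      also have "ennreal v1 * \<dots> \<le> ennreal v1 * (ennreal (k2\<^sup>2) * ennreal (HL_const TYPE('b) * S1 * (L2norm F)\<^sup>2))"
        unfolding HF_def by (intro mult_left_mono wav_HL_L2_first F) auto
      also have "\<dots> = ennreal (?a\<^sup>2)"
        using S_pos v0 by (simp add: ennreal_mult[symmetric] power_mult_distrib ac_simps)
      finally show ?thesis .
    qed
    show "(\<integral>\<^sup>+p. W p \<partial>lborel) \<le> ennreal (?b\<^sup>2)"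
    proof -
      have "(\<integral>\<^sup>+p. W p \<partial>lborel) = (\<integral>\<^sup>+p1. \<integral>\<^sup>+p2. W (p1, p2) \<partial>lborel \<partial>lborel)"
        by (rule nn_integral_lborel_pair(1)) measurable
      also have "\<dots> = (\<integral>\<^sup>+p1. ennreal v2 * (\<integral>\<^sup>+z2. (ennreal k1 * HG z2 p1)\<^sup>2 \<partial>hspace) \<partial>lborel)"
        unfolding W_def e2_def v2_def fst_conv snd_conv by (intro nn_integral_cong cone_average) measurable
      also have "\<dots> = ennreal v2 * (\<integral>\<^sup>+p1. \<integral>\<^sup>+z2. (ennreal k1 * HG z2 p1)\<^sup>2 \<partial>hspace \<partial>lborel)"
        by (rule nn_integral_cmult) measurable
      also have "(\<integral>\<^sup>+p1. \<integral>\<^sup>+z2. (ennreal k1 * HG z2 p1)\<^sup>2 \<partial>hspace \<partial>lborel) = (\<integral>\<^sup>+z2. \<integral>\<^sup>+p1. (ennreal k1 * HG z2 p1)\<^sup>2 \<partial>lborel \<partial>hspace)"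
        by (rule hl2.Fubini') measurable
      also have "\<dots> = (\<integral>\<^sup>+z2. ennreal (k1\<^sup>2) * (\<integral>\<^sup>+p1. (HG z2 p1)\<^sup>2 \<partial>lborel) \<partial>hspace)"
        unfolding power_mult_distrib ennreal_power[OF k_nonneg(1)] by (intro nn_integral_cong nn_integral_cmult) measurable
      also have "\<dots> = ennreal (k1\<^sup>2) * (\<integral>\<^sup>+z2. \<integral>\<^sup>+p1. (HG z2 p1)\<^sup>2 \<partial>lborel \<partial>hspace)"
        by (rule nn_integral_cmult) measurable
      also have "ennreal v2 * \<dots> \<le> ennreal v2 * (ennreal (k1\<^sup>2) * ennreal (HL_const TYPE('a) * S2 * (L2norm G)\<^sup>2))"
        unfolding HG_def by (intro mult_left_mono wav_HL_L2_second G) auto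
      also have "\<dots> = ennreal (?b\<^sup>2)"
        using S_pos v0 by (simp add: ennreal_mult[symmetric] power_mult_distrib ac_simps)
      finally show ?thesis .
    qed
    show "0 \<le> ?a" "0 \<le> ?b" using k_nonneg S_pos v0 by auto
  qed measurable
  then show ?thesis
    by (simp add: u_def v_def ennreal_mult mixed_const_def ac_simps)
qed

end

section \<open>Approximation of the symbol\<close>

text \<open>The partial derivatives are continuous on the compact support and vanish outside, hence
  are bounded; the sum of their bounds over \<open>Basis\<close> dominates the operator norm of the
  derivative.\<close>

lemma test_fun_bump:
  fixes f :: "'a::euclidean_space \<Rightarrow> real"
  assumes f: "test_fun f" and supp: "closure {x. f x \<noteq> 0} \<subseteq> ball 0 r" and r: "1 \<le> r"
  shows "\<exists>B. bump f r B"
proof -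
  let ?K = "closure {x. f x \<noteq> 0}"
  let ?d = "\<lambda>j x. frechet_derivative f (at x) j"
  have K: "compact ?K" using f by (simp add: test_fun_def)
  have sm: "smooth_fun f" using f by (simp add: test_fun_def)
  \<comment> \<open>Smoothness for the empty list and for single directions: the function and its
    first partial derivatives are differentiable, so the latter are continuous.\<close>
  have df: "f differentiable (at x)" for x
    using sm[unfolded smooth_fun_def, rule_format, of "[]" x] by simp
  have "?d j differentiable (at x)" if "j \<in> Basis" for j x
    using sm[unfolded smooth_fun_def, rule_format, of "[j]" x] that by simp
  then have cd: "continuous_on ?K (?d j)" if "j \<in> Basis" for j
    using that by (meson continuous_at_imp_continuous_on differentiable_imp_continuous_within)
  have out: "f x = 0" if "x \<notin> ?K" for x
    using that closure_subset[of "{x. f x \<noteq> 0}"] by auto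
  have d_out: "?d j x = 0" if "x \<notin> ?K" for j x
  proof -
    have "(f has_derivative (\<lambda>_. 0)) (at x)"
    proof (rule has_derivative_transform_within_open[of "\<lambda>_. 0" _ _ _ "- ?K"])
      show "((\<lambda>_. 0) has_derivative (\<lambda>_. 0)) (at x)" by simp
      show "open (- ?K)" by (rule open_Compl[OF closed_closure])
      show "x \<in> - ?K" using that by simp
      show "0 = f y" if "y \<in> - ?K" for y using out[of y] that by simp
    qed
    from fun_cong[OF frechet_derivative_at[OF this], of j] show ?thesis by simp
  qed
  have "\<exists>M. \<forall>x. \<bar>?d j x\<bar> \<le> M" if j: "j \<in> Basis" for j
  proof -
    have "bounded (?d j ` ?K)" using compact_imp_bounded[OF compact_continuous_image[OF cd[OF j] K]] .
    then obtain M where M: "\<And>x. x \<in> ?K \<Longrightarrow> \<bar>?d j x\<bar> \<le> M" by (auto simp: bounded_iff)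
    have "\<bar>?d j x\<bar> \<le> max M 0" for x
      using M[of x] d_out[of x j] by (cases "x \<in> ?K") auto
    then show ?thesis by blast
  qed
  then obtain M where M: "\<And>j x. j \<in> Basis \<Longrightarrow> \<bar>?d j x\<bar> \<le> M j" by metis
  define L where "L = (\<Sum>j\<in>Basis. M j)"
  have M0: "0 \<le> M j" if "j \<in> Basis" for j using M[OF that, of 0] by linarith
  have lip: "\<bar>f x - f y\<bar> \<le> L * norm (x - y)" for x y
  proof -
    have hd: "(f has_derivative frechet_derivative f (at z)) (at z)" for z
      using df frechet_derivative_works by blast
    have "norm (f x - f y) \<le> L * norm (x - y)"
    proof (rule differentiable_bound[of UNIV f "\<lambda>z. frechet_derivative f (at z)"])
      fix z :: 'a
      show "onorm (frechet_derivative f (at z)) \<le> L"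
      proof (rule onorm_le)
        fix h :: 'a
        have lin: "linear (frechet_derivative f (at z))"
          using hd has_derivative_linear by blast
        have "frechet_derivative f (at z) h = frechet_derivative f (at z) (\<Sum>j\<in>Basis. (h \<bullet> j) *\<^sub>R j)"
          by (simp add: euclidean_representation)
        also have "\<dots> = (\<Sum>j\<in>Basis. (h \<bullet> j) * ?d j z)"
          by (simp add: linear_sum[OF lin] linear_scale[OF lin])
        finally have "norm (frechet_derivative f (at z) h) \<le> (\<Sum>j\<in>Basis. \<bar>(h \<bullet> j) * ?d j z\<bar>)"
          by (simp add: sum_abs)
        also have "\<dots> \<le> (\<Sum>j\<in>Basis. norm h * M j)"
          using M by (intro sum_mono) (auto simp: abs_mult intro!: mult_mono Basis_le_norm)
        also have "\<dots> = L * norm h" by (simp add: L_def sum_distrib_left mult.commute)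
        finally show "norm (frechet_derivative f (at z) h) \<le> L * norm h" .
      qed
    qed (use hd in auto)
    then show ?thesis by simp
  qed
  have "continuous_on ?K f"
    using df by (meson continuous_at_imp_continuous_on differentiable_imp_continuous_within)
  then have "bounded (f ` ?K)" using compact_imp_bounded[OF compact_continuous_image[OF _ K]] by blast
  then obtain D where D: "\<And>x. x \<in> ?K \<Longrightarrow> \<bar>f x\<bar> \<le> D" by (auto simp: bounded_iff)
  define B where "B = max 1 (max L D)"
  have "bump f r B"
    unfolding bump_def
  proof (intro conjI allI impI)
    show "1 \<le> r" by (rule r)
    show "1 \<le> B" by (simp add: B_def)
    show "\<bar>f x\<bar> \<le> B" for x using D[of x] out[of x] by (cases "x \<in> ?K") (auto simp: B_def)
    show "f x = 0" if "r \<le> norm x" for x using supp that by (intro out) auto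
    show "\<bar>f x - f y\<bar> \<le> B * norm (x - y)" for x y
    proof -
      have "L * norm (x - y) \<le> B * norm (x - y)" by (intro mult_right_mono) (auto simp: B_def)
      then show ?thesis using lip[of x y] by linarith
    qed
  qed
  then show ?thesis by blast
qed

lemma adm_wavelet_mean_zero_bump:
  assumes "adm_wavelet \<psi>"
  shows "\<exists>B. mean_zero_bump \<psi> B"
  using assms test_fun_bump[of \<psi> 1] by (auto simp: adm_wavelet_def mean_zero_bump_def)

lemma adm_bump_bump:
  assumes "adm_bump \<phi>"
  shows "\<exists>r B. bump \<phi> r B"
proof -
  have \<phi>: "test_fun \<phi>" using assms by (simp add: adm_bump_def)
  then have "bounded (closure {x. \<phi> x \<noteq> 0})" by (simp add: test_fun_def compact_imp_bounded)
  then obtain r where "closure {x. \<phi> x \<noteq> 0} \<subseteq> ball 0 r" by (meson bounded_subset_ballD)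
  then have "closure {x. \<phi> x \<noteq> 0} \<subseteq> ball 0 (max 1 r)" by force
  from test_fun_bump[OF \<phi> this] show ?thesis by auto
qed

section \<open>Lipschitz approximation of functions vanishing at infinity\<close>

definition soft :: "real \<Rightarrow> real \<Rightarrow> real" where
  "soft e a = max 0 (a - e) + min 0 (a + e)"

lemma soft:
  assumes "0 < e"
  shows "\<bar>soft e a - a\<bar> \<le> e" "\<bar>soft e a - soft e b\<bar> \<le> \<bar>a - b\<bar>" "\<bar>a\<bar> \<le> e \<Longrightarrow> soft e a = 0"
  using assms unfolding soft_def by linarith+

text \<open>The sup-convolution \<open>x \<mapsto> sup\<^sub>y (g y - L |x - y|)\<close> is Lipschitz and close to \<open>g\<close>; soft thresholding
  then makes the support bounded.\<close>
lemma C0_lipschitz_approx_real: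
  fixes g :: "'c::euclidean_space \<Rightarrow> real"
  assumes cont: "continuous_on UNIV g" and lim: "(g \<longlongrightarrow> 0) at_infinity" and e: "0 < e"
  shows "\<exists>h L R. 0 \<le> L \<and> (\<forall>x. \<bar>g x - h x\<bar> \<le> 3 * e) \<and> (\<forall>x y. \<bar>h x - h y\<bar> \<le> L * norm (x - y)) \<and> (\<forall>x. R \<le> norm x \<longrightarrow> h x = 0)"
proof -
  have "\<forall>\<^sub>F x in at_infinity. dist (g x) 0 < e / 2" using tendstoD[OF lim, of "e / 2"] e by simp
  then obtain R where R: "\<And>x. R \<le> norm x \<Longrightarrow> \<bar>g x\<bar> < e / 2"
    by (auto simp: eventually_at_infinity)
  \<comment> \<open>The margin 1, with \<open>\<delta> \<le> 1\<close> below, guarantees that two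
    close points lie both in the larger ball or both at norm at least \<open>R\<close>, where
    \<open>g\<close> is small.\<close>
  have "uniformly_continuous_on (cball 0 (R + 1)) g"
    using cont by (intro compact_uniformly_continuous) (auto intro: continuous_on_subset)
  then obtain d where d: "0 < d" "\<And>x y. x \<in> cball 0 (R + 1) \<Longrightarrow> y \<in> cball 0 (R + 1) \<Longrightarrow> dist y x < d \<Longrightarrow> dist (g y) (g x) < e"
    using e unfolding uniformly_continuous_on_def by metis
  define \<delta> where "\<delta> = min d 1"
  have \<delta>: "0 < \<delta>" using d by (simp add: \<delta>_def)
  have uc: "\<bar>g y - g x\<bar> < e" if "norm (x - y) < \<delta>" for x y
  proof (cases "norm x \<le> R + 1 \<and> norm y \<le> R + 1")
    case True
    then show ?thesis using d(2)[of x y] that by (simp add: dist_norm norm_minus_commute \<delta>_def)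
  next
    case False
    have "norm (x - y) < 1" using that by (simp add: \<delta>_def)
    then have "R \<le> norm x" "R \<le> norm y"
      using False norm_triangle_ineq2[of x y] norm_triangle_ineq3[of x y] by auto
    from R[OF this(1)] R[OF this(2)] show ?thesis by linarith
  qed
  have "bounded (g ` cball 0 R)"
    using cont by (intro compact_imp_bounded compact_continuous_image) (auto intro: continuous_on_subset)
  then obtain M0 where "\<forall>x\<in>cball 0 R. \<bar>g x\<bar> \<le> M0" by (auto simp: bounded_iff)
  then have M0: "\<bar>g x\<bar> \<le> M0" if "norm x \<le> R" for x using that by simp
  define M where "M = max M0 e"
  have M: "\<bar>g x\<bar> \<le> M" for x using M0[of x] R[of x] e by (cases "norm x \<le> R") (auto simp: M_def)
  \<comment> \<open>With this slope a point at distance at least \<open>\<delta>\<close> from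
    \<open>x\<close> pays at least \<open>2 * M\<close>, as much as \<open>g\<close> can gain, so
    the supremum is governed by the points near \<open>x\<close>.\<close>
  define L where "L = 2 * M / \<delta>"
  have L0: "0 \<le> L" using \<delta> M[of 0] by (simp add: L_def)
  define s where "s x = (SUP y. g y - L * norm (x - y))" for x
  have bdd: "bdd_above (range (\<lambda>y. g y - L * norm (x - y)))" for x
  proof (rule bdd_aboveI2)
    fix y show "g y - L * norm (x - y) \<le> M"
      using M[of y] mult_nonneg_nonneg[OF L0 norm_ge_zero[of "x - y"]] by linarith
  qed
  have s_ge: "g x \<le> s x" for x
    unfolding s_def using cSUP_upper[OF UNIV_I bdd, of x x] by simp
  have s_le: "s x \<le> g x + e" for x
    unfolding s_def
  proof (rule cSUP_least)
    fix y
    show "g y - L * norm (x - y) \<le> g x + e"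
    proof (cases "norm (x - y) < \<delta>")
      case True
      then show ?thesis using uc[OF True] mult_nonneg_nonneg[OF L0 norm_ge_zero[of "x - y"]] by linarith
    next
      case False
      then have "L * \<delta> \<le> L * norm (x - y)" using L0 by (intro mult_left_mono) auto
      then have "2 * M \<le> L * norm (x - y)" using \<delta> by (simp add: L_def)
      then show ?thesis using M[of x] M[of y] e by linarith
    qed
  qed simp
  have s_lip1: "s x \<le> s y + L * norm (x - y)" for x y
    unfolding s_def[of x]
  proof (rule cSUP_least)
    fix u
    have "g u - L * norm (y - u) \<le> s y"
      unfolding s_def using cSUP_upper[OF UNIV_I bdd] by blast
    moreover have "L * norm (y - u) \<le> L * (norm (x - u) + norm (x - y))"
      using L0 norm_triangle_ineq[of "y - x" "x - u"] by (intro mult_left_mono) (auto simp: norm_minus_commute)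
    ultimately show "g u - L * norm (x - u) \<le> s y + L * norm (x - y)"
      by (simp add: distrib_left)
  qed simp
  have s_lip: "\<bar>s x - s y\<bar> \<le> L * norm (x - y)" for x y
    using s_lip1[of x y] s_lip1[of y x] by (simp add: norm_minus_commute)
  \<comment> \<open>At norm at least \<open>R\<close> the value of \<open>s\<close> is at most e/2 +
    e in modulus, which the threshold \<open>2 * e\<close> kills. The error is \<open>e\<close> from
    \<open>s\<close> and \<open>2 * e\<close> from the threshold.\<close>
  define h where "h x = soft (2 * e) (s x)" for x
  have "\<bar>g x - h x\<bar> \<le> 3 * e" for x
    using soft(1)[of "2 * e" "s x"] s_ge[of x] s_le[of x] e by (simp add: h_def abs_le_iff)
  moreover have "\<bar>h x - h y\<bar> \<le> L * norm (x - y)" for x y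
    using soft(2)[of "2 * e" "s x" "s y"] s_lip[of x y] e by (simp add: h_def)
  moreover have "h x = 0" if "R \<le> norm x" for x
    unfolding h_def using R[OF that] s_ge[of x] s_le[of x] e by (intro soft(3)) auto
  ultimately show ?thesis using L0 by blast
qed

lemma C0_lipschitz_approx:
  fixes g :: "'c::euclidean_space \<Rightarrow> complex"
  assumes cont: "continuous_on UNIV g" and lim: "(g \<longlongrightarrow> 0) at_infinity" and e: "0 < e"
  shows "\<exists>h L R. 0 \<le> L \<and> 0 \<le> R \<and> (\<forall>x. cmod (g x - h x) \<le> e) \<and> (\<forall>x y. cmod (h x - h y) \<le> L * norm (x - y)) \<and> (\<forall>x. R \<le> norm x \<longrightarrow> h x = 0)"
proof -
  have e6: "0 < e / 6" using e by simp
  obtain h1 L1 R1 where h1: "0 \<le> L1" "\<And>x. \<bar>Re (g x) - h1 x\<bar> \<le> 3 * (e / 6)" "\<And>x y. \<bar>h1 x - h1 y\<bar> \<le> L1 * norm (x - y)" "\<And>x. R1 \<le> norm x \<Longrightarrow> h1 x = 0"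
    using C0_lipschitz_approx_real[of "\<lambda>x. Re (g x)", OF continuous_on_Re[OF cont] _ e6] tendsto_Re[OF lim] by auto
  obtain h2 L2 R2 where h2: "0 \<le> L2" "\<And>x. \<bar>Im (g x) - h2 x\<bar> \<le> 3 * (e / 6)" "\<And>x y. \<bar>h2 x - h2 y\<bar> \<le> L2 * norm (x - y)" "\<And>x. R2 \<le> norm x \<Longrightarrow> h2 x = 0"
    using C0_lipschitz_approx_real[of "\<lambda>x. Im (g x)", OF continuous_on_Im[OF cont] _ e6] tendsto_Im[OF lim] by auto
  let ?h = "\<lambda>x. Complex (h1 x) (h2 x)"
  have "cmod (g x - ?h x) \<le> e" for x
    using cmod_le[of "g x - ?h x"] h1(2)[of x] h2(2)[of x] by simp
  moreover have "cmod (?h x - ?h y) \<le> (L1 + L2) * norm (x - y)" for x y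
    using cmod_le[of "?h x - ?h y"] h1(3)[of x y] h2(3)[of x y] by (simp add: distrib_right)
  moreover have "?h x = 0" if "max 0 (max R1 R2) \<le> norm x" for x
    using that h1(4)[of x] h2(4)[of x] by (simp add: Complex_eq_0)
  ultimately show ?thesis
    using h1(1) h2(1) by (intro exI[of _ ?h] exI[of _ "L1 + L2"] exI[of _ "max 0 (max R1 R2)"]) auto
qed

text \<open>At positive scales \<open>z\<close> fails to be in the tent when some point outside
  \<open>\<Omega>\<close> lies in its rectangle. For a fixed point this is an open condition on
  \<open>z\<close>, so a tent is an open set minus an open union, for arbitrary
  \<open>\<Omega>\<close>.\<close>

lemma tent_measurable [measurable]:
  fixes \<Omega> :: "('a::euclidean_space \<times> 'b::euclidean_space) set"
  shows "tent \<Omega> \<in> sets (borel \<Otimes>\<^sub>M borel)"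
proof -
  define N where "N p = {z :: ('a \<times> real) \<times> ('b \<times> real). dist (fst (fst z)) (fst p) < snd (fst z) \<and> dist (fst (snd z)) (snd p) < snd (snd z)}"
    for p :: "'a \<times> 'b"
  have "open (N p)" for p
    unfolding N_def by (intro open_Collect_conj open_Collect_less continuous_intros)
  then have "open (\<Union>p\<in>- \<Omega>. N p)" by blast
  moreover have "open {z :: ('a \<times> real) \<times> ('b \<times> real). 0 < snd (fst z) \<and> 0 < snd (snd z)}"
    by (intro open_Collect_conj open_Collect_less continuous_intros)
  ultimately have "{z. 0 < snd (fst z) \<and> 0 < snd (snd z)} - (\<Union>p\<in>- \<Omega>. N p) \<in> sets borel"
    by (intro sets.Diff borel_open)
  moreover have "z \<in> N p \<longleftrightarrow> p \<in> rect z" for z p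
    by (simp add: N_def rect_def mem_Times_iff)
  then have "{z. 0 < snd (fst z) \<and> 0 < snd (snd z)} - (\<Union>p\<in>- \<Omega>. N p) = tent \<Omega>"
    unfolding tent_eq subset_eq by blast
  ultimately have "tent \<Omega> \<in> sets borel" by simp
  then show ?thesis by (subst borel_prod)
qed

section \<open>Calculus of Carleson bounds\<close>

lemma carleson_bound_mono:
  fixes c :: "('a::euclidean_space \<times> real) \<times> ('b::euclidean_space \<times> real) \<Rightarrow> ennreal"
  assumes "carleson_bound c' A'" "A' \<le> A" "\<And>z. 0 < snd (fst z) \<Longrightarrow> 0 < snd (snd z) \<Longrightarrow> c z \<le> c' z"
  shows "carleson_bound c A"
  unfolding carleson_bound_def
proof (intro allI impI)
  fix \<Omega> :: "('a \<times> 'b) set" assume \<Omega>: "open \<Omega>" "emeasure lborel \<Omega> < \<infinity>"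
  have "(\<integral>\<^sup>+z. (c z)\<^sup>2 * indicator (tent \<Omega>) z \<partial>zmeasure) \<le> (\<integral>\<^sup>+z. (c' z)\<^sup>2 * indicator (tent \<Omega>) z \<partial>zmeasure)"
    using assms(3) by (intro nn_integral_mono) (auto simp: indicator_def tent_eq intro!: power_mono)
  also have "\<dots> \<le> ennreal A' * emeasure lborel \<Omega>" using assms(1) \<Omega> by (simp add: carleson_bound_def)
  also have "\<dots> \<le> ennreal A * emeasure lborel \<Omega>" by (intro mult_right_mono ennreal_leI assms(2)) auto
  finally show "(\<integral>\<^sup>+z. (c z)\<^sup>2 * indicator (tent \<Omega>) z \<partial>zmeasure) \<le> ennreal A * emeasure lborel \<Omega>" .
qed

lemma carleson_bound_add:
  fixes c1 :: "('a::euclidean_space \<times> real) \<times> ('b::euclidean_space \<times> real) \<Rightarrow> ennreal"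
  assumes [measurable]: "c1 \<in> borel_measurable (borel \<Otimes>\<^sub>M borel)" "c2 \<in> borel_measurable (borel \<Otimes>\<^sub>M borel)"
    and "carleson_bound c1 A1" "carleson_bound c2 A2" "0 \<le> A1" "0 \<le> A2"
  shows "carleson_bound (\<lambda>z. c1 z + c2 z) (2 * (A1 + A2))"
  unfolding carleson_bound_def
proof (intro allI impI)
  fix \<Omega> :: "('a \<times> 'b) set" assume \<Omega>: "open \<Omega>" "emeasure lborel \<Omega> < \<infinity>"
  have sq: "(x + y)\<^sup>2 \<le> 2 * (x\<^sup>2 + y\<^sup>2)" for x y :: ennreal
  proof (cases x rule: ennreal_cases; cases y rule: ennreal_cases)
    fix a b assume "x = ennreal a" "y = ennreal b" "0 \<le> a" "0 \<le> b"
    moreover have "(a + b)\<^sup>2 \<le> 2 * (a\<^sup>2 + b\<^sup>2)"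
      using zero_le_power2[of "a - b"] by (simp add: power2_eq_square algebra_simps)
    then have "ennreal ((a + b)\<^sup>2) \<le> ennreal (2 * (a\<^sup>2 + b\<^sup>2))" by (rule ennreal_leI)
    ultimately show ?thesis
      by (simp only: ennreal_power ennreal_plus[symmetric] zero_le_power2 add_nonneg_nonneg)
         (simp add: ennreal_mult')
  qed (simp_all add: power2_eq_square ennreal_mult_top ennreal_top_mult)
  have "(\<integral>\<^sup>+z. (c1 z + c2 z)\<^sup>2 * indicator (tent \<Omega>) z \<partial>zmeasure)
      \<le> (\<integral>\<^sup>+z. 2 * ((c1 z)\<^sup>2 * indicator (tent \<Omega>) z + (c2 z)\<^sup>2 * indicator (tent \<Omega>) z) \<partial>zmeasure)"
    using sq by (intro nn_integral_mono) (auto simp: indicator_def)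
  also have "\<dots> = 2 * ((\<integral>\<^sup>+z. (c1 z)\<^sup>2 * indicator (tent \<Omega>) z \<partial>zmeasure) + (\<integral>\<^sup>+z. (c2 z)\<^sup>2 * indicator (tent \<Omega>) z \<partial>zmeasure))"
    by (subst nn_integral_cmult, measurable) (subst nn_integral_add, auto)
  also have "\<dots> \<le> 2 * (ennreal A1 * emeasure lborel \<Omega> + ennreal A2 * emeasure lborel \<Omega>)"
    using assms(3,4) \<Omega> by (intro mult_left_mono add_mono) (auto simp: carleson_bound_def)
  also have "\<dots> = ennreal (2 * (A1 + A2)) * emeasure lborel \<Omega>"
    using assms(5,6) by (simp add: ennreal_mult distrib_right mult.assoc)
  finally show "(\<integral>\<^sup>+z. (c1 z + c2 z)\<^sup>2 * indicator (tent \<Omega>) z \<partial>zmeasure) \<le> ennreal (2 * (A1 + A2)) * emeasure lborel \<Omega>" .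
qed

text \<open>\<open>carleson\<close> ranges over open sets of positive measure. An open null set is
  empty, and so is its tent, since rectangles of positive scales are nonempty.\<close>

lemma carleson_bound_coef:
  fixes b :: "'a::euclidean_space \<times> 'b::euclidean_space \<Rightarrow> complex"
  assumes "carleson \<psi>1 \<psi>2 b \<le> ennreal A"
  shows "carleson_bound (\<lambda>z. ennreal (cmod (coef \<psi>1 \<psi>2 b z))) A"
  unfolding carleson_bound_def
proof (intro allI impI)
  fix \<Omega> :: "('a \<times> 'b) set" assume \<Omega>: "open \<Omega>" "emeasure lborel \<Omega> < \<infinity>"
  let ?I = "\<integral>\<^sup>+z. (ennreal (cmod (coef \<psi>1 \<psi>2 b z)))\<^sup>2 * indicator (tent \<Omega>) z \<partial>zmeasure"
  show "?I \<le> ennreal A * emeasure lborel \<Omega>"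
  proof (cases "emeasure lborel \<Omega> = 0")
    case True
    have "\<Omega> = {}"
    proof (rule ccontr)
      assume "\<Omega> \<noteq> {}"
      then obtain x r where "0 < r" "ball x r \<subseteq> \<Omega>" using \<Omega>(1) by (meson ex_in_conv open_contains_ball)
      then have "emeasure lborel (ball x r) = 0"
        using True \<Omega>(1) emeasure_mono[of "ball x r" \<Omega> lborel] by simp
      then show False
        using \<open>0 < r\<close> unit_vol_pos[where 'a="'a \<times> 'b"] zero_less_power[OF \<open>0 < r\<close>, of "DIM('a \<times> 'b)"]
        by (simp add: emeasure_lborel_ball ennreal_eq_0_iff mult_le_0_iff not_le[symmetric])
    qed
    then have "tent \<Omega> = {}"
      by (auto simp: tent_eq rect_def subset_empty Times_empty)
    then show ?thesis by simp
  next
    case False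
    have "?I / emeasure lborel \<Omega> \<le> carleson \<psi>1 \<psi>2 b"
      unfolding carleson_def using \<Omega> False
      by (intro SUP_upper2[of \<Omega>]) (auto simp: ennreal_power zero_less_iff_neq_zero)
    then have "?I / emeasure lborel \<Omega> \<le> ennreal A" using assms by simp
    then have "?I / emeasure lborel \<Omega> * emeasure lborel \<Omega> \<le> ennreal A * emeasure lborel \<Omega>"
      by (intro mult_right_mono) auto
    then show ?thesis using False \<Omega>(2) by (simp add: ennreal_divide_times ennreal_times_divide less_top[symmetric] mult_divide_eq_ennreal)
  qed
qed

lemma loc_int_bounded:
  fixes h :: "'c::euclidean_space \<Rightarrow> complex"
  assumes [measurable]: "h \<in> borel_measurable borel" and "\<And>p. cmod (h p) \<le> M"
  shows "loc_int h"
  unfolding loc_int_def set_integrable_def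
proof (intro conjI allI impI)
  fix K :: "'c set" assume K: "compact K"
  then have [measurable]: "K \<in> sets borel" by (simp add: borel_compact)
  have "emeasure lborel K < \<infinity>" using emeasure_compact_finite[OF K] .
  then have "integrable lborel (\<lambda>x. indicator K x * M)"
    by (intro integrable_mult_left integrable_real_indicator) auto
  then show "integrable lborel (\<lambda>x. indicator K x *\<^sub>R h x)"
  proof (rule Bochner_Integration.integrable_bound)
    show "AE x in lborel. norm (indicator K x *\<^sub>R h x) \<le> norm (indicator K x * M)"
    proof (rule AE_I2)
      fix x show "norm (indicator K x *\<^sub>R h x) \<le> norm (indicator K x * M)"
        using assms(2)[of x] by (cases "x \<in> K") auto
    qed
  qed measurable
qed simp

section \<open>Decay of the coefficients at extreme scales\<close>

context mean_zero_bump
begin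

text \<open>Here \<open>w\<close> is the half space point of one variable and \<open>h w\<close> a
  coefficient already taken in that variable, of which only the size \<open>\<kappa>\<close>
  matters. The square function handles the other variable on the section of \<open>\<Omega>\<close>
  through the centre of \<open>w\<close>; integrating over the centres gives the measure of
  \<open>\<Omega>\<close>, and the scale integral is a separate factor.\<close>

lemma section_square_bound:
  fixes h :: "'c::euclidean_space \<times> real \<Rightarrow> 'a \<Rightarrow> complex" and \<Omega> :: "('c \<times> 'a) set"
  assumes [measurable]: "(\<lambda>(w, y). h w y) \<in> borel_measurable (borel \<Otimes>\<^sub>M borel)" "\<Omega> \<in> sets borel" "S \<in> sets borel" "\<kappa> \<in> borel_measurable borel"
    and h: "\<And>w y. 0 < snd w \<Longrightarrow> cmod (h w y) \<le> \<kappa> (snd w)"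
  shows "(\<integral>\<^sup>+w. \<integral>\<^sup>+z. ennreal ((cmod (pairing (\<lambda>y. h w y * indicator \<Omega> (fst w, y)) (wav \<psi> z)))\<^sup>2) * indicator S (snd w) \<partial>hspace \<partial>hspace)
    \<le> ennreal schur_const * (\<integral>\<^sup>+t. indicator {0<..} t * indicator S t * ennreal ((\<kappa> t)\<^sup>2 * t powr (- (real DIM('c) + 1))) \<partial>lborel) * emeasure lborel \<Omega>"
proof -
  define m where "m x = (\<integral>\<^sup>+y. indicator \<Omega> (x, y) \<partial>lborel)" for x
  have [measurable]: "(\<lambda>p. indicator \<Omega> p :: complex) \<in> borel_measurable borel" "(\<lambda>p. indicator \<Omega> p :: ennreal) \<in> borel_measurable borel"
    by measurable
  have [measurable]: "m \<in> borel_measurable borel" unfolding m_def[abs_def] by measurable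
  let ?k = "\<lambda>w y. h w y * indicator \<Omega> (fst w, y)"
  have [measurable]: "(\<lambda>y. ?k w y) \<in> borel_measurable borel" for w
    using measurable_Pair2[OF assms(1), of w] by measurable
  have inner: "(\<integral>\<^sup>+z. ennreal ((cmod (pairing (?k w) (wav \<psi> z)))\<^sup>2) * indicator S (snd w) \<partial>hspace)
      \<le> ennreal schur_const * (ennreal ((\<kappa> (snd w))\<^sup>2) * indicator S (snd w) * m (fst w))" if w: "0 < snd w" for w
  proof -
    have "(\<integral>\<^sup>+z. ennreal ((cmod (pairing (?k w) (wav \<psi> z)))\<^sup>2) * indicator S (snd w) \<partial>hspace)
        = (\<integral>\<^sup>+z. ennreal ((cmod (pairing (?k w) (wav \<psi> z)))\<^sup>2) \<partial>hspace) * indicator S (snd w)"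
      by (rule nn_integral_multc) measurable
    also have "\<dots> \<le> ennreal schur_const * (\<integral>\<^sup>+y. ennreal ((cmod (?k w y))\<^sup>2) \<partial>lborel) * indicator S (snd w)"
      by (intro mult_right_mono square_function_bound) auto
    also have "\<dots> \<le> ennreal schur_const * (\<integral>\<^sup>+y. ennreal ((\<kappa> (snd w))\<^sup>2) * indicator \<Omega> (fst w, y) \<partial>lborel) * indicator S (snd w)"
      using h[OF w] by (intro mult_right_mono mult_left_mono nn_integral_mono)
        (auto simp: indicator_def norm_mult intro!: ennreal_leI power_mono)
    also have "(\<integral>\<^sup>+y. ennreal ((\<kappa> (snd w))\<^sup>2) * indicator \<Omega> (fst w, y) \<partial>lborel) = ennreal ((\<kappa> (snd w))\<^sup>2) * m (fst w)"
      unfolding m_def by (rule nn_integral_cmult) measurable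
    finally show ?thesis by (simp add: ac_simps)
  qed
  have "(\<integral>\<^sup>+w. \<integral>\<^sup>+z. ennreal ((cmod (pairing (?k w) (wav \<psi> z)))\<^sup>2) * indicator S (snd w) \<partial>hspace \<partial>hspace)
      \<le> (\<integral>\<^sup>+w. ennreal schur_const * (ennreal ((\<kappa> (snd w))\<^sup>2) * indicator S (snd w) * m (fst w)) \<partial>hspace)"
    by (rule nn_integral_mono_AE, use AE_hspace in eventually_elim) (rule inner)
  also have "\<dots> = ennreal schur_const * (\<integral>\<^sup>+w. ennreal ((\<kappa> (snd w))\<^sup>2) * indicator S (snd w) * m (fst w) \<partial>hspace)"
    by (rule nn_integral_cmult) measurable
  also have "(\<integral>\<^sup>+w. ennreal ((\<kappa> (snd w))\<^sup>2) * indicator S (snd w) * m (fst w) \<partial>hspace)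
     = (\<integral>\<^sup>+t. \<integral>\<^sup>+x. (indicator {0<..} t * indicator S t * ennreal ((\<kappa> t)\<^sup>2 * t powr (- (real DIM('c) + 1)))) * m x \<partial>lborel \<partial>lborel)"
    by (subst nn_integral_hspace, measurable) (intro nn_integral_cong, auto simp: ennreal_mult ac_simps)
  also have "\<dots> = (\<integral>\<^sup>+t. (indicator {0<..} t * indicator S t * ennreal ((\<kappa> t)\<^sup>2 * t powr (- (real DIM('c) + 1)))) * (\<integral>\<^sup>+x. m x \<partial>lborel) \<partial>lborel)"
    by (intro nn_integral_cong nn_integral_cmult) measurable
  also have "\<dots> = (\<integral>\<^sup>+t. indicator {0<..} t * indicator S t * ennreal ((\<kappa> t)\<^sup>2 * t powr (- (real DIM('c) + 1))) \<partial>lborel) * (\<integral>\<^sup>+x. m x \<partial>lborel)"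
    by (rule nn_integral_multc) measurable
  also have "(\<integral>\<^sup>+x. m x \<partial>lborel) = emeasure lborel \<Omega>"
    unfolding m_def using nn_integral_lborel_pair(1)[of "indicator \<Omega>"] by simp
  finally show ?thesis by (simp add: mult.assoc)
qed

text \<open>Mean zero allows subtracting \<open>k x\<close>; the Lipschitz bound then gains one
  power of the scale over the size t^(n/2) of the coefficients of a bounded function.\<close>

lemma pairing_wav_small_scale:
  fixes k :: "'a \<Rightarrow> complex"
  assumes [measurable]: "k \<in> borel_measurable borel" and M: "\<And>y. cmod (k y) \<le> M"
    and L: "\<And>y y'. cmod (k y - k y') \<le> L * norm (y - y')" and L0: "0 \<le> L" and t: "0 < t"
  shows "cmod (pairing k (wav \<psi> (x, t))) \<le> L * B * measure lborel (ball (0::'a) 1) * t powr (1 + real DIM('a) / 2)"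
proof -
  let ?n = "real DIM('a)" and ?w = "measure lborel (ball (0::'a) 1)"
  let ?c = "L * t * (t powr (- ?n / 2) * B)"
  have B: "1 \<le> B" using bumpD(2)[OF bump] .
  have wint: "integrable lborel (wav \<psi> (x, t))"
  proof (rule integrableI_bounded)
    have "(\<integral>\<^sup>+y. ennreal (norm (wav \<psi> (x, t) y)) \<partial>lborel) \<le> (\<integral>\<^sup>+y. ennreal (t powr (- ?n / 2) * B) * indicator (ball x t) y \<partial>lborel)"
      using wav_bound[OF bump t, of x] by (intro nn_integral_mono ennreal_le_indicator) (simp add: mult.assoc)
    also have "\<dots> < \<infinity>"
      using emeasure_lborel_ball_finite[of x t] by (simp add: nn_integral_cmult_indicator ennreal_mult_less_top)
    finally show "(\<integral>\<^sup>+y. ennreal (norm (wav \<psi> (x, t) y)) \<partial>lborel) < \<infinity>" .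
  qed measurable
  have kint: "integrable lborel (\<lambda>y. k y * wav \<psi> (x, t) y)"
  proof (rule Bochner_Integration.integrable_bound)
    show "integrable lborel (\<lambda>y. M * norm (wav \<psi> (x, t) y))" using wint by auto
    show "AE y in lborel. norm (k y * wav \<psi> (x, t) y) \<le> norm (M * norm (wav \<psi> (x, t) y))"
      using M by (auto simp: norm_mult abs_mult intro!: mult_right_mono order_trans[OF _ abs_ge_self] always_eventually)
  qed measurable
  have "pairing k (wav \<psi> (x, t)) = (\<integral>y. (k y - k x) * wav \<psi> (x, t) y \<partial>lborel)"
    unfolding pairing_def left_diff_distrib using wint kint integral_wav_\<psi>[OF t]
    by (subst Bochner_Integration.integral_diff) auto
  also have "ennreal (cmod \<dots>) \<le> (\<integral>\<^sup>+y. ennreal (cmod ((k y - k x) * wav \<psi> (x, t) y)) \<partial>lborel)"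
    by (rule ennreal_norm_integral_le)
  also have "\<dots> \<le> (\<integral>\<^sup>+y. ennreal ?c * indicator (ball x t) y \<partial>lborel)"
  proof (intro nn_integral_mono ennreal_le_indicator)
    fix y
    show "cmod ((k y - k x) * wav \<psi> (x, t) y) \<le> ?c * indicator (ball x t) y"
    proof (cases "y \<in> ball x t")
      case True
      then have "norm (y - x) \<le> t" by (simp add: dist_norm norm_minus_commute)
      then have "cmod (k y - k x) \<le> L * t" using L[of y x] mult_left_mono[OF _ L0] by (meson order_trans)
      then show ?thesis
        using wav_bound[OF bump t, of x y] True B L0 t unfolding norm_mult by (auto intro!: mult_mono)
    next
      case False
      then show ?thesis using wav_bound[OF bump t, of x y] by simp
    qed
  qed
  also have "\<dots> = ennreal ?c * ennreal (t ^ DIM('a) * ?w)"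
    using t by (simp add: nn_integral_cmult_indicator emeasure_lborel_ball)
  also have "\<dots> = ennreal (?c * (t ^ DIM('a) * ?w))"
    using t B L0 by (intro ennreal_mult[symmetric]) auto
  also have "?c * (t ^ DIM('a) * ?w) = L * B * ?w * (t * (t powr (- ?n / 2) * t ^ DIM('a)))"
    by (simp only: ac_simps)
  also have "t * (t powr (- ?n / 2) * t ^ DIM('a)) = t powr (1 + ?n / 2)"
    using t by (simp add: powr_realpow[symmetric] powr_add[symmetric]) (simp add: powr_add)
  finally show ?thesis using B L0 by simp
qed

text \<open>The wavelet is spread out: its height t^(-n/2) multiplies the volume of the fixed ball
  that supports \<open>k\<close>.\<close>

lemma pairing_wav_large_scale:
  fixes k :: "'a \<Rightarrow> complex"
  assumes M: "\<And>y. cmod (k y) \<le> M" and supp: "\<And>y. R \<le> norm y \<Longrightarrow> k y = 0" and R: "0 \<le> R" and t: "0 < t"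
  shows "cmod (pairing k (wav \<psi> (x, t))) \<le> M * B * (R ^ DIM('a) * measure lborel (ball (0::'a) 1)) * t powr (- real DIM('a) / 2)"
proof -
  let ?n = "real DIM('a)" and ?w = "measure lborel (ball (0::'a) 1)"
  let ?c = "M * (t powr (- ?n / 2) * B)"
  have B: "1 \<le> B" using bumpD(2)[OF bump] .
  have M0: "0 \<le> M" using order_trans[OF norm_ge_zero M] .
  have "ennreal (cmod (pairing k (wav \<psi> (x, t)))) \<le> (\<integral>\<^sup>+y. ennreal (cmod (k y * wav \<psi> (x, t) y)) \<partial>lborel)"
    unfolding pairing_def by (rule ennreal_norm_integral_le)
  also have "\<dots> \<le> (\<integral>\<^sup>+y. ennreal ?c * indicator (ball (0::'a) R) y \<partial>lborel)"
  proof (intro nn_integral_mono ennreal_le_indicator)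
    fix y
    have w: "cmod (wav \<psi> (x, t) y) \<le> t powr (- ?n / 2) * B"
      using wav_bound[OF bump t, of x y] B by (auto simp: indicator_def split: if_splits intro: order_trans)
    show "cmod (k y * wav \<psi> (x, t) y) \<le> ?c * indicator (ball 0 R) y"
    proof (cases "R \<le> norm y")
      case True
      then show ?thesis using supp[OF True] by simp
    next
      case False
      then show ?thesis using mult_mono[OF M w M0 norm_ge_zero] by (simp add: norm_mult)
    qed
  qed
  also have "\<dots> = ennreal ?c * ennreal (R ^ DIM('a) * ?w)"
    using R by (simp add: nn_integral_cmult_indicator emeasure_lborel_ball)
  also have "\<dots> = ennreal (?c * (R ^ DIM('a) * ?w))"
    using R B M0 by (intro ennreal_mult[symmetric]) auto
  finally have "cmod (pairing k (wav \<psi> (x, t))) \<le> ?c * (R ^ DIM('a) * ?w)"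
    using B M0 R by simp
  then show ?thesis by (simp only: ac_simps)
qed

end

text \<open>Nonpositive numbers are included, so that for positive \<open>N\<close> everything
  outside this set is a positive scale.\<close>

definition extreme_scales :: "real \<Rightarrow> real set" where
  "extreme_scales N = {t. t \<le> 1 / N \<or> N \<le> t}"

lemma extreme_scales_measurable [measurable]: "extreme_scales N \<in> sets borel"
  unfolding extreme_scales_def by measurable

text \<open>Under the weight t^(-n-1) the square of \<open>\<kappa>\<close> is K1^2 t at small
  scales and K2^2 t^(-2n-1) at large ones, hence at most K1^2 and K2^2/t^2. Each of the two ranges
  integrates to a multiple of 1/N.\<close>

lemma extreme_scales_integral:
  assumes N: "1 \<le> N" and n: "1 \<le> n" and K: "0 \<le> K1" "0 \<le> K2"
    and \<kappa>_def: "\<And>t. \<kappa> t = (if t < 1 then K1 * t powr (1 + real n / 2) else K2 * t powr (- real n / 2))"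
  shows "(\<integral>\<^sup>+t. indicator {0<..} t * indicator (extreme_scales N) t * ennreal ((\<kappa> t)\<^sup>2 * t powr (- (real n + 1))) \<partial>lborel)
    \<le> ennreal ((K1\<^sup>2 + K2\<^sup>2) / N)"
proof -
  have "(\<integral>\<^sup>+t. indicator {0<..} t * indicator (extreme_scales N) t * ennreal ((\<kappa> t)\<^sup>2 * t powr (- (real n + 1))) \<partial>lborel)
      \<le> (\<integral>\<^sup>+t. ennreal (K1\<^sup>2) * indicator {0..1/N} t + ennreal (K2\<^sup>2) * (ennreal (1 / t\<^sup>2) * indicator {N..} t) \<partial>lborel)"
  proof (rule nn_integral_mono)
    fix t :: real
    show "indicator {0<..} t * indicator (extreme_scales N) t * ennreal ((\<kappa> t)\<^sup>2 * t powr (- (real n + 1)))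
        \<le> ennreal (K1\<^sup>2) * indicator {0..1/N} t + ennreal (K2\<^sup>2) * (ennreal (1 / t\<^sup>2) * indicator {N..} t)"
    proof (cases "0 < t \<and> t \<in> extreme_scales N")
      case True
      show ?thesis
      proof (cases "t < 1")
        case t1: True
        then have "t \<le> 1 / N" using True N by (auto simp: extreme_scales_def)
        have "(\<kappa> t)\<^sup>2 * t powr (- (real n + 1)) = K1\<^sup>2 * ((t powr (1 + real n / 2))\<^sup>2 * t powr (- (real n + 1)))"
          using t1 by (simp add: \<kappa>_def power_mult_distrib)
        also have "(t powr (1 + real n / 2))\<^sup>2 * t powr (- (real n + 1)) = t"
          using True by (simp add: power2_eq_square powr_add[symmetric])
        finally have "(\<kappa> t)\<^sup>2 * t powr (- (real n + 1)) = K1\<^sup>2 * t" .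
        also have "\<dots> \<le> K1\<^sup>2" using t1 by (simp add: mult_left_le)
        finally have "ennreal ((\<kappa> t)\<^sup>2 * t powr (- (real n + 1))) \<le> ennreal (K1\<^sup>2)" by (rule ennreal_leI)
        then show ?thesis using True \<open>t \<le> 1 / N\<close> by (simp add: add_increasing2)
      next
        case False
        \<comment> \<open>As \<open>1 \<le> t\<close>, the alternative \<open>t \<le> 1 / N\<close>
          is possible only for \<open>N = 1\<close>, where the claim holds anyway.\<close>
        have "N \<le> t"
        proof (rule ccontr)
          assume "\<not> N \<le> t"
          then have "t \<le> 1 / N" using True by (auto simp: extreme_scales_def)
          moreover have "1 / N < 1" using N False \<open>\<not> N \<le> t\<close> by simp
          ultimately show False using False by linarith
        qed
        have "(\<kappa> t)\<^sup>2 * t powr (- (real n + 1)) = K2\<^sup>2 * ((t powr (- real n / 2))\<^sup>2 * t powr (- (real n + 1)))"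
          using False by (simp add: \<kappa>_def power_mult_distrib)
        also have "(t powr (- real n / 2))\<^sup>2 * t powr (- (real n + 1)) = t powr (- (2 * real n + 1))"
          using True by (simp add: power2_eq_square powr_add[symmetric])
        also have "\<dots> \<le> t powr (-2)" using False n by (intro powr_mono) auto
        also have "\<dots> = 1 / t\<^sup>2" using True by (simp add: powr_minus_divide)
        finally have "(\<kappa> t)\<^sup>2 * t powr (- (real n + 1)) \<le> K2\<^sup>2 * (1 / t\<^sup>2)" by (simp add: mult_left_mono)
        then have "ennreal ((\<kappa> t)\<^sup>2 * t powr (- (real n + 1))) \<le> ennreal (K2\<^sup>2) * ennreal (1 / t\<^sup>2)"
          by (simp add: ennreal_mult[symmetric] ennreal_leI)
        then show ?thesis using True \<open>N \<le> t\<close> by (simp add: add_increasing)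
      qed
    qed (auto simp: indicator_def)
  qed
  also have "\<dots> = ennreal (K1\<^sup>2) * ennreal (1 / N) + ennreal (K2\<^sup>2) * (\<integral>\<^sup>+t. ennreal (1 / t\<^sup>2) * indicator {N..} t \<partial>lborel)"
    using N by (subst nn_integral_add, measurable) (simp add: nn_integral_cmult nn_integral_cmult_indicator)
  also have "(\<integral>\<^sup>+t. ennreal (1 / t\<^sup>2) * indicator {N..} t \<partial>lborel) = ennreal (0 - (- 1 / N))"
  proof (rule nn_integral_FTC_atLeast[where F = "\<lambda>t. - 1 / t"])
    show "DERIV (\<lambda>t. - 1 / t) t :> 1 / t\<^sup>2" if "N \<le> t" for t :: real
      using that N by (auto intro!: derivative_eq_intros simp: power2_eq_square)
    show "((\<lambda>t::real. - 1 / t) \<longlongrightarrow> 0) at_top"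
      by (rule real_tendsto_divide_at_top[OF tendsto_const filterlim_ident])
  qed auto
  also have "ennreal (K1\<^sup>2) * ennreal (1 / N) + ennreal (K2\<^sup>2) * ennreal (0 - (- 1 / N)) = ennreal (K1\<^sup>2 * (1 / N)) + ennreal (K2\<^sup>2 * (1 / N))"
    using N by (simp add: ennreal_mult[symmetric])
  also have "\<dots> = ennreal (K1\<^sup>2 * (1 / N) + K2\<^sup>2 * (1 / N))"
    using N by (intro ennreal_plus[symmetric]) auto
  also have "K1\<^sup>2 * (1 / N) + K2\<^sup>2 * (1 / N) = (K1\<^sup>2 + K2\<^sup>2) / N"
    by (simp add: add_divide_distrib)
  finally show ?thesis .
qed

context wavelet_system
begin

lemma wav_wav_bound:
  assumes "0 < snd (fst z)" "0 < snd (snd z)"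
  shows "cmod (tens (wav \<psi>1 (fst z)) (wav \<psi>2 (snd z)) p)
    \<le> (snd (fst z) powr (- real DIM('a) / 2) * B1) * (snd (snd z) powr (- real DIM('b) / 2) * B2) * indicator (rect z) p"
proof -
  have B: "1 \<le> B1" "1 \<le> B2" using bumpD(2)[OF m1.bump] bumpD(2)[OF m2.bump] by auto
  have "cmod (tens (wav \<psi>1 (fst z)) (wav \<psi>2 (snd z)) p)
      \<le> (snd (fst z) powr (- real DIM('a) / 2) * (B1 * indicator (ball (fst (fst z)) (1 * snd (fst z))) (fst p)))
        * (snd (snd z) powr (- real DIM('b) / 2) * (B2 * indicator (ball (fst (snd z)) (1 * snd (snd z))) (snd p)))"
    unfolding tens_def norm_mult
    using wav_bound[OF m1.bump assms(1), of "fst (fst z)" "fst p"] wav_bound[OF m2.bump assms(2), of "fst (snd z)" "snd p"] B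
    by (intro mult_mono) auto
  also have "\<dots> = (snd (fst z) powr (- real DIM('a) / 2) * B1) * (snd (snd z) powr (- real DIM('b) / 2) * B2) * indicator (rect z) p"
    by (cases p) (simp add: rect_def indicator_times)
  finally show ?thesis .
qed

lemma wav_wav_supp:
  assumes "0 < snd (fst z)" "0 < snd (snd z)" "p \<notin> rect z"
  shows "tens (wav \<psi>1 (fst z)) (wav \<psi>2 (snd z)) p = 0"
  using wav_wav_bound[OF assms(1,2), of p] assms(3) by simp

lemma loc_int_integrable:
  fixes b :: "'a \<times> 'b \<Rightarrow> complex"
  assumes b: "loc_int b" and z: "0 < snd (fst z)" "0 < snd (snd z)"
  shows "integrable lborel (\<lambda>p. b p * tens (wav \<psi>1 (fst z)) (wav \<psi>2 (snd z)) p)"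
proof -
  let ?K = "cball (fst (fst z)) (snd (fst z)) \<times> cball (fst (snd z)) (snd (snd z))"
  let ?C = "(snd (fst z) powr (- real DIM('a) / 2) * B1) * (snd (snd z) powr (- real DIM('b) / 2) * B2)"
  have [measurable]: "b \<in> borel_measurable borel" using b by (simp add: loc_int_def)
  have K: "compact ?K" by (intro compact_Times compact_cball)
  then have int: "integrable lborel (\<lambda>p. indicator ?K p *\<^sub>R b p)"
    using b by (simp add: loc_int_def set_integrable_def)
  show ?thesis
  proof (rule Bochner_Integration.integrable_bound)
    show "integrable lborel (\<lambda>p. ?C * norm (indicator ?K p *\<^sub>R b p))" using integrable_norm[OF int] by (intro integrable_mult_right)
    show "AE p in lborel. norm (b p * tens (wav \<psi>1 (fst z)) (wav \<psi>2 (snd z)) p) \<le> norm (?C * norm (indicator ?K p *\<^sub>R b p))"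
    proof (rule AE_I2)
      fix p
      show "norm (b p * tens (wav \<psi>1 (fst z)) (wav \<psi>2 (snd z)) p) \<le> norm (?C * norm (indicator ?K p *\<^sub>R b p))"
      proof (cases "p \<in> rect z")
        case True
        then have "p \<in> ?K" by (auto simp: rect_def)
        have "cmod (tens (wav \<psi>1 (fst z)) (wav \<psi>2 (snd z)) p) \<le> \<bar>?C\<bar>"
          using wav_wav_bound[OF z, of p] True by (auto intro: order_trans[OF _ abs_ge_self])
        then have "norm (b p * tens (wav \<psi>1 (fst z)) (wav \<psi>2 (snd z)) p) \<le> cmod (b p) * \<bar>?C\<bar>"
          unfolding norm_mult by (intro mult_left_mono) auto
        also have "\<dots> = norm (?C * norm (indicator ?K p *\<^sub>R b p))"
          using \<open>p \<in> ?K\<close> by (simp only: indicator_simps scaleR_one real_norm_def abs_mult abs_norm_cancel mult.commute)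
        finally show ?thesis .
      next
        case False
        then show ?thesis using wav_wav_supp[OF z False] by simp
      qed
    qed
  qed measurable
qed

text \<open>Additivity asks for coefficients that are genuine integrals; local integrability and the
  bounded support of the wavelets provide this at positive scales.\<close>

lemma coef_diff:
  assumes "loc_int f" "loc_int g" "0 < snd (fst z)" "0 < snd (snd z)"
  shows "coef \<psi>1 \<psi>2 (\<lambda>p. f p - g p) z = coef \<psi>1 \<psi>2 f z - coef \<psi>1 \<psi>2 g z"
  unfolding coef_def pairing_def using loc_int_integrable[OF assms(1,3,4)] loc_int_integrable[OF assms(2,3,4)]
  by (simp add: left_diff_distrib)

lemma coef_measurable [measurable]:
  assumes "b \<in> borel_measurable borel"
  shows "coef \<psi>1 \<psi>2 b \<in> borel_measurable (borel \<Otimes>\<^sub>M borel)"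
  using pairing_tens_measurable(1)[OF assms] by (simp add: coef_def[abs_def])

text \<open>Bounded functions are in product BMO: for \<open>z\<close> in the tent the wavelet lives
  inside \<open>\<Omega>\<close>, so \<open>h\<close> may be cut off to \<open>\<Omega>\<close> and
  the square function bound applies to the result, which is in \<open>L2\<close>.\<close>

lemma carleson_bound_bounded:
  fixes h :: "'a \<times> 'b \<Rightarrow> complex"
  assumes [measurable]: "h \<in> borel_measurable borel" and M: "\<And>p. cmod (h p) \<le> M"
  shows "carleson_bound (\<lambda>z. ennreal (cmod (coef \<psi>1 \<psi>2 h z))) (S1 * S2 * M\<^sup>2)"
  unfolding carleson_bound_def
proof (intro allI impI)
  fix \<Omega> :: "('a \<times> 'b) set" assume \<Omega>: "open \<Omega>" "emeasure lborel \<Omega> < \<infinity>"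
  then have [measurable]: "\<Omega> \<in> sets borel" by simp
  let ?k = "\<lambda>p. h p * indicator \<Omega> p"
  have [measurable]: "?k \<in> borel_measurable borel" by measurable
  have "(\<integral>\<^sup>+p. ennreal ((cmod (?k p))\<^sup>2) \<partial>lborel) \<le> (\<integral>\<^sup>+p. ennreal (M\<^sup>2) * indicator \<Omega> p \<partial>lborel)"
    using M by (intro nn_integral_mono) (auto simp: indicator_def norm_mult intro!: ennreal_leI power_mono)
  also have "\<dots> = ennreal (M\<^sup>2) * emeasure lborel \<Omega>"
    by (rule nn_integral_cmult_indicator) simp
  finally have k_le: "(\<integral>\<^sup>+p. ennreal ((cmod (?k p))\<^sup>2) \<partial>lborel) \<le> ennreal (M\<^sup>2) * emeasure lborel \<Omega>" .
  then have k: "?k \<in> L2"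
    using \<Omega>(2) by (intro L2I) (auto intro: order_le_less_trans simp: ennreal_mult_less_top)
  have "(\<integral>\<^sup>+z. (ennreal (cmod (coef \<psi>1 \<psi>2 h z)))\<^sup>2 * indicator (tent \<Omega>) z \<partial>zmeasure)
      \<le> (\<integral>\<^sup>+z. ennreal ((cmod (pairing ?k (tens (wav \<psi>1 (fst z)) (wav \<psi>2 (snd z)))))\<^sup>2) \<partial>zmeasure)"
  proof (rule nn_integral_mono)
    fix z :: "('a \<times> real) \<times> ('b \<times> real)"
    show "(ennreal (cmod (coef \<psi>1 \<psi>2 h z)))\<^sup>2 * indicator (tent \<Omega>) z
        \<le> ennreal ((cmod (pairing ?k (tens (wav \<psi>1 (fst z)) (wav \<psi>2 (snd z)))))\<^sup>2)"
    proof (cases "z \<in> tent \<Omega>")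
      case True
      have "h p * tens (wav \<psi>1 (fst z)) (wav \<psi>2 (snd z)) p = ?k p * tens (wav \<psi>1 (fst z)) (wav \<psi>2 (snd z)) p" for p
        using True wav_wav_supp[of z p] by (cases "p \<in> rect z") (auto simp: tent_eq)
      then have "coef \<psi>1 \<psi>2 h z = pairing ?k (tens (wav \<psi>1 (fst z)) (wav \<psi>2 (snd z)))"
        unfolding coef_def pairing_def by presburger
      then show ?thesis using True by (simp add: ennreal_power)
    qed simp
  qed
  also have "\<dots> \<le> ennreal (S1 * S2 * (L2norm ?k)\<^sup>2)" by (rule wav_wav_L2[OF k])
  also have "\<dots> = ennreal (S1 * S2) * (\<integral>\<^sup>+p. ennreal ((cmod (?k p))\<^sup>2) \<partial>lborel)"
    using S_pos by (simp add: nn_integral_L2[OF k] ennreal_mult)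
  also have "\<dots> \<le> ennreal (S1 * S2) * (ennreal (M\<^sup>2) * emeasure lborel \<Omega>)"
    by (intro mult_left_mono k_le) auto
  also have "\<dots> = ennreal (S1 * S2 * M\<^sup>2) * emeasure lborel \<Omega>"
    using S_pos by (simp add: ennreal_mult mult.assoc)
  finally show "(\<integral>\<^sup>+z. (ennreal (cmod (coef \<psi>1 \<psi>2 h z)))\<^sup>2 * indicator (tent \<Omega>) z \<partial>zmeasure)
      \<le> ennreal (S1 * S2 * M\<^sup>2) * emeasure lborel \<Omega>" .
qed

text \<open>Extreme scales in one variable suffice for a Carleson constant of order 1/N. The
  coefficient is first taken in that variable, where its size decays, and the square function in the
  other variable supplies the measure of \<open>\<Omega>\<close>.\<close>

lemma carleson_bound_extreme_scales:
  fixes g :: "'a \<times> 'b \<Rightarrow> complex"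
  assumes [measurable]: "g \<in> borel_measurable borel" and M: "\<And>p. cmod (g p) \<le> M"
    and L: "\<And>p q. cmod (g p - g q) \<le> L * norm (p - q)" and R: "\<And>p. R \<le> norm p \<Longrightarrow> g p = 0"
    and L0: "0 \<le> L" and R0: "0 \<le> R"
  obtains A where "0 \<le> A"
    and "\<And>N. 1 \<le> N \<Longrightarrow> carleson_bound (\<lambda>z. ennreal (cmod (coef \<psi>1 \<psi>2 g z)) * indicator (extreme_scales N) (snd (fst z))) (A / N)"
    and "\<And>N. 1 \<le> N \<Longrightarrow> carleson_bound (\<lambda>z. ennreal (cmod (coef \<psi>1 \<psi>2 g z)) * indicator (extreme_scales N) (snd (snd z))) (A / N)"
proof -
  have M0: "0 \<le> M" using order_trans[OF norm_ge_zero M] .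
  have g_loc: "loc_int g" by (rule loc_int_bounded[OF assms(1) M])
  have B: "1 \<le> B1" "1 \<le> B2" using bumpD(2)[OF m1.bump] bumpD(2)[OF m2.bump] by auto
  define K1 where "K1 = L * B1 * v1"
  define K2 where "K2 = M * B1 * (R ^ DIM('a) * v1)"
  define J1 where "J1 = L * B2 * v2"
  define J2 where "J2 = M * B2 * (R ^ DIM('b) * v2)"
  have K0: "0 \<le> K1" "0 \<le> K2" "0 \<le> J1" "0 \<le> J2"
    using M0 L0 R0 B by (auto simp: K1_def K2_def J1_def J2_def v1_def v2_def)
  \<comment> \<open>Below scale 1 the Lipschitz bound with mean zero is used, from scale 1 on the
    bounded support.\<close>
  define \<kappa>1 where "\<kappa>1 t = (if t < 1 then K1 * t powr (1 + real DIM('a) / 2) else K2 * t powr (- real DIM('a) / 2))" for t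
  define \<kappa>2 where "\<kappa>2 t = (if t < 1 then J1 * t powr (1 + real DIM('b) / 2) else J2 * t powr (- real DIM('b) / 2))" for t
  have [measurable]: "\<kappa>1 \<in> borel_measurable borel" "\<kappa>2 \<in> borel_measurable borel"
    unfolding \<kappa>1_def[abs_def] \<kappa>2_def[abs_def] by measurable
  define h1 where "h1 w y = pairing (\<lambda>y1. g (y1, y)) (wav \<psi>1 w)" for w y
  define h2 where "h2 w y = pairing (\<lambda>y2. g (y, y2)) (wav \<psi>2 w)" for w y
  have [measurable]: "(\<lambda>(w, y). h1 w y) \<in> borel_measurable (borel \<Otimes>\<^sub>M borel)"
    unfolding h1_def[abs_def] by measurable
  have [measurable]: "(\<lambda>(w, y). h2 w y) \<in> borel_measurable (borel \<Otimes>\<^sub>M borel)"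
    unfolding h2_def[abs_def] by measurable
  have norm_fst: "norm (p::'a) \<le> norm (p, q::'b)" and norm_snd: "norm (q::'b) \<le> norm (p::'a, q)" for p q
    using norm_fst_le[of p q] norm_snd_le[of q p] by auto
  have h1: "cmod (h1 w y) \<le> \<kappa>1 (snd w)" if w: "0 < snd w" for w y
  proof (cases w)
    case (Pair x t)
    have t: "0 < t" using w Pair by simp
    have "cmod (h1 w y) \<le> L * B1 * measure lborel (ball (0::'a) 1) * t powr (1 + real DIM('a) / 2)"
      unfolding h1_def Pair
    proof (rule m1.pairing_wav_small_scale[OF _ M _ L0 t])
      show "cmod (g (u, y) - g (u', y)) \<le> L * norm (u - u')" for u u'
        using L[of "(u, y)" "(u', y)"] by simp
    qed measurable
    moreover have "cmod (h1 w y) \<le> M * B1 * (R ^ DIM('a) * measure lborel (ball (0::'a) 1)) * t powr (- real DIM('a) / 2)"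
      unfolding h1_def Pair
    proof (rule m1.pairing_wav_large_scale[OF M _ R0 t])
      show "g (u, y) = 0" if "R \<le> norm u" for u
        using R[of "(u, y)"] that norm_fst[of u y] by simp
    qed
    ultimately show ?thesis by (simp add: \<kappa>1_def K1_def K2_def v1_def Pair)
  qed
  have h2: "cmod (h2 w y) \<le> \<kappa>2 (snd w)" if w: "0 < snd w" for w y
  proof (cases w)
    case (Pair x t)
    have t: "0 < t" using w Pair by simp
    have "cmod (h2 w y) \<le> L * B2 * measure lborel (ball (0::'b) 1) * t powr (1 + real DIM('b) / 2)"
      unfolding h2_def Pair
    proof (rule m2.pairing_wav_small_scale[OF _ M _ L0 t])
      show "cmod (g (y, u) - g (y, u')) \<le> L * norm (u - u')" for u u'
        using L[of "(y, u)" "(y, u')"] by simp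
    qed measurable
    moreover have "cmod (h2 w y) \<le> M * B2 * (R ^ DIM('b) * measure lborel (ball (0::'b) 1)) * t powr (- real DIM('b) / 2)"
      unfolding h2_def Pair
    proof (rule m2.pairing_wav_large_scale[OF M _ R0 t])
      show "g (y, u) = 0" if "R \<le> norm u" for u
        using R[of "(y, u)"] that norm_snd[of u y] by simp
    qed
    ultimately show ?thesis by (simp add: \<kappa>2_def J1_def J2_def v2_def Pair)
  qed
  define A where "A = max (S2 * (K1\<^sup>2 + K2\<^sup>2)) (S1 * (J1\<^sup>2 + J2\<^sup>2))"
  have A0: "0 \<le> A" using S_pos by (simp add: A_def le_max_iff_disj)
  show ?thesis
  proof (rule that[OF A0])
    fix N :: real assume N: "1 \<le> N"
    have A_ge: "S2 * ((K1\<^sup>2 + K2\<^sup>2) / N) \<le> A / N" "S1 * ((J1\<^sup>2 + J2\<^sup>2) / N) \<le> A / N"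
      using N by (auto simp: A_def divide_right_mono)
    show "carleson_bound (\<lambda>z. ennreal (cmod (coef \<psi>1 \<psi>2 g z)) * indicator (extreme_scales N) (snd (fst z))) (A / N)"
      unfolding carleson_bound_def
    proof (intro allI impI)
      fix \<Omega> :: "('a \<times> 'b) set" assume \<Omega>: "open \<Omega>" "emeasure lborel \<Omega> < \<infinity>"
      then have [measurable]: "\<Omega> \<in> sets borel" by simp
      let ?D = "\<lambda>w z. ennreal ((cmod (pairing (\<lambda>y. h1 w y * indicator \<Omega> (fst w, y)) (wav \<psi>2 z)))\<^sup>2) * indicator (extreme_scales N) (snd w)"
      have [measurable]: "(\<lambda>p. indicator \<Omega> p :: complex) \<in> borel_measurable borel" by measurable
      have "(\<integral>\<^sup>+z. (ennreal (cmod (coef \<psi>1 \<psi>2 g z)) * indicator (extreme_scales N) (snd (fst z)))\<^sup>2 * indicator (tent \<Omega>) z \<partial>zmeasure)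
          \<le> (\<integral>\<^sup>+z. ?D (fst z) (snd z) \<partial>zmeasure)"
      proof (rule nn_integral_mono)
        fix z :: "('a \<times> real) \<times> ('b \<times> real)"
        show "(ennreal (cmod (coef \<psi>1 \<psi>2 g z)) * indicator (extreme_scales N) (snd (fst z)))\<^sup>2 * indicator (tent \<Omega>) z \<le> ?D (fst z) (snd z)"
        proof (cases "z \<in> tent \<Omega>")
          case True
          then have z: "0 < snd (fst z)" "0 < snd (snd z)" "rect z \<subseteq> \<Omega>" by (auto simp: tent_eq)
          \<comment> \<open>The slice through the centre \<open>fst (fst z)\<close> of the rectangle
            lies in \<open>\<Omega>\<close>, so inserting the indicator changes nothing.\<close>
          have "h1 (fst z) y * wav \<psi>2 (snd z) y = h1 (fst z) y * indicator \<Omega> (fst (fst z), y) * wav \<psi>2 (snd z) y" for y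
          proof (cases "y \<in> ball (fst (snd z)) (snd (snd z))")
            case True
            then have "(fst (fst z), y) \<in> \<Omega>" using z by (auto simp: rect_def)
            then show ?thesis by simp
          next
            case False
            then show ?thesis using wav_bound[OF m2.bump z(2), of "fst (snd z)" y] by simp
          qed
          then have "coef \<psi>1 \<psi>2 g z = pairing (\<lambda>y. h1 (fst z) y * indicator \<Omega> (fst (fst z), y)) (wav \<psi>2 (snd z))"
            unfolding coef_def pairing_tens(1)[OF loc_int_integrable[OF g_loc z(1,2)]] h1_def[symmetric]
            unfolding pairing_def by presburger
          then show ?thesis using True by (simp add: ennreal_power power_mult_distrib indicator_def)
        qed simp
      qed
      also have "\<dots> = (\<integral>\<^sup>+w. \<integral>\<^sup>+z. ?D w z \<partial>hspace \<partial>hspace)"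
        by (subst nn_integral_zmeasure(1)) auto
      also have "\<dots> \<le> ennreal S2 * (\<integral>\<^sup>+t. indicator {0<..} t * indicator (extreme_scales N) t * ennreal ((\<kappa>1 t)\<^sup>2 * t powr (- (real DIM('a) + 1))) \<partial>lborel) * emeasure lborel \<Omega>"
        unfolding S2_def using h1 by (intro m2.section_square_bound) auto
      also have "\<dots> \<le> ennreal S2 * ennreal ((K1\<^sup>2 + K2\<^sup>2) / N) * emeasure lborel \<Omega>"
        by (intro mult_right_mono mult_left_mono extreme_scales_integral[OF N _ K0(1,2) \<kappa>1_def]) auto
      also have "\<dots> = ennreal (S2 * ((K1\<^sup>2 + K2\<^sup>2) / N)) * emeasure lborel \<Omega>"
        using S_pos N by (subst ennreal_mult) auto
      also have "\<dots> \<le> ennreal (A / N) * emeasure lborel \<Omega>"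
        by (intro mult_right_mono ennreal_leI A_ge) auto
      finally show "(\<integral>\<^sup>+z. (ennreal (cmod (coef \<psi>1 \<psi>2 g z)) * indicator (extreme_scales N) (snd (fst z)))\<^sup>2 * indicator (tent \<Omega>) z \<partial>zmeasure)
          \<le> ennreal (A / N) * emeasure lborel \<Omega>" .
    qed
    show "carleson_bound (\<lambda>z. ennreal (cmod (coef \<psi>1 \<psi>2 g z)) * indicator (extreme_scales N) (snd (snd z))) (A / N)"
      unfolding carleson_bound_def
    proof (intro allI impI)
      fix \<Omega> :: "('a \<times> 'b) set" assume \<Omega>: "open \<Omega>" "emeasure lborel \<Omega> < \<infinity>"
      then have [measurable]: "\<Omega> \<in> sets borel" by simp
      \<comment> \<open>The variables are exchanged because \<open>section_square_bound\<close> puts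
        the variable of \<open>w\<close> first.\<close>
      define \<Omega>' where "\<Omega>' = {q :: 'b \<times> 'a. (snd q, fst q) \<in> \<Omega>}"
      have [measurable]: "\<Omega>' \<in> sets borel" unfolding \<Omega>'_def by measurable
      have ind: "indicator \<Omega>' (y, x) = indicator \<Omega> (x, y)" for x y by (simp add: \<Omega>'_def indicator_def)
      have em: "emeasure lborel \<Omega>' = emeasure lborel \<Omega>"
        using nn_integral_lborel_pair(1)[of "indicator \<Omega>'"] nn_integral_lborel_pair(2)[of "indicator \<Omega>"] by (simp add: ind)
      let ?D = "\<lambda>w z. ennreal ((cmod (pairing (\<lambda>y. h2 w y * indicator \<Omega>' (fst w, y)) (wav \<psi>1 z)))\<^sup>2) * indicator (extreme_scales N) (snd w)"
      have [measurable]: "(\<lambda>p. indicator \<Omega>' p :: complex) \<in> borel_measurable borel" by measurable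
      have "(\<integral>\<^sup>+z. (ennreal (cmod (coef \<psi>1 \<psi>2 g z)) * indicator (extreme_scales N) (snd (snd z)))\<^sup>2 * indicator (tent \<Omega>) z \<partial>zmeasure)
          \<le> (\<integral>\<^sup>+z. ?D (snd z) (fst z) \<partial>zmeasure)"
      proof (rule nn_integral_mono)
        fix z :: "('a \<times> real) \<times> ('b \<times> real)"
        show "(ennreal (cmod (coef \<psi>1 \<psi>2 g z)) * indicator (extreme_scales N) (snd (snd z)))\<^sup>2 * indicator (tent \<Omega>) z \<le> ?D (snd z) (fst z)"
        proof (cases "z \<in> tent \<Omega>")
          case True
          then have z: "0 < snd (fst z)" "0 < snd (snd z)" "rect z \<subseteq> \<Omega>" by (auto simp: tent_eq)
          have "h2 (snd z) y * wav \<psi>1 (fst z) y = h2 (snd z) y * indicator \<Omega>' (fst (snd z), y) * wav \<psi>1 (fst z) y" for y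
          proof (cases "y \<in> ball (fst (fst z)) (snd (fst z))")
            case True
            then have "(y, fst (snd z)) \<in> \<Omega>" using z by (auto simp: rect_def)
            then show ?thesis by (simp add: ind)
          next
            case False
            then show ?thesis using wav_bound[OF m1.bump z(1), of "fst (fst z)" y] by simp
          qed
          then have "coef \<psi>1 \<psi>2 g z = pairing (\<lambda>y. h2 (snd z) y * indicator \<Omega>' (fst (snd z), y)) (wav \<psi>1 (fst z))"
            unfolding coef_def pairing_tens(2)[OF loc_int_integrable[OF g_loc z(1,2)]] h2_def[symmetric]
            unfolding pairing_def by presburger
          then show ?thesis using True by (simp add: ennreal_power power_mult_distrib indicator_def)
        qed simp
      qed
      also have "\<dots> = (\<integral>\<^sup>+w. \<integral>\<^sup>+z. ?D w z \<partial>hspace \<partial>hspace)"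
        by (subst nn_integral_zmeasure(2)) auto
      also have "\<dots> \<le> ennreal S1 * (\<integral>\<^sup>+t. indicator {0<..} t * indicator (extreme_scales N) t * ennreal ((\<kappa>2 t)\<^sup>2 * t powr (- (real DIM('b) + 1))) \<partial>lborel) * emeasure lborel \<Omega>'"
        unfolding S1_def using h2 by (intro m1.section_square_bound) auto
      also have "\<dots> \<le> ennreal S1 * ennreal ((J1\<^sup>2 + J2\<^sup>2) / N) * emeasure lborel \<Omega>'"
        by (intro mult_right_mono mult_left_mono extreme_scales_integral[OF N _ K0(3,4) \<kappa>2_def]) auto
      also have "\<dots> = ennreal (S1 * ((J1\<^sup>2 + J2\<^sup>2) / N)) * emeasure lborel \<Omega>"
        unfolding em using S_pos N by (subst ennreal_mult) auto
      also have "\<dots> \<le> ennreal (A / N) * emeasure lborel \<Omega>"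
        by (intro mult_right_mono ennreal_leI A_ge) auto
      finally show "(\<integral>\<^sup>+z. (ennreal (cmod (coef \<psi>1 \<psi>2 g z)) * indicator (extreme_scales N) (snd (snd z)))\<^sup>2 * indicator (tent \<Omega>) z \<partial>zmeasure)
          \<le> ennreal (A / N) * emeasure lborel \<Omega>" .
    qed
  qed
qed

end

section \<open>Compactness\<close>

definition middle_scales :: "real \<Rightarrow> (('a::euclidean_space \<times> real) \<times> ('b::euclidean_space \<times> real)) set" where
  "middle_scales N = {z. snd (fst z) \<notin> extreme_scales N \<and> snd (snd z) \<notin> extreme_scales N}"

lemma middle_scales_measurable [measurable]:
  "(middle_scales N :: (('a::euclidean_space \<times> real) \<times> ('b::euclidean_space \<times> real)) set) \<in> sets (borel \<Otimes>\<^sub>M borel)"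
proof -
  have "{z \<in> space (borel \<Otimes>\<^sub>M borel). \<not> (snd (fst z) \<le> 1 / N \<or> N \<le> snd (fst z)) \<and> \<not> (snd (snd z) \<le> 1 / N \<or> N \<le> snd (snd z))}
      \<in> sets ((borel :: ('a \<times> real) measure) \<Otimes>\<^sub>M (borel :: ('b \<times> real) measure))"
    by measurable
  then show ?thesis by (simp add: middle_scales_def extreme_scales_def space_pair_measure)
qed

text \<open>\<open>g\<close> vanishes at a point of norm \<open>R\<close>, whose distance from any
  \<open>p\<close> of smaller norm is at most \<open>2 * R\<close>.\<close>

lemma lipschitz_bounded_support_bounded:
  fixes g :: "'c::euclidean_space \<Rightarrow> complex"
  assumes L: "\<And>p q. cmod (g p - g q) \<le> L * norm (p - q)" and R: "\<And>p. R \<le> norm p \<Longrightarrow> g p = 0" and "0 \<le> L" "0 \<le> R"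
  shows "cmod (g p) \<le> L * (2 * R)"
proof (cases "R \<le> norm p")
  case True
  then show ?thesis using R[OF True] assms(3,4) by simp
next
  case False
  obtain u :: 'c where u: "u \<in> Basis" using nonempty_Basis by blast
  let ?q = "R *\<^sub>R u"
  have q: "norm ?q = R" using u \<open>0 \<le> R\<close> by simp
  have "cmod (g p) = cmod (g p - g ?q)" using R[of ?q] q by simp
  also have "\<dots> \<le> L * norm (p - ?q)" by (rule L)
  also have "\<dots> \<le> L * (2 * R)"
    using False q norm_triangle_ineq4[of p ?q] \<open>0 \<le> L\<close> by (intro mult_left_mono) auto
  finally show ?thesis .
qed

context wavelet_system
begin

text \<open>The error has four parts: \<open>b - f\<close> is small by the definition of CMO,
  \<open>f - g\<close> because it is uniformly small, and the coefficients of \<open>g\<close> at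
  extreme scales of the first or of the second variable by their decay. Each part gets
  \<open>\<delta> / 16\<close>, since two rounds of \<open>carleson_bound_add\<close>, each doubling
  a sum of two constants, turn this into \<open>\<delta>\<close>.\<close>

lemma CMO_approx:
  fixes b :: "'a \<times> 'b \<Rightarrow> complex"
  assumes b: "CMO \<psi>1 \<psi>2 b" and \<delta>: "0 < \<delta>"
  shows "\<exists>g M R N. g \<in> borel_measurable borel \<and> (\<forall>p. cmod (g p) \<le> M) \<and> (\<forall>p. R \<le> norm p \<longrightarrow> g p = 0) \<and> 0 \<le> R \<and> 1 \<le> N
    \<and> carleson_bound (\<lambda>z. ennreal (cmod (coef \<psi>1 \<psi>2 b z - coef \<psi>1 \<psi>2 g z * indicator (middle_scales N) z))) \<delta>"
proof -
  have b_loc: "loc_int b" using b by (simp add: CMO_def BMO_def)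
  then have [measurable]: "b \<in> borel_measurable borel" by (simp add: loc_int_def)
  obtain f where f: "continuous_on UNIV f" "(f \<longlongrightarrow> 0) at_infinity" and fc: "carleson \<psi>1 \<psi>2 (\<lambda>x. b x - f x) < ennreal (\<delta> / 16)"
    using b \<delta> unfolding CMO_def by (meson divide_pos_pos zero_less_numeral)
  have [measurable]: "f \<in> borel_measurable borel" using f(1) by (rule borel_measurable_continuous_onI)
  \<comment> \<open>Solves \<open>S1 * S2 * e\<^sup>2 = \<delta> / 16\<close>, the left side being
    the constant that \<open>carleson_bound_bounded\<close> assigns to \<open>f - g\<close>.\<close>
  define e where "e = sqrt (\<delta> / (16 * (S1 * S2)))"
  have e: "0 < e" "S1 * S2 * e\<^sup>2 = \<delta> / 16" using \<delta> S_pos by (auto simp: e_def)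
  obtain g L R where L0: "0 \<le> L" and R0: "0 \<le> R" and fg: "\<And>x. cmod (f x - g x) \<le> e"
    and L: "\<And>x y. cmod (g x - g y) \<le> L * norm (x - y)" and R: "\<And>x. R \<le> norm x \<Longrightarrow> g x = 0"
    using C0_lipschitz_approx[OF f e(1)] by blast
  have "L-lipschitz_on UNIV g" using L L0 by (intro lipschitz_onI) (auto simp: dist_norm)
  then have gm [measurable]: "g \<in> borel_measurable borel"
    by (intro borel_measurable_continuous_onI lipschitz_on_continuous_on)
  define M where "M = L * (2 * R)"
  have M: "cmod (g p) \<le> M" for p
    unfolding M_def by (rule lipschitz_bounded_support_bounded[OF L R L0 R0])
  have "cmod (f p) \<le> M + e" for p
    using M[of p] fg[of p] norm_triangle_ineq2[of "f p" "g p"] by linarith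
  then have f_loc: "loc_int f" by (intro loc_int_bounded) auto
  have g_loc: "loc_int g" by (rule loc_int_bounded[OF gm M])
  obtain A where A: "0 \<le> A"
    and A1: "\<And>N. 1 \<le> N \<Longrightarrow> carleson_bound (\<lambda>z. ennreal (cmod (coef \<psi>1 \<psi>2 g z)) * indicator (extreme_scales N) (snd (fst z))) (A / N)"
    and A2: "\<And>N. 1 \<le> N \<Longrightarrow> carleson_bound (\<lambda>z. ennreal (cmod (coef \<psi>1 \<psi>2 g z)) * indicator (extreme_scales N) (snd (snd z))) (A / N)"
    using carleson_bound_extreme_scales[OF gm M L R L0 R0] by blast
  define N where "N = max 1 (16 * A / \<delta>)"
  have N: "1 \<le> N" "A / N \<le> \<delta> / 16"
  proof -
    show "1 \<le> N" by (simp add: N_def)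
    have "16 * A / \<delta> \<le> N" "0 < N" by (simp_all add: N_def)
    then show "A / N \<le> \<delta> / 16" using \<delta> by (simp add: field_simps)
  qed
  let ?c1 = "\<lambda>z. ennreal (cmod (coef \<psi>1 \<psi>2 (\<lambda>x. b x - f x) z))"
  let ?c2 = "\<lambda>z. ennreal (cmod (coef \<psi>1 \<psi>2 (\<lambda>x. f x - g x) z))"
  let ?c3 = "\<lambda>z. ennreal (cmod (coef \<psi>1 \<psi>2 g z)) * indicator (extreme_scales N) (snd (fst z))"
  let ?c4 = "\<lambda>z. ennreal (cmod (coef \<psi>1 \<psi>2 g z)) * indicator (extreme_scales N) (snd (snd z))"
  have [measurable]: "?c1 \<in> borel_measurable (borel \<Otimes>\<^sub>M borel)" "?c2 \<in> borel_measurable (borel \<Otimes>\<^sub>M borel)"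
    "?c3 \<in> borel_measurable (borel \<Otimes>\<^sub>M borel)" "?c4 \<in> borel_measurable (borel \<Otimes>\<^sub>M borel)"
    by measurable
  have c1: "carleson_bound ?c1 (\<delta> / 16)" using fc by (intro carleson_bound_coef) simp
  have c2: "carleson_bound ?c2 (\<delta> / 16)"
    using carleson_bound_bounded[OF _ fg] by (simp add: e(2))
  have c3: "carleson_bound ?c3 (\<delta> / 16)" by (rule carleson_bound_mono[OF A1[OF N(1)] N(2)]) simp
  have c4: "carleson_bound ?c4 (\<delta> / 16)" by (rule carleson_bound_mono[OF A2[OF N(1)] N(2)]) simp
  have "carleson_bound (\<lambda>z. (?c1 z + ?c2 z) + (?c3 z + ?c4 z)) (2 * (2 * (\<delta> / 16 + \<delta> / 16) + 2 * (\<delta> / 16 + \<delta> / 16)))"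
    using \<delta> by (intro carleson_bound_add c1 c2 c3 c4) auto
  then have "carleson_bound (\<lambda>z. ennreal (cmod (coef \<psi>1 \<psi>2 b z - coef \<psi>1 \<psi>2 g z * indicator (middle_scales N) z))) \<delta>"
  proof (rule carleson_bound_mono)
    fix z :: "('a \<times> real) \<times> ('b \<times> real)" assume z: "0 < snd (fst z)" "0 < snd (snd z)"
    let ?b = "coef \<psi>1 \<psi>2 b z" and ?f = "coef \<psi>1 \<psi>2 f z" and ?g = "coef \<psi>1 \<psi>2 g z"
    have eq: "coef \<psi>1 \<psi>2 (\<lambda>x. b x - f x) z = ?b - ?f" "coef \<psi>1 \<psi>2 (\<lambda>x. f x - g x) z = ?f - ?g"
      by (rule coef_diff[OF b_loc f_loc z], rule coef_diff[OF f_loc g_loc z])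
    have tri: "cmod (?b - ?g) \<le> cmod (?b - ?f) + cmod (?f - ?g)"
      using norm_triangle_ineq[of "?b - ?f" "?f - ?g"] by simp
    show "ennreal (cmod (?b - ?g * indicator (middle_scales N) z)) \<le> (?c1 z + ?c2 z) + (?c3 z + ?c4 z)"
    proof (cases "z \<in> middle_scales N")
      case True
      then have "ennreal (cmod (?b - ?g * indicator (middle_scales N) z)) \<le> ennreal (cmod (?b - ?f) + cmod (?f - ?g))"
        using tri by (simp add: ennreal_leI del: ennreal_plus)
      also have "\<dots> = ?c1 z + ?c2 z" by (simp add: eq)
      finally show ?thesis by (rule order_trans) simp
    next
      \<comment> \<open>Outside the middle scales the coefficient of \<open>b\<close> itself must be
        bounded; that of \<open>g\<close> is paid for by whichever of \<open>?c3\<close>,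
        \<open>?c4\<close> sees an extreme scale.\<close>
      case False
      have "cmod ?b \<le> cmod (?b - ?f) + cmod (?f - ?g) + cmod ?g"
        using tri norm_triangle_ineq2[of ?b ?g] by linarith
      then have "ennreal (cmod (?b - ?g * indicator (middle_scales N) z)) \<le> ennreal (cmod (?b - ?f) + cmod (?f - ?g) + cmod ?g)"
        using False by (simp add: ennreal_leI del: ennreal_plus)
      also have "\<dots> = (?c1 z + ?c2 z) + ennreal (cmod ?g)" by (simp add: eq)
      also have "\<dots> \<le> (?c1 z + ?c2 z) + (?c3 z + ?c4 z)"
        using False by (intro add_left_mono) (auto simp: middle_scales_def indicator_def)
      finally show ?thesis .
    qed
  qed simp
  then show ?thesis
    using gm M R R0 N(1) by (intro exI[of _ g] exI[of _ M] exI[of _ R] exI[of _ N]) simp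
qed

lemma scaled_kernel_bounds:
  fixes f1 f2 :: "'c::euclidean_space \<Rightarrow> real"
  assumes f: "bump f1 s1 D1" "bump f2 s2 D2" and N: "1 \<le> N"
    and a: "a = wav f1 \<or> a = avg f2"
  obtains K R where "0 \<le> K" "0 \<le> R" "\<And>z y. z \<in> scale_region N \<Longrightarrow> cmod (a z y) \<le> K"
    "\<And>z y. z \<in> scale_region N \<Longrightarrow> y \<notin> cball 0 R \<Longrightarrow> a z y = 0"
    "\<And>z y y'. z \<in> scale_region N \<Longrightarrow> cmod (a z y - a z y') \<le> K * norm (y - y')"
  using a
proof
  assume "a = wav f1"
  with wav_avg_on_scales[OF f(1) N _ disjI1[OF refl]] bumpD(1,2)[OF f(1)] N show ?thesis
    by (intro that[of "N powr (real DIM('c) + 1) * D1" "N + s1 * N"]) auto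
next
  assume "a = avg f2"
  with wav_avg_on_scales[OF f(2) N _ disjI2[OF refl]] bumpD(1,2)[OF f(2)] N show ?thesis
    by (intro that[of "N powr (real DIM('c) + 1) * D2" "N + s2 * N"]) auto
qed

lemma tens_kernel_bounds:
  assumes N: "1 \<le> N" and a1: "a1 = wav \<psi>1 \<or> a1 = avg \<phi>1" and a2: "a2 = wav \<psi>2 \<or> a2 = avg \<phi>2"
  obtains K R where "0 \<le> K" "0 \<le> R"
    "\<And>z p. fst z \<in> scale_region N \<Longrightarrow> snd z \<in> scale_region N \<Longrightarrow> cmod (tens (a1 (fst z)) (a2 (snd z)) p) \<le> K"
    "\<And>z p. fst z \<in> scale_region N \<Longrightarrow> snd z \<in> scale_region N \<Longrightarrow> p \<notin> cball 0 R \<Longrightarrow> tens (a1 (fst z)) (a2 (snd z)) p = 0"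
    "\<And>z p q. fst z \<in> scale_region N \<Longrightarrow> snd z \<in> scale_region N \<Longrightarrow>
       cmod (tens (a1 (fst z)) (a2 (snd z)) p - tens (a1 (fst z)) (a2 (snd z)) q) \<le> 2 * K * norm (p - q)"
proof -
  obtain K1 R1 where 1: "0 \<le> K1" "0 \<le> R1" "\<And>z y. z \<in> scale_region N \<Longrightarrow> cmod (a1 z y) \<le> K1"
    "\<And>z y. z \<in> scale_region N \<Longrightarrow> y \<notin> cball 0 R1 \<Longrightarrow> a1 z y = 0"
    "\<And>z y y'. z \<in> scale_region N \<Longrightarrow> cmod (a1 z y - a1 z y') \<le> K1 * norm (y - y')"
    using scaled_kernel_bounds[OF m1.bump \<phi>1 N a1] by blast
  obtain K2 R2 where 2: "0 \<le> K2" "0 \<le> R2" "\<And>z y. z \<in> scale_region N \<Longrightarrow> cmod (a2 z y) \<le> K2"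
    "\<And>z y. z \<in> scale_region N \<Longrightarrow> y \<notin> cball 0 R2 \<Longrightarrow> a2 z y = 0"
    "\<And>z y y'. z \<in> scale_region N \<Longrightarrow> cmod (a2 z y - a2 z y') \<le> K2 * norm (y - y')"
    using scaled_kernel_bounds[OF m2.bump \<phi>2 N a2] by blast
  show ?thesis
  proof (rule that[of "K1 * K2" "R1 + R2"])
    show "0 \<le> K1 * K2" "0 \<le> R1 + R2" using 1 2 by auto
    fix z :: "('a \<times> real) \<times> ('b \<times> real)" and p q :: "'a \<times> 'b"
    assume z: "fst z \<in> scale_region N" "snd z \<in> scale_region N"
    show "cmod (tens (a1 (fst z)) (a2 (snd z)) p) \<le> K1 * K2"
      unfolding tens_def norm_mult using 1 2 z by (intro mult_mono) auto
    show "tens (a1 (fst z)) (a2 (snd z)) p = 0" if "p \<notin> cball 0 (R1 + R2)"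
    proof -
      have "norm p \<le> norm (fst p) + norm (snd p)" using norm_Pair_le[of "fst p" "snd p"] by simp
      then have "fst p \<notin> cball 0 R1 \<or> snd p \<notin> cball 0 R2" using that by auto
      then show ?thesis unfolding tens_def using 1(4)[OF z(1)] 2(4)[OF z(2)] by auto
    qed
    let ?a = "a1 (fst z)" and ?b = "a2 (snd z)"
    have "tens ?a ?b p - tens ?a ?b q = (?a (fst p) - ?a (fst q)) * ?b (snd p) + ?a (fst q) * (?b (snd p) - ?b (snd q))"
      by (simp add: tens_def algebra_simps)
    also have "cmod \<dots> \<le> K1 * norm (fst p - fst q) * K2 + K1 * (K2 * norm (snd p - snd q))"
      by (rule order_trans[OF norm_triangle_ineq], unfold norm_mult, intro add_mono mult_mono 1(3,5) 2(3,5) z) (use 1(1) 2(1) in auto)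
    also have "\<dots> \<le> K1 * norm (p - q) * K2 + K1 * (K2 * norm (p - q))"
      using norm_fst_le[of "fst (p - q)" "snd (p - q)", unfolded prod.collapse] norm_snd_le[of "snd (p - q)" "fst (p - q)", unfolded prod.collapse] 1(1) 2(1)
      by (intro add_mono mult_left_mono mult_right_mono) auto
    also have "\<dots> = 2 * (K1 * K2) * norm (p - q)" by simp
    finally show "cmod (tens ?a ?b p - tens ?a ?b q) \<le> 2 * (K1 * K2) * norm (p - q)" .
  qed
qed

lemma tens_kernel_measurable:
  assumes a1: "a1 = wav \<psi>1 \<or> a1 = avg \<phi>1" and a2: "a2 = wav \<psi>2 \<or> a2 = avg \<phi>2"
  shows "(\<lambda>(z, p). tens (a1 (fst z)) (a2 (snd z)) p) \<in> borel_measurable ((borel \<Otimes>\<^sub>M borel) \<Otimes>\<^sub>M borel)"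
  using a1 a2 by (elim disjE; hypsubst; intro tens_measurable_joint)

lemma superposition_tens:
  fixes c :: "('a \<times> real) \<times> ('b \<times> real) \<Rightarrow> complex"
  assumes [measurable]: "c \<in> borel_measurable (borel \<Otimes>\<^sub>M borel)" and D: "\<And>z. cmod (c z) \<le> D"
    and supp: "\<And>z. c z \<noteq> 0 \<Longrightarrow> fst z \<in> scale_region N \<and> snd z \<in> scale_region N" and N: "1 \<le> N"
    and a: "a1 = wav \<psi>1 \<or> a1 = avg \<phi>1" "a2 = wav \<psi>2 \<or> a2 = avg \<phi>2"
    and b: "b1 = wav \<psi>1 \<or> b1 = avg \<phi>1" "b2 = wav \<psi>2 \<or> b2 = avg \<phi>2"
  shows "\<exists>K L R. superposition zmeasure c (\<lambda>z. tens (a1 (fst z)) (a2 (snd z))) (\<lambda>z. tens (b1 (fst z)) (b2 (snd z))) K L R"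
proof -
  interpret pair_sigma_finite "hspace :: ('a \<times> real) measure" "hspace :: ('b \<times> real) measure"
    by (rule pair_sigma_finite_hspace)
  obtain K1 R1 where 1: "0 \<le> K1" "0 \<le> R1"
    "\<And>z p. fst z \<in> scale_region N \<Longrightarrow> snd z \<in> scale_region N \<Longrightarrow> cmod (tens (a1 (fst z)) (a2 (snd z)) p) \<le> K1"
    "\<And>z p. fst z \<in> scale_region N \<Longrightarrow> snd z \<in> scale_region N \<Longrightarrow> p \<notin> cball 0 R1 \<Longrightarrow> tens (a1 (fst z)) (a2 (snd z)) p = 0"
    "\<And>z p q. fst z \<in> scale_region N \<Longrightarrow> snd z \<in> scale_region N \<Longrightarrow>
       cmod (tens (a1 (fst z)) (a2 (snd z)) p - tens (a1 (fst z)) (a2 (snd z)) q) \<le> 2 * K1 * norm (p - q)"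
    by (rule tens_kernel_bounds[OF N a], rule that)
  obtain K2 R2 where 2: "0 \<le> K2" "0 \<le> R2"
    "\<And>z p. fst z \<in> scale_region N \<Longrightarrow> snd z \<in> scale_region N \<Longrightarrow> cmod (tens (b1 (fst z)) (b2 (snd z)) p) \<le> K2"
    "\<And>z p. fst z \<in> scale_region N \<Longrightarrow> snd z \<in> scale_region N \<Longrightarrow> p \<notin> cball 0 R2 \<Longrightarrow> tens (b1 (fst z)) (b2 (snd z)) p = 0"
    "\<And>z p q. fst z \<in> scale_region N \<Longrightarrow> snd z \<in> scale_region N \<Longrightarrow>
       cmod (tens (b1 (fst z)) (b2 (snd z)) p - tens (b1 (fst z)) (b2 (snd z)) q) \<le> 2 * K2 * norm (p - q)"
    by (rule tens_kernel_bounds[OF N b], rule that)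
  have meas: "(\<lambda>(z, p). tens (a1 (fst z)) (a2 (snd z)) p) \<in> borel_measurable (zmeasure \<Otimes>\<^sub>M borel)"
    "(\<lambda>(z, p). tens (b1 (fst z)) (b2 (snd z)) p) \<in> borel_measurable (zmeasure \<Otimes>\<^sub>M borel)"
    using tens_kernel_measurable[OF a] tens_kernel_measurable[OF b] by measurable
  have D0: "0 \<le> D" using order_trans[OF norm_ge_zero D] .
  let ?S = "scale_region N \<times> scale_region N :: (('a \<times> real) \<times> ('b \<times> real)) set"
  have int: "integrable zmeasure c"
  proof (rule integrableI_bounded)
    have "(\<integral>\<^sup>+z. ennreal (norm (c z)) \<partial>zmeasure) \<le> (\<integral>\<^sup>+z. ennreal D * indicator ?S z \<partial>zmeasure)"
    proof (rule nn_integral_mono)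
      fix z show "ennreal (norm (c z)) \<le> ennreal D * indicator ?S z"
        using supp[of z] D[of z] by (cases "c z = 0") (auto simp: indicator_def mem_Times_iff ennreal_leI)
    qed
    also have "\<dots> = ennreal D * emeasure zmeasure ?S"
      by (rule nn_integral_cmult_indicator) simp
    also have "emeasure zmeasure ?S = emeasure hspace (scale_region N :: ('a \<times> real) set) * emeasure hspace (scale_region N :: ('b \<times> real) set)"
      unfolding zmeasure_def by (rule M2.emeasure_pair_measure_Times) auto
    also have "ennreal D * \<dots> < \<infinity>"
      using emeasure_scale_region_finite[OF N, where 'a='a] emeasure_scale_region_finite[OF N, where 'a='b]
      by (simp add: ennreal_mult_less_top)
    finally show "(\<integral>\<^sup>+z. ennreal (norm (c z)) \<partial>zmeasure) < \<infinity>" .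
  qed measurable
  have "superposition zmeasure c (\<lambda>z. tens (a1 (fst z)) (a2 (snd z))) (\<lambda>z. tens (b1 (fst z)) (b2 (snd z))) (max K1 K2) (2 * K2) (max R1 R2)"
  proof (intro superposition.intro superposition_axioms.intro sigma_finite_zmeasure int meas)
    fix z p q assume "c z \<noteq> 0"
    then have z: "fst z \<in> scale_region N" "snd z \<in> scale_region N" using supp by auto
    show "cmod (tens (a1 (fst z)) (a2 (snd z)) p) \<le> max K1 K2" "cmod (tens (b1 (fst z)) (b2 (snd z)) p) \<le> max K1 K2"
      using 1(3)[OF z, of p] 2(3)[OF z, of p] by auto
    show "cmod (tens (b1 (fst z)) (b2 (snd z)) p - tens (b1 (fst z)) (b2 (snd z)) q) \<le> 2 * K2 * norm (p - q)"
      by (rule 2(5)[OF z])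
    show "tens (a1 (fst z)) (a2 (snd z)) p = 0" "tens (b1 (fst z)) (b2 (snd z)) p = 0" if "p \<notin> cball 0 (max R1 R2)"
      using that 1(4)[OF z, of p] 2(4)[OF z, of p] by auto
  qed simp
  then show ?thesis by blast
qed

text \<open>A wavelet of scale below \<open>N\<close> centred further than \<open>R + N\<close> from
  the origin misses the support of \<open>g\<close>, so the cut-off in scale is also one in
  space.\<close>

lemma coef_middle_scales:
  fixes g :: "'a \<times> 'b \<Rightarrow> complex"
  assumes [measurable]: "g \<in> borel_measurable borel" and M: "\<And>p. cmod (g p) \<le> M" and R: "\<And>p. R \<le> norm p \<Longrightarrow> g p = 0"
    and R0: "0 \<le> R" and N: "1 \<le> N"
  shows "\<exists>D. \<forall>z. cmod (coef \<psi>1 \<psi>2 g z * indicator (middle_scales N) z) \<le> D"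
    and "coef \<psi>1 \<psi>2 g z * indicator (middle_scales N) z \<noteq> 0 \<Longrightarrow> fst z \<in> scale_region (R + N) \<and> snd z \<in> scale_region (R + N)"
proof -
  have g: "g \<in> L2" using R by (intro L2_bounded_support(1)[OF assms(1) M, of R]) auto
  have supp: "fst z \<in> scale_region (R + N) \<and> snd z \<in> scale_region (R + N)"
    if "coef \<psi>1 \<psi>2 g z * indicator (middle_scales N) z \<noteq> 0" for z
  proof -
    have mz: "z \<in> middle_scales N" and cz: "coef \<psi>1 \<psi>2 g z \<noteq> 0" using that by (auto simp: indicator_def split: if_splits)
    have t: "1 / N < snd (fst z)" "snd (fst z) < N" "1 / N < snd (snd z)" "snd (snd z) < N"
      using mz by (auto simp: middle_scales_def extreme_scales_def)
    have "0 < 1 / N" using N by simp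
    then have t0: "0 < snd (fst z)" "0 < snd (snd z)" using t by linarith+
    obtain p where p: "g p * tens (wav \<psi>1 (fst z)) (wav \<psi>2 (snd z)) p \<noteq> 0"
      using cz unfolding coef_def pairing_def by (metis (mono_tags, lifting) integral_eq_zero_AE always_eventually)
    have "p \<in> rect z" using p wav_wav_supp[OF t0, of p] by auto
    then have d: "dist (fst (fst z)) (fst p) < N" "dist (fst (snd z)) (snd p) < N"
      using t by (auto simp: rect_def)
    have "norm p < R" using p R[of p] by force
    then have "norm (fst p) < R" "norm (snd p) < R"
      using norm_fst_le[of "fst p" "snd p"] norm_snd_le[of "snd p" "fst p"] by auto
    then have "norm (fst (fst z)) \<le> R + N" "norm (fst (snd z)) \<le> R + N"
      using d norm_triangle_ineq2[of "fst (fst z)" "fst p"] norm_triangle_ineq2[of "fst (snd z)" "snd p"] by (auto simp: dist_norm)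
    moreover have "1 / (R + N) \<le> 1 / N" using R0 N by (intro divide_left_mono) auto
    ultimately show ?thesis using t R0 by (auto simp: scale_region_def)
  qed
  show "coef \<psi>1 \<psi>2 g z * indicator (middle_scales N) z \<noteq> 0 \<Longrightarrow> fst z \<in> scale_region (R + N) \<and> snd z \<in> scale_region (R + N)"
    by (rule supp)
  have RN: "1 \<le> R + N" using R0 N by simp
  obtain K R' where K: "0 \<le> K" "0 \<le> R'"
    "\<And>z p. fst z \<in> scale_region (R + N) \<Longrightarrow> snd z \<in> scale_region (R + N) \<Longrightarrow> cmod (tens (wav \<psi>1 (fst z)) (wav \<psi>2 (snd z)) p) \<le> K"
    "\<And>z p. fst z \<in> scale_region (R + N) \<Longrightarrow> snd z \<in> scale_region (R + N) \<Longrightarrow> p \<notin> cball 0 R' \<Longrightarrow> tens (wav \<psi>1 (fst z)) (wav \<psi>2 (snd z)) p = 0"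
    using tens_kernel_bounds[OF RN disjI1[OF refl] disjI1[OF refl]] by metis
  let ?V = "K * sqrt (measure lborel (cball (0::'a \<times> 'b) R'))"
  have "cmod (coef \<psi>1 \<psi>2 g z * indicator (middle_scales N) z) \<le> L2norm g * ?V" for z
  proof (cases "coef \<psi>1 \<psi>2 g z * indicator (middle_scales N) z = 0")
    case True
    then show ?thesis using K(1) by (simp only: norm_zero) simp
  next
    case False
    from supp[OF this] have z: "fst z \<in> scale_region (R + N)" "snd z \<in> scale_region (R + N)" by auto
    have "tens (wav \<psi>1 (fst z)) (wav \<psi>2 (snd z)) \<in> borel_measurable borel" by measurable
    note w = L2_bounded_support[OF this K(3)[OF z] K(4)[OF z]]
    have "cmod (coef \<psi>1 \<psi>2 g z * indicator (middle_scales N) z) \<le> cmod (coef \<psi>1 \<psi>2 g z)"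
      by (auto simp: norm_mult indicator_def)
    also have "\<dots> \<le> L2norm g * L2norm (tens (wav \<psi>1 (fst z)) (wav \<psi>2 (snd z)))"
      unfolding coef_def by (rule pairing_Cauchy_Schwarz[OF g w(1)])
    also have "\<dots> \<le> L2norm g * ?V" by (intro mult_left_mono w(2)) auto
    finally show ?thesis .
  qed
  then show "\<exists>D. \<forall>z. cmod (coef \<psi>1 \<psi>2 g z * indicator (middle_scales N) z) \<le> D" by blast
qed

lemma BMO_carleson_bound:
  assumes "BMO \<psi>1 \<psi>2 b"
  shows "\<exists>A>0. carleson_bound (\<lambda>z. ennreal (cmod (coef \<psi>1 \<psi>2 b z))) A"
proof -
  have fin: "carleson \<psi>1 \<psi>2 b < \<infinity>" using assms by (simp add: BMO_def)
  let ?A = "enn2real (carleson \<psi>1 \<psi>2 b) + 1"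
  have "carleson \<psi>1 \<psi>2 b = ennreal (enn2real (carleson \<psi>1 \<psi>2 b))" using fin by simp
  also have "\<dots> \<le> ennreal ?A" by (intro ennreal_leI) simp
  finally have "carleson_bound (\<lambda>z. ennreal (cmod (coef \<psi>1 \<psi>2 b z))) ?A" by (rule carleson_bound_coef)
  moreover have "0 < ?A" by (simp add: add_nonneg_pos)
  ultimately show ?thesis by blast
qed

text \<open>\<open>K\<close> is uniform in \<open>c\<close>, so that the bound applies both to the
  coefficients of \<open>b\<close> and to the approximation error, where a small \<open>A\<close>
  yields a small form.\<close>

definition bounded_form :: "(('a \<times> real) \<times> ('b \<times> real) \<Rightarrow> 'a \<times> 'b \<Rightarrow> complex)
    \<Rightarrow> (('a \<times> real) \<times> ('b \<times> real) \<Rightarrow> 'a \<times> 'b \<Rightarrow> complex) \<Rightarrow> real \<Rightarrow> bool" where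
  "bounded_form \<eta> \<theta> K \<longleftrightarrow> 0 \<le> K \<and> (\<forall>(c :: ('a \<times> real) \<times> ('b \<times> real) \<Rightarrow> ennreal) A F G. c \<in> borel_measurable (borel \<Otimes>\<^sub>M borel) \<longrightarrow> 0 < A \<longrightarrow> carleson_bound c A \<longrightarrow> F \<in> L2 \<longrightarrow> G \<in> L2 \<longrightarrow>
     (\<integral>\<^sup>+z. c z * ennreal (cmod (pairing F (\<eta> z)) * cmod (pairing G (\<theta> z))) \<partial>zmeasure) \<le> ennreal (K * sqrt A * (L2norm F * L2norm G)))"

lemma bounded_form_commute:
  assumes "bounded_form \<eta> \<theta> K"
  shows "bounded_form \<theta> \<eta> K"
  unfolding bounded_form_def
proof (intro conjI allI impI)
  fix c :: "('a \<times> real) \<times> ('b \<times> real) \<Rightarrow> ennreal" and A :: real and F G :: "'a \<times> 'b \<Rightarrow> complex"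
  assume "c \<in> borel_measurable (borel \<Otimes>\<^sub>M borel)" "0 < A" "carleson_bound c A" "F \<in> L2" "G \<in> L2"
  then have "(\<integral>\<^sup>+z. c z * ennreal (cmod (pairing G (\<eta> z)) * cmod (pairing F (\<theta> z))) \<partial>zmeasure) \<le> ennreal (K * sqrt A * (L2norm G * L2norm F))"
    using assms by (simp add: bounded_form_def)
  then show "(\<integral>\<^sup>+z. c z * ennreal (cmod (pairing F (\<theta> z)) * cmod (pairing G (\<eta> z))) \<partial>zmeasure) \<le> ennreal (K * sqrt A * (L2norm F * L2norm G))"
    by (simp add: mult.commute)
qed (use assms in \<open>auto simp: bounded_form_def\<close>)

lemma form_integrable:
  fixes c :: "('a \<times> real) \<times> ('b \<times> real) \<Rightarrow> complex"
  assumes form: "bounded_form \<eta> \<theta> K"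
    and [measurable]: "(\<lambda>(z, p). \<eta> z p) \<in> borel_measurable ((borel \<Otimes>\<^sub>M borel) \<Otimes>\<^sub>M borel)"
      "(\<lambda>(z, p). \<theta> z p) \<in> borel_measurable ((borel \<Otimes>\<^sub>M borel) \<Otimes>\<^sub>M borel)" "c \<in> borel_measurable (borel \<Otimes>\<^sub>M borel)"
    and A: "0 < A" and c: "carleson_bound (\<lambda>z. ennreal (cmod (c z))) A" and F: "F \<in> L2" and G: "G \<in> L2"
  shows "integrable zmeasure (\<lambda>z. c z * pairing F (\<eta> z) * pairing (\<theta> z) G)"
    and "cmod (\<integral>z. c z * pairing F (\<eta> z) * pairing (\<theta> z) G \<partial>zmeasure) \<le> K * sqrt A * (L2norm F * L2norm G)"
proof -
  have [measurable]: "F \<in> borel_measurable borel" "G \<in> borel_measurable borel" using F G by auto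
  have [measurable]: "(\<lambda>z. pairing F (\<eta> z)) \<in> borel_measurable (borel \<Otimes>\<^sub>M borel)" "(\<lambda>z. pairing (\<theta> z) G) \<in> borel_measurable (borel \<Otimes>\<^sub>M borel)"
    unfolding pairing_def by measurable
  have "(\<integral>\<^sup>+z. ennreal (cmod (c z * pairing F (\<eta> z) * pairing (\<theta> z) G)) \<partial>zmeasure)
      = (\<integral>\<^sup>+z. ennreal (cmod (c z)) * ennreal (cmod (pairing F (\<eta> z)) * cmod (pairing G (\<theta> z))) \<partial>zmeasure)"
    by (intro nn_integral_cong) (simp add: norm_mult ennreal_mult mult.assoc pairing_commute[of G])
  also have "\<dots> \<le> ennreal (K * sqrt A * (L2norm F * L2norm G))"
    using form A c F G unfolding bounded_form_def by simp
  finally have le: "(\<integral>\<^sup>+z. ennreal (cmod (c z * pairing F (\<eta> z) * pairing (\<theta> z) G)) \<partial>zmeasure) \<le> ennreal (K * sqrt A * (L2norm F * L2norm G))" .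
  show "integrable zmeasure (\<lambda>z. c z * pairing F (\<eta> z) * pairing (\<theta> z) G)"
    by (rule integrableI_bounded, measurable) (rule order_le_less_trans[OF le], simp)
  have "0 \<le> K * sqrt A * (L2norm F * L2norm G)" using form A by (simp add: bounded_form_def)
  then show "cmod (\<integral>z. c z * pairing F (\<eta> z) * pairing (\<theta> z) G \<partial>zmeasure) \<le> K * sqrt A * (L2norm F * L2norm G)"
    using order_trans[OF ennreal_norm_integral_le le] by simp
qed

text \<open>The cut-off coefficients from \<open>CMO_approx\<close> are bounded and live on a
  bounded region, which makes their superposition compact. The remaining coefficients have Carleson
  constant \<open>\<delta>\<close> and change the form by at most \<open>K * sqrt \<delta>\<close>
  times the norms.\<close>

theorem compact_op_of_bounded_form:
  fixes b :: "'a \<times> 'b \<Rightarrow> complex"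
  assumes b: "CMO \<psi>1 \<psi>2 b"
    and a: "a1 = wav \<psi>1 \<or> a1 = avg \<phi>1" "a2 = wav \<psi>2 \<or> a2 = avg \<phi>2"
    and d: "d1 = wav \<psi>1 \<or> d1 = avg \<phi>1" "d2 = wav \<psi>2 \<or> d2 = avg \<phi>2"
    and form: "bounded_form (\<lambda>z. tens (a1 (fst z)) (a2 (snd z))) (\<lambda>z. tens (d1 (fst z)) (d2 (snd z))) K"
  shows "\<exists>T. compact_op T \<and> (\<forall>F\<in>L2. \<forall>G\<in>L2. pairing (T F) G
    = (\<integral>z. coef \<psi>1 \<psi>2 b z * pairing F (tens (a1 (fst z)) (a2 (snd z))) * pairing (tens (d1 (fst z)) (d2 (snd z))) G \<partial>zmeasure))"
proof -
  let ?\<eta> = "\<lambda>z. tens (a1 (fst z)) (a2 (snd z))" and ?\<theta> = "\<lambda>z. tens (d1 (fst z)) (d2 (snd z))"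
  have [measurable]: "b \<in> borel_measurable borel" using b by (simp add: CMO_def BMO_def loc_int_def)
  note meas = tens_kernel_measurable[OF a] tens_kernel_measurable[OF d]
  obtain A where A: "0 < A" "carleson_bound (\<lambda>z. ennreal (cmod (coef \<psi>1 \<psi>2 b z))) A"
    using BMO_carleson_bound b unfolding CMO_def by blast
  have K: "0 \<le> K" using form by (simp add: bounded_form_def)
  have "\<exists>S. compact_op S \<and> (\<forall>F\<in>L2. \<forall>G\<in>L2.
      cmod ((\<integral>z. coef \<psi>1 \<psi>2 b z * pairing F (?\<eta> z) * pairing (?\<theta> z) G \<partial>zmeasure) - pairing (S F) G) \<le> K * sqrt \<delta> * L2norm F * L2norm G)"
    if \<delta>: "0 < \<delta>" for \<delta>
  proof -
    obtain g M R N where g [measurable]: "g \<in> borel_measurable borel" and M: "\<And>p. cmod (g p) \<le> M" and R: "\<And>p. R \<le> norm p \<Longrightarrow> g p = 0"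
      and R0: "0 \<le> R" and N: "1 \<le> N"
      and cb: "carleson_bound (\<lambda>z. ennreal (cmod (coef \<psi>1 \<psi>2 b z - coef \<psi>1 \<psi>2 g z * indicator (middle_scales N) z))) \<delta>"
      using CMO_approx[OF b \<delta>] by blast
    define c where "c z = coef \<psi>1 \<psi>2 g z * indicator (middle_scales N) z" for z
    have [measurable]: "c \<in> borel_measurable (borel \<Otimes>\<^sub>M borel)" unfolding c_def[abs_def] by measurable
    obtain D where D: "\<And>z. cmod (c z) \<le> D"
      using coef_middle_scales(1)[OF g M R R0 N] unfolding c_def by blast
    have supp: "fst z \<in> scale_region (R + N) \<and> snd z \<in> scale_region (R + N)" if "c z \<noteq> 0" for z
      using coef_middle_scales(2)[OF g M R R0 N, of z] that unfolding c_def by blast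
    have RN: "1 \<le> R + N" using R0 N by simp
    obtain K' L' R' where sp: "superposition zmeasure c ?\<eta> ?\<theta> K' L' R'"
      using superposition_tens[of c, OF _ D supp RN a d] by auto
    interpret superposition zmeasure c ?\<eta> ?\<theta> K' L' R' by (rule sp)
    have "cmod ((\<integral>z. coef \<psi>1 \<psi>2 b z * pairing F (?\<eta> z) * pairing (?\<theta> z) G \<partial>zmeasure) - pairing (T F) G) \<le> K * sqrt \<delta> * L2norm F * L2norm G"
      if F: "F \<in> L2" and G: "G \<in> L2" for F G
    proof -
      have X1: "integrable zmeasure (\<lambda>z. coef \<psi>1 \<psi>2 b z * pairing F (?\<eta> z) * pairing (?\<theta> z) G)"
        by (rule form_integrable(1)[OF form meas _ A F G]) measurable
      have cb': "carleson_bound (\<lambda>z. ennreal (cmod (coef \<psi>1 \<psi>2 b z - c z))) \<delta>" using cb by (simp add: c_def)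
      have X2: "integrable zmeasure (\<lambda>z. (coef \<psi>1 \<psi>2 b z - c z) * pairing F (?\<eta> z) * pairing (?\<theta> z) G)"
        and X2_le: "cmod (\<integral>z. (coef \<psi>1 \<psi>2 b z - c z) * pairing F (?\<eta> z) * pairing (?\<theta> z) G \<partial>zmeasure) \<le> K * sqrt \<delta> * (L2norm F * L2norm G)"
        by (rule form_integrable[OF form meas _ \<delta> cb' F G], measurable)+
      have "pairing (T F) G = (\<integral>z. coef \<psi>1 \<psi>2 b z * pairing F (?\<eta> z) * pairing (?\<theta> z) G - (coef \<psi>1 \<psi>2 b z - c z) * pairing F (?\<eta> z) * pairing (?\<theta> z) G \<partial>zmeasure)"
        unfolding pairing_T[OF F G] by (simp add: algebra_simps)
      also have "\<dots> = (\<integral>z. coef \<psi>1 \<psi>2 b z * pairing F (?\<eta> z) * pairing (?\<theta> z) G \<partial>zmeasure) - (\<integral>z. (coef \<psi>1 \<psi>2 b z - c z) * pairing F (?\<eta> z) * pairing (?\<theta> z) G \<partial>zmeasure)"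
        by (rule Bochner_Integration.integral_diff[OF X1 X2])
      finally show ?thesis using X2_le by (simp add: mult.assoc)
    qed
    then show ?thesis using compact_op_T by blast
  qed
  then have "\<forall>n::nat. \<exists>S. compact_op S \<and> (\<forall>F\<in>L2. \<forall>G\<in>L2.
      cmod ((\<integral>z. coef \<psi>1 \<psi>2 b z * pairing F (?\<eta> z) * pairing (?\<theta> z) G \<partial>zmeasure) - pairing (S F) G) \<le> K * sqrt (inverse (real (Suc n))) * L2norm F * L2norm G)"
    by simp
  from choice[OF this] obtain T where T': "\<forall>n::nat. compact_op (T n) \<and> (\<forall>F\<in>L2. \<forall>G\<in>L2.
      cmod ((\<integral>z. coef \<psi>1 \<psi>2 b z * pairing F (?\<eta> z) * pairing (?\<theta> z) G \<partial>zmeasure) - pairing (T n F) G) \<le> K * sqrt (inverse (real (Suc n))) * L2norm F * L2norm G)" ..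
  have T: "\<And>n. compact_op (T n)"
    and approx: "\<And>n F G. F \<in> L2 \<Longrightarrow> G \<in> L2 \<Longrightarrow>
      cmod ((\<integral>z. coef \<psi>1 \<psi>2 b z * pairing F (?\<eta> z) * pairing (?\<theta> z) G \<partial>zmeasure) - pairing (T n F) G) \<le> K * sqrt (inverse (real (Suc n))) * L2norm F * L2norm G"
    using T' by blast+
  have "(\<lambda>n. K * sqrt (inverse (real (Suc n)))) \<longlonglongrightarrow> K * sqrt 0"
    by (intro tendsto_intros LIMSEQ_inverse_real_of_nat)
  then have lim: "(\<lambda>n. K * sqrt (inverse (real (Suc n)))) \<longlonglongrightarrow> 0" by simp
  show ?thesis
    by (rule compact_op_of_form_limit[OF T _ lim approx]) (use K in auto)
qed

end

section \<open>Tensor arguments and truncated integrals\<close>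

lemma pairing_tens_tens:
  assumes "f1 \<in> L2" "f2 \<in> L2" "a1 \<in> L2" "a2 \<in> L2"
  shows "pairing (tens f1 f2) (tens a1 a2) = pairing f1 a1 * pairing f2 a2"
proof -
  have scale: "pairing (\<lambda>y1. f2 y2 * f1 y1) a1 = pairing f1 a1 * f2 y2" for y2
    by (subst pairing_scale_left) (rule mult.commute)
  have "pairing (tens f1 f2) (tens a1 a2) = pairing (\<lambda>y2. pairing (\<lambda>y1. f2 y2 * f1 y1) a1) a2"
    by (subst pairing_tens(1)[OF integrable_L2_mult[OF tens_L2[OF assms(1,2)] tens_L2[OF assms(3,4)]]])
       (simp add: tens_def mult.commute)
  then show ?thesis unfolding scale by (simp only: pairing_scale_left)
qed

lemma trunc_region_measurable [measurable]:
  "(trunc_region e :: (('a::euclidean_space \<times> real) \<times> ('b::euclidean_space \<times> real)) set) \<in> sets (borel \<Otimes>\<^sub>M borel)"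
proof -
  have "{z \<in> space (borel \<Otimes>\<^sub>M borel). e < snd (fst z) \<and> snd (fst z) < 1 / e \<and> e < snd (snd z) \<and> snd (snd z) < 1 / e
        \<and> norm (fst (fst z)) < 1 / e \<and> norm (fst (snd z)) < 1 / e}
      \<in> sets ((borel :: ('a \<times> real) measure) \<Otimes>\<^sub>M (borel :: ('b \<times> real) measure))"
    by measurable
  also have "{z \<in> space (borel \<Otimes>\<^sub>M borel). e < snd (fst z) \<and> snd (fst z) < 1 / e \<and> e < snd (snd z) \<and> snd (snd z) < 1 / e
        \<and> norm (fst (fst z)) < 1 / e \<and> norm (fst (snd z)) < 1 / e} = (trunc_region e :: (('a \<times> real) \<times> ('b \<times> real)) set)"
    by (auto simp: trunc_region_def space_pair_measure)
  finally show ?thesis .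
qed

text \<open>Dominated convergence: every \<open>z\<close> with positive scales belongs to
  \<open>trunc_region e\<close> for all small \<open>e\<close>. For an absolutely convergent form
  the truncations in \<open>is_paraproduct\<close> thus tend to the full integral.\<close>

lemma tendsto_trunc_region:
  fixes H :: "('a::euclidean_space \<times> real) \<times> ('b::euclidean_space \<times> real) \<Rightarrow> complex"
  assumes H: "integrable zmeasure H"
  shows "((\<lambda>e. \<integral>z\<in>trunc_region e. H z \<partial>zmeasure) \<longlongrightarrow> (\<integral>z. H z \<partial>zmeasure)) (at_right 0)"
proof (rule tendsto_at_right_sequentially[of 0 1])
  fix S :: "nat \<Rightarrow> real"
  assume S: "\<And>n. 0 < S n" "S \<longlonglongrightarrow> 0"
  show "(\<lambda>n. \<integral>z\<in>trunc_region (S n). H z \<partial>zmeasure) \<longlonglongrightarrow> (\<integral>z. H z \<partial>zmeasure)"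
    unfolding set_lebesgue_integral_def
  proof (rule integral_dominated_convergence[where w = "\<lambda>z. norm (H z)"])
    have "H \<in> borel_measurable zmeasure" using H by simp
    then have [measurable]: "H \<in> borel_measurable (borel \<Otimes>\<^sub>M borel)" by (simp cong: measurable_cong_sets)
    show "H \<in> borel_measurable zmeasure" by measurable
    show "(\<lambda>z. indicator (trunc_region (S n)) z *\<^sub>R H z) \<in> borel_measurable zmeasure" for n by measurable
    show "integrable zmeasure (\<lambda>z. norm (H z))" using H by (rule integrable_norm)
    show "AE z in zmeasure. norm (indicator (trunc_region (S n)) z *\<^sub>R H z) \<le> norm (H z)" for n
      by (intro AE_I2) (auto simp: indicator_def)
    show "AE z in zmeasure. (\<lambda>n. indicator (trunc_region (S n)) z *\<^sub>R H z) \<longlonglongrightarrow> H z"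
      using AE_zmeasure
    proof eventually_elim
      case (elim z)
      define m where "m = max (max (snd (fst z)) (snd (snd z))) (max (norm (fst (fst z))) (norm (fst (snd z))))"
      have m: "0 < m" using elim by (auto simp: m_def less_max_iff_disj)
      \<comment> \<open>Once \<open>S n\<close> is below \<open>d\<close>, it is below both scales,
        and \<open>1 / S n\<close> exceeds \<open>m\<close>, which bounds scales and
        positions.\<close>
      define d where "d = min (min (snd (fst z)) (snd (snd z))) (1 / m)"
      have d: "0 < d" using elim m by (simp add: d_def)
      have "\<forall>\<^sub>F n in sequentially. S n < d" using order_tendstoD(2)[OF S(2) d] .
      then have "\<forall>\<^sub>F n in sequentially. indicator (trunc_region (S n)) z *\<^sub>R H z = H z"
      proof eventually_elim
        case (elim n)
        then have 1: "S n < snd (fst z)" "S n < snd (snd z)" "S n < 1 / m" by (auto simp: d_def)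
        then have "m < 1 / S n" using S(1)[of n] m by (simp add: field_simps)
        then have "snd (fst z) < 1 / S n" "snd (snd z) < 1 / S n" "norm (fst (fst z)) < 1 / S n" "norm (fst (snd z)) < 1 / S n"
          by (auto simp: m_def)
        with 1 have "z \<in> trunc_region (S n)" by (auto simp: trunc_region_def case_prod_beta)
        then show ?case by simp
      qed
      then show ?case by (rule tendsto_eventually)
    qed
  qed
qed simp

context wavelet_system
begin

lemma bounded_form_paraproduct:
  "bounded_form (\<lambda>z. tens (avg \<phi>1 (fst z)) (avg \<phi>2 (snd z))) (\<lambda>z. tens (wav \<psi>1 (fst z)) (wav \<psi>2 (snd z))) para_const"
  unfolding bounded_form_def using para_const_nonneg paraproduct_form_bound by blast

lemma bounded_form_mixed:
  "bounded_form (\<lambda>z. tens (wav \<psi>1 (fst z)) (avg \<phi>2 (snd z))) (\<lambda>z. tens (avg \<phi>1 (fst z)) (wav \<psi>2 (snd z))) mixed_const"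
  unfolding bounded_form_def using mixed_const_nonneg mixed_form_bound by blast

text \<open>On tensors each pairing factorises, and a transpose only permutes which argument meets
  which one-variable kernel. The four forms therefore have the same integrand \<open>I\<close> at
  almost every \<open>z\<close>, and the transpose relations follow.\<close>

lemma form_tens:
  fixes b :: "'a \<times> 'b \<Rightarrow> complex"
  assumes [measurable]: "b \<in> borel_measurable borel"
    and f: "f1 \<in> L2" "f2 \<in> L2" "g1 \<in> L2" "g2 \<in> L2"
  defines "I \<equiv> \<lambda>z. coef \<psi>1 \<psi>2 b z * (pairing f1 (avg \<phi>1 (fst z)) * pairing f2 (avg \<phi>2 (snd z)) * pairing g1 (wav \<psi>1 (fst z)) * pairing g2 (wav \<psi>2 (snd z)))"
  shows "(\<integral>z. coef \<psi>1 \<psi>2 b z * pairing (tens f1 f2) (tens (avg \<phi>1 (fst z)) (avg \<phi>2 (snd z))) * pairing (tens (wav \<psi>1 (fst z)) (wav \<psi>2 (snd z))) (tens g1 g2) \<partial>zmeasure) = (\<integral>z. I z \<partial>zmeasure)"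
    "(\<integral>z. coef \<psi>1 \<psi>2 b z * pairing (tens g1 g2) (tens (wav \<psi>1 (fst z)) (wav \<psi>2 (snd z))) * pairing (tens (avg \<phi>1 (fst z)) (avg \<phi>2 (snd z))) (tens f1 f2) \<partial>zmeasure) = (\<integral>z. I z \<partial>zmeasure)"
    "(\<integral>z. coef \<psi>1 \<psi>2 b z * pairing (tens g1 f2) (tens (wav \<psi>1 (fst z)) (avg \<phi>2 (snd z))) * pairing (tens (avg \<phi>1 (fst z)) (wav \<psi>2 (snd z))) (tens f1 g2) \<partial>zmeasure) = (\<integral>z. I z \<partial>zmeasure)"
    "(\<integral>z. coef \<psi>1 \<psi>2 b z * pairing (tens f1 g2) (tens (avg \<phi>1 (fst z)) (wav \<psi>2 (snd z))) * pairing (tens (wav \<psi>1 (fst z)) (avg \<phi>2 (snd z))) (tens g1 f2) \<partial>zmeasure) = (\<integral>z. I z \<partial>zmeasure)"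
proof -
  have [measurable]: "f1 \<in> borel_measurable borel" "f2 \<in> borel_measurable borel" "g1 \<in> borel_measurable borel" "g2 \<in> borel_measurable borel"
    using f by auto
  have [measurable]: "I \<in> borel_measurable zmeasure" unfolding I_def pairing_def by measurable
  have AE: "AE z in zmeasure. wav \<psi>1 (fst z) \<in> L2 \<and> wav \<psi>2 (snd z) \<in> L2 \<and> avg \<phi>1 (fst z) \<in> L2 \<and> avg \<phi>2 (snd z) \<in> L2"
    using AE_zmeasure
  proof eventually_elim
    case (elim z)
    then show ?case
      using wav_avg_L2[OF m1.bump, of "fst z"] wav_avg_L2[OF m2.bump, of "snd z"] wav_avg_L2[OF \<phi>1, of "fst z"] wav_avg_L2[OF \<phi>2, of "snd z"] by auto
  qed
  note [simp] = pairing_tens_tens f pairing_commute[of "wav _ _"] pairing_commute[of "avg _ _"] pairing_commute[of "tens (wav _ _) _"] pairing_commute[of "tens (avg _ _) _"]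
  note [measurable] = pairing_tens_measurable
  show "(\<integral>z. coef \<psi>1 \<psi>2 b z * pairing (tens f1 f2) (tens (avg \<phi>1 (fst z)) (avg \<phi>2 (snd z))) * pairing (tens (wav \<psi>1 (fst z)) (wav \<psi>2 (snd z))) (tens g1 g2) \<partial>zmeasure) = (\<integral>z. I z \<partial>zmeasure)"
    unfolding pairing_commute[of "tens (wav _ _) _"]
    by (rule integral_cong_AE, measurable, use AE in eventually_elim) (simp add: I_def)
  show "(\<integral>z. coef \<psi>1 \<psi>2 b z * pairing (tens g1 g2) (tens (wav \<psi>1 (fst z)) (wav \<psi>2 (snd z))) * pairing (tens (avg \<phi>1 (fst z)) (avg \<phi>2 (snd z))) (tens f1 f2) \<partial>zmeasure) = (\<integral>z. I z \<partial>zmeasure)"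
    unfolding pairing_commute[of "tens (avg _ _) _"]
    by (rule integral_cong_AE, measurable, use AE in eventually_elim) (simp add: I_def)
  show "(\<integral>z. coef \<psi>1 \<psi>2 b z * pairing (tens g1 f2) (tens (wav \<psi>1 (fst z)) (avg \<phi>2 (snd z))) * pairing (tens (avg \<phi>1 (fst z)) (wav \<psi>2 (snd z))) (tens f1 g2) \<partial>zmeasure) = (\<integral>z. I z \<partial>zmeasure)"
    unfolding pairing_commute[of "tens (avg _ _) _"]
    by (rule integral_cong_AE, measurable, use AE in eventually_elim) (simp add: I_def)
  show "(\<integral>z. coef \<psi>1 \<psi>2 b z * pairing (tens f1 g2) (tens (avg \<phi>1 (fst z)) (wav \<psi>2 (snd z))) * pairing (tens (wav \<psi>1 (fst z)) (avg \<phi>2 (snd z))) (tens g1 f2) \<partial>zmeasure) = (\<integral>z. I z \<partial>zmeasure)"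
    unfolding pairing_commute[of "tens (wav _ _) _"]
    by (rule integral_cong_AE, measurable, use AE in eventually_elim) (simp add: I_def)
qed

end

theorem theorem5p3:
  fixes \<psi>1 \<phi>1 :: "'a::euclidean_space \<Rightarrow> real"
    and \<psi>2 \<phi>2 :: "'b::euclidean_space \<Rightarrow> real"
    and b :: "'a \<times> 'b \<Rightarrow> complex"
  assumes "adm_wavelet \<psi>1" and "adm_wavelet \<psi>2"
    and "adm_bump \<phi>1" and "adm_bump \<phi>2"
    and "CMO \<psi>1 \<psi>2 b"
  shows "\<exists>P Pt Pp Ppt.
           is_paraproduct \<psi>1 \<psi>2 \<phi>1 \<phi>2 b P
         \<and> is_full_transpose P Pt
         \<and> is_partial_transpose P Pp
         \<and> is_partial_full_transpose P Ppt
         \<and> compact_op P \<and> compact_op Pt \<and> compact_op Pp \<and> compact_op Ppt"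
proof -
  obtain B1 B2 where B: "mean_zero_bump \<psi>1 B1" "mean_zero_bump \<psi>2 B2"
    using adm_wavelet_mean_zero_bump[OF assms(1)] adm_wavelet_mean_zero_bump[OF assms(2)] by blast
  obtain r1 C1 r2 C2 where C: "bump \<phi>1 r1 C1" "bump \<phi>2 r2 C2"
    using adm_bump_bump[OF assms(3)] adm_bump_bump[OF assms(4)] by blast
  interpret wavelet_system \<psi>1 B1 \<psi>2 B2 \<phi>1 r1 C1 \<phi>2 r2 C2
    using B C by (simp add: wavelet_system_def wavelet_system_axioms_def)
  note b = assms(5)
  have bm [measurable]: "b \<in> borel_measurable borel" using b by (simp add: CMO_def BMO_def loc_int_def)
  obtain P where P: "compact_op P" "\<And>F G. F \<in> L2 \<Longrightarrow> G \<in> L2 \<Longrightarrow> pairing (P F) G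
      = (\<integral>z. coef \<psi>1 \<psi>2 b z * pairing F (tens (avg \<phi>1 (fst z)) (avg \<phi>2 (snd z))) * pairing (tens (wav \<psi>1 (fst z)) (wav \<psi>2 (snd z))) G \<partial>zmeasure)"
    using compact_op_of_bounded_form[OF b disjI2[OF refl] disjI2[OF refl] disjI1[OF refl] disjI1[OF refl] bounded_form_paraproduct] by auto
  obtain Pt where Pt: "compact_op Pt" "\<And>F G. F \<in> L2 \<Longrightarrow> G \<in> L2 \<Longrightarrow> pairing (Pt F) G
      = (\<integral>z. coef \<psi>1 \<psi>2 b z * pairing F (tens (wav \<psi>1 (fst z)) (wav \<psi>2 (snd z))) * pairing (tens (avg \<phi>1 (fst z)) (avg \<phi>2 (snd z))) G \<partial>zmeasure)"
    using compact_op_of_bounded_form[OF b disjI1[OF refl] disjI1[OF refl] disjI2[OF refl] disjI2[OF refl] bounded_form_commute[OF bounded_form_paraproduct]] by auto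
  \<comment> \<open>A partial transpose does not inherit compactness from \<open>P\<close>; its own
    form, with wavelet and average exchanged in the first variable only, is bounded by the mixed
    estimate.\<close>
  obtain Pp where Pp: "compact_op Pp" "\<And>F G. F \<in> L2 \<Longrightarrow> G \<in> L2 \<Longrightarrow> pairing (Pp F) G
      = (\<integral>z. coef \<psi>1 \<psi>2 b z * pairing F (tens (wav \<psi>1 (fst z)) (avg \<phi>2 (snd z))) * pairing (tens (avg \<phi>1 (fst z)) (wav \<psi>2 (snd z))) G \<partial>zmeasure)"
    using compact_op_of_bounded_form[OF b disjI1[OF refl] disjI2[OF refl] disjI2[OF refl] disjI1[OF refl] bounded_form_mixed] by auto
  obtain Ppt where Ppt: "compact_op Ppt" "\<And>F G. F \<in> L2 \<Longrightarrow> G \<in> L2 \<Longrightarrow> pairing (Ppt F) G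
      = (\<integral>z. coef \<psi>1 \<psi>2 b z * pairing F (tens (avg \<phi>1 (fst z)) (wav \<psi>2 (snd z))) * pairing (tens (wav \<psi>1 (fst z)) (avg \<phi>2 (snd z))) G \<partial>zmeasure)"
    using compact_op_of_bounded_form[OF b disjI2[OF refl] disjI1[OF refl] disjI1[OF refl] disjI2[OF refl] bounded_form_commute[OF bounded_form_mixed]] by auto
  \<comment> \<open>The Carleson bound of \<open>b\<close> makes the form absolutely convergent for
    each pair of arguments, so that its truncations converge.\<close>
  obtain A where A: "0 < A" "carleson_bound (\<lambda>z. ennreal (cmod (coef \<psi>1 \<psi>2 b z))) A"
    using BMO_carleson_bound b unfolding CMO_def by blast
  have "is_paraproduct \<psi>1 \<psi>2 \<phi>1 \<phi>2 b P"
    unfolding is_paraproduct_def para_form_trunc_def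
  proof (intro ballI)
    fix F G :: "'a \<times> 'b \<Rightarrow> complex" assume F: "F \<in> L2" and G: "G \<in> L2"
    show "((\<lambda>e. \<integral>z\<in>trunc_region e. coef \<psi>1 \<psi>2 b z * pairing F (tens (avg \<phi>1 (fst z)) (avg \<phi>2 (snd z)))
        * pairing (tens (wav \<psi>1 (fst z)) (wav \<psi>2 (snd z))) G \<partial>zmeasure) \<longlongrightarrow> pairing (P F) G) (at_right 0)"
      unfolding P(2)[OF F G]
      by (rule tendsto_trunc_region[OF form_integrable(1)[OF bounded_form_paraproduct tens_measurable_joint(2,1) coef_measurable[OF bm] A F G]])
  qed
  moreover have "is_full_transpose P Pt"
    unfolding is_full_transpose_def
  proof (intro ballI)
    fix f1 g1 :: "'a \<Rightarrow> complex" and f2 g2 :: "'b \<Rightarrow> complex"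
    assume f: "f1 \<in> L2" "g1 \<in> L2" "f2 \<in> L2" "g2 \<in> L2"
    show "pairing (Pt (tens g1 g2)) (tens f1 f2) = pairing (P (tens f1 f2)) (tens g1 g2)"
      using form_tens(1,2)[OF bm f(1,3,2,4)] by (simp only: P(2) Pt(2) tens_L2 f)
  qed
  moreover have "is_partial_transpose P Pp"
    unfolding is_partial_transpose_def
  proof (intro ballI)
    fix f1 g1 :: "'a \<Rightarrow> complex" and f2 g2 :: "'b \<Rightarrow> complex"
    assume f: "f1 \<in> L2" "g1 \<in> L2" "f2 \<in> L2" "g2 \<in> L2"
    show "pairing (Pp (tens g1 f2)) (tens f1 g2) = pairing (P (tens f1 f2)) (tens g1 g2)"
      using form_tens(1,3)[OF bm f(1,3,2,4)] by (simp only: P(2) Pp(2) tens_L2 f)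
  qed
  moreover have "is_partial_full_transpose P Ppt"
    unfolding is_partial_full_transpose_def
  proof (intro ballI)
    fix f1 g1 :: "'a \<Rightarrow> complex" and f2 g2 :: "'b \<Rightarrow> complex"
    assume f: "f1 \<in> L2" "g1 \<in> L2" "f2 \<in> L2" "g2 \<in> L2"
    show "pairing (Ppt (tens f1 g2)) (tens g1 f2) = pairing (P (tens f1 f2)) (tens g1 g2)"
      using form_tens(1,4)[OF bm f(1,3,2,4)] by (simp only: P(2) Ppt(2) tens_L2 f)
  qed
  ultimately show ?thesis using P(1) Pt(1) Pp(1) Ppt(1) by blast
qed

end
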